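(* Let $X$ be a projective variety over an algebraically closed field of characteristic zero, and let $E$ and $F$ be two vector bundles on $X$. Then $$\mathbb{B}_{+}(E\oplus F)=\mathbb{B}_{+}(E)\cup\mathbb{B}_{+}(F)\quad\text{and}\quad\mathbb{B}_{-}(E\oplus F)=\mathbb{B}_{-}(E)\cup\mathbb{B}_{-}(F).$$ In particular, if $E$ and $F$ are both V-big (respectively both V-psef), then so is $E\oplus F$.
   Context: A vector bundle is a locally free sheaf of finite positive rank. Write $S^m=\mathrm{Sym}^m$. For a vector bundle $V$ on $X$, $\mathrm{Bs}(V)$ is the set of (scheme-theoretic) points $x\in X$ such that $H^0(X,V)\to V(x)=V\otimes\kappa(x)$ is not surjective. For any ample line bundle $A$ on $X$ (the definitions do not depend on the choice), the augmented and diminished base loci are $$\mathbb{B}_+(V)=\bigcap_{q\geq 1}\bigcap_{m\geq 1}\mathrm{Bs}(S^mS^qV\otimes A^{-m}),\qquad \mathbb{B}_-(V)=\bigcup_{q\geq 1}\bigcap_{m\geq 1}\mathrm{Bs}(S^mS^qV\otimes A^{m}).$$ $V$ is V-big if $\mathbb{B}_+(V)\neq X$ and V-psef if $\mathbb{B}_-(V)\neq X$. *)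

theory Defs
  imports
    "HOL-Library.Poly_Mapping"
    "HOL-Analysis.Abstract_Topology"
    "HOL-Computational_Algebra.Polynomial"
    "HOL-Algebra.Module"
    "HOL-Algebra.QuotRing"
begin

section \<open>Modules: spans, quotients, generators and relations\<close>

definition module_span :: "('r, 'c) ring_scheme \<Rightarrow> ('r, 'm, 'd) module_scheme \<Rightarrow> 'm set \<Rightarrow> 'm set" where
  "module_span R M G = \<Inter> {N. submodule N R M \<and> G \<subseteq> N}"

text \<open>In a module record the fields \<open>mult\<close> and \<open>one\<close> inherited from rings carry no meaning.\<close>

definition quot_module :: "('r, 'm, 'd) module_scheme \<Rightarrow> 'm set \<Rightarrow> ('r, 'm set) module" where
  "quot_module M N =
    \<lparr>carrier = a_rcosets\<^bsub>M\<^esub> N, monoid.mult = undefined, monoid.one = undefined,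
     ring.zero = N, ring.add = set_add M,
     module.smult = (\<lambda>r C. \<Union>c\<in>C. N +>\<^bsub>M\<^esub> (r \<odot>\<^bsub>M\<^esub> c))\<rparr>"

definition free_module :: "('r, 'c) ring_scheme \<Rightarrow> 'b set \<Rightarrow> ('r, 'b \<Rightarrow> 'r) module" where
  "free_module R B =
    \<lparr>carrier = {f. (\<forall>b. f b \<in> carrier R) \<and> (\<forall>b. b \<notin> B \<longrightarrow> f b = \<zero>\<^bsub>R\<^esub>) \<and> finite {b. f b \<noteq> \<zero>\<^bsub>R\<^esub>}},
     monoid.mult = undefined, monoid.one = undefined,
     ring.zero = (\<lambda>_. \<zero>\<^bsub>R\<^esub>), ring.add = (\<lambda>f g b. f b \<oplus>\<^bsub>R\<^esub> g b),
     module.smult = (\<lambda>r f b. r \<otimes>\<^bsub>R\<^esub> f b)\<rparr>"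

definition free_gen :: "('r, 'c) ring_scheme \<Rightarrow> 'b \<Rightarrow> 'b \<Rightarrow> 'r" where
  "free_gen R b = (\<lambda>c. if c = b then \<one>\<^bsub>R\<^esub> else \<zero>\<^bsub>R\<^esub>)"

definition presented_module ::
  "('r, 'c) ring_scheme \<Rightarrow> 'b set \<Rightarrow> ('b \<Rightarrow> 'r) set \<Rightarrow> ('r, ('b \<Rightarrow> 'r) set) module" where
  "presented_module R B Rel = quot_module (free_module R B) (module_span R (free_module R B) Rel)"

definition presented_gen ::
  "('r, 'c) ring_scheme \<Rightarrow> 'b set \<Rightarrow> ('b \<Rightarrow> 'r) set \<Rightarrow> 'b \<Rightarrow> ('b \<Rightarrow> 'r) set" where
  "presented_gen R B Rel b =
    module_span R (free_module R B) Rel +>\<^bsub>free_module R B\<^esub> free_gen R b"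

text \<open>The map of presented modules induced by a map \<open>\<sigma>\<close> of coefficient rings \<open>R \<rightarrow> R'\<close> and a
  map \<open>\<phi>\<close> of generators \<open>B \<rightarrow> B'\<close>, on classes of linear combinations of generators.\<close>

definition presented_map ::
  "('r, 'c) ring_scheme \<Rightarrow> ('s, 'd) ring_scheme \<Rightarrow> 'e set \<Rightarrow> ('e \<Rightarrow> 's) set \<Rightarrow>
   ('r \<Rightarrow> 's) \<Rightarrow> ('b \<Rightarrow> 'e) \<Rightarrow> ('b \<Rightarrow> 'r) set \<Rightarrow> ('e \<Rightarrow> 's) set" where
  "presented_map R R' B' Rel' \<sigma> \<phi> C =
    (\<Union>f\<in>C. module_span R' (free_module R' B') Rel' +>\<^bsub>free_module R' B'\<^esub>
       (\<lambda>e. finsum R' (\<lambda>b. \<sigma> (f b)) {b. f b \<noteq> \<zero>\<^bsub>R\<^esub> \<and> \<phi> b = e}))"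

subsection \<open>Tensor products, tensor powers and symmetric powers\<close>

definition tensor_rels ::
  "('r, 'c) ring_scheme \<Rightarrow> ('r, 'm) module \<Rightarrow> ('r, 'n) module \<Rightarrow> ('m \<times> 'n \<Rightarrow> 'r) set" where
  "tensor_rels R M N =
    (let F = free_module R (carrier M \<times> carrier N); e = (\<lambda>x y. free_gen R (x, y)) in
      {e (x \<oplus>\<^bsub>M\<^esub> x') y \<ominus>\<^bsub>F\<^esub> (e x y \<oplus>\<^bsub>F\<^esub> e x' y) | x x' y.
         x \<in> carrier M \<and> x' \<in> carrier M \<and> y \<in> carrier N} \<union>
      {e x (y \<oplus>\<^bsub>N\<^esub> y') \<ominus>\<^bsub>F\<^esub> (e x y \<oplus>\<^bsub>F\<^esub> e x y') | x y y'.
         x \<in> carrier M \<and> y \<in> carrier N \<and> y' \<in> carrier N} \<union>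
      {e (r \<odot>\<^bsub>M\<^esub> x) y \<ominus>\<^bsub>F\<^esub> (r \<odot>\<^bsub>F\<^esub> e x y) | r x y.
         r \<in> carrier R \<and> x \<in> carrier M \<and> y \<in> carrier N} \<union>
      {e x (r \<odot>\<^bsub>N\<^esub> y) \<ominus>\<^bsub>F\<^esub> (r \<odot>\<^bsub>F\<^esub> e x y) | r x y.
         r \<in> carrier R \<and> x \<in> carrier M \<and> y \<in> carrier N})"

definition tensor_module ::
  "('r, 'c) ring_scheme \<Rightarrow> ('r, 'm) module \<Rightarrow> ('r, 'n) module \<Rightarrow> ('r, ('m \<times> 'n \<Rightarrow> 'r) set) module" where
  "tensor_module R M N = presented_module R (carrier M \<times> carrier N) (tensor_rels R M N)"

definition pure_tensor ::
  "('r, 'c) ring_scheme \<Rightarrow> ('r, 'm) module \<Rightarrow> ('r, 'n) module \<Rightarrow> 'm \<Rightarrow> 'n \<Rightarrow> ('m \<times> 'n \<Rightarrow> 'r) set" where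
  "pure_tensor R M N x y = presented_gen R (carrier M \<times> carrier N) (tensor_rels R M N) (x, y)"

definition words :: "nat \<Rightarrow> ('r, 'm) module \<Rightarrow> 'm list set" where
  "words n M = {l. length l = n \<and> set l \<subseteq> carrier M}"

definition tensor_power_rels ::
  "('r, 'c) ring_scheme \<Rightarrow> nat \<Rightarrow> ('r, 'm) module \<Rightarrow> ('m list \<Rightarrow> 'r) set" where
  "tensor_power_rels R n M =
    (let F = free_module R (words n M); e = free_gen R in
      {e (l[i := x \<oplus>\<^bsub>M\<^esub> y]) \<ominus>\<^bsub>F\<^esub> (e (l[i := x]) \<oplus>\<^bsub>F\<^esub> e (l[i := y])) | l i x y.
         l \<in> words n M \<and> i < n \<and> x \<in> carrier M \<and> y \<in> carrier M} \<union>
      {e (l[i := r \<odot>\<^bsub>M\<^esub> x]) \<ominus>\<^bsub>F\<^esub> (r \<odot>\<^bsub>F\<^esub> e (l[i := x])) | l i r x.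
         l \<in> words n M \<and> i < n \<and> r \<in> carrier R \<and> x \<in> carrier M})"

definition sym_power_rels ::
  "('r, 'c) ring_scheme \<Rightarrow> nat \<Rightarrow> ('r, 'm) module \<Rightarrow> ('m list \<Rightarrow> 'r) set" where
  "sym_power_rels R n M =
    (let F = free_module R (words n M); e = free_gen R in
      tensor_power_rels R n M \<union>
      {e l \<ominus>\<^bsub>F\<^esub> e l' | l l'. l \<in> words n M \<and> l' \<in> words n M \<and> mset l = mset l'})"

section \<open>Ringed spaces and sheaves of modules\<close>

record ('x, 'r) ringed_space =
  topo :: "'x topology"
  sec :: "'x set \<Rightarrow> 'r ring"
  res :: "'x set \<Rightarrow> 'x set \<Rightarrow> 'r \<Rightarrow> 'r"

text \<open>\<open>res X U V\<close> restricts from \<open>U\<close> to \<open>V\<close>. The values of these functions at sets that are not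
  open, or at \<open>V\<close> not contained in \<open>U\<close>, are irrelevant; likewise for \<open>msec\<close> and \<open>mres\<close>.\<close>

record ('x, 'r, 'm) mod_presheaf =
  msec :: "'x set \<Rightarrow> ('r, 'm) module"
  mres :: "'x set \<Rightarrow> 'x set \<Rightarrow> 'm \<Rightarrow> 'm"

definition opens_in :: "('x, 'r) ringed_space \<Rightarrow> 'x set \<Rightarrow> 'x set set" where
  "opens_in X U = {W. openin (topo X) W \<and> W \<subseteq> U}"

abbreviation pts :: "('x, 'r) ringed_space \<Rightarrow> 'x set" where
  "pts X \<equiv> topspace (topo X)"

definition set_sheaf ::
  "'x topology \<Rightarrow> ('x set \<Rightarrow> 's set) \<Rightarrow> ('x set \<Rightarrow> 'x set \<Rightarrow> 's \<Rightarrow> 's) \<Rightarrow> bool" where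
  "set_sheaf T S \<rho> \<longleftrightarrow>
    (\<forall>U V. openin T U \<and> openin T V \<and> V \<subseteq> U \<longrightarrow> \<rho> U V \<in> S U \<rightarrow> S V) \<and>
    (\<forall>U. openin T U \<longrightarrow> (\<forall>s\<in>S U. \<rho> U U s = s)) \<and>
    (\<forall>U V W. openin T U \<and> openin T V \<and> openin T W \<and> W \<subseteq> V \<and> V \<subseteq> U \<longrightarrow>
       (\<forall>s\<in>S U. \<rho> V W (\<rho> U V s) = \<rho> U W s)) \<and>
    (\<forall>\<V> s. (\<forall>V\<in>\<V>. openin T V) \<and> (\<forall>V\<in>\<V>. s V \<in> S V) \<and>
       (\<forall>V\<in>\<V>. \<forall>W\<in>\<V>. \<rho> V (V \<inter> W) (s V) = \<rho> W (V \<inter> W) (s W)) \<longrightarrow>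
       (\<exists>!t. t \<in> S (\<Union>\<V>) \<and> (\<forall>V\<in>\<V>. \<rho> (\<Union>\<V>) V t = s V)))"

definition is_ringed_space :: "('x, 'r) ringed_space \<Rightarrow> bool" where
  "is_ringed_space X \<longleftrightarrow>
    (\<forall>U. openin (topo X) U \<longrightarrow> cring (sec X U)) \<and>
    (\<forall>U V. openin (topo X) U \<and> openin (topo X) V \<and> V \<subseteq> U \<longrightarrow>
       res X U V \<in> ring_hom (sec X U) (sec X V)) \<and>
    set_sheaf (topo X) (\<lambda>U. carrier (sec X U)) (res X)"

definition module_sheaf :: "('x, 'r) ringed_space \<Rightarrow> ('x, 'r, 'm) mod_presheaf \<Rightarrow> bool" where
  "module_sheaf X M \<longleftrightarrow>
    (\<forall>U. openin (topo X) U \<longrightarrow> module (sec X U) (msec M U)) \<and>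
    (\<forall>U V. openin (topo X) U \<and> openin (topo X) V \<and> V \<subseteq> U \<longrightarrow>
       (\<forall>a\<in>carrier (msec M U). \<forall>b\<in>carrier (msec M U).
          mres M U V (a \<oplus>\<^bsub>msec M U\<^esub> b) = mres M U V a \<oplus>\<^bsub>msec M V\<^esub> mres M U V b) \<and>
       (\<forall>r\<in>carrier (sec X U). \<forall>a\<in>carrier (msec M U).
          mres M U V (r \<odot>\<^bsub>msec M U\<^esub> a) = res X U V r \<odot>\<^bsub>msec M V\<^esub> mres M U V a)) \<and>
    set_sheaf (topo X) (\<lambda>U. carrier (msec M U)) (mres M)"

subsection \<open>Stalks\<close>

text \<open>A germ is an equivalence class of pairs \<open>(U, s)\<close>. Operations on germs are unions over
  representatives (on common restrictions), as for cosets in \<^theory>\<open>HOL-Algebra.Coset\<close>.\<close>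

type_synonym ('x, 's) germ = "('x set \<times> 's) set"

definition germ ::
  "'x topology \<Rightarrow> ('x set \<Rightarrow> 's set) \<Rightarrow> ('x set \<Rightarrow> 'x set \<Rightarrow> 's \<Rightarrow> 's) \<Rightarrow>
   'x \<Rightarrow> 'x set \<Rightarrow> 's \<Rightarrow> ('x, 's) germ" where
  "germ T S \<rho> x U s =
    {(V, t). openin T V \<and> x \<in> V \<and> t \<in> S V \<and>
       (\<exists>W. openin T W \<and> x \<in> W \<and> W \<subseteq> U \<inter> V \<and> \<rho> U W s = \<rho> V W t)}"

definition rgerm :: "('x, 'r) ringed_space \<Rightarrow> 'x \<Rightarrow> 'x set \<Rightarrow> 'r \<Rightarrow> ('x, 'r) germ" where
  "rgerm X = germ (topo X) (\<lambda>U. carrier (sec X U)) (res X)"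

definition stalk :: "('x, 'r) ringed_space \<Rightarrow> 'x \<Rightarrow> ('x, 'r) germ ring" where
  "stalk X x =
    \<lparr>carrier = {rgerm X x U s | U s. openin (topo X) U \<and> x \<in> U \<and> s \<in> carrier (sec X U)},
     monoid.mult = (\<lambda>a b. \<Union>(U, s)\<in>a. \<Union>(V, t)\<in>b. rgerm X x (U \<inter> V)
        (res X U (U \<inter> V) s \<otimes>\<^bsub>sec X (U \<inter> V)\<^esub> res X V (U \<inter> V) t)),
     monoid.one = rgerm X x (pts X) \<one>\<^bsub>sec X (pts X)\<^esub>,
     ring.zero = rgerm X x (pts X) \<zero>\<^bsub>sec X (pts X)\<^esub>,
     ring.add = (\<lambda>a b. \<Union>(U, s)\<in>a. \<Union>(V, t)\<in>b. rgerm X x (U \<inter> V)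
        (res X U (U \<inter> V) s \<oplus>\<^bsub>sec X (U \<inter> V)\<^esub> res X V (U \<inter> V) t))\<rparr>"

definition mgerm ::
  "('x, 'r) ringed_space \<Rightarrow> ('x, 'r, 'm) mod_presheaf \<Rightarrow> 'x \<Rightarrow> 'x set \<Rightarrow> 'm \<Rightarrow> ('x, 'm) germ" where
  "mgerm X M = germ (topo X) (\<lambda>U. carrier (msec M U)) (mres M)"

definition mstalk ::
  "('x, 'r) ringed_space \<Rightarrow> ('x, 'r, 'm) mod_presheaf \<Rightarrow> 'x \<Rightarrow>
   (('x, 'r) germ, ('x, 'm) germ) module" where
  "mstalk X M x =
    \<lparr>carrier = {mgerm X M x U s | U s. openin (topo X) U \<and> x \<in> U \<and> s \<in> carrier (msec M U)},
     monoid.mult = undefined, monoid.one = undefined,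
     ring.zero = mgerm X M x (pts X) \<zero>\<^bsub>msec M (pts X)\<^esub>,
     ring.add = (\<lambda>a b. \<Union>(U, s)\<in>a. \<Union>(V, t)\<in>b. mgerm X M x (U \<inter> V)
        (mres M U (U \<inter> V) s \<oplus>\<^bsub>msec M (U \<inter> V)\<^esub> mres M V (U \<inter> V) t)),
     module.smult = (\<lambda>a b. \<Union>(U, r)\<in>a. \<Union>(V, t)\<in>b. mgerm X M x (U \<inter> V)
        (res X U (U \<inter> V) r \<odot>\<^bsub>msec M (U \<inter> V)\<^esub> mres M V (U \<inter> V) t))\<rparr>"

subsection \<open>Sheafification\<close>

definition sheafify ::
  "('x, 'r) ringed_space \<Rightarrow> ('x, 'r, 'm) mod_presheaf \<Rightarrow> ('x, 'r, 'x \<Rightarrow> ('x, 'm) germ) mod_presheaf" where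
  "sheafify X P =
    \<lparr>msec = (\<lambda>U.
       \<lparr>carrier = {s \<in> extensional U. \<forall>x\<in>U. \<exists>W\<in>opens_in X U. x \<in> W \<and>
                    (\<exists>t\<in>carrier (msec P W). \<forall>y\<in>W. s y = mgerm X P y W t)},
        monoid.mult = undefined, monoid.one = undefined,
        ring.zero = (\<lambda>x\<in>U. \<zero>\<^bsub>mstalk X P x\<^esub>),
        ring.add = (\<lambda>s t. \<lambda>x\<in>U. s x \<oplus>\<^bsub>mstalk X P x\<^esub> t x),
        module.smult = (\<lambda>r s. \<lambda>x\<in>U. rgerm X x U r \<odot>\<^bsub>mstalk X P x\<^esub> s x)\<rparr>),
     mres = (\<lambda>U V s. restrict s V)\<rparr>"

subsection \<open>Tensor products, tensor powers, symmetric powers, direct sums, duals\<close>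

definition presented_sheaf ::
  "('x, 'r) ringed_space \<Rightarrow> ('x set \<Rightarrow> 'b set) \<Rightarrow> ('x set \<Rightarrow> ('b \<Rightarrow> 'r) set) \<Rightarrow>
   ('x set \<Rightarrow> 'x set \<Rightarrow> 'b \<Rightarrow> 'b) \<Rightarrow> ('x, 'r, 'x \<Rightarrow> ('x, ('b \<Rightarrow> 'r) set) germ) mod_presheaf" where
  "presented_sheaf X B Rel \<phi> = sheafify X
    \<lparr>msec = (\<lambda>U. presented_module (sec X U) (B U) (Rel U)),
     mres = (\<lambda>U V. presented_map (sec X U) (sec X V) (B V) (Rel V) (res X U V) (\<phi> U V))\<rparr>"

definition tensor_sheaf ::
  "('x, 'r) ringed_space \<Rightarrow> ('x, 'r, 'm) mod_presheaf \<Rightarrow> ('x, 'r, 'n) mod_presheaf \<Rightarrow>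
   ('x, 'r, 'x \<Rightarrow> ('x, ('m \<times> 'n \<Rightarrow> 'r) set) germ) mod_presheaf" where
  "tensor_sheaf X M N = presented_sheaf X
    (\<lambda>U. carrier (msec M U) \<times> carrier (msec N U))
    (\<lambda>U. tensor_rels (sec X U) (msec M U) (msec N U))
    (\<lambda>U V. map_prod (mres M U V) (mres N U V))"

definition tensor_power_sheaf ::
  "('x, 'r) ringed_space \<Rightarrow> nat \<Rightarrow> ('x, 'r, 'm) mod_presheaf \<Rightarrow>
   ('x, 'r, 'x \<Rightarrow> ('x, ('m list \<Rightarrow> 'r) set) germ) mod_presheaf" where
  "tensor_power_sheaf X n M = presented_sheaf X
    (\<lambda>U. words n (msec M U)) (\<lambda>U. tensor_power_rels (sec X U) n (msec M U))
    (\<lambda>U V. map (mres M U V))"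

definition sym_power_sheaf ::
  "('x, 'r) ringed_space \<Rightarrow> nat \<Rightarrow> ('x, 'r, 'm) mod_presheaf \<Rightarrow>
   ('x, 'r, 'x \<Rightarrow> ('x, ('m list \<Rightarrow> 'r) set) germ) mod_presheaf" where
  "sym_power_sheaf X n M = presented_sheaf X
    (\<lambda>U. words n (msec M U)) (\<lambda>U. sym_power_rels (sec X U) n (msec M U))
    (\<lambda>U V. map (mres M U V))"

definition direct_sum_sheaf ::
  "('x, 'r, 'm) mod_presheaf \<Rightarrow> ('x, 'r, 'n) mod_presheaf \<Rightarrow> ('x, 'r, 'm \<times> 'n) mod_presheaf" where
  "direct_sum_sheaf M N =
    \<lparr>msec = (\<lambda>U.
       \<lparr>carrier = carrier (msec M U) \<times> carrier (msec N U),
        monoid.mult = undefined, monoid.one = undefined,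
        ring.zero = (\<zero>\<^bsub>msec M U\<^esub>, \<zero>\<^bsub>msec N U\<^esub>),
        ring.add = (\<lambda>(a, b) (a', b'). (a \<oplus>\<^bsub>msec M U\<^esub> a', b \<oplus>\<^bsub>msec N U\<^esub> b')),
        module.smult = (\<lambda>r (a, b). (r \<odot>\<^bsub>msec M U\<^esub> a, r \<odot>\<^bsub>msec N U\<^esub> b))\<rparr>),
     mres = (\<lambda>U V. map_prod (mres M U V) (mres N U V))\<rparr>"

text \<open>Morphisms of \<open>\<O>\<^sub>U\<close>-modules from \<open>M|\<^sub>U\<close> to \<open>N|\<^sub>U\<close>, for \<open>U\<close> open.\<close>

definition mod_hom ::
  "('x, 'r) ringed_space \<Rightarrow> 'x set \<Rightarrow> ('x, 'r, 'm) mod_presheaf \<Rightarrow> ('x, 'r, 'n) mod_presheaf \<Rightarrow>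
   ('x set \<Rightarrow> 'm \<Rightarrow> 'n) \<Rightarrow> bool" where
  "mod_hom X U M N \<phi> \<longleftrightarrow>
    (\<forall>W\<in>opens_in X U.
       \<phi> W \<in> carrier (msec M W) \<rightarrow> carrier (msec N W) \<and>
       (\<forall>a\<in>carrier (msec M W). \<forall>b\<in>carrier (msec M W).
          \<phi> W (a \<oplus>\<^bsub>msec M W\<^esub> b) = \<phi> W a \<oplus>\<^bsub>msec N W\<^esub> \<phi> W b) \<and>
       (\<forall>r\<in>carrier (sec X W). \<forall>a\<in>carrier (msec M W).
          \<phi> W (r \<odot>\<^bsub>msec M W\<^esub> a) = r \<odot>\<^bsub>msec N W\<^esub> \<phi> W a) \<and>
       (\<forall>W'\<in>opens_in X W. \<forall>a\<in>carrier (msec M W).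
          \<phi> W' (mres M W W' a) = mres N W W' (\<phi> W a)))"

definition mod_iso_on ::
  "('x, 'r) ringed_space \<Rightarrow> 'x set \<Rightarrow> ('x, 'r, 'm) mod_presheaf \<Rightarrow> ('x, 'r, 'n) mod_presheaf \<Rightarrow> bool" where
  "mod_iso_on X U M N \<longleftrightarrow>
    (\<exists>\<phi>. mod_hom X U M N \<phi> \<and>
      (\<forall>W\<in>opens_in X U. bij_betw (\<phi> W) (carrier (msec M W)) (carrier (msec N W))))"

definition structure_module :: "('x, 'r) ringed_space \<Rightarrow> ('x, 'r, 'r) mod_presheaf" where
  "structure_module X =
    \<lparr>msec = (\<lambda>U.
       \<lparr>carrier = carrier (sec X U), monoid.mult = monoid.mult (sec X U), monoid.one = monoid.one (sec X U),
        ring.zero = ring.zero (sec X U), ring.add = ring.add (sec X U), module.smult = monoid.mult (sec X U)\<rparr>),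
     mres = res X\<rparr>"

definition free_sheaf :: "('x, 'r) ringed_space \<Rightarrow> nat \<Rightarrow> ('x, 'r, nat \<Rightarrow> 'r) mod_presheaf" where
  "free_sheaf X n =
    \<lparr>msec = (\<lambda>U.
       \<lparr>carrier = {..<n} \<rightarrow>\<^sub>E carrier (sec X U), monoid.mult = undefined, monoid.one = undefined,
        ring.zero = (\<lambda>i\<in>{..<n}. \<zero>\<^bsub>sec X U\<^esub>),
        ring.add = (\<lambda>f g. \<lambda>i\<in>{..<n}. f i \<oplus>\<^bsub>sec X U\<^esub> g i),
        module.smult = (\<lambda>r f. \<lambda>i\<in>{..<n}. r \<otimes>\<^bsub>sec X U\<^esub> f i)\<rparr>),
     mres = (\<lambda>U V f. \<lambda>i\<in>{..<n}. res X U V (f i))\<rparr>"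

definition dual_sheaf ::
  "('x, 'r) ringed_space \<Rightarrow> ('x, 'r, 'm) mod_presheaf \<Rightarrow> ('x, 'r, 'x set \<Rightarrow> 'm \<Rightarrow> 'r) mod_presheaf" where
  "dual_sheaf X M =
    \<lparr>msec = (\<lambda>U.
       \<lparr>carrier = {\<phi> \<in> extensional (opens_in X U).
                    (\<forall>W\<in>opens_in X U. \<phi> W \<in> extensional (carrier (msec M W))) \<and>
                    mod_hom X U M (structure_module X) \<phi>},
        monoid.mult = undefined, monoid.one = undefined,
        ring.zero = (\<lambda>W\<in>opens_in X U. \<lambda>a\<in>carrier (msec M W). \<zero>\<^bsub>sec X W\<^esub>),
        ring.add = (\<lambda>\<phi> \<psi>. \<lambda>W\<in>opens_in X U. \<lambda>a\<in>carrier (msec M W). \<phi> W a \<oplus>\<^bsub>sec X W\<^esub> \<psi> W a),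
        module.smult = (\<lambda>r \<phi>. \<lambda>W\<in>opens_in X U. \<lambda>a\<in>carrier (msec M W).
                   res X U W r \<otimes>\<^bsub>sec X W\<^esub> \<phi> W a)\<rparr>),
     mres = (\<lambda>U V \<phi>. restrict \<phi> (opens_in X V))\<rparr>"

section \<open>Vector bundles, coherent sheaves, ample line bundles\<close>

definition locally_free :: "('x, 'r) ringed_space \<Rightarrow> nat \<Rightarrow> ('x, 'r, 'm) mod_presheaf \<Rightarrow> bool" where
  "locally_free X n M \<longleftrightarrow> module_sheaf X M \<and>
    (\<forall>x\<in>pts X. \<exists>U. openin (topo X) U \<and> x \<in> U \<and> mod_iso_on X U M (free_sheaf X n))"

definition vector_bundle :: "('x, 'r) ringed_space \<Rightarrow> ('x, 'r, 'm) mod_presheaf \<Rightarrow> bool" where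
  "vector_bundle X M \<longleftrightarrow> (\<exists>n>0. locally_free X n M)"

text \<open>Local existence of exact sequences \<open>\<O>\<^sup>p \<rightarrow> \<O>\<^sup>q \<rightarrow> M \<rightarrow> 0\<close>; exactness is exactness
  of sheaves, so lifts exist locally only. On a locally noetherian scheme this is coherence.\<close>

definition coherent_sheaf :: "('x, 'r) ringed_space \<Rightarrow> ('x, 'r, 'm) mod_presheaf \<Rightarrow> bool" where
  "coherent_sheaf X M \<longleftrightarrow> module_sheaf X M \<and>
    (\<forall>x\<in>pts X. \<exists>U p q \<phi> \<psi>. openin (topo X) U \<and> x \<in> U \<and>
       mod_hom X U (free_sheaf X p) (free_sheaf X q) \<phi> \<and>
       mod_hom X U (free_sheaf X q) M \<psi> \<and>
       (\<forall>W\<in>opens_in X U. \<forall>s\<in>carrier (msec M W). \<forall>y\<in>W. \<exists>W'\<in>opens_in X W. y \<in> W' \<and>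
          (\<exists>t\<in>carrier (msec (free_sheaf X q) W'). \<psi> W' t = mres M W W' s)) \<and>
       (\<forall>W\<in>opens_in X U. \<forall>t\<in>carrier (msec (free_sheaf X q) W).
          \<psi> W t = \<zero>\<^bsub>msec M W\<^esub> \<longleftrightarrow>
          (\<forall>y\<in>W. \<exists>W'\<in>opens_in X W. y \<in> W' \<and>
             (\<exists>u\<in>carrier (msec (free_sheaf X p) W'). \<phi> W' u = mres (free_sheaf X q) W W' t))))"

definition globally_generated :: "('x, 'r) ringed_space \<Rightarrow> ('x, 'r, 'm) mod_presheaf \<Rightarrow> bool" where
  "globally_generated X M \<longleftrightarrow>
    (\<forall>x\<in>pts X. module_span (stalk X x) (mstalk X M x)
       (mgerm X M x (pts X) ` carrier (msec M (pts X))) = carrier (mstalk X M x))"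

text \<open>A formula cannot quantify over types, so \<open>\<F>\<close> runs over the coherent sheaves whose sections
  have the same type \<open>'r\<close> as the functions on \<open>X\<close>. For a projective variety \<open>X\<close> over an
  algebraically closed field \<open>k\<close> every coherent sheaf is isomorphic to one of these: a module of
  sections embeds into a finite product of finitely generated modules over finitely generated
  \<open>k\<close>-algebras, so it has at most as many elements as the infinite field \<open>k \<subseteq> \<O>(X)\<close>.\<close>

definition ample :: "('x, 'r) ringed_space \<Rightarrow> ('x, 'r, 'm) mod_presheaf \<Rightarrow> bool" where
  "ample X A \<longleftrightarrow> locally_free X 1 A \<and>
    (\<forall>\<F> :: ('x, 'r, 'r) mod_presheaf. coherent_sheaf X \<F> \<longrightarrow>
      (\<exists>n0. \<forall>n\<ge>n0. globally_generated X (tensor_sheaf X \<F> (tensor_power_sheaf X n A))))"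

section \<open>Schemes and projective varieties\<close>

definition local_ring :: "('r, 'c) ring_scheme \<Rightarrow> bool" where
  "local_ring R \<longleftrightarrow> cring R \<and> (\<exists>!m. maximalideal m R)"

definition max_ideal :: "('r, 'c) ring_scheme \<Rightarrow> 'r set" where
  "max_ideal R = (THE m. maximalideal m R)"

definition locally_ringed_space :: "('x, 'r) ringed_space \<Rightarrow> bool" where
  "locally_ringed_space X \<longleftrightarrow> is_ringed_space X \<and> (\<forall>x\<in>pts X. local_ring (stalk X x))"

definition open_subspace :: "('x, 'r) ringed_space \<Rightarrow> 'x set \<Rightarrow> ('x, 'r) ringed_space" where
  "open_subspace X U = X\<lparr>topo := subtopology (topo X) U\<rparr>"

definition preim :: "('x, 'r) ringed_space \<Rightarrow> ('x \<Rightarrow> 'y) \<Rightarrow> 'y set \<Rightarrow> 'x set" where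
  "preim X f V = {x \<in> pts X. f x \<in> V}"

text \<open>\<open>\<phi>\<close> is the comorphism \<open>\<O>\<^sub>Y \<rightarrow> f\<^sub>*\<O>\<^sub>X\<close>. The last clause says that the maps on stalks are
  local: they reflect units.\<close>

definition lrs_morphism ::
  "('x, 'r) ringed_space \<Rightarrow> ('y, 's) ringed_space \<Rightarrow> ('x \<Rightarrow> 'y) \<Rightarrow> ('y set \<Rightarrow> 's \<Rightarrow> 'r) \<Rightarrow> bool" where
  "lrs_morphism X Y f \<phi> \<longleftrightarrow>
    continuous_map (topo X) (topo Y) f \<and>
    (\<forall>V. openin (topo Y) V \<longrightarrow> \<phi> V \<in> ring_hom (sec Y V) (sec X (preim X f V))) \<and>
    (\<forall>V W. openin (topo Y) V \<and> openin (topo Y) W \<and> W \<subseteq> V \<longrightarrow>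
       (\<forall>s\<in>carrier (sec Y V). \<phi> W (res Y V W s) = res X (preim X f V) (preim X f W) (\<phi> V s))) \<and>
    (\<forall>V s. openin (topo Y) V \<and> s \<in> carrier (sec Y V) \<longrightarrow>
       (\<forall>x\<in>preim X f V. rgerm X x (preim X f V) (\<phi> V s) \<in> Units (stalk X x) \<longrightarrow>
          rgerm Y (f x) V s \<in> Units (stalk Y (f x))))"

definition lrs_isomorphic :: "('x, 'r) ringed_space \<Rightarrow> ('y, 's) ringed_space \<Rightarrow> bool" where
  "lrs_isomorphic X Y \<longleftrightarrow>
    (\<exists>f \<phi>. lrs_morphism X Y f \<phi> \<and> homeomorphic_map (topo X) (topo Y) f \<and>
      (\<forall>V. openin (topo Y) V \<longrightarrow>
         bij_betw (\<phi> V) (carrier (sec Y V)) (carrier (sec X (preim X f V)))))"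

definition closed_immersion ::
  "('x, 'r) ringed_space \<Rightarrow> ('y, 's) ringed_space \<Rightarrow> ('x \<Rightarrow> 'y) \<Rightarrow> ('y set \<Rightarrow> 's \<Rightarrow> 'r) \<Rightarrow> bool" where
  "closed_immersion X Y f \<phi> \<longleftrightarrow> lrs_morphism X Y f \<phi> \<and>
    embedding_map (topo X) (topo Y) f \<and> closedin (topo Y) (f ` pts X) \<and>
    (\<forall>V. openin (topo Y) V \<longrightarrow> (\<forall>s\<in>carrier (sec X (preim X f V)). \<forall>y\<in>V.
       \<exists>W\<in>opens_in Y V. y \<in> W \<and>
         (\<exists>t\<in>carrier (sec Y W). \<phi> W t = res X (preim X f V) (preim X f W) s)))"

subsection \<open>Spectra and projective spaces\<close>

definition fraction :: "('a, 'c) ring_scheme \<Rightarrow> 'a set \<Rightarrow> 'a \<Rightarrow> 'a \<Rightarrow> ('a \<times> 'a) set" where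
  "fraction S T a b =
    {(c, d). c \<in> carrier S \<and> d \<in> T \<and>
       (\<exists>t\<in>T. t \<otimes>\<^bsub>S\<^esub> (a \<otimes>\<^bsub>S\<^esub> d) = t \<otimes>\<^bsub>S\<^esub> (c \<otimes>\<^bsub>S\<^esub> b))}"

definition localization :: "('a, 'c) ring_scheme \<Rightarrow> 'a set \<Rightarrow> ('a \<times> 'a) set ring" where
  "localization S T =
    \<lparr>carrier = {fraction S T a b | a b. a \<in> carrier S \<and> b \<in> T},
     monoid.mult = (\<lambda>u v. \<Union>(a, b)\<in>u. \<Union>(c, d)\<in>v. fraction S T (a \<otimes>\<^bsub>S\<^esub> c) (b \<otimes>\<^bsub>S\<^esub> d)),
     monoid.one = fraction S T \<one>\<^bsub>S\<^esub> \<one>\<^bsub>S\<^esub>,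
     ring.zero = fraction S T \<zero>\<^bsub>S\<^esub> \<one>\<^bsub>S\<^esub>,
     ring.add = (\<lambda>u v. \<Union>(a, b)\<in>u. \<Union>(c, d)\<in>v.
       fraction S T ((a \<otimes>\<^bsub>S\<^esub> d) \<oplus>\<^bsub>S\<^esub> (c \<otimes>\<^bsub>S\<^esub> b)) (b \<otimes>\<^bsub>S\<^esub> d))\<rparr>"

text \<open>Common construction of \<open>Spec\<close> and \<open>Proj\<close>: \<open>P\<close> is a set of prime ideals of \<open>S\<close>, with the
  topology generated by the sets \<open>{p \<in> P. f \<notin> p}\<close> for \<open>f \<in> B\<close>. Sections over \<open>U\<close> send \<open>p \<in> U\<close> to
  an element of the localization at \<open>p\<close> and are locally given by one fraction whose numerator and
  denominator lie in a common member of \<open>H\<close>: the whole ring for \<open>Spec\<close>, a graded piece for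
  \<open>Proj\<close>. Accordingly only denominators from \<open>\<Union>H\<close> are inverted.\<close>

definition fraction_space ::
  "('a, 'c) ring_scheme \<Rightarrow> 'a set set \<Rightarrow> 'a set set \<Rightarrow> 'a set \<Rightarrow>
   ('a set, 'a set \<Rightarrow> ('a \<times> 'a) set) ringed_space" where
  "fraction_space S H P B =
    (let T = topology_generated_by {{p \<in> P. f \<notin> p} | f. f \<in> B};
         L = (\<lambda>p. localization S (\<Union>H - p)) in
      \<lparr>topo = T,
       sec = (\<lambda>U.
         \<lparr>carrier = {s \<in> extensional U. \<forall>p\<in>U. \<exists>W h a b. openin T W \<and> p \<in> W \<and> W \<subseteq> U \<and>
                      h \<in> H \<and> a \<in> h \<and> b \<in> h \<and>
                      (\<forall>q\<in>W. b \<notin> q \<and> s q = fraction S (\<Union>H - q) a b)},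
          monoid.mult = (\<lambda>s t. \<lambda>p\<in>U. s p \<otimes>\<^bsub>L p\<^esub> t p),
          monoid.one = (\<lambda>p\<in>U. \<one>\<^bsub>L p\<^esub>), ring.zero = (\<lambda>p\<in>U. \<zero>\<^bsub>L p\<^esub>),
          ring.add = (\<lambda>s t. \<lambda>p\<in>U. s p \<oplus>\<^bsub>L p\<^esub> t p)\<rparr>),
       res = (\<lambda>U V s. restrict s V)\<rparr>)"

definition Spec :: "('a, 'c) ring_scheme \<Rightarrow> ('a set, 'a set \<Rightarrow> ('a \<times> 'a) set) ringed_space" where
  "Spec R = fraction_space R {carrier R} {p. primeideal p R} (carrier R)"

text \<open>\<open>h d\<close> is the graded piece of degree \<open>d\<close>; an ideal is homogeneous if it is generated by its
  homogeneous elements.\<close>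

definition Proj ::
  "('a, 'c) ring_scheme \<Rightarrow> (nat \<Rightarrow> 'a set) \<Rightarrow> ('a set, 'a set \<Rightarrow> ('a \<times> 'a) set) ringed_space" where
  "Proj S h = fraction_space S (range h)
    {p. primeideal p S \<and> genideal S (p \<inter> (\<Union>d. h d)) = p \<and> \<not> (\<Union>d\<in>{0<..}. h d) \<subseteq> p}
    (\<Union>d\<in>{0<..}. h d)"

type_synonym 'k poly_ring = "(nat \<Rightarrow>\<^sub>0 nat) \<Rightarrow>\<^sub>0 'k"

text \<open>The polynomial ring in \<open>x\<^sub>0, \<dots>, x\<^sub>n\<close>: a polynomial is a finitely supported function on
  exponent vectors.\<close>

definition polys :: "nat \<Rightarrow> 'k::field poly_ring ring" where
  "polys n =
    \<lparr>carrier = {f. \<forall>m \<in> Poly_Mapping.keys f. Poly_Mapping.keys m \<subseteq> {..n}},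
     monoid.mult = (*), monoid.one = 1, ring.zero = 0, ring.add = (+)\<rparr>"

definition forms :: "nat \<Rightarrow> nat \<Rightarrow> 'k::field poly_ring set" where
  "forms n d = {f \<in> carrier (polys n). \<forall>m \<in> Poly_Mapping.keys f.
     (\<Sum>i \<in> Poly_Mapping.keys m. Poly_Mapping.lookup m i) = d}"

definition projective_space ::
  "nat \<Rightarrow> ('k::field poly_ring set, 'k poly_ring set \<Rightarrow> ('k poly_ring \<times> 'k poly_ring) set) ringed_space" where
  "projective_space n = Proj (polys n) (forms n)"

definition projective_space_scalar ::
  "nat \<Rightarrow> 'k::field \<Rightarrow> 'k poly_ring set \<Rightarrow> ('k poly_ring \<times> 'k poly_ring) set" where
  "projective_space_scalar n c =
    (\<lambda>p \<in> pts (projective_space n).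
       fraction (polys n) ((\<Union>d. forms n d) - p) (Poly_Mapping.single 0 c) 1)"

subsection \<open>Projective varieties\<close>

definition scheme :: "('x, 'r) ringed_space \<Rightarrow> bool" where
  "scheme X \<longleftrightarrow> locally_ringed_space X \<and>
    (\<forall>x\<in>pts X. \<exists>U (R :: 'r ring). openin (topo X) U \<and> x \<in> U \<and> cring R \<and>
       lrs_isomorphic (open_subspace X U) (Spec R))"

definition integral_scheme :: "('x, 'r) ringed_space \<Rightarrow> bool" where
  "integral_scheme X \<longleftrightarrow> scheme X \<and> pts X \<noteq> {} \<and>
    (\<forall>U. openin (topo X) U \<and> U \<noteq> {} \<longrightarrow> domain (sec X U))"

definition scalar_ring :: "'k::field ring" where
  "scalar_ring =
    \<lparr>carrier = UNIV, monoid.mult = (*), monoid.one = 1, ring.zero = 0, ring.add = (+)\<rparr>"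

text \<open>The map \<open>c\<close> gives the structure of a scheme over the field \<open>'k\<close>.\<close>

definition projective_variety :: "('x, 'r) ringed_space \<Rightarrow> ('k::field \<Rightarrow> 'r) \<Rightarrow> bool" where
  "projective_variety X c \<longleftrightarrow> integral_scheme X \<and>
    c \<in> ring_hom scalar_ring (sec X (pts X)) \<and>
    (\<exists>n f \<phi>. closed_immersion X (projective_space n) f \<phi> \<and>
      (\<forall>a :: 'k. \<phi> (pts (projective_space n)) (projective_space_scalar n a) = c a))"

section \<open>Base loci\<close>

definition residue_field_module :: "('r, 'c) ring_scheme \<Rightarrow> ('r, 'r set) module" where
  "residue_field_module R =
    (let K = R Quot max_ideal R in
      \<lparr>carrier = carrier K, monoid.mult = monoid.mult K, monoid.one = monoid.one K, ring.zero = ring.zero K, ring.add = ring.add K,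
       module.smult = (\<lambda>r C. (max_ideal R +>\<^bsub>R\<^esub> r) \<otimes>\<^bsub>K\<^esub> C)\<rparr>)"

definition fiber ::
  "('x, 'r) ringed_space \<Rightarrow> ('x, 'r, 'm) mod_presheaf \<Rightarrow> 'x \<Rightarrow>
   (('x, 'r) germ, (('x, 'm) germ \<times> ('x, 'r) germ set \<Rightarrow> ('x, 'r) germ) set) module" where
  "fiber X V x = tensor_module (stalk X x) (mstalk X V x) (residue_field_module (stalk X x))"

definition fiber_eval ::
  "('x, 'r) ringed_space \<Rightarrow> ('x, 'r, 'm) mod_presheaf \<Rightarrow> 'x \<Rightarrow> 'm \<Rightarrow>
   (('x, 'm) germ \<times> ('x, 'r) germ set \<Rightarrow> ('x, 'r) germ) set" where
  "fiber_eval X V x s =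
    pure_tensor (stalk X x) (mstalk X V x) (residue_field_module (stalk X x))
      (mgerm X V x (pts X) s) \<one>\<^bsub>residue_field_module (stalk X x)\<^esub>"

text \<open>At a point that is not closed, surjectivity of \<open>H\<^sup>0(X, V) \<rightarrow> V(x)\<close> is that of the induced
  \<open>\<kappa>(x)\<close>-linear map \<open>H\<^sup>0(X, V) \<otimes> \<kappa>(x) \<rightarrow> V(x)\<close>, i.e. the values of global sections span
  \<open>V(x)\<close>. (The \<open>\<kappa>(x)\<close>-subspaces of \<open>V(x)\<close> are its \<open>\<O>\<^sub>x\<close>-submodules.)\<close>

definition Bs :: "('x, 'r) ringed_space \<Rightarrow> ('x, 'r, 'm) mod_presheaf \<Rightarrow> 'x set" where
  "Bs X V = {x \<in> pts X.
     module_span (stalk X x) (fiber X V x) (fiber_eval X V x ` carrier (msec V (pts X)))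
       \<noteq> carrier (fiber X V x)}"

text \<open>The ample line bundle \<open>A\<close> is an explicit parameter of the loci and of the two positivity
  notions. The negative power \<open>A\<^sup>-\<^sup>m\<close> is the \<open>m\<close>-th tensor power of the dual of \<open>A\<close>.\<close>

definition augmented_base_locus ::
  "('x, 'r) ringed_space \<Rightarrow> ('x, 'r, 'l) mod_presheaf \<Rightarrow> ('x, 'r, 'm) mod_presheaf \<Rightarrow> 'x set" where
  "augmented_base_locus X A V = (\<Inter>q\<in>{1..}. \<Inter>m\<in>{1..}.
     Bs X (tensor_sheaf X (sym_power_sheaf X m (sym_power_sheaf X q V))
                          (tensor_power_sheaf X m (dual_sheaf X A))))"

definition diminished_base_locus ::
  "('x, 'r) ringed_space \<Rightarrow> ('x, 'r, 'l) mod_presheaf \<Rightarrow> ('x, 'r, 'm) mod_presheaf \<Rightarrow> 'x set" where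
  "diminished_base_locus X A V = (\<Union>q\<in>{1..}. \<Inter>m\<in>{1..}.
     Bs X (tensor_sheaf X (sym_power_sheaf X m (sym_power_sheaf X q V))
                          (tensor_power_sheaf X m A)))"

definition V_big ::
  "('x, 'r) ringed_space \<Rightarrow> ('x, 'r, 'l) mod_presheaf \<Rightarrow> ('x, 'r, 'm) mod_presheaf \<Rightarrow> bool" where
  "V_big X A V \<longleftrightarrow> augmented_base_locus X A V \<noteq> pts X"

definition V_psef ::
  "('x, 'r) ringed_space \<Rightarrow> ('x, 'r, 'l) mod_presheaf \<Rightarrow> ('x, 'r, 'm) mod_presheaf \<Rightarrow> bool" where
  "V_psef X A V \<longleftrightarrow> diminished_base_locus X A V \<noteq> pts X"

end

theory Submission
  imports Defs "HOL-Combinatorics.Permutations"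
begin

text \<open>Sheaves are handled through families of elements of their stalks; such a family is a local
section if it is locally a family of germs. With a generator a of every stalk of A fixed, a section
of V(d), the twist of V by the d-th power of A, becomes a family s in the stalks of V such that
u^(-d) s is a local section for every local generator u a of A. The bundle V is full at d if the
values at x of these families generate V modulo the maximal ideal, i.e. if x is not in Bs(V(d)).

If S^m S^q E is full at d, so is its quotient S^(mq) E. As A is ample, taking products shows that
S^j E is full at all degrees at least t j + c, where t = d/(mq). So such a bound holds for some t < 0
if x is not in the augmented base locus, and for all t = 1/(2q) if x is not in the diminished one.
Let E and F both satisfy it. The polarized product sends (a^j, b^j) to j! (ab)^j, and j! is
invertible, so the j-th power of a monomial of degree q in generators of E and F is generated in
degree q t j + c'. Finitely many monomials generate S^q(E + F), so S^m S^q(E + F) is full at degrees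
at least q t m + c''; then choose q and m. Conversely, S^m S^q(E + F) surjects onto S^m S^q E. By
Nakayama, a base locus different from X misses the generic point, which gives the last two claims.\<close>

text \<open>The obstacle is that bounds on symmetric powers do not pass to tensor products: the
  polarized map from S^j M and S^j N to S^j of their tensor product is in general not onto. It does
  reach the powers of pure tensors, up to j!. Hence bounds are multiplied for powers of single germs
  (\<open>prate\<close>) and turned back into bounds for whole symmetric powers
  (\<open>rate\<close>) only at the end. This works because a word in finitely many letters is a
  product of one power per letter, so the additive constants grow with the number of generators and
  not with the length of the word. They are absorbed by a large m, for which some slack in the slope
  is needed: q t <= -2 for the augmented locus, q t = 1/2 for the diminished one.

  Stalks are preferred to sections because S^m S^q V twisted by a power of A is a nest of
  sheafifications: its sections are unwieldy, while its stalks satisfy the universal properties of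
  algebra, and continuity of stalkwise maps can be tested on generators. Ampleness quantifies only
  over sheaves whose sections have the type of functions, so locally free sheaves must first be
  moved to that type.\<close>

notation carrier ("$_" [1000] 1000) and funcset (infixr "->" 60) and iff (infixr "<->" 25)
abbreviation add_in ("_ +[_] _" [65, 0, 66] 65) where "x +[R] y \<equiv> x \<oplus>\<^bsub>R\<^esub> y"
abbreviation minus_in ("_ -[_] _" [65, 0, 66] 65) where "x -[R] y \<equiv> x \<ominus>\<^bsub>R\<^esub> y"
abbreviation a_inv_in ("-[_] _" [0, 81] 80) where "-[R] x \<equiv> \<ominus>\<^bsub>R\<^esub> x"
abbreviation mult_in ("_ *[_] _" [70, 0, 71] 70) where "x *[R] y \<equiv> x \<otimes>\<^bsub>R\<^esub> y"
abbreviation smult_in ("_ *.[_] _" [70, 0, 71] 70) where "r *.[M] x \<equiv> r \<odot>\<^bsub>M\<^esub> x"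
abbreviation zero_in ("0[_]") where "0[R] \<equiv> \<zero>\<^bsub>R\<^esub>"
abbreviation one_in ("1[_]") where "1[R] \<equiv> \<one>\<^bsub>R\<^esub>"

section \<open>Semilinear maps, spans, quotients and free modules\<close>

text \<open>Restriction maps and germ maps change the coefficient ring, so linearity is taken along
  a map \<open>h\<close> of scalars; ordinary linear maps are the case of the identity. Nothing is
  required of \<open>h\<close> here, and lemmas that need it to respect carriers say so.\<close>

definition slin :: "'r ring => ('r => 's) => ('r, 'm) module => ('s, 'n) module => ('m => 'n) => bool" where
 "slin R h M N f <-> f:$M -> $N &
  (ALL x:$M. ALL y:$M. f (x +[M] y) = f x +[N] f y) &
  (ALL r:$R. ALL x:$M. f (r *.[M] x) = h r *.[N] f x)"

abbreviation lin :: "'r ring => ('r, 'm) module => ('r, 'n) module => ('m => 'n) => bool" where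
 "lin R \<equiv> slin R (%r. r)"

lemma slinD:
 assumes "slin R h M N f"
 shows "x:$M ==> f x:$N"
  and "x:$M ==> y:$M ==> f (x +[M] y) = f x +[N] f y"
  and "r:$R ==> x:$M ==> f (r *.[M] x) = h r *.[N] f x"
 using assms unfolding slin_def by auto

lemma slinI:
 assumes "!!x. x:$M ==> f x:$N"
  and "!!x y. x:$M ==> y:$M ==> f (x +[M] y) = f x +[N] f y"
  and "!!r x. r:$R ==> x:$M ==> f (r *.[M] x) = h r *.[N] f x"
 shows "slin R h M N f"
 using assms unfolding slin_def by auto

lemma slin_comp:
 assumes "slin R h M N f" "slin S k N P g" "h:$R -> $S"
 shows "slin R (%r. k (h r)) M P (%x. g (f x))"
 using assms unfolding slin_def by (auto simp: Pi_def)

lemma lin_comp: "lin R M N f ==> lin R N P g ==> lin R M P (%x. g (f x))"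
 unfolding slin_def by (auto simp: Pi_def)

lemma slin_cong:
 assumes "slin R h M N f" "module R M" "!!x. x:$M ==> f x = g x"
 shows "slin R h M N g"
proof -
 interpret module R M by fact
 show ?thesis using assms(1,3) unfolding slin_def by (auto simp: Pi_def)
qed

lemma slin_zero:
 assumes "slin R h M N f" "abelian_group M" "abelian_group N"
 shows "f 0[M] = 0[N]"
proof -
 interpret M: abelian_group M by fact
 interpret N: abelian_group N by fact
 have "f 0[M] +[N] f 0[M] = f 0[M]"
  using slinD(2)[OF assms(1), of "0[M]" "0[M]"] by simp
 then show ?thesis using slinD(1)[OF assms(1)] N.add.r_cancel_one' by (metis M.zero_closed)
qed

lemma slin_neg:
 assumes "slin R h M N f" "abelian_group M" "abelian_group N" "x:$M"
 shows "f (-[M] x) = -[N] f x"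
proof -
 interpret M: abelian_group M by fact
 interpret N: abelian_group N by fact
 have "f (-[M] x) +[N] f x = 0[N]"
  using slinD(2)[OF assms(1), of "-[M] x" x] slin_zero[OF assms(1-3)] assms(4) by (simp add: M.l_neg)
 then show ?thesis using slinD(1)[OF assms(1)] assms(4) N.minus_equality by (metis M.a_inv_closed)
qed

lemma slin_minus:
 assumes "slin R h M N f" "abelian_group M" "abelian_group N" "x:$M" "y:$M"
 shows "f (x -[M] y) = f x -[N] f y"
 using slinD(2)[OF assms(1)] slin_neg[OF assms(1-3)] assms(4,5) abelian_group.a_inv_closed[OF assms(2)]
 unfolding a_minus_def by simp

lemma module_groups: "module R M ==> abelian_group M" "module R M ==> cring R"
 unfolding module_def by auto

lemma submoduleI':
 assumes "module R M" "H <= $M" "0[M]:H"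
  "!!a b. a:H ==> b:H ==> a +[M] b:H"
  "!!r a. r:$R ==> a:H ==> r *.[M] a:H"
 shows "submodule H R M"
proof -
 interpret module R M by fact
 show ?thesis
 proof (rule submoduleI)
  fix a assume "a:H"
  then have "(-[R] 1[R]) *.[M] a:H" using assms(5) by auto
  then show "-[M] a:H" using \<open>a \<in> H\<close> assms(2) smult_l_minus[of "1[R]" a] by auto
 qed (use assms in auto)
qed

lemma submoduleD:
 assumes "module R M" "submodule H R M"
 shows "H <= $M" "0[M]:H" "a:H ==> b:H ==> a +[M] b:H"
  "r:$R ==> a:H ==> r *.[M] a:H" "a:H ==> -[M] a:H"
  "a:H ==> b:H ==> a -[M] b:H"
proof -
 interpret module R M by fact
 note * = submoduleE[OF assms(2)]
 show "H <= $M" using *(1) .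
 show "0[M]:H" using assms(2) by (simp add: submodule_def subgroup_def)
 show "a:H ==> b:H ==> a +[M] b:H" "r:$R ==> a:H ==> r *.[M] a:H"
  "a:H ==> -[M] a:H" "a:H ==> b:H ==> a -[M] b:H"
  using * by (auto simp: a_minus_def)
qed

lemma submodule_zero: "module R M ==> submodule {0[M]} R M"
proof -
 assume m: "module R M"
 interpret module R M by fact
 show ?thesis by (rule submoduleI'[OF m]) auto
qed

lemma submodule_preimage:
 assumes "slin R h M N f" "module R M" "module S N" "h:$R -> $S" "submodule H S N"
 shows "submodule {x:$M. f x:H} R M"
proof -
 interpret M: module R M by fact
 interpret N: module S N by fact
 show ?thesis
  using slinD[OF assms(1)] submoduleD[OF assms(3,5)] assms(4)
  by (intro submoduleI' assms(2)) (auto simp: Pi_def slin_zero[OF assms(1) M.abelian_group_axioms N.abelian_group_axioms])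
qed

lemma submodule_image:
 assumes "lin R M N f" "module R M" "module R N" "submodule H R M"
 shows "submodule (f ` H) R N"
proof -
 interpret M: module R M by fact
 interpret N: module R N by fact
 note H = submoduleD[OF assms(2,4)] and f = slinD[OF assms(1)]
 show ?thesis
 proof (rule submoduleI'[OF assms(3)])
  show "f ` H <= $N" using H(1) f(1) by auto
  show "0[N]:f ` H"
   using H(2) slin_zero[OF assms(1) M.abelian_group_axioms N.abelian_group_axioms] by (metis imageI)
  show "a +[N] b:f ` H" if "a:f ` H" "b:f ` H" for a b
   using that H f(2) by (smt (verit) image_iff subsetD)
  show "r *.[N] a:f ` H" if "r:$R" "a:f ` H" for r a
   using that H f(3) by (smt (verit) image_iff subsetD)
 qed
qed

lemma span_submodule:
 assumes "module R M" "G <= $M"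
 shows "submodule (module_span R M G) R M"
proof -
 interpret module R M by fact
 have c: "$M:{N. submodule N R M & G <= N}" using assms(2) carrier_is_submodule by simp
 then have "module_span R M G <= $M" unfolding module_span_def by blast
 then show ?thesis
  by (intro submoduleI' assms(1)) (auto simp: module_span_def submoduleD[OF assms(1)])
qed

lemma span_superset: "G <= module_span R M G"
 unfolding module_span_def by auto

lemma span_incl: "x:G ==> x:module_span R M G"
 using span_superset[of G R M] by auto

lemma span_least: "submodule N R M ==> G <= N ==> module_span R M G <= N"
 unfolding module_span_def by auto

lemma span_mono: "G <= G' ==> module_span R M G <= module_span R M G'"
 unfolding module_span_def by auto

lemma span_carrier:
 assumes "module R M" "G <= $M"
 shows "module_span R M G <= $M"
 using span_submodule[OF assms] submoduleD(1)[OF assms(1)] by auto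

lemma span_induct [consumes 3, case_names gen zero add smult]:
 assumes "x:module_span R M G" "module R M" "G <= $M"
  and "!!x. x:G ==> P x" "P 0[M]"
  and "!!x y. x:$M ==> y:$M ==> P x ==> P y ==> P (x +[M] y)"
  and "!!r x. r:$R ==> x:$M ==> P x ==> P (r *.[M] x)"
 shows "P x"
proof -
 interpret module R M by fact
 have "submodule {x:$M. P x} R M"
  by (rule submoduleI'[OF assms(2)]) (use assms(5-7) in auto)
 from span_least[OF this, of G] show ?thesis using assms(1,3,4) by auto
qed

lemma slin_span:
 assumes "slin R h M N f" "module R M" "module S N" "h:$R -> $S" "submodule H S N"
  and "G <= $M" "!!x. x:G ==> f x:H" "x:module_span R M G"
 shows "f x:H"
 using span_least[OF submodule_preimage[OF assms(1-5)], of G] assms(6-8) by auto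

lemma slin_eq_on_span:
 assumes "slin R h M N f" "slin R h M N g" "module R M" "module S N" "h:$R -> $S"
  and "G <= $M" "!!x. x:G ==> f x = g x" "x:module_span R M G"
 shows "f x = g x"
 using assms(8,3,6)
proof (induction rule: span_induct)
 case zero
 show ?case
  using slin_zero[OF assms(1) module_groups(1)[OF assms(3)] module_groups(1)[OF assms(4)]]
   slin_zero[OF assms(2) module_groups(1)[OF assms(3)] module_groups(1)[OF assms(4)]] by simp
next
 case (add x y)
 then show ?case using slinD(2)[OF assms(1)] slinD(2)[OF assms(2)] by simp
next
 case (smult r x)
 then show ?case using slinD(3)[OF assms(1)] slinD(3)[OF assms(2)] by simp
qed (rule assms(7))

text \<open>Splitting off a single generator is what Nakayama's lemma below needs in order to remove
  generators one at a time.\<close>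

lemma span_finite_insert:
 assumes "module R M" "insert g G <= $M" "x:module_span R M (insert g G)"
 shows "EX r:$R. EX y:module_span R M G. x = (r *.[M] g) +[M] y"
 using assms(3,1,2)
proof (induction rule: span_induct)
 interpret module R M by fact
 have G: "G <= $M" and g: "g:$M" using assms(2) by auto
 note S = submoduleD[OF assms(1) span_submodule[OF assms(1) G]]
 {
  case (gen x)
  then show ?case
  proof
   assume "x = g"
   then show ?thesis using S(2) g by (intro bexI[of _ "1[R]"] bexI[of _ "0[M]"]) auto
  next
   assume "x:G"
   then show ?thesis using span_incl[of x G] G g by (intro bexI[of _ "0[R]"] bexI[of _ x]) auto
  qed
 next
  case zero
  show ?case using S(2) g by (intro bexI[of _ "0[R]"] bexI[of _ "0[M]"]) auto
 next
  case (add x y)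
  then obtain r u s v where *: "r:$R" "u:module_span R M G" "x = (r *.[M] g) +[M] u"
   "s:$R" "v:module_span R M G" "y = (s *.[M] g) +[M] v" by blast
  moreover have "u:$M" "v:$M" using *(2,5) S(1) by auto
  ultimately have "x +[M] y = ((r +[R] s) *.[M] g) +[M] (u +[M] v)"
   using g by (simp add: smult_l_distr M.a_ac)
  then show ?case using * S(3) by blast
 next
  case (smult t x)
  then obtain r u where *: "r:$R" "u:module_span R M G" "x = (r *.[M] g) +[M] u" by blast
  moreover have "u:$M" using *(2) S(1) by auto
  ultimately have "t *.[M] x = ((t *[R] r) *.[M] g) +[M] (t *.[M] u)"
   using g smult(1) by (simp add: smult_r_distr smult_assoc1)
  then show ?case using * S(4) smult(1) by blast
 }
qed

subsection \<open>Quotients\<close>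

context
 fixes R :: "'r ring" and M :: "('r, 'm) module" and N :: "'m set"
 assumes M: "module R M" and N: "submodule N R M"
begin

interpretation module R M by (rule M)

lemma submodule_abelian_subgroup: "abelian_subgroup N M"
proof -
 have "subgroup N (add_monoid M)" using N by (simp add: submodule_def)
 then show ?thesis
  by (intro abelian_subgroupI3 additive_subgroupI M.abelian_group_axioms)
qed

interpretation N: abelian_subgroup N M by (rule submodule_abelian_subgroup)

lemma quot_eq_iff: "x:$M ==> y:$M ==> N +>\<^bsub>M\<^esub> x = N +>\<^bsub>M\<^esub> y <-> x -[M] y:N"
 using N.a_rcos_module[of y x] N.a_repr_independence'[of x y] N.a_rcos_self[of x]
 by (auto simp: a_minus_def)

lemma quot_rep: "x:$M ==> c:N +>\<^bsub>M\<^esub> x ==> c:$M & N +>\<^bsub>M\<^esub> c = N +>\<^bsub>M\<^esub> x"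
 using N.a_repr_independence'[of c x] M.a_r_coset_subset_G[of N x] N.a_subset by blast

lemma quot_carrier: "$(quot_module M N) = {N +>\<^bsub>M\<^esub> x | x. x:$M}"
 by (auto simp: quot_module_def A_RCOSETS_def')

lemma quot_zero: "0[quot_module M N] = N +>\<^bsub>M\<^esub> 0[M]"
 using N.a_subset by (simp add: quot_module_def)

lemma quot_add: "x:$M ==> y:$M ==>
 (N +>\<^bsub>M\<^esub> x) +[quot_module M N] (N +>\<^bsub>M\<^esub> y) = N +>\<^bsub>M\<^esub> (x +[M] y)"
 by (simp add: quot_module_def N.a_rcos_sum)

text \<open>Scalar multiplication of cosets is defined as a union over representatives, so the point
  is that all representatives contribute the same coset.\<close>

lemma quot_smult:
 assumes "r:$R" "x:$M"
 shows "r *.[quot_module M N] (N +>\<^bsub>M\<^esub> x) = N +>\<^bsub>M\<^esub> (r *.[M] x)"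
proof -
 have *: "N +>\<^bsub>M\<^esub> (r *.[M] c) = N +>\<^bsub>M\<^esub> (r *.[M] x)" if "c:N +>\<^bsub>M\<^esub> x" for c
 proof -
  have c: "c:$M" "c -[M] x:N" using quot_rep[OF assms(2) that] quot_eq_iff assms(2) by auto
  have "r *.[M] (c -[M] x):N" using submoduleD[OF M N] c(2) assms(1) by auto
  then have "(r *.[M] c) -[M] (r *.[M] x):N"
   using assms c by (simp add: a_minus_def smult_r_distr smult_r_minus)
  then show ?thesis using quot_eq_iff assms c by auto
 qed
 have "x:N +>\<^bsub>M\<^esub> x" using assms(2) N.a_rcos_self by auto
 then have "(\<Union>c\<in>N +>\<^bsub>M\<^esub> x. N +>\<^bsub>M\<^esub> (r *.[M] c)) = N +>\<^bsub>M\<^esub> (r *.[M] x)"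
  by (intro UN_constant_eq[of x]) (auto dest: *)
 then show ?thesis by (simp add: quot_module_def)
qed

lemma quot_module: "module R (quot_module M N)"
proof -
 let ?Q = "quot_module M N"
 have a: "abelian_group ?Q"
 proof (rule abelian_groupI)
  show "EX y:$?Q. y +[?Q] x = 0[?Q]" if "x:$?Q" for x
  proof -
   obtain v where "v:$M" "x = N +>\<^bsub>M\<^esub> v" using \<open>x \<in> carrier ?Q\<close> by (auto simp: quot_carrier)
   then show ?thesis
    by (intro bexI[of _ "N +>\<^bsub>M\<^esub> (-[M] v)"]) (auto simp: quot_carrier quot_add quot_zero M.l_neg)
  qed
 qed (auto simp: quot_carrier quot_add quot_zero M.a_ac)
 show ?thesis
  by (rule moduleI[OF R.is_cring a])
   (auto simp: quot_carrier quot_add quot_zero quot_smult smult_l_distr smult_r_distr smult_assoc1)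
qed

lemma quot_proj: "lin R M (quot_module M N) (%x. N +>\<^bsub>M\<^esub> x)"
 by (rule slinI) (auto simp: quot_carrier quot_add quot_smult)

lemma quot_lift:
 assumes "slin R h M Z f" "abelian_group Z" "!!n. n:N ==> f n = 0[Z]"
 shows "EX g. slin R h (quot_module M N) Z g & (ALL x:$M. g (N +>\<^bsub>M\<^esub> x) = f x)"
proof -
 interpret Z: abelian_group Z by fact
 define g where "g C = f (SOME c. c:C)" for C
 have g: "g (N +>\<^bsub>M\<^esub> x) = f x" if x: "x:$M" for x
 proof -
  define c where "c = (SOME c. c:N +>\<^bsub>M\<^esub> x)"
  have "c:N +>\<^bsub>M\<^esub> x" unfolding c_def using someI[of "%c. c:N +>\<^bsub>M\<^esub> x" x] x N.a_rcos_self by auto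
  then have c: "c:$M" "c -[M] x:N" using quot_rep[OF x] quot_eq_iff[of c x] x by blast+
  then have "f c -[Z] f x = 0[Z]"
   using assms(3) slin_minus[OF assms(1) M.abelian_group_axioms assms(2)] x by metis
  then show ?thesis using c x slinD(1)[OF assms(1)] unfolding g_def c_def[symmetric]
   by (simp add: a_minus_def) (metis Z.add.inv_closed Z.add.inv_comm Z.add.inv_equality Z.minus_minus)
 qed
 have "slin R h (quot_module M N) Z g"
  using slinD[OF assms(1)] by (intro slinI) (auto simp: quot_carrier quot_add quot_smult g)
 then show ?thesis using g by auto
qed

end

subsection \<open>Free modules\<close>

text \<open>This is the semilinear extension of \<open>w\<close> from generators to the free module.
  The index set of the basis does not occur, because the sum runs over the support, which is finite
  for members of a free module.\<close>

definition lext :: "'r ring => ('s, 'n) module => ('r => 's) => ('b => 'n) => ('b => 'r) => 'n" where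
 "lext R N h w f = finsum N (%b. h (f b) *.[N] w b) {b. f b ~= 0[R]}"

context
 fixes R :: "'r ring" and B :: "'b set"
 assumes R: "cring R"
begin

interpretation R: cring R by (rule R)

lemma free_carrier: "f:$(free_module R B) <->
  (ALL b. f b:$R) & (ALL b. b \<notin> B --> f b = 0[R]) & finite {b. f b ~= 0[R]}"
 by (simp add: free_module_def)

lemma free_module: "module R (free_module R B)"
proof (rule moduleI[OF R], goal_cases)
 case 1
 show ?case
 proof (rule abelian_groupI)
  fix f g assume f: "f:$(free_module R B)" and g: "g:$(free_module R B)"
  have "{b. f b +[R] g b ~= 0[R]} <= {b. f b ~= 0[R]} Un {b. g b ~= 0[R]}" by auto
  then show "f +[free_module R B] g:$(free_module R B)"
   using f g finite_subset by (auto simp: free_module_def)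
  show "f +[free_module R B] g = g +[free_module R B] f"
   using f g by (auto simp: free_module_def R.a_comm)
 next
  fix f assume f: "f:$(free_module R B)"
  have "{b. -[R] f b ~= 0[R]} <= {b. f b ~= 0[R]}" by auto
  then have "(%b. -[R] f b):$(free_module R B)"
   using f finite_subset by (auto simp: free_module_def)
  then show "EX g:$(free_module R B). g +[free_module R B] f = 0[free_module R B]"
   using f by (intro bexI[of _ "%b. -[R] f b"]) (auto simp: free_module_def R.l_neg)
 qed (auto simp: free_module_def R.a_assoc)
next
 case (2 a f)
 have "{b. a *[R] f b ~= 0[R]} <= {b. f b ~= 0[R]}" using 2 by auto
 then show ?case using 2 finite_subset by (auto simp: free_module_def)
qed (auto simp: free_module_def R.l_distr R.r_distr R.m_assoc)

interpretation F: module R "free_module R B" by (rule free_module)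

lemma free_gen_carrier: "b:B ==> free_gen R b:$(free_module R B)"
 by (auto simp: free_module_def free_gen_def)

text \<open>Induction on the support: clearing one coefficient leaves a combination with one
  generator fewer.\<close>

lemma free_span: "module_span R (free_module R B) (free_gen R ` B) = $(free_module R B)"
proof
 have sub: "free_gen R ` B <= $(free_module R B)" using free_gen_carrier by auto
 show "module_span R (free_module R B) (free_gen R ` B) <= $(free_module R B)"
  by (rule span_carrier[OF free_module sub])
 note S = submoduleD[OF free_module span_submodule[OF free_module sub]]
 have "f:module_span R (free_module R B) (free_gen R ` B)"
  if "finite A" "{b. f b ~= 0[R]} = A" "f:$(free_module R B)" for A f
  using that
 proof (induction A arbitrary: f)
  case empty
  then have "f = 0[free_module R B]" by (auto simp: free_module_def)
  then show ?case using S(2) by simp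
 next
  case (insert b A)
  let ?g = "f(b := 0[R])"
  have b: "b:B" "f b:$R" using insert.prems insert.hyps(2) by (auto simp: free_carrier)
  have eq: "{c. ?g c ~= 0[R]} = A" using insert by auto
  then have "?g:$(free_module R B)" using insert by (auto simp: free_carrier)
  then have g: "?g:module_span R (free_module R B) (free_gen R ` B)" using insert.IH eq by blast
  have "f = (f b *.[free_module R B] free_gen R b) +[free_module R B] ?g"
   using insert.prems by (auto simp: free_module_def free_gen_def)
  then show ?case using S(3,4) g b span_incl[of "free_gen R b" "free_gen R ` B"] by (metis imageI)
 qed
 then show "$(free_module R B) <= module_span R (free_module R B) (free_gen R ` B)"
  by (auto simp: free_carrier)
qed

context
 fixes S :: "'s ring" and N :: "('s, 'n) module" and h w
 assumes N: "module S N" and h: "h:ring_hom R S" and w: "w:B -> $N"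
begin

interpretation N: module S N by (rule N)

lemma h_simps: "h 0[R] = 0[S]" "h 1[R] = 1[S]" "r:$R ==> h r:$S"
 using h R N ring_hom_zero[of h R S] ring_hom_one[of h R S] ring_hom_closed[of h R S] N.R.ring_axioms R.ring_axioms by auto

text \<open>Additivity of \<open>lext\<close> compares vectors with different supports, so all sums
  are first moved to a common finite index set.\<close>

lemma lext_superset:
 assumes f: "f:$(free_module R B)" and A: "finite A" "{b. f b ~= 0[R]} <= A" "A <= B"
 shows "lext R N h w f = finsum N (%b. h (f b) *.[N] w b) A"
 unfolding lext_def
 by (rule N.M.add.finprod_mono_neutral_cong_left)
  (use assms w h_simps in "auto simp: free_carrier Pi_def intro!: N.smult_closed")

lemma lext_slin: "slin R h (free_module R B) N (lext R N h w)"
proof (rule slinI)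
 fix f assume f: "f:$(free_module R B)"
 have sB: "{b. f b ~= 0[R]} <= B" "finite {b. f b ~= 0[R]}" using f by (auto simp: free_carrier)
 have cl: "b:B ==> h (f b) *.[N] w b:$N" for b
  using f w h_simps by (auto simp: free_carrier Pi_def)
 show "lext R N h w f:$N"
  unfolding lext_def by (rule N.M.finsum_closed) (use sB cl in blast)
 {
  fix r assume r: "r:$R"
  have "lext R N h w (r *.[free_module R B] f)
    = finsum N (%b. h ((r *.[free_module R B] f) b) *.[N] w b) {b. f b ~= 0[R]}"
   by (rule lext_superset) (use r f sB F.smult_closed in "auto simp: free_module_def")
  also have "\<dots> = finsum N (%b. h r *.[N] (h (f b) *.[N] w b)) {b. f b ~= 0[R]}"
   using r f w sB(1) h_simps ring_hom_mult[OF h]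
   by (intro N.M.finsum_cong') (auto simp: free_module_def N.smult_assoc1 Pi_def subset_iff)
  also have "\<dots> = h r *.[N] lext R N h w f"
   unfolding lext_def using N.finsum_smult_ldistr[OF sB(2), of "h r" "%b. h (f b) *.[N] w b"] h_simps r cl sB(1)
   by (auto simp: Pi_def subset_iff)
  finally show "lext R N h w (r *.[free_module R B] f) = h r *.[N] lext R N h w f" .
 }
 fix g assume g: "g:$(free_module R B)"
 let ?A = "{b. f b ~= 0[R]} Un {b. g b ~= 0[R]}"
 have A: "finite ?A" "?A <= B" using f g by (auto simp: free_carrier)
 have clg: "b:B ==> h (g b) *.[N] w b:$N" for b
  using g w h_simps by (auto simp: free_carrier Pi_def)
 have "lext R N h w (f +[free_module R B] g) = finsum N (%b. h ((f +[free_module R B] g) b) *.[N] w b) ?A"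
  by (rule lext_superset) (use F.a_closed[OF f g] A in auto, auto simp: free_module_def)
 also have "\<dots> = finsum N (%b. h (f b) *.[N] w b +[N] h (g b) *.[N] w b) ?A"
  using f g w A(2) h_simps ring_hom_add[OF h] cl clg
  by (intro N.M.finsum_cong') (auto simp: free_module_def N.smult_l_distr Pi_def subset_iff)
 also have "\<dots> = finsum N (%b. h (f b) *.[N] w b) ?A +[N] finsum N (%b. h (g b) *.[N] w b) ?A"
  by (rule N.M.finsum_addf) (use cl clg A(2) in "auto simp: Pi_def subset_iff")
 also have "\<dots> = lext R N h w f +[N] lext R N h w g"
  using lext_superset[OF f A(1) _ A(2)] lext_superset[OF g A(1) _ A(2)] by auto
 finally show "lext R N h w (f +[free_module R B] g) = lext R N h w f +[N] lext R N h w g" .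
qed

lemma lext_gen:
 assumes "b:B"
 shows "lext R N h w (free_gen R b) = w b"
proof -
 have "lext R N h w (free_gen R b) = finsum N (%c. h (free_gen R b c) *.[N] w c) {b}"
  by (rule lext_superset[OF free_gen_carrier[OF assms]]) (use assms in "auto simp: free_gen_def")
 also have "\<dots> = w b" using assms w h_simps by (auto simp: free_gen_def Pi_def)
 finally show ?thesis .
qed

lemma free_ext_unique:
 assumes "slin R h (free_module R B) N phi" "!!b. b:B ==> phi (free_gen R b) = w b" "f:$(free_module R B)"
 shows "phi f = lext R N h w f"
 by (rule slin_eq_on_span[OF assms(1) lext_slin free_module N, of "free_gen R ` B"])
  (use assms(2,3) free_gen_carrier lext_gen h_simps free_span in auto)

end
end

lemma minus_zero_iff:
 assumes "abelian_group M" "x:$M" "y:$M"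
 shows "x -[M] y = 0[M] <-> x = y"
proof -
 interpret abelian_group M by fact
 have "x = (x -[M] y) +[M] y" using assms(2,3) by (simp add: a_minus_def a_assoc l_neg)
 then show ?thesis using assms(2,3) by (auto simp: a_minus_def r_neg)
qed

subsection \<open>Presented modules\<close>

text \<open>The formula hidden in \<open>presented_map\<close>, isolated so that it can be
  recognized as a semilinear extension. Several generators may have the same image, hence the sum
  over a fibre of \<open>phi\<close>.\<close>

definition push :: "'r ring => 's ring => ('r => 's) => ('b => 'e) => ('b => 'r) => 'e => 's" where
 "push R R' sg phi f = (%e. finsum R' (%b. sg (f b)) {b. f b ~= 0[R] & phi b = e})"

text \<open>Both sides are compared at one generator \<open>e\<close>: among the terms
  \<open>sg (f b)\<close> times the generator \<open>phi b\<close>, exactly those with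
  \<open>phi b = e\<close> have a nonzero coordinate there.\<close>

lemma push_lext:
 assumes R: "cring R" and R': "cring R'" and sg: "sg:ring_hom R R'" and phi: "phi:B -> B'"
  and f: "f:$(free_module R B)"
 shows "push R R' sg phi f = lext R (free_module R' B') sg (%b. free_gen R' (phi b)) f"
proof
 interpret R: cring R by fact
 interpret R': cring R' by fact
 interpret F: module R' "free_module R' B'" by (rule free_module[OF R'])
 have pt: "finsum (free_module R' B') g A e = finsum R' (%b. g b e) A"
  if "finite A" "g:A -> $(free_module R' B')" for g A e
  using that
 proof (induction A)
  case empty
  show ?case unfolding F.M.finsum_empty R'.finsum_empty by (simp add: free_module_def)
 next
  case (insert a A)
  then have c: "g a:$(free_module R' B')" "g:A -> $(free_module R' B')" by auto
  have c': "(%b. g b e):A -> $R'" "g a e:$R'"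
   using c by (auto simp: free_carrier[OF R'] Pi_def)
  have "finsum (free_module R' B') g (insert a A) e = (g a +[free_module R' B'] finsum (free_module R' B') g A) e"
   using insert c by simp
  also have "\<dots> = g a e +[R'] finsum R' (%b. g b e) A"
   using insert c by (simp add: free_module_def)
  finally show ?case using insert c' by simp
 qed
 fix e
 let ?S = "{b. f b ~= 0[R]}"
 have S: "finite ?S" "?S <= B" "!!b. f b:$R" using f by (auto simp: free_carrier[OF R])
 have cl: "(%b. sg (f b) *.[free_module R' B'] free_gen R' (phi b)):?S -> $(free_module R' B')"
  using S phi ring_hom_closed[OF sg] by (auto simp: subset_iff Pi_def intro!: F.smult_closed free_gen_carrier[OF R'])
 have "lext R (free_module R' B') sg (%b. free_gen R' (phi b)) f e
   = finsum R' (%b. (sg (f b) *.[free_module R' B'] free_gen R' (phi b)) e) ?S"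
  unfolding lext_def by (rule pt[OF S(1) cl])
 also have "\<dots> = finsum R' (%b. sg (f b)) {b. f b ~= 0[R] & phi b = e}"
  by (rule R'.add.finprod_mono_neutral_cong)
   (use S ring_hom_closed[OF sg] in "auto simp: free_module_def free_gen_def intro: finite_subset[OF _ S(1)]")
 finally show "push R R' sg phi f e = lext R (free_module R' B') sg (%b. free_gen R' (phi b)) f e"
  unfolding push_def by simp
qed

lemma push_slin:
 assumes "cring R" "cring R'" "sg:ring_hom R R'" "phi:B -> B'"
 shows "slin R sg (free_module R B) (free_module R' B') (push R R' sg phi)"
  and "b:B ==> push R R' sg phi (free_gen R b) = free_gen R' (phi b)"
proof -
 have w: "(%b. free_gen R' (phi b)):B -> $(free_module R' B')"
  using assms(4) by (auto intro!: free_gen_carrier[OF assms(2)])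
 note L = lext_slin[OF assms(1) free_module[OF assms(2)] assms(3) w]
 show "slin R sg (free_module R B) (free_module R' B') (push R R' sg phi)"
  by (rule slin_cong[OF L free_module[OF assms(1)]]) (simp add: push_lext[OF assms])
 show "b:B ==> push R R' sg phi (free_gen R b) = free_gen R' (phi b)"
  using lext_gen[OF assms(1) free_module[OF assms(2)] assms(3) w]
  by (simp add: push_lext[OF assms free_gen_carrier[OF assms(1)]])
qed

definition pclass :: "'r ring => 'b set => ('b => 'r) set => ('b => 'r) => ('b => 'r) set" where
 "pclass R B Rel f = module_span R (free_module R B) Rel +>\<^bsub>free_module R B\<^esub> f"

context
 fixes R :: "'r ring" and B :: "'b set" and Rel :: "('b => 'r) set"
 assumes R: "cring R" and Rel: "Rel <= $(free_module R B)"
begin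

lemmas presented_submodule = span_submodule[OF free_module[OF R] Rel]

lemma presented_module: "module R (presented_module R B Rel)"
 unfolding presented_module_def by (rule quot_module[OF free_module[OF R] presented_submodule])

lemma pclass_lin: "lin R (free_module R B) (presented_module R B Rel) (pclass R B Rel)"
 unfolding presented_module_def pclass_def[abs_def]
 by (rule quot_proj[OF free_module[OF R] presented_submodule])

lemma presented_carrier: "$(presented_module R B Rel) = pclass R B Rel ` $(free_module R B)"
 unfolding presented_module_def pclass_def quot_carrier[OF free_module[OF R] presented_submodule] by auto

lemma pclass_eq_iff: "f:$(free_module R B) ==> g:$(free_module R B) ==>
  pclass R B Rel f = pclass R B Rel g <-> f -[free_module R B] g:module_span R (free_module R B) Rel"
 unfolding pclass_def by (rule quot_eq_iff[OF free_module[OF R] presented_submodule])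

lemma pclass_rel:
 assumes "f:module_span R (free_module R B) Rel"
 shows "pclass R B Rel f = 0[presented_module R B Rel]"
proof -
 interpret module R "free_module R B" by (rule free_module[OF R])
 have f: "f:$(free_module R B)" using assms span_carrier[OF free_module[OF R] Rel] by auto
 have "f -[free_module R B] 0[free_module R B] = f" using f by (simp add: a_minus_def)
 then show ?thesis
  using pclass_eq_iff[OF f, of "0[free_module R B]"] assms
   slin_zero[OF pclass_lin module_groups(1)[OF free_module[OF R]] module_groups(1)[OF presented_module]]
  by simp
qed

lemma pgen_class: "presented_gen R B Rel b = pclass R B Rel (free_gen R b)"
 unfolding presented_gen_def pclass_def ..

lemma pgen_carrier: "b:B ==> presented_gen R B Rel b:$(presented_module R B Rel)"
 unfolding pgen_class by (rule slinD(1)[OF pclass_lin free_gen_carrier[OF R]])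

lemma pgen_span: "module_span R (presented_module R B Rel) (presented_gen R B Rel ` B)
  = $(presented_module R B Rel)" (is "?S = ?C")
proof
 have g: "presented_gen R B Rel ` B <= ?C" using pgen_carrier by auto
 show "?S <= ?C" by (rule span_carrier[OF presented_module g])
 have "pclass R B Rel f:?S" if "f:$(free_module R B)" for f
  by (rule slin_span[OF pclass_lin free_module[OF R] presented_module _ span_submodule[OF presented_module g],
     of "free_gen R ` B"])
   (use that in "auto simp: free_span[OF R] pgen_class[symmetric] intro!: free_gen_carrier[OF R] span_incl")
 then show "?C <= ?S" unfolding presented_carrier by auto
qed

lemma presented_lift:
 fixes S :: "'s ring" and N :: "('s, 'n) module"
 assumes N: "module S N" and h: "h:ring_hom R S" and w: "w:B -> $N"
  and z: "!!rh. rh:Rel ==> lext R N h w rh = 0[N]"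
 shows "EX phi. slin R h (presented_module R B Rel) N phi &
  (ALL f:$(free_module R B). phi (pclass R B Rel f) = lext R N h w f) &
  (ALL b:B. phi (presented_gen R B Rel b) = w b)"
proof -
 note L = lext_slin[OF R N h w]
 have hc: "h:$R -> $S" using h by (auto intro: ring_hom_closed)
 have "lext R N h w n = 0[N]" if "n:module_span R (free_module R B) Rel" for n
  using slin_span[OF L free_module[OF R] N hc submodule_zero[OF N] Rel _ that] z by auto
 from quot_lift[OF free_module[OF R] presented_submodule L module_groups(1)[OF N] this]
 obtain g where "slin R h (presented_module R B Rel) N g" "ALL f:$(free_module R B). g (pclass R B Rel f) = lext R N h w f"
  unfolding presented_module_def pclass_def by auto
 then show ?thesis
  by (intro exI[of _ g]) (auto simp: pgen_class lext_gen[OF R N h w] free_gen_carrier[OF R])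
qed

end

text \<open>Since \<open>push\<close> sends relations into the span of the relations of the target,
  two representatives of a class have images in the same coset, and the union over representatives
  collapses to that coset.\<close>

lemma presented_map:
 assumes R: "cring R" and R': "cring R'" and sg: "sg:ring_hom R R'" and phi: "phi:B -> B'"
  and Rel: "Rel <= $(free_module R B)" and Rel': "Rel' <= $(free_module R' B')"
  and rel: "!!rh. rh:Rel ==> push R R' sg phi rh:module_span R' (free_module R' B') Rel'"
 shows "slin R sg (presented_module R B Rel) (presented_module R' B' Rel') (presented_map R R' B' Rel' sg phi)"
  and "f:$(free_module R B) ==>
   presented_map R R' B' Rel' sg phi (pclass R B Rel f) = pclass R' B' Rel' (push R R' sg phi f)"
  and "b:B ==> presented_map R R' B' Rel' sg phi (presented_gen R B Rel b) = presented_gen R' B' Rel' (phi b)"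
proof -
 note P = push_slin[OF R R' sg phi] and FR = free_module[OF R, of B] and FR' = free_module[OF R', of B']
 note sp = span_submodule[OF FR Rel] and sp' = span_submodule[OF FR' Rel']
 have sgc: "sg:$R -> $R'" using sg by (auto intro: ring_hom_closed)
 have *: "presented_map R R' B' Rel' sg phi (pclass R B Rel f) = pclass R' B' Rel' (push R R' sg phi f)"
  if f: "f:$(free_module R B)" for f
 proof -
  have c: "pclass R' B' Rel' (push R R' sg phi g) = pclass R' B' Rel' (push R R' sg phi f)" if "g:pclass R B Rel f" for g
  proof -
   have g: "g:$(free_module R B)" "g -[free_module R B] f:module_span R (free_module R B) Rel"
    using quot_rep[OF FR sp f that[unfolded pclass_def]] quot_eq_iff[OF FR sp, of g f] f by blast+
   have "push R R' sg phi (g -[free_module R B] f):module_span R' (free_module R' B') Rel'"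
    by (rule slin_span[OF P(1) FR FR' sgc sp' Rel rel g(2)])
   then show ?thesis
    using pclass_eq_iff[OF R' Rel'] slinD(1)[OF P(1)] f g(1)
     slin_minus[OF P(1) module_groups(1)[OF FR] module_groups(1)[OF FR']] by auto
  qed
  have "f:pclass R B Rel f"
   unfolding pclass_def using abelian_subgroup.a_rcos_self[OF submodule_abelian_subgroup[OF FR sp]] f by auto
  then have "(\<Union>g\<in>pclass R B Rel f. pclass R' B' Rel' (push R R' sg phi g)) = pclass R' B' Rel' (push R R' sg phi f)"
   by (intro UN_constant_eq[of f]) (auto dest: c)
  then show ?thesis unfolding presented_map_def pclass_def push_def by simp
 qed
 show "f:$(free_module R B) ==>
   presented_map R R' B' Rel' sg phi (pclass R B Rel f) = pclass R' B' Rel' (push R R' sg phi f)"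
  by (rule *)
 show "b:B ==> presented_map R R' B' Rel' sg phi (presented_gen R B Rel b) = presented_gen R' B' Rel' (phi b)"
  using *[OF free_gen_carrier[OF R]] P(2) by (simp add: pgen_class[OF R Rel] pgen_class[OF R' Rel'])
 note Q = slinD[OF pclass_lin[OF R Rel]] and Q' = slinD[OF pclass_lin[OF R' Rel']] and P' = slinD[OF P(1)]
 interpret F: module R "free_module R B" by (rule FR)
 show "slin R sg (presented_module R B Rel) (presented_module R' B' Rel') (presented_map R R' B' Rel' sg phi)"
 proof (rule slinI)
  fix x r assume x: "x:$(presented_module R B Rel)" and r: "r:$R"
  then obtain f where f: "f:$(free_module R B)" "x = pclass R B Rel f"
   by (auto simp: presented_carrier[OF R Rel])
  show "presented_map R R' B' Rel' sg phi (r *.[presented_module R B Rel] x) =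
    sg r *.[presented_module R' B' Rel'] presented_map R R' B' Rel' sg phi x"
   using f r sgc by (simp add: Q(3)[symmetric] Q'(3)[symmetric] * P' Pi_def)
 next
  fix x y assume "x:$(presented_module R B Rel)" "y:$(presented_module R B Rel)"
  then obtain f g where "f:$(free_module R B)" "x = pclass R B Rel f"
   "g:$(free_module R B)" "y = pclass R B Rel g"
   by (auto simp: presented_carrier[OF R Rel])
  then show "presented_map R R' B' Rel' sg phi (x +[presented_module R B Rel] y) =
    presented_map R R' B' Rel' sg phi x +[presented_module R' B' Rel'] presented_map R R' B' Rel' sg phi y"
   by (simp add: Q(2)[symmetric] Q'(2)[symmetric] * P')
 qed (use * Q'(1) P'(1) in "auto simp: presented_carrier[OF R Rel]")
qed

text \<open>\<open>S\<close> with the generators \<open>w\<close> is, up to isomorphism, the presented module.\<close>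

definition pres :: "'r ring => 'b set => ('b => 'r) set => ('r, 's) module => ('b => 's) => bool" where
 "pres R B Rel S w <-> module R S & w:B -> $S &
  (ALL rh:Rel. lext R S (%r. r) w rh = 0[S]) & module_span R S (w ` B) = $S &
  (EX phi. lin R S (presented_module R B Rel) phi & (ALL b:B. phi (w b) = presented_gen R B Rel b))"

lemma id_ring_hom: "cring R ==> (%r. r):ring_hom R R"
 by (auto simp: ring_hom_def)

lemma pres_lift:
 assumes p: "pres R B Rel S w" and Rel: "Rel <= $(free_module R B)" and N: "module R N" and b: "b:B -> $N"
  and z: "!!rh. rh:Rel ==> lext R N (%r. r) b rh = 0[N]"
 shows "EX phi. lin R S N phi & (ALL x:B. phi (w x) = b x)"
proof -
 from p obtain phi where R: "cring R" and phi: "lin R S (presented_module R B Rel) phi" "!!x. x:B ==> phi (w x) = presented_gen R B Rel x"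
  unfolding pres_def using module_groups by blast
 from presented_lift[OF R Rel N id_ring_hom[OF R] b z] obtain psi where
  "lin R (presented_module R B Rel) N psi" "!!x. x:B ==> psi (presented_gen R B Rel x) = b x" by blast
 then show ?thesis using phi lin_comp[OF phi(1)] by (intro exI[of _ "%x. psi (phi x)"]) auto
qed

section \<open>Germs, stalks and local sections\<close>

definition presh :: "'x topology => ('x set => 's set) => ('x set => 'x set => 's => 's) => bool" where
 "presh T S rh <->
  (ALL U V. openin T U & openin T V & V <= U --> rh U V:S U -> S V) &
  (ALL U. openin T U --> (ALL s:S U. rh U U s = s)) &
  (ALL U V W. openin T U & openin T V & openin T W & W <= V & V <= U -->
   (ALL s:S U. rh V W (rh U V s) = rh U W s))"

lemma set_sheaf_presh: "set_sheaf T S rh ==> presh T S rh"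
 unfolding set_sheaf_def presh_def by (elim conjE) (intro conjI; assumption)

lemma preshD:
 assumes "presh T S rh"
 shows "openin T U ==> openin T V ==> V <= U ==> s:S U ==> rh U V s:S V"
  and "openin T U ==> s:S U ==> rh U U s = s"
  and "openin T U ==> openin T V ==> openin T W ==> W <= V ==> V <= U ==> s:S U ==> rh V W (rh U V s) = rh U W s"
 using assms by (simp_all add: presh_def Pi_iff)

lemma set_sheaf_glue:
 assumes "set_sheaf T S rh" "!!V. V:VV ==> openin T V" "!!V. V:VV ==> s V:S V"
  and "!!V W. V:VV ==> W:VV ==> rh V (V Int W) (s V) = rh W (V Int W) (s W)"
 shows "EX t:S (\<Union>VV). ALL V:VV. rh (\<Union>VV) V t = s V"
proof -
 have "(ALL V:VV. openin T V) & (ALL V:VV. s V:S V) &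
   (ALL V:VV. ALL W:VV. rh V (V Int W) (s V) = rh W (V Int W) (s W))"
  by (intro conjI ballI assms(2-4))
 then have "EX! t. t:S (\<Union>VV) & (ALL V:VV. rh (\<Union>VV) V t = s V)"
  using assms(1) unfolding set_sheaf_def by (elim conjE) (drule spec[of _ VV], drule spec[of _ s], simp)
 then show ?thesis by blast
qed

text \<open>The open sets on which \<open>s\<close> and \<open>t\<close> agree cover
  \<open>U\<close>, and both sections glue the same family over that cover.\<close>

lemma set_sheaf_eq:
 assumes sh: "set_sheaf T S rh" and U: "openin T U" and s: "s:S U" "t:S U"
  and loc: "!!y. y:U ==> EX W. openin T W & y:W & W <= U & rh U W s = rh U W t"
 shows "s = t"
proof -
 note P = preshD[OF set_sheaf_presh[OF sh]]
 define VV where "VV = {W. openin T W & W <= U & rh U W s = rh U W t}"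
 have un: "\<Union>VV = U" unfolding VV_def using loc by blast
 have "(ALL V:VV. openin T V) & (ALL V:VV. rh U V s:S V) &
   (ALL V:VV. ALL W:VV. rh V (V Int W) (rh U V s) = rh W (V Int W) (rh U W s))"
 proof (intro conjI ballI)
  fix V W assume "V:VV" "W:VV"
  then have VW: "openin T V" "V <= U" "openin T W" "W <= U" "openin T (V Int W)" by (auto simp: VV_def)
  show "rh V (V Int W) (rh U V s) = rh W (V Int W) (rh U W s)"
   using P(3)[OF U VW(1,5) _ VW(2) s(1)] P(3)[OF U VW(3,5) _ VW(4) s(1)] by simp
 qed (use P(1)[OF U _ _ s(2)] in "auto simp: VV_def")
 then have "EX! t. t:S (\<Union>VV) & (ALL V:VV. rh (\<Union>VV) V t = rh U V s)"
  using sh unfolding set_sheaf_def by (elim conjE) (drule spec[of _ VV], drule spec[of _ "%V. rh U V s"], simp)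
 moreover have "s:S (\<Union>VV) & (ALL V:VV. rh (\<Union>VV) V s = rh U V s)" using s un by auto
 moreover have "t:S (\<Union>VV) & (ALL V:VV. rh (\<Union>VV) V t = rh U V s)" using s un by (auto simp: VV_def)
 ultimately show ?thesis by blast
qed

lemma germ_mem: "(V, t):germ T S rh x U s <-> openin T V & x:V & t:S V &
  (EX W. openin T W & x:W & W <= U Int V & rh U W s = rh V W t)"
 by (simp add: germ_def)

text \<open>Anything that agrees with one section near \<open>x\<close> agrees with the other on the
  intersection of the two witnessing neighbourhoods.\<close>

lemma germ_eqI:
 assumes P: "presh T S rh" and U: "openin T U" "s:S U" and V: "openin T V" "t:S V"
  and W: "openin T W" "x:W" "W <= U Int V" "rh U W s = rh V W t"
 shows "germ T S rh x U s = germ T S rh x V t"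
proof -
 have *: "germ T S rh x U s <= germ T S rh x V t"
  if U: "openin T U" "s:S U" and V: "openin T V" "t:S V"
   and W: "W <= U Int V" "rh U W s = rh V W t" for U V s t
 proof
  fix p assume "p:germ T S rh x U s"
  then obtain A a B where p: "p = (A, a)" "openin T A" "x:A" "a:S A"
   and B: "openin T B" "x:B" "B <= U Int A" "rh U B s = rh A B a"
   by (cases p) (auto simp: germ_mem)
  note \<open>openin T W\<close>
  have WB: "openin T (W Int B)" using \<open>openin T W\<close> B by auto
  have "rh V (W Int B) t = rh W (W Int B) (rh V W t)"
   using preshD(3)[OF P, of V W "W Int B" t] WB V W \<open>openin T W\<close> by auto
  also have "\<dots> = rh U (W Int B) s"
   using preshD(3)[OF P, of U W "W Int B" s] WB U W \<open>openin T W\<close> by auto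
  also have "\<dots> = rh B (W Int B) (rh U B s)"
   using preshD(3)[OF P, of U B "W Int B" s] WB U B by auto
  also have "\<dots> = rh A (W Int B) a"
   using preshD(3)[OF P, of A B "W Int B" a] WB p B by auto
  finally show "p:germ T S rh x V t"
   using p WB \<open>x \<in> W\<close> B W by (auto simp: germ_mem intro!: exI[of _ "W Int B"])
 qed
 show ?thesis using *[OF U V W(3,4)] *[OF V U _ W(4)[symmetric]] W(3) by auto
qed

lemma germ_self:
 assumes "presh T S rh" "openin T U" "x:U" "s:S U"
 shows "(U, s):germ T S rh x U s"
 using assms by (auto simp: germ_mem)

lemma germ_eq_iff:
 assumes P: "presh T S rh" and U: "openin T U" "x:U" "s:S U" and V: "openin T V" "x:V" "t:S V"
 shows "germ T S rh x U s = germ T S rh x V t <->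
  (EX W. openin T W & x:W & W <= U Int V & rh U W s = rh V W t)"
 using germ_eqI[OF P U(1,3) V(1,3)] germ_self[OF P V] germ_mem[of V t T S rh x U s] by blast

lemma germ_res:
 assumes "presh T S rh" "openin T U" "openin T V" "V <= U" "x:V" "s:S U"
 shows "germ T S rh x V (rh U V s) = germ T S rh x U s"
 using assms preshD[OF assms(1)] by (intro germ_eqI[OF assms(1), where W=V]) auto

text \<open>Operations on germs are unions over all pairs of representatives; compatibility of
  \<open>f\<close> with restriction makes all members of the union one and the same germ. Three
  presheaves are allowed, so that products, sums and the action of scalars on modules are covered
  together.\<close>

lemma germ_op:
 fixes S :: "'x set => 's set" and S' :: "'x set => 't set" and S'' :: "'x set => 'u set"
 assumes P: "presh T S rh" and P': "presh T S' rh'" and P'': "presh T S'' rh''"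
  and op: "!!U s t. openin T U ==> s:S U ==> t:S' U ==> f U s t:S'' U"
  and op_res: "!!U V s t. openin T U ==> openin T V ==> V <= U ==> s:S U ==> t:S' U ==>
   rh'' U V (f U s t) = f V (rh U V s) (rh' U V t)"
  and U: "openin T U" "x:U" "s:S U" "t:S' U"
 shows "(\<Union>(A, a)\<in>germ T S rh x U s. \<Union>(B, b)\<in>germ T S' rh' x U t.
   germ T S'' rh'' x (A Int B) (f (A Int B) (rh A (A Int B) a) (rh' B (A Int B) b))) = germ T S'' rh'' x U (f U s t)"
proof -
 have *: "germ T S'' rh'' x (A Int B) (f (A Int B) (rh A (A Int B) a) (rh' B (A Int B) b)) = germ T S'' rh'' x U (f U s t)"
  if Aa: "(A, a):germ T S rh x U s" and Bb: "(B, b):germ T S' rh' x U t" for A a B b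
 proof -
  from Aa obtain C where A: "openin T A" "x:A" "a:S A"
   and C: "openin T C" "x:C" "C <= U Int A" "rh U C s = rh A C a" by (auto simp: germ_mem)
  from Bb obtain D where B: "openin T B" "x:B" "b:S' B"
   and D: "openin T D" "x:D" "D <= U Int B" "rh' U D t = rh' B D b" by (auto simp: germ_mem)
  have AB0: "openin T (A Int B)" using A B by auto
  then have AB: "openin T (A Int B)" "rh A (A Int B) a:S (A Int B)" "rh' B (A Int B) b:S' (A Int B)"
   using preshD(1)[OF P A(1) AB0 _ A(3)] preshD(1)[OF P' B(1) AB0 _ B(3)] by auto
  have CD: "openin T (C Int D)" using C D by auto
  have "rh (A Int B) (C Int D) (rh A (A Int B) a) = rh C (C Int D) (rh A C a)"
   using preshD(3)[OF P A(1) AB(1) CD _ _ A(3)] preshD(3)[OF P A(1) C(1) CD _ _ A(3)] C D by auto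
  also have "\<dots> = rh U (C Int D) s" using preshD(3)[OF P U(1) C(1) CD _ _ U(3)] C D by auto
  finally have 1: "rh (A Int B) (C Int D) (rh A (A Int B) a) = rh U (C Int D) s" .
  have "rh' (A Int B) (C Int D) (rh' B (A Int B) b) = rh' D (C Int D) (rh' B D b)"
   using preshD(3)[OF P' B(1) AB(1) CD _ _ B(3)] preshD(3)[OF P' B(1) D(1) CD _ _ B(3)] C D by auto
  also have "\<dots> = rh' U (C Int D) t" using preshD(3)[OF P' U(1) D(1) CD _ _ U(4)] C D by auto
  finally have 2: "rh' (A Int B) (C Int D) (rh' B (A Int B) b) = rh' U (C Int D) t" .
  have sub: "C Int D <= A Int B" "C Int D <= U" using C D by auto
  have "rh'' (A Int B) (C Int D) (f (A Int B) (rh A (A Int B) a) (rh' B (A Int B) b)) = rh'' U (C Int D) (f U s t)"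
   using op_res[OF AB(1) CD sub(1) AB(2,3)] op_res[OF U(1) CD sub(2) U(3,4)] 1 2 by simp
  then show ?thesis
   by (intro germ_eqI[OF P'' AB(1) op[OF AB] U(1) op[OF U(1,3,4)] CD]) (use sub C D in auto)
 qed
 have "(\<Union>(B, b)\<in>germ T S' rh' x U t.
   germ T S'' rh'' x (A Int B) (f (A Int B) (rh A (A Int B) a) (rh' B (A Int B) b))) = germ T S'' rh'' x U (f U s t)"
  if "(A, a):germ T S rh x U s" for A a
  by (rule UN_constant_eq[of "(U, t)"]) (use germ_self[OF P' U(1,2,4)] *[OF that] in auto)
 then show ?thesis
  by (intro UN_constant_eq[of "(U, s)"]) (use germ_self[OF P U(1-3)] in auto)
qed

text \<open>Stalks and local sections make sense without gluing, and presented presheaves do not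
  glue. The sheaf axiom is needed only to turn a family of germs back into a section.\<close>

definition mod_presh :: "('x, 'r) ringed_space => ('x, 'r, 'm) mod_presheaf => bool" where
 "mod_presh X P <-> (ALL U. openin (topo X) U --> module (sec X U) (msec P U)) &
  (ALL U V. openin (topo X) U & openin (topo X) V & V <= U -->
   slin (sec X U) (res X U V) (msec P U) (msec P V) (mres P U V)) &
  presh (topo X) (%U. $(msec P U)) (mres P)"

lemma sheaf_presh: "module_sheaf X M ==> mod_presh X M"
 unfolding module_sheaf_def mod_presh_def slin_def
 using set_sheaf_presh[of "topo X" "%U. $(msec M U)" "mres M"] by (auto simp: presh_def)

text \<open>Up to its values outside \<open>U\<close>, such a family is a section over
  \<open>U\<close> of the sheafification of \<open>P\<close>. Leaving these values free allows
  families to be written as plain functions on points.\<close>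

definition lsec :: "('x, 'r) ringed_space => ('x, 'r, 'm) mod_presheaf => 'x set => ('x => ('x, 'm) germ) => bool" where
 "lsec X P U sg <-> openin (topo X) U & (ALL y:U. EX W. openin (topo X) W & y:W & W <= U &
  (EX t:$(msec P W). ALL z:W. sg z = mgerm X P z W t))"

locale lrs =
 fixes X :: "('x, 'r) ringed_space"
 assumes lrs: "locally_ringed_space X"
begin

abbreviation "St \<equiv> mstalk X"
abbreviation "mg \<equiv> mgerm X"
abbreviation "rg \<equiv> rgerm X"
abbreviation "lse \<equiv> lsec X"
abbreviation "mp \<equiv> mod_presh X"
abbreviation "SX \<equiv> sec X"


abbreviation op where "op \<equiv> openin (topo X)"
abbreviation Ox where "Ox \<equiv> stalk X"
abbreviation OX where "OX \<equiv> structure_module X"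

lemma rs: "is_ringed_space X" using lrs by (simp add: locally_ringed_space_def)

lemma sec_cring: "op U ==> cring (SX U)" using rs by (simp add: is_ringed_space_def)
lemma res_hom: "op U ==> op V ==> V <= U ==> res X U V:ring_hom (SX U) (SX V)"
 using rs by (simp add: is_ringed_space_def)
lemma sec_sheaf: "set_sheaf (topo X) (%U. $(SX U)) (res X)" using rs by (simp add: is_ringed_space_def)
lemmas sec_presh = set_sheaf_presh[OF sec_sheaf]
lemma stalk_local: "y:pts X ==> local_ring (Ox y)" using lrs by (simp add: locally_ringed_space_def)
lemma stalk_cring: "y:pts X ==> cring (Ox y)" using stalk_local by (simp add: local_ring_def)
lemma op_pts: "op U ==> y:U ==> y:pts X" using openin_subset by blast
text \<open>Regarding functions as sections of the module \<open>OX\<close> makes every fact about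
  local sections of modules available for scalars as well.\<close>

lemma rgerm_mgerm: "rg = mg OX"
 by (intro ext) (simp add: rgerm_def mgerm_def structure_module_def)

lemma OX_carrier: "$(msec OX U) = $(SX U)"
 by (simp add: structure_module_def)

lemma OX_sheaf: "module_sheaf X OX"
 unfolding module_sheaf_def
proof (intro conjI allI impI)
 fix U assume U: "op U"
 interpret cring "SX U" by (rule sec_cring[OF U])
 have "abelian_group (msec OX U)"
  by (rule abelian_groupI) (auto simp: structure_module_def a_ac intro!: bexI[of _ "-[SX U] _"] l_neg)
 then show "module (SX U) (msec OX U)"
  by (intro moduleI is_cring) (auto simp: structure_module_def l_distr r_distr m_assoc)
next
 show "set_sheaf (topo X) (%U. $(msec OX U)) (mres OX)"
  using sec_sheaf by (simp add: structure_module_def)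
qed (auto simp: structure_module_def ring_hom_add[OF res_hom] ring_hom_mult[OF res_hom])

lemmas OX_presh = sheaf_presh[OF OX_sheaf]

lemma rgerm_op:
 assumes U: "op U" "y:U" "r:$(SX U)" "s:$(SX U)"
 shows "rg y U r:$(Ox y)"
  and "rg y U r *[Ox y] rg y U s = rg y U (r *[SX U] s)"
  and "rg y U r +[Ox y] rg y U s = rg y U (r +[SX U] s)"
proof -
 show "rg y U r:$(Ox y)" using U by (auto simp: stalk_def)
 have c: "op V ==> ring (SX V)" for V using sec_cring by (simp add: cring_def)
 show "rg y U r *[Ox y] rg y U s = rg y U (r *[SX U] s)"
  using germ_op[OF sec_presh sec_presh sec_presh _ _ U, of "%U. monoid.mult (SX U)"]
  by (simp add: stalk_def rgerm_def ring_hom_mult[OF res_hom] monoid.m_closed[OF ring.axioms(2)[OF c]])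
 show "rg y U r +[Ox y] rg y U s = rg y U (r +[SX U] s)"
  using germ_op[OF sec_presh sec_presh sec_presh _ _ U, of "%U. ring.add (SX U)"]
  by (simp add: stalk_def rgerm_def ring_hom_add[OF res_hom] ring.ring_simprules(1)[OF c])
qed

lemma rgerm_res: "op U ==> op V ==> V <= U ==> y:V ==> r:$(SX U) ==>
  rg y V (res X U V r) = rg y U r"
 unfolding rgerm_def by (rule germ_res[OF sec_presh])

lemma rgerm_one: "op U ==> y:U ==> rg y U 1[SX U] = 1[Ox y]"
 using rgerm_res[of "pts X" U y "1[SX (pts X)]"] ring_hom_one[OF res_hom[of "pts X" U]]
  sec_cring[of "pts X"] openin_subset[of "topo X" U]
 by (simp add: stalk_def cring_def ring.ring_simprules)

lemma rgerm_zero: "op U ==> y:U ==> rg y U 0[SX U] = 0[Ox y]"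
 using rgerm_res[of "pts X" U y "0[SX (pts X)]"] ring_hom_zero[OF res_hom[of "pts X" U]]
  sec_cring[of "pts X"] sec_cring[of U] openin_subset[of "topo X" U]
 by (simp add: stalk_def cring_def ring.ring_simprules)

lemma rgerm_hom: "op U ==> y:U ==> rg y U:ring_hom (SX U) (Ox y)"
 by (rule ring_hom_memI) (auto simp: rgerm_op rgerm_one)

lemma stalk_rep:
 assumes "a:$(Ox y)"
 obtains U r where "op U" "y:U" "r:$(SX U)" "a = rg y U r"
 using assms by (auto simp: stalk_def)

lemma presh_modD:
 assumes "mp P"
 shows "op U ==> module (SX U) (msec P U)"
  and "op U ==> op V ==> V <= U ==> slin (SX U) (res X U V) (msec P U) (msec P V) (mres P U V)"
  and "presh (topo X) (%U. $(msec P U)) (mres P)"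
 using assms unfolding mod_presh_def by auto

context
 fixes P :: "('x, 'r, 'm) mod_presheaf"
 assumes P: "mp P"
begin

lemmas P' = presh_modD[OF P]

lemma mgerm_res: "op U ==> op V ==> V <= U ==> y:V ==> s:$(msec P U) ==>
  mg P y V (mres P U V s) = mg P y U s"
 unfolding mgerm_def by (rule germ_res[OF P'(3)])

lemma mres_closed: "op U ==> op V ==> V <= U ==> s:$(msec P U) ==> mres P U V s:$(msec P V)"
 by (rule preshD(1)[OF P'(3)])

lemma mgerm_eq_iff: "op U ==> y:U ==> s:$(msec P U) ==> op V ==> y:V ==> t:$(msec P V) ==>
  mg P y U s = mg P y V t <-> (EX W. op W & y:W & W <= U Int V & mres P U W s = mres P V W t)"
 unfolding mgerm_def by (rule germ_eq_iff[OF P'(3)])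

lemma mstalk_rep:
 assumes "a:$(St P y)"
 obtains U s where "op U" "y:U" "s:$(msec P U)" "a = mg P y U s"
 using assms by (auto simp: mstalk_def)

lemma mgerm_op:
 assumes U: "op U" "y:U" "s:$(msec P U)"
 shows "mg P y U s:$(St P y)"
  and "t:$(msec P U) ==> mg P y U s +[St P y] mg P y U t = mg P y U (s +[msec P U] t)"
  and "r:$(SX U) ==> rg y U r *.[St P y] mg P y U s = mg P y U (r *.[msec P U] s)"
proof -
 show "mg P y U s:$(St P y)" using U by (auto simp: mstalk_def)
 have c: "op V ==> abelian_group (msec P V)" for V by (rule module_groups(1)[OF P'(1)])
 show "mg P y U s +[St P y] mg P y U t = mg P y U (s +[msec P U] t)"
  if t: "t:$(msec P U)"
  using germ_op[OF P'(3) P'(3) P'(3) _ _ U t, of "%U. ring.add (msec P U)"]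
  by (simp add: mstalk_def mgerm_def slinD(2)[OF P'(2)] abelian_groupE(1)[OF c])
 show "rg y U r *.[St P y] mg P y U s = mg P y U (r *.[msec P U] s)"
  if r: "r:$(SX U)"
  using germ_op[OF sec_presh P'(3) P'(3) _ _ U(1,2) r U(3), of "%U. module.smult (msec P U)"]
  by (simp add: mstalk_def mgerm_def rgerm_def slinD(3)[OF P'(2)] module.smult_closed[OF P'(1)])
qed

lemma mgerm_zero: "op U ==> y:U ==> mg P y U 0[msec P U] = 0[St P y]"
 using mgerm_res[of "pts X" U y "0[msec P (pts X)]"] slin_zero[OF P'(2)[of "pts X" U]]
  module_groups(1)[OF P'(1)] openin_subset[of "topo X" U]
 by (simp add: mstalk_def abelian_groupE(2))

lemma mgerm_slin: "op U ==> y:U ==> slin (SX U) (rg y U) (msec P U) (St P y) (mg P y U)"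
 by (rule slinI) (simp_all add: mgerm_op)

text \<open>Finitely many germs live on a common neighbourhood. Lists are used because symmetric and
  tensor powers of stalks are generated by words of germs.\<close>

lemma mstalk_list_rep:
 assumes "set l <= $(St P y)" "y:pts X"
 shows "EX U ss. op U & y:U & set ss <= $(msec P U) & l = map (mg P y U) ss"
 using assms(1)
proof (induction l)
 case Nil
 show ?case using assms(2) by (intro exI[of _ "pts X"] exI[of _ "[]"]) auto
next
 case (Cons a l)
 then obtain U ss where U: "op U" "y:U" "set ss <= $(msec P U)" "l = map (mg P y U) ss" by auto
 obtain V s where V: "op V" "y:V" "s:$(msec P V)" "a = mg P y V s"
  using mstalk_rep[of a y] Cons.prems by auto
 have o: "op (U Int V)" using U V by auto
 have "map (mg P y (U Int V)) (map (mres P U (U Int V)) ss) = l"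
  using U V o by (auto simp: mgerm_res subset_iff)
 then show ?case using U V o
  by (intro exI[of _ "U Int V"] exI[of _ "mres P V (U Int V) s # map (mres P U (U Int V)) ss"])
   (auto simp: mgerm_res mres_closed subset_iff)
qed

lemma mstalk_rep2:
 assumes "a:$(St P y)" "b:$(St P y)" "y:pts X"
 obtains U s t where "op U" "y:U" "s:$(msec P U)" "t:$(msec P U)"
  "a = mg P y U s" "b = mg P y U t"
 using mstalk_list_rep[of "[a, b]" y] assms by auto

lemma stalk_module:
 assumes y: "y:pts X"
 shows "module (Ox y) (St P y)"
proof (rule moduleI[OF stalk_cring[OF y]])
 let ?M = "St P y"
 have mm: "op U ==> module (SX U) (msec P U)" and aa: "op U ==> abelian_group (msec P U)" for U
  using P'(1) module_groups by blast+
 show "abelian_group ?M"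
 proof (rule abelian_groupI)
  fix a b c assume abc: "a:$?M" "b:$?M" "c:$?M"
  from mstalk_list_rep[of "[a, b, c]" y] abc y obtain U r s t where
   U: "op U" "y:U" "r:$(msec P U)" "s:$(msec P U)" "t:$(msec P U)"
   "a = mg P y U r" "b = mg P y U s" "c = mg P y U t" by auto
  interpret module "SX U" "msec P U" by (rule mm[OF U(1)])
  show "a +[?M] b +[?M] c = a +[?M] (b +[?M] c)"
   using U by (simp add: mgerm_op M.a_assoc)
 next
  fix a b assume ab: "a:$?M" "b:$?M"
  from mstalk_rep2[OF this y] obtain U r s where
   U: "op U" "y:U" "r:$(msec P U)" "s:$(msec P U)"
   "a = mg P y U r" "b = mg P y U s" by metis
  interpret module "SX U" "msec P U" by (rule mm[OF U(1)])
  show "a +[?M] b:$?M" "a +[?M] b = b +[?M] a"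
   using U by (simp_all add: mgerm_op M.a_comm)
 next
  fix a assume a: "a:$?M"
  from mstalk_rep[OF this] obtain U r where
   U: "op U" "y:U" "r:$(msec P U)" "a = mg P y U r" by metis
  interpret module "SX U" "msec P U" by (rule mm[OF U(1)])
  show "0[?M] +[?M] a = a"
   using U by (simp add: mgerm_op mgerm_zero[OF U(1,2), symmetric])
  show "EX b:$?M. b +[?M] a = 0[?M]"
   using U by (intro bexI[of _ "mg P y U (-[msec P U] r)"])
    (auto simp: mgerm_op mgerm_zero[OF U(1,2), symmetric] M.l_neg)
 next
  show "0[?M]:$?M"
   using mgerm_op(1)[of "pts X" y "0[msec P (pts X)]"] mgerm_zero[of "pts X" y] y aa[of "pts X"]
   by (simp add: abelian_groupE(2))
 qed
 \<comment> \<open>The axioms on the scalar action involve at most two scalars and two vectors. Four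
   germs are therefore represented on one neighbourhood, where the axioms hold for sections.\<close>
 have rep: "EX U r q s t. op U & y:U & r:$(SX U) & q:$(SX U) &
   s:$(msec P U) & t:$(msec P U) &
   a = rg y U r & b = rg y U q & x = mg P y U s & z = mg P y U t"
  if "a:$(Ox y)" "b:$(Ox y)" "x:$?M" "z:$?M" for a b x z
 proof -
  from stalk_rep[OF that(1)] obtain A r where
   A: "op A" "y:A" "r:$(SX A)" "a = rg y A r" by blast
  from stalk_rep[OF that(2)] obtain B q where
   B: "op B" "y:B" "q:$(SX B)" "b = rg y B q" by blast
  from mstalk_rep2[OF that(3,4) y] obtain U s t where
   U: "op U" "y:U" "s:$(msec P U)" "t:$(msec P U)"
   "x = mg P y U s" "z = mg P y U t" by blast
  let ?W = "A Int B Int U"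
  have W: "op ?W" "y:?W" using A B U by auto
  have sub: "?W <= A" "?W <= B" "?W <= U" by auto
  show ?thesis
   by (rule exI[of _ ?W], rule exI[of _ "res X A ?W r"], rule exI[of _ "res X B ?W q"],
     rule exI[of _ "mres P U ?W s"], rule exI[of _ "mres P U ?W t"])
    (simp only: W A(4) B(4) U(5,6) preshD(1)[OF sec_presh A(1) W(1) sub(1) A(3)]
     preshD(1)[OF sec_presh B(1) W(1) sub(2) B(3)]
     rgerm_res[OF A(1) W(1) sub(1) W(2) A(3)] rgerm_res[OF B(1) W(1) sub(2) W(2) B(3)]
     mres_closed[OF U(1) W(1) sub(3) U(3)] mres_closed[OF U(1) W(1) sub(3) U(4)]
     mgerm_res[OF U(1) W(1) sub(3) W(2) U(3)] mgerm_res[OF U(1) W(1) sub(3) W(2) U(4)] simp_thms)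
 qed
 have all: "a *.[?M] x:$?M & (a +[Ox y] b) *.[?M] x = a *.[?M] x +[?M] b *.[?M] x &
   a *.[?M] (x +[?M] z) = a *.[?M] x +[?M] a *.[?M] z &
   (a *[Ox y] b) *.[?M] x = a *.[?M] (b *.[?M] x) & 1[Ox y] *.[?M] x = x"
  if a: "a:$(Ox y)" and b: "b:$(Ox y)" and x: "x:$?M" and z: "z:$?M" for a b x z
 proof -
  from rep[OF a b x z] obtain U r q s t where
   U: "op U" "y:U" "r:$(SX U)" "q:$(SX U)"
   "s:$(msec P U)" "t:$(msec P U)"
   "a = rg y U r" "b = rg y U q" "x = mg P y U s" "z = mg P y U t" by blast
  interpret module "SX U" "msec P U" by (rule mm[OF U(1)])
  show ?thesis
   using U by (simp add: mgerm_op rgerm_op smult_l_distr smult_r_distr smult_assoc1 rgerm_one[OF U(1,2), symmetric])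
 qed
 have z1: "1[Ox y]:$(Ox y)" using stalk_cring[OF y] by (simp add: cring_def ring.ring_simprules)
 fix a x assume x: "x:$?M"
 show "1[Ox y] *.[?M] x = x" using all[OF z1 z1 x x] by blast
 assume a: "a:$(Ox y)"
 show "a *.[?M] x:$?M" using all[OF a a x x] by blast
 fix b
 show "(a +[Ox y] b) *.[?M] x = a *.[?M] x +[?M] b *.[?M] x"
  "(a *[Ox y] b) *.[?M] x = a *.[?M] (b *.[?M] x)" if "b:$(Ox y)"
  using all[OF a that x x] by blast+
 show "a *.[?M] (x +[?M] z) = a *.[?M] x +[?M] a *.[?M] z" if "z:$?M" for z
  using all[OF a a x that] by blast
qed

end

end

section \<open>Families of germs that are local sections\<close>

context lrs
begin

lemma OX_stalk:
 "$(St OX y) = $(Ox y)" "add (St OX y) = add (Ox y)" "zero (St OX y) = zero (Ox y)"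
 "r *.[St OX y] a = r *[Ox y] a"
 by (simp_all add: mstalk_def stalk_def rgerm_mgerm structure_module_def)

context
 fixes P :: "('x, 'r, 'm) mod_presheaf"
 assumes P: "mp P"
begin

lemma lsec_open: "lse P U sg ==> op U"
 by (simp add: lsec_def)

lemma lsecD:
 assumes "lse P U sg" "y:U"
 obtains W t where "op W" "y:W" "W <= U" "t:$(msec P W)" "!!z. z:W ==> sg z = mg P z W t"
proof -
 from assms have "EX W. op W & y:W & W <= U & (EX t:$(msec P W). ALL z:W. sg z = mg P z W t)"
  by (simp add: lsec_def)
 then show thesis by (elim exE conjE bexE) (rule that, auto)
qed

lemma lsecI:
 assumes "op U" "!!y. y:U ==> EX W t. op W & y:W & W <= U & t:$(msec P W) & (ALL z:W. sg z = mg P z W t)"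
 shows "lse P U sg"
 using assms by (simp add: lsec_def Bex_def)

lemma lsec_carrier: "lse P U sg ==> y:U ==> sg y:$(St P y)"
 by (erule (1) lsecD) (simp add: mgerm_op(1)[OF P])

lemma lsec_germ: "op U ==> s:$(msec P U) ==> lse P U (%y. mg P y U s)"
 by (rule lsecI) blast+

lemma lsec_cong: "lse P U sg ==> (!!y. y:U ==> sg y = ta y) ==> lse P U ta"
 by (rule lsecI, rule lsec_open, assumption) (erule (1) lsecD, metis subsetD)

lemma lsec_local:
 assumes "op U" "!!y. y:U ==> EX W. y:W & W <= U & lse P W sg"
 shows "lse P U sg"
proof (rule lsecI[OF assms(1)])
 fix y assume "y:U"
 then obtain V where V: "y:V" "V <= U" "lse P V sg" using assms(2) by blast
 then obtain W t where "op W" "y:W" "W <= V" "t:$(msec P W)" "!!z. z:W ==> sg z = mg P z W t"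
  using lsecD by metis
 then show "EX W t. op W & y:W & W <= U & t:$(msec P W) & (ALL z:W. sg z = mg P z W t)"
  using V(2) by (intro exI[of _ W] exI[of _ t]) auto
qed

lemma lsec_subset:
 assumes "lse P U sg" "op V" "V <= U"
 shows "lse P V sg"
proof (rule lsecI[OF assms(2)])
 fix y assume y: "y:V"
 then obtain W t where W: "op W" "y:W" "W <= U" "t:$(msec P W)" "!!z. z:W ==> sg z = mg P z W t"
  using lsecD[OF assms(1), of y] assms(3) by blast
 have o: "op (W Int V)" using W(1) assms(2) by auto
 then show "EX W t. op W & y:W & W <= V & t:$(msec P W) & (ALL z:W. sg z = mg P z W t)"
  using W y by (intro exI[of _ "W Int V"] exI[of _ "mres P W (W Int V) t"])
   (auto simp: mgerm_res[OF P] mres_closed[OF P])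
qed

lemma lsec_list:
 assumes "op U" "!!sg. sg:set sgs ==> lse P U sg" "y:U"
 shows "EX W ss. op W & y:W & W <= U & length ss = length sgs & set ss <= $(msec P W) &
  (ALL z:W. map (%sg. sg z) sgs = map (mg P z W) ss)"
 using assms(2)
proof (induction sgs)
 case Nil
 show ?case using assms(1,3) by auto
next
 case (Cons sg sgs)
 then obtain V ss where V: "op V" "y:V" "V <= U" "length ss = length sgs" "set ss <= $(msec P V)"
  "ALL z:V. map (%sg. sg z) sgs = map (mg P z V) ss" by auto
 obtain W t where W: "op W" "y:W" "W <= U" "t:$(msec P W)" "!!z. z:W ==> sg z = mg P z W t"
  using lsecD[of U sg y] Cons.prems assms(3) by auto
 have o: "op (V Int W)" using V W by auto
 have "map (mg P z (V Int W)) (map (mres P V (V Int W)) ss) = map (mg P z V) ss" if "z:V Int W" for z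
  using V o that by (auto simp: mgerm_res[OF P] subset_iff)
 then show ?case
  using V W o by (intro exI[of _ "V Int W"] exI[of _ "mres P W (V Int W) t # map (mres P V (V Int W)) ss"])
   (auto simp: mgerm_res[OF P] mres_closed[OF P] subset_iff)
qed

lemma lsec_pair:
 assumes "lse P U sg" "lse P U ta" "y:U"
 obtains W s t where "op W" "y:W" "W <= U" "s:$(msec P W)" "t:$(msec P W)"
  "!!z. z:W ==> sg z = mg P z W s" "!!z. z:W ==> ta z = mg P z W t"
proof -
 have "!!rh. rh:set [sg, ta] ==> lse P U rh" using assms by auto
 from lsec_list[OF lsec_open[OF assms(1)], of "[sg, ta]", OF this assms(3)]
 obtain W ss where W: "op W" "y:W" "W <= U" "length ss = 2" "set ss <= $(msec P W)"
  "ALL z:W. [sg z, ta z] = map (mg P z W) ss" by (auto simp: numeral_2_eq_2)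
 then show thesis by (intro that[of W "ss ! 0" "ss ! 1"]) (auto simp: numeral_2_eq_2 length_Suc_conv)
qed

lemma lsec_zero: "op U ==> lse P U (%y. 0[St P y])"
 using lsec_germ[of U "0[msec P U]"] abelian_groupE(2)[OF module_groups(1)[OF P'(1)[OF P]], of U]
 by (auto intro: lsec_cong simp: mgerm_zero[OF P])

lemma lsec_add:
 assumes "lse P U sg" "lse P U ta"
 shows "lse P U (%y. sg y +[St P y] ta y)"
proof (rule lsecI[OF lsec_open[OF assms(1)]])
 fix y assume y: "y:U"
 from lsec_pair[OF assms y] obtain W s t where W: "op W" "y:W" "W <= U" "s:$(msec P W)" "t:$(msec P W)"
  "!!z. z:W ==> sg z = mg P z W s" "!!z. z:W ==> ta z = mg P z W t" by metis
 have "s +[msec P W] t:$(msec P W)"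
  using abelian_groupE(1)[OF module_groups(1)[OF P'(1)[OF P W(1)]]] W by auto
 then show "EX W t. op W & y:W & W <= U & t:$(msec P W) &
   (ALL z:W. sg z +[St P z] ta z = mg P z W t)"
  using W by (intro exI[of _ W] exI[of _ "s +[msec P W] t"]) (auto simp: mgerm_op(2)[OF P])
qed

text \<open>Equal germs have representatives that agree on a neighbourhood, so an equality at one
  point spreads. This makes constructions through chosen local sections well defined and later moves
  generation from a point to its generizations.\<close>

lemma lsec_agree:
 assumes "lse P U sg" "lse P U ta" "y:U" "sg y = ta y"
 shows "EX W. op W & y:W & W <= U & (ALL z:W. sg z = ta z)"
proof -
 from lsec_pair[OF assms(1-3)] obtain W s t where W: "op W" "y:W" "W <= U" "s:$(msec P W)" "t:$(msec P W)"
  "!!z. z:W ==> sg z = mg P z W s" "!!z. z:W ==> ta z = mg P z W t" by metis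
 have "mg P y W s = mg P y W t" using W assms(4) by auto
 then obtain V where V: "op V" "y:V" "V <= W" "mres P W V s = mres P W V t"
  using mgerm_eq_iff[OF P, of W y s W t] W by auto
 have "sg z = ta z" if "z:V" for z
  using mgerm_res[OF P W(1) V(1,3) that, of s] mgerm_res[OF P W(1) V(1,3) that, of t] W V that by auto
 then show ?thesis using V W by blast
qed

end

lemma lsec_smult:
 assumes P: "mp P" and r: "lse OX U r" and s: "lse P U sg"
 shows "lse P U (%y. r y *.[St P y] sg y)"
proof (rule lsecI[OF P lsec_open[OF P s]])
 fix y assume y: "y:U"
 obtain V a where V: "op V" "y:V" "V <= U" "a:$(SX V)" "!!z. z:V ==> r z = rg z V a"
  using lsecD[OF OX_presh r y] by (auto simp: OX_carrier rgerm_mgerm)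
 obtain W t where W: "op W" "y:W" "W <= U" "t:$(msec P W)" "!!z. z:W ==> sg z = mg P z W t"
  using lsecD[OF P s y] by metis
 let ?Z = "V Int W"
 have o: "op ?Z" using V W by auto
 let ?a = "res X V ?Z a" and ?t = "mres P W ?Z t"
 have c: "?a:$(SX ?Z)" "?t:$(msec P ?Z)"
  using preshD(1)[OF sec_presh V(1) o _ V(4)] mres_closed[OF P W(1) o _ W(4)] by auto
 have "r z *.[St P z] sg z = mg P z ?Z (?a *.[msec P ?Z] ?t)" if "z:?Z" for z
  using that V(5) W(5) mgerm_op(3)[OF P o that c(2,1)]
   rgerm_res[OF V(1) o _ that V(4)] mgerm_res[OF P W(1) o _ that W(4)] by auto
 moreover have "?a *.[msec P ?Z] ?t:$(msec P ?Z)" using module.smult_closed[OF P'(1)[OF P o]] c by auto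
 ultimately show "EX W t. op W & y:W & W <= U & t:$(msec P W) &
   (ALL z:W. r z *.[St P z] sg z = mg P z W t)"
  using o V W by (intro exI[of _ ?Z]) blast
qed

lemma rsec_carrier: "lse OX U r ==> y:U ==> r y:$(Ox y)"
 using lsec_carrier[OF OX_presh] by (simp add: OX_stalk)

lemma rsec_germ: "op U ==> r:$(SX U) ==> lse OX U (%y. rg y U r)"
 using lsec_germ[OF OX_presh] by (simp add: OX_carrier rgerm_mgerm)

lemma rsec_mult: "lse OX U r ==> lse OX U s ==> lse OX U (%y. r y *[Ox y] s y)"
 using lsec_smult[OF OX_presh] by (simp add: OX_stalk)

lemma rsec_one: "op U ==> lse OX U (%y. 1[Ox y])"
 using rsec_germ[of U "1[SX U]"] sec_cring[of U] lsec_cong[OF OX_presh, of U _ "%y. 1[Ox y]"]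
 by (simp add: rgerm_one cring_def ring.ring_simprules)

lemma sheaf_sec_eq:
 assumes M: "module_sheaf X M" and U: "op U" "s:$(msec M U)" "t:$(msec M U)"
  and eq: "!!y. y:U ==> mg M y U s = mg M y U t"
 shows "s = t"
proof -
 have sh: "set_sheaf (topo X) (%U. $(msec M U)) (mres M)" using M by (simp add: module_sheaf_def)
 show ?thesis
 proof (rule set_sheaf_eq[OF sh U])
  fix y assume y: "y:U"
  show "EX W. op W & y:W & W <= U & mres M U W s = mres M U W t"
   using eq[OF y] unfolding mgerm_eq_iff[OF sheaf_presh[OF M] U(1) y U(2) U(1) y U(3)] by simp
 qed
qed

text \<open>Over small open sets the representing section is unique, because in a sheaf a section is
  determined by its germs; the representatives therefore agree on overlaps and glue.\<close>

lemma sheaf_lsec: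
 assumes M: "module_sheaf X M" and sg: "lse M U sg"
 shows "EX s:$(msec M U). ALL y:U. sg y = mg M y U s"
proof -
 note Mp = sheaf_presh[OF M]
 have U: "op U" by (rule lsec_open[OF Mp sg])
 have sh: "set_sheaf (topo X) (%U. $(msec M U)) (mres M)" using M by (simp add: module_sheaf_def)
 define VV where "VV = {W. op W & W <= U & (EX t:$(msec M W). ALL z:W. sg z = mg M z W t)}"
 have un: "\<Union>VV = U" unfolding VV_def using sg by (fastforce simp: lsec_def)
 define s where "s W = (SOME t. t:$(msec M W) & (ALL z:W. sg z = mg M z W t))" for W
 have s: "s W:$(msec M W)" "!!z. z:W ==> sg z = mg M z W (s W)" if "W:VV" for W
 proof -
  from that have "EX t. t:$(msec M W) & (ALL z:W. sg z = mg M z W t)" by (auto simp: VV_def)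
  from someI_ex[OF this] show "s W:$(msec M W)" "!!z. z:W ==> sg z = mg M z W (s W)"
   unfolding s_def by auto
 qed
 have "EX t:$(msec M (\<Union>VV)). ALL V:VV. mres M (\<Union>VV) V t = s V"
 proof (rule set_sheaf_glue[OF sh])
  fix V W assume VW: "V:VV" "W:VV"
  have o: "op V" "op W" "op (V Int W)" using VW by (auto simp: VV_def)
  show "mres M V (V Int W) (s V) = mres M W (V Int W) (s W)"
  proof (rule sheaf_sec_eq[OF M o(3)])
   fix y assume y: "y:V Int W"
   then show "mg M y (V Int W) (mres M V (V Int W) (s V)) = mg M y (V Int W) (mres M W (V Int W) (s W))"
    using mgerm_res[OF Mp o(1,3) _ y s(1)[OF VW(1)]] mgerm_res[OF Mp o(2,3) _ y s(1)[OF VW(2)]]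
     s(2)[OF VW(1), of y] s(2)[OF VW(2), of y] by simp
  qed (use mres_closed[OF Mp o(1,3) _ s(1)[OF VW(1)]] mres_closed[OF Mp o(2,3) _ s(1)[OF VW(2)]] in simp_all)
 qed (use s(1) in "auto simp: VV_def")
 then obtain t where t: "t:$(msec M U)" "!!V. V:VV ==> mres M U V t = s V" unfolding un by blast
 have "sg y = mg M y U t" if "y:U" for y
 proof -
  from that un obtain V where V: "V:VV" "y:V" by blast
  then have "op V" "V <= U" by (auto simp: VV_def)
  from mgerm_res[OF Mp U this V(2) t(1)] t(2)[OF V(1)] s(2)[OF V] show ?thesis by simp
 qed
 then show ?thesis using t by blast
qed

end

section \<open>Sheafification\<close>

context lrs
begin

context
 fixes P :: "('x, 'r, 'm) mod_presheaf"
 assumes P: "mp P"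
begin

lemma sheafify_carrier: "op U ==> s:$(msec (sheafify X P) U) <-> s:extensional U & lse P U s"
 unfolding sheafify_def lsec_def opens_in_def by (auto 4 4)

lemma sheafify_simps:
 "add (msec (sheafify X P) U) s t = (\<lambda>x\<in>U. s x +[St P x] t x)"
 "zero (msec (sheafify X P) U) = (\<lambda>x\<in>U. 0[St P x])"
 "r *.[msec (sheafify X P) U] s = (\<lambda>x\<in>U. rg x U r *.[St P x] s x)"
 "mres (sheafify X P) U V s = restrict s V"
 by (simp_all add: sheafify_def)

lemma sheafify_restrict: "lse P U s ==> restrict s U:$(msec (sheafify X P) U)"
 using lsec_cong[OF P, of U s "restrict s U"] lsec_open[OF P, of U s] by (simp add: sheafify_carrier)

lemma sheafify_module:
 assumes U: "op U"
 shows "module (SX U) (msec (sheafify X P) U)"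
proof (rule moduleI[OF sec_cring[OF U]])
 let ?S = "msec (sheafify X P) U"
 have m: "module (Ox y) (St P y)" if "y:U" for y
  using stalk_module[OF P] op_pts[OF U that] .
 have ag: "abelian_group (St P y)" if "y:U" for y using module_groups(1)[OF m[OF that]] .
 have c: "s y:$(St P y)" if "s:$?S" "y:U" for s y
  using that lsec_carrier[OF P, of U s y] U by (simp add: sheafify_carrier)
 have ls: "lse P U s" "s:extensional U" if "s:$?S" for s
  using that U by (simp_all add: sheafify_carrier)
 have eqI: "s = t" if "s:extensional U" "t:extensional U" "!!y. y:U ==> s y = t y"
  for s t :: "'x => ('x, 'm) germ" using that by (rule extensionalityI)
 show "abelian_group ?S"
 proof (rule abelian_groupI)
  fix s t assume st: "s:$?S" "t:$?S"
  show "s +[?S] t:$?S"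
   using sheafify_restrict[OF lsec_add[OF P ls(1)[OF st(1)] ls(1)[OF st(2)]]] by (simp add: sheafify_simps)
  show "s +[?S] t = t +[?S] s"
   by (rule eqI) (simp_all add: sheafify_simps abelian_groupE(4)[OF ag] c st)
  fix u assume u: "u:$?S"
  show "s +[?S] t +[?S] u = s +[?S] (t +[?S] u)"
   by (rule eqI) (simp_all add: sheafify_simps abelian_groupE(3)[OF ag] c st u)
 next
  show "0[?S]:$?S" using sheafify_restrict[OF lsec_zero[OF P U]] by (simp add: sheafify_simps)
 next
  fix s assume s: "s:$?S"
  show "0[?S] +[?S] s = s"
   by (rule eqI) (simp_all add: sheafify_simps abelian_groupE(5)[OF ag] c s ls)
  \<comment> \<open>The negative is written as multiplication by -1, so that it is a local section
    by the closure under scalars.\<close>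
  define t where "t = (\<lambda>x\<in>U. rg x U (-[SX U] 1[SX U]) *.[St P x] s x)"
  interpret SU: cring "SX U" by (rule sec_cring[OF U])
  have "t:$?S"
   unfolding t_def by (rule sheafify_restrict[OF lsec_smult[OF P rsec_germ[OF U] ls(1)[OF s]]]) simp
  moreover have "t +[?S] s = 0[?S]"
  proof (rule eqI)
   fix y assume y: "y:U"
   interpret M: module "Ox y" "St P y" by (rule m[OF y])
   have one: "1[Ox y] = rg y U 1[SX U]" using rgerm_one[OF U y] by simp
   have "rg y U (-[SX U] 1[SX U]) +[Ox y] 1[Ox y] = 0[Ox y]"
    unfolding one using rgerm_op(3)[OF U y, of "-[SX U] 1[SX U]" "1[SX U]"] rgerm_zero[OF U y]
    by (simp add: SU.l_neg)
   then show "(t +[?S] s) y = 0[?S] y"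
    using y M.smult_l_distr[of "rg y U (-[SX U] 1[SX U])" "1[Ox y]" "s y"] c[OF s y]
     rgerm_op(1)[OF U y, of "-[SX U] 1[SX U]" "1[SX U]"]
    by (simp add: sheafify_simps t_def)
  qed (simp_all add: sheafify_simps)
  ultimately show "EX t:$?S. t +[?S] s = 0[?S]" by blast
 qed
 fix r s assume r: "r:$(SX U)" and s: "s:$?S"
 have rg: "rg y U r:$(Ox y)" if "y:U" for y using rgerm_op(1)[OF U that r r] .
 show "r *.[?S] s:$?S"
  using sheafify_restrict[OF lsec_smult[OF P rsec_germ[OF U r] ls(1)[OF s]]] by (simp add: sheafify_simps)
 show "r *.[?S] (s +[?S] t) = r *.[?S] s +[?S] r *.[?S] t" if t: "t:$?S" for t
  by (rule eqI) (simp_all add: sheafify_simps module.smult_r_distr[OF m] rg c s t)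
 fix q assume q: "q:$(SX U)"
 have qg: "rg y U q:$(Ox y)" if "y:U" for y using rgerm_op(1)[OF U that q q] .
 show "(r +[SX U] q) *.[?S] s = r *.[?S] s +[?S] q *.[?S] s"
  by (rule eqI) (simp_all add: sheafify_simps rgerm_op(3)[OF U _ r q, symmetric] module.smult_l_distr[OF m] rg qg c s)
 show "(r *[SX U] q) *.[?S] s = r *.[?S] (q *.[?S] s)"
  by (rule eqI) (simp_all add: sheafify_simps rgerm_op(2)[OF U _ r q, symmetric] module.smult_assoc1[OF m] rg qg c s)
next
 fix s assume "s:$(msec (sheafify X P) U)"
 then have s: "lse P U s" "s:extensional U" using U by (simp_all add: sheafify_carrier)
 show "1[SX U] *.[msec (sheafify X P) U] s = s"
  by (rule extensionalityI[of _ U])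
   (use s module.smult_one[OF stalk_module[OF P op_pts[OF U]] lsec_carrier[OF P s(1)]] in "simp_all add: sheafify_simps rgerm_one[OF U]")
qed

lemma sheafify_sheaf: "module_sheaf X (sheafify X P)"
 unfolding module_sheaf_def
proof (intro conjI allI impI ballI)
 let ?S = "sheafify X P"
 show "op U ==> module (SX U) (msec ?S U)" for U by (rule sheafify_module)
 {
  fix U V a b assume UV: "op U & op V & V <= U" and a: "a:$(msec ?S U)" and b: "b:$(msec ?S U)"
  show "mres ?S U V (a +[msec ?S U] b) = mres ?S U V a +[msec ?S V] mres ?S U V b"
   using UV by (simp add: sheafify_simps restrict_def fun_eq_iff subset_iff)
 next
  fix U V r a assume UV: "op U & op V & V <= U" and r: "r:$(SX U)" and a: "a:$(msec ?S U)"
  show "mres ?S U V (r *.[msec ?S U] a) = res X U V r *.[msec ?S V] mres ?S U V a"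
   using UV r by (simp add: sheafify_simps restrict_def fun_eq_iff subset_iff rgerm_res)
 }
 show "set_sheaf (topo X) (%U. $(msec ?S U)) (mres ?S)"
  unfolding set_sheaf_def
 proof (intro conjI allI impI ballI)
  show "mres ?S U V:$(msec ?S U) -> $(msec ?S V)" if "op U & op V & V <= U" for U V
   using that sheafify_restrict[OF lsec_subset[OF P, of U _ V]] by (auto simp: sheafify_carrier sheafify_simps)
  show "mres ?S U U s = s" if "op U" "s:$(msec ?S U)" for U s
   using that by (simp add: sheafify_carrier sheafify_simps extensional_restrict)
  show "mres ?S V W (mres ?S U V s) = mres ?S U W s" if "op U & op V & op W & W <= V & V <= U" for U V W s
   using that by (auto simp: sheafify_simps restrict_def fun_eq_iff)
  fix VV :: "'x set set" and s :: "'x set => 'x => ('x, 'm) germ"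
  assume as: "(ALL V:VV. op V) & (ALL V:VV. s V:$(msec ?S V)) &
   (ALL V:VV. ALL W:VV. mres ?S V (V Int W) (s V) = mres ?S W (V Int W) (s W))"
  have oV: "!!V. V:VV ==> op V" and "!!V. V:VV ==> s V:$(msec ?S V)" using as by blast+
  then have sV: "!!V. V:VV ==> lse P V (s V)" "!!V. V:VV ==> s V:extensional V"
   using sheafify_carrier by blast+
  have o: "op (\<Union>VV)" using oV by (intro openin_Union) blast
  have agree: "s V y = s W y" if "V:VV" "W:VV" "y:V" "y:W" for V W y
  proof -
   have "restrict (s V) (V Int W) = restrict (s W) (V Int W)" using as that(1,2) unfolding sheafify_simps by blast
   then have "restrict (s V) (V Int W) y = restrict (s W) (V Int W) y" by simp
   then show ?thesis using that by simp
  qed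
  define t where "t = (\<lambda>y\<in>\<Union>VV. s (SOME V. V:VV & y:V) y)"
  have t: "t y = s V y" if "V:VV" "y:V" for V y
  proof -
   have "(SOME V. V:VV & y:V):VV & y:(SOME V. V:VV & y:V)"
    using someI[of "%V. V:VV & y:V" V] that by blast
   moreover have "t y = s (SOME V. V:VV & y:V) y" using that unfolding t_def by (simp add: restrict_apply') blast
   ultimately show ?thesis using agree[of "SOME V. V:VV & y:V" V y] that by simp
  qed
  have "lse P (\<Union>VV) t"
  proof (rule lsec_local[OF P o])
   fix y assume "y:\<Union>VV"
   then obtain V where V: "V:VV" "y:V" by blast
   have "lse P V t" using sV(1)[OF V(1)] by (rule lsec_cong[OF P]) (simp add: t[OF V(1)])
   then show "EX W. y:W & W <= \<Union>VV & lse P W t" using V by blast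
  qed
  then have tc: "t:$(msec ?S (\<Union>VV))" using o by (simp add: sheafify_carrier t_def)
  have tr: "mres ?S (\<Union>VV) V t = s V" if V: "V:VV" for V
   by (rule extensionalityI[of _ V]) (use V sV(2) in "simp_all add: sheafify_simps t[OF V]")
  show "EX! t. t:$(msec ?S (\<Union>VV)) & (ALL V:VV. mres ?S (\<Union>VV) V t = s V)"
  proof (rule ex1I[of _ t])
   fix u assume u: "u:$(msec ?S (\<Union>VV)) & (ALL V:VV. mres ?S (\<Union>VV) V u = s V)"
   show "u = t"
   proof (rule extensionalityI[of _ "\<Union>VV"])
    fix y assume "y:\<Union>VV"
    then obtain V where V: "V:VV" "y:V" by blast
    have "restrict u V = s V" using u V by (simp add: sheafify_simps)
    then have "u y = s V y" using V(2) by (metis restrict_apply')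
    then show "u y = t y" using t[OF V] by simp
   qed (use u o in "simp_all add: sheafify_carrier t_def")
  qed (use tc tr in blast)
 qed
qed

lemmas sheafify_presh = sheaf_presh[OF sheafify_sheaf]

text \<open>The canonical isomorphism from the stalk of a presheaf to the stalk of its
  sheafification: a germ is spread out to a local family of germs, and the germ of that family is
  taken. The choice of the family does not matter because families that agree at \<open>y\<close>
  agree near \<open>y\<close>.\<close>

definition shg :: "'x => ('x, 'm) germ => ('x, 'x => ('x, 'm) germ) germ" where
 "shg y a = (SOME b. EX U ta. y:U & lse P U ta & ta y = a & b = mg (sheafify X P) y U (restrict ta U))"

lemma shg_lsec:
 assumes ta: "lse P U ta" and y: "y:U"
 shows "shg y (ta y) = mg (sheafify X P) y U (restrict ta U)"
proof -
 have "EX b. EX V ta'. y:V & lse P V ta' & ta' y = ta y & b = mg (sheafify X P) y V (restrict ta' V)"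
  using assms by blast
 from someI_ex[OF this] obtain V ta' where V: "y:V" "lse P V ta'" "ta' y = ta y"
  "shg y (ta y) = mg (sheafify X P) y V (restrict ta' V)" unfolding shg_def[symmetric] by blast
 have o: "op U" "op V" "op (U Int V)" using lsec_open[OF P] ta V by auto
 have "lse P (U Int V) ta'" "lse P (U Int V) ta" using lsec_subset[OF P _ o(3)] ta V by auto
 from lsec_agree[OF P this _ V(3)] y V obtain W where W: "op W" "y:W" "W <= U Int V" "!!z. z:W ==> ta' z = ta z" by auto
 have "restrict (restrict ta U) W = restrict (restrict ta' V) W" using W by (auto simp: restrict_def fun_eq_iff)
 then have "mg (sheafify X P) y U (restrict ta U) = mg (sheafify X P) y V (restrict ta' V)"
  using W unfolding mgerm_eq_iff[OF sheafify_presh o(1) y sheafify_restrict[OF ta] o(2) V(1) sheafify_restrict[OF V(2)]]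
  by (auto simp: sheafify_simps)
 then show ?thesis using V(4) by simp
qed

lemma mstalk_lsec:
 assumes "a:$(St P y)"
 obtains U ta where "y:U" "lse P U ta" "ta y = a"
proof -
 from mstalk_rep[OF P assms] obtain U s where "op U" "y:U" "s:$(msec P U)" "a = mg P y U s" by blast
 then show thesis using that[of U "%y. mg P y U s"] lsec_germ[OF P, of U s] by simp
qed

lemma shg_lin:
 assumes y: "y:pts X"
 shows "lin (Ox y) (St P y) (St (sheafify X P) y) (shg y)"
proof (rule slinI)
 fix a assume a: "a:$(St P y)"
 then obtain U ta where U: "y:U" "lse P U ta" "ta y = a" using mstalk_lsec by metis
 have o: "op U" using lsec_open[OF P U(2)] .
 show "shg y a:$(St (sheafify X P) y)"
  using shg_lsec[OF U(2,1)] U(3) mgerm_op(1)[OF sheafify_presh o U(1) sheafify_restrict[OF U(2)]] by simp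
next
 fix a b assume "a:$(St P y)" "b:$(St P y)"
 then obtain U ta V ta' where U': "y:U" "lse P U ta" "ta y = a" and V: "y:V" "lse P V ta'" "ta' y = b"
  using mstalk_lsec by metis
 have o: "op (U Int V)" using lsec_open[OF P] U' V by auto
 let ?W = "U Int V"
 have U: "lse P ?W ta" "lse P ?W ta'" "y:?W" using lsec_subset[OF P _ o] U' V by auto
 have "restrict ta ?W +[msec (sheafify X P) ?W] restrict ta' ?W = restrict (%y. ta y +[St P y] ta' y) ?W"
  by (simp add: sheafify_simps restrict_def fun_eq_iff)
 then show "shg y (a +[St P y] b) = shg y a +[St (sheafify X P) y] shg y b"
  using shg_lsec[OF U(1,3)] shg_lsec[OF U(2,3)] shg_lsec[OF lsec_add[OF P U(1,2)] U(3)] U'(3) V(3)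
   mgerm_op(2)[OF sheafify_presh o U(3) sheafify_restrict[OF U(1)] sheafify_restrict[OF U(2)]] by simp
next
 fix r a assume r: "r:$(Ox y)" and "a:$(St P y)"
 then obtain U ta where U': "y:U" "lse P U ta" "ta y = a"
  using mstalk_lsec by metis
 from stalk_rep[OF r] obtain V q where V: "op V" "y:V" "q:$(SX V)" "r = rg y V q" by blast
 have o: "op (U Int V)" using lsec_open[OF P] U' V by auto
 let ?W = "U Int V" and ?q = "res X V (U Int V) q"
 have U: "lse P ?W ta" "y:?W" using lsec_subset[OF P _ o] U' V by auto
 have q: "?q:$(SX ?W)" using preshD(1)[OF sec_presh V(1) o _ V(3)] by simp
 have qr: "rg y ?W ?q = r" using rgerm_res[OF V(1) o _ U(2) V(3)] V(4) by simp
 have "?q *.[msec (sheafify X P) ?W] restrict ta ?W = restrict (%y. rg y ?W ?q *.[St P y] ta y) ?W"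
  by (simp add: sheafify_simps restrict_def fun_eq_iff)
 then show "shg y (r *.[St P y] a) = r *.[St (sheafify X P) y] shg y a"
  using shg_lsec[OF U] shg_lsec[OF lsec_smult[OF P rsec_germ[OF o q] U(1)] U(2)] U'(3) qr
   mgerm_op(3)[OF sheafify_presh o U(2) sheafify_restrict[OF U(1)] q] by simp
qed

lemma shg_image: "y:pts X ==> shg y ` $(St P y) = $(St (sheafify X P) y)"
proof
 assume y: "y:pts X"
 show "shg y ` $(St P y) <= $(St (sheafify X P) y)" using slinD(1)[OF shg_lin[OF y]] by blast
 show "$(St (sheafify X P) y) <= shg y ` $(St P y)"
 proof
  fix b assume "b:$(St (sheafify X P) y)"
  from mstalk_rep[OF sheafify_presh this] obtain U s where U: "op U" "y:U" "s:$(msec (sheafify X P) U)"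
   "b = mg (sheafify X P) y U s" by blast
  have s: "lse P U s" "restrict s U = s" using U by (simp_all add: sheafify_carrier extensional_restrict)
  show "b:shg y ` $(St P y)"
   using shg_lsec[OF s(1) U(2)] s(2) U(4) lsec_carrier[OF P s(1) U(2)] by (metis imageI)
 qed
qed

lemma shg_inj: "y:pts X ==> inj_on (shg y) ($(St P y))"
proof (rule inj_onI)
 fix a b assume "a:$(St P y)" "b:$(St P y)" and eq: "shg y a = shg y b"
 then obtain U ta V ta' where U: "y:U" "lse P U ta" "ta y = a" and V: "y:V" "lse P V ta'" "ta' y = b"
  using mstalk_lsec by metis
 have "mg (sheafify X P) y U (restrict ta U) = mg (sheafify X P) y V (restrict ta' V)"
  using shg_lsec[OF U(2,1)] shg_lsec[OF V(2,1)] eq U V by simp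
 then obtain W where "y:W" "W <= U Int V" "restrict (restrict ta U) W = restrict (restrict ta' V) W"
  unfolding mgerm_eq_iff[OF sheafify_presh lsec_open[OF P U(2)] U(1) sheafify_restrict[OF U(2)]
    lsec_open[OF P V(2)] V(1) sheafify_restrict[OF V(2)]] by (auto simp: sheafify_simps)
 then show "a = b" using U(1,3) V(1,3) by (metis restrict_apply')
qed

lemma shg_continuous:
 assumes ta: "lse P U ta"
 shows "lse (sheafify X P) U (%y. shg y (ta y))"
 by (rule lsec_cong[OF sheafify_presh lsec_germ[OF sheafify_presh lsec_open[OF P ta] sheafify_restrict[OF ta]]])
  (simp add: shg_lsec[OF ta])

text \<open>Two layers of representatives are unwound: a local family of germs of the sheafification
  is given near \<open>y\<close> by one section of it, and that section by one section of the
  presheaf.\<close>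

lemma shg_surj_local:
 assumes sg: "lse (sheafify X P) U sg" and y: "y:U"
 shows "EX W t. op W & y:W & W <= U & t:$(msec P W) & (ALL z:W. sg z = shg z (mg P z W t))"
proof -
 from lsecD[OF sheafify_presh sg y] obtain V s where V: "op V" "y:V" "V <= U" "s:$(msec (sheafify X P) V)"
  "!!z. z:V ==> sg z = mg (sheafify X P) z V s" by metis
 have s: "lse P V s" "restrict s V = s" using V by (simp_all add: sheafify_carrier extensional_restrict)
 from lsecD[OF P s(1) V(2)] obtain W t where W: "op W" "y:W" "W <= V" "t:$(msec P W)"
  "!!z. z:W ==> s z = mg P z W t" by metis
 have "sg z = shg z (mg P z W t)" if z: "z:W" for z
  using shg_lsec[OF s(1), of z] s(2) W(3,5) V(5) z by auto
 then show ?thesis using W V(3) by (intro exI[of _ W] exI[of _ t]) auto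
qed

end

end

section \<open>Sheaves presented by generators and relations\<close>

lemma lin_inverse:
 assumes f: "lin R M N f" and M: "module R M" and b: "bij_betw f ($M) ($N)"
 shows "lin R N M (inv_into ($M) f)"
proof -
 interpret module R M by fact
 let ?g = "inv_into ($M) f"
 have im: "f ` $M = $N" and inj: "inj_on f ($M)" using b by (auto simp: bij_betw_def)
 have g: "?g y:$M" "f (?g y) = y" if "y:$N" for y
  using inv_into_into[of y f "$M"] f_inv_into_f[of y f "$M"] that im by auto
 have u: "x:$M ==> ?g (f x) = x" for x using inj by simp
 show ?thesis
 proof (rule slinI)
  fix x y assume "x:$N" "y:$N"
  then show "?g (x +[N] y) = ?g x +[M] ?g y"
   using u[of "?g x +[M] ?g y"] slinD(2)[OF f] g by simp
 next
  fix r x assume "r:$R" "x:$N"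
  then show "?g (r *.[N] x) = r *.[M] ?g x"
   using u[of "r *.[M] ?g x"] slinD(3)[OF f] g by simp
 qed (use g in simp)
qed

lemma pres_iso:
 assumes p: "pres R B Rel S w" and Rel: "Rel <= $(free_module R B)" and S': "module R S'"
  and f: "lin R S S' f" and b: "bij_betw f ($S) ($S')"
 shows "pres R B Rel S' (%x. f (w x))"
proof -
 from p have S: "module R S" and w: "w:B -> $S" and z: "!!rh. rh:Rel ==> lext R S (%r. r) w rh = 0[S]"
  and sp: "module_span R S (w ` B) = $S" by (auto simp: pres_def)
 from p obtain phi where phi: "lin R S (presented_module R B Rel) phi" "!!x. x:B ==> phi (w x) = presented_gen R B Rel x"
  by (auto simp: pres_def)
 have R: "cring R" using module_groups(2)[OF S] .
 have w': "(%x. f (w x)):B -> $S'" using w slinD(1)[OF f] by auto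
 note L = lext_slin[OF R S id_ring_hom[OF R] w]
 have "lext R S' (%r. r) (%x. f (w x)) rh = 0[S']" if rh: "rh:Rel" for rh
 proof -
  have "f (lext R S (%r. r) w rh) = lext R S' (%r. r) (%x. f (w x)) rh"
   by (rule free_ext_unique[OF R S' id_ring_hom[OF R] w' lin_comp[OF L f]])
    (use rh Rel lext_gen[OF R S id_ring_hom[OF R] w] in auto)
  then show ?thesis using z[OF rh] slin_zero[OF f module_groups(1)[OF S] module_groups(1)[OF S']] by simp
 qed
 moreover have "module_span R S' ((%x. f (w x)) ` B) = $S'" (is "?L = _")
 proof
  have sub: "(%x. f (w x)) ` B <= $S'" using w' by auto
  show "?L <= $S'" by (rule span_carrier[OF S' sub])
  have "f x:?L" if "x:$S" for x
   by (rule slin_span[OF f S S' _ span_submodule[OF S' sub], of "w ` B"])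
    (use that w sp in "auto intro: span_incl")
  then have "f ` $S <= ?L" by (rule image_subsetI)
  then show "$S' <= ?L" using bij_betw_imp_surj_on[OF b] by simp
 qed
 moreover have "lin R S' (presented_module R B Rel) (%x. phi (inv_into ($S) f x))"
  by (rule lin_comp[OF lin_inverse[OF f S b] phi(1)])
 moreover have "phi (inv_into ($S) f (f (w x))) = presented_gen R B Rel x" if "x:B" for x
  using that w b phi(2) by (simp add: bij_betw_def Pi_iff)
 ultimately show ?thesis unfolding pres_def using S' w' by blast
qed

text \<open>\<open>(Bst y, Rst y)\<close> is the colimit of the generators and relations \<open>(B U, Rel U)\<close> over the
 neighbourhoods \<open>U\<close> of \<open>y\<close>.\<close>

locale psheaf = lrs X for X :: "('x, 'r) ringed_space" +
 fixes B :: "'x set => 'b set" and Rel :: "'x set => ('b => 'r) set" and phi :: "'x set => 'x set => 'b => 'b"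
  and Bst :: "'x => 'c set" and Rst :: "'x => ('c => ('x, 'r) germ) set" and ga :: "'x => 'x set => 'b => 'c"
 assumes Rel: "op U ==> Rel U <= $(free_module (SX U) (B U))"
  and phi: "op U ==> op V ==> V <= U ==> b:B U ==> phi U V b:B V"
  and phi_id: "op U ==> b:B U ==> phi U U b = b"
  and phi_comp: "op U ==> op V ==> op W ==> W <= V ==> V <= U ==> b:B U ==> phi V W (phi U V b) = phi U W b"
  and phi_rel: "op U ==> op V ==> V <= U ==> rh:Rel U ==> push (SX U) (SX V) (res X U V) (phi U V) rh:Rel V"
  and Rst: "y:pts X ==> Rst y <= $(free_module (Ox y) (Bst y))"
  and ga: "op U ==> y:U ==> b:B U ==> ga y U b:Bst y"
  and ga_phi: "op U ==> op V ==> V <= U ==> y:V ==> b:B U ==> ga y V (phi U V b) = ga y U b"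
  and ga_eq: "op U ==> y:U ==> b:B U ==> op V ==> y:V ==> b':B V ==> ga y U b = ga y V b' ==>
   EX W. op W & y:W & W <= U Int V & phi U W b = phi V W b'"
  and ga_surj: "y:pts X ==> c:Bst y ==> EX U b. op U & y:U & b:B U & c = ga y U b"
  and ga_rel: "op U ==> y:U ==> rh:Rel U ==> push (SX U) (Ox y) (rg y U) (ga y U) rh:Rst y"
  and ga_rel_surj: "y:pts X ==> rhs:Rst y ==>
   EX U rh'. op U & y:U & rh':Rel U & rhs = push (SX U) (Ox y) (rg y U) (ga y U) rh'"
begin

definition PP :: "('x, 'r, ('b => 'r) set) mod_presheaf" where
 "PP = \<lparr>msec = (%U. presented_module (SX U) (B U) (Rel U)),
  mres = (%U V. presented_map (SX U) (SX V) (B V) (Rel V) (res X U V) (phi U V))\<rparr>"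

abbreviation SS where "SS \<equiv> presented_sheaf X B Rel phi"

lemma SS_PP: "SS = sheafify X PP"
 by (simp add: presented_sheaf_def PP_def)

abbreviation gn where "gn U b \<equiv> presented_gen (SX U) (B U) (Rel U) b"

lemma PP_sec: "msec PP U = presented_module (SX U) (B U) (Rel U)"
 by (simp add: PP_def)

lemma PP_module: "op U ==> module (SX U) (msec PP U)"
 unfolding PP_sec by (rule presented_module[OF sec_cring Rel])

lemma gn_carrier: "op U ==> b:B U ==> gn U b:$(msec PP U)"
 unfolding PP_sec by (rule pgen_carrier[OF sec_cring Rel])

lemma gn_span: "op U ==> module_span (SX U) (msec PP U) (gn U ` B U) = $(msec PP U)"
 unfolding PP_sec by (rule pgen_span[OF sec_cring Rel])

lemma res_fun: "op U ==> op V ==> V <= U ==> res X U V:$(SX U) -> $(SX V)"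
 using ring_hom_closed[OF res_hom] by blast

lemma rgerm_fun: "op U ==> y:U ==> rg y U:$(SX U) -> $(Ox y)"
 using ring_hom_closed[OF rgerm_hom] by blast

lemma PP_res:
 assumes U: "op U" "op V" "V <= U"
 shows "slin (SX U) (res X U V) (msec PP U) (msec PP V) (mres PP U V)"
  and "b:B U ==> mres PP U V (gn U b) = gn V (phi U V b)"
proof -
 have phi': "phi U V:B U -> B V" using phi[OF U] by blast
 note p = presented_map[OF sec_cring[OF U(1)] sec_cring[OF U(2)] res_hom[OF U] phi' Rel[OF U(1)] Rel[OF U(2)]
   span_incl[OF phi_rel[OF U]]]
 show "slin (SX U) (res X U V) (msec PP U) (msec PP V) (mres PP U V)" using p(1) by (simp add: PP_def)
 show "b:B U ==> mres PP U V (gn U b) = gn V (phi U V b)" using p(3) by (simp add: PP_def)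
qed

lemma sec_slin_eq:
 assumes U: "op U" and f: "slin (SX U) h (msec PP U) N f" "slin (SX U) h (msec PP U) N g"
  and N: "module S N" and h: "h:$(SX U) -> $S"
  and eq: "!!b. b:B U ==> f (gn U b) = g (gn U b)" and s: "s:$(msec PP U)"
 shows "f s = g s"
 by (rule slin_eq_on_span[OF f PP_module[OF U] N h, of "gn U ` B U"]) (use gn_carrier[OF U] eq s gn_span[OF U] in auto)

lemma PP_presh: "mp PP"
 unfolding mod_presh_def
proof (intro conjI allI impI)
 show "presh (topo X) (%U. $(msec PP U)) (mres PP)"
  unfolding presh_def
 proof (intro conjI allI impI ballI)
  show "mres PP U V:$(msec PP U) -> $(msec PP V)" if "op U & op V & V <= U" for U V
   using PP_res(1)[of U V] that by (auto simp: slin_def)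
 next
  fix U s assume U: "op U" and s: "s:$(msec PP U)"
  have "res X U U r = r" if "r:$(SX U)" for r using preshD(2)[OF sec_presh U that] .
  then have "slin (SX U) (res X U U) (msec PP U) (msec PP U) (%s. s)" by (intro slinI) auto
  from sec_slin_eq[OF U PP_res(1)[OF U U] this PP_module[OF U] res_fun[OF U U] _ s]
  show "mres PP U U s = s" using PP_res(2)[OF U U] phi_id[OF U] by simp
 next
  fix U V W s assume UVW: "op U & op V & op W & W <= V & V <= U" and s: "s:$(msec PP U)"
  then have o: "op U" "op V" "op W" "W <= V" "V <= U" "W <= U" by auto
  have "slin (SX U) (%r. res X V W (res X U V r)) (msec PP U) (msec PP W) (%s. mres PP V W (mres PP U V s))"
   by (rule slin_comp[OF PP_res(1)[OF o(1,2,5)] PP_res(1)[OF o(2,3,4)] res_fun[OF o(1,2,5)]])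
  then have "slin (SX U) (res X U W) (msec PP U) (msec PP W) (%s. mres PP V W (mres PP U V s))"
   unfolding slin_def using preshD(3)[OF sec_presh o(1-5)] by simp
  from sec_slin_eq[OF o(1) this PP_res(1)[OF o(1,3,6)] PP_module[OF o(3)] res_fun[OF o(1,3,6)] _ s]
  show "mres PP V W (mres PP U V s) = mres PP U W s"
   using PP_res(2)[OF o(1,2,5)] PP_res(2)[OF o(2,3,4) phi[OF o(1,2,5)]] PP_res(2)[OF o(1,3,6)] phi_comp[OF o(1-5)] by simp
 qed
qed (use PP_module PP_res(1) in auto)

lemmas SS_sheaf = sheafify_sheaf[OF PP_presh, folded SS_PP]
lemmas SS_presh = sheaf_presh[OF SS_sheaf]

text \<open>The germ of a generator, indexed by the colimit \<open>Bst y\<close> instead of by a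
  neighbourhood. By \<open>ga_eq\<close>, generators that become equal in the colimit are already
  equal on some smaller neighbourhood, so the choice is harmless.\<close>

definition wP :: "'x => 'c => ('x, ('b => 'r) set) germ" where
 "wP y c = (SOME a. EX U b. op U & y:U & b:B U & c = ga y U b & a = mg PP y U (gn U b))"

lemma wP:
 assumes U: "op U" "y:U" "b:B U"
 shows "wP y (ga y U b) = mg PP y U (gn U b)"
proof -
 have "EX a. EX V b'. op V & y:V & b':B V & ga y U b = ga y V b' & a = mg PP y V (gn V b')"
  using U by blast
 from someI_ex[OF this] obtain V b' where V: "op V" "y:V" "b':B V" "ga y U b = ga y V b'"
  "wP y (ga y U b) = mg PP y V (gn V b')" unfolding wP_def by blast
 from ga_eq[OF U V(1-4)] obtain W where W: "op W" "y:W" "W <= U" "W <= V" "phi U W b = phi V W b'" by auto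
 have "mres PP U W (gn U b) = mres PP V W (gn V b')"
  using PP_res(2)[OF U(1) W(1,3) U(3)] PP_res(2)[OF V(1) W(1,4) V(3)] W(5) by simp
 then have "mg PP y U (gn U b) = mg PP y V (gn V b')"
  unfolding mgerm_eq_iff[OF PP_presh U(1,2) gn_carrier[OF U(1,3)] V(1,2) gn_carrier[OF V(1,3)]] using W by blast
 then show ?thesis using V(5) by simp
qed

lemma wP_carrier: "y:pts X ==> wP y:Bst y -> $(St PP y)"
proof
 fix c assume y: "y:pts X" and "c:Bst y"
 from ga_surj[OF this] obtain U b where U: "op U" "y:U" "b:B U" "c = ga y U b" by blast
 show "wP y c:$(St PP y)"
  unfolding U(4) wP[OF U(1-3)] by (rule mgerm_op(1)[OF PP_presh U(1,2) gn_carrier[OF U(1,3)]])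
qed

abbreviation Pst where "Pst y \<equiv> presented_module (Ox y) (Bst y) (Rst y)"
abbreviation pm where "pm y U \<equiv> presented_map (SX U) (Ox y) (Bst y) (Rst y) (rg y U) (ga y U)"

lemma Pst_module: "y:pts X ==> module (Ox y) (Pst y)"
 by (rule presented_module[OF stalk_cring Rst])

lemma pm:
 assumes U: "op U" "y:U"
 shows "slin (SX U) (rg y U) (msec PP U) (Pst y) (pm y U)"
  and "b:B U ==> pm y U (gn U b) = presented_gen (Ox y) (Bst y) (Rst y) (ga y U b)"
proof -
 have y: "y:pts X" using op_pts U by blast
 have ga': "ga y U:B U -> Bst y" using ga[OF U] by blast
 note p = presented_map[OF sec_cring[OF U(1)] stalk_cring[OF y] rgerm_hom[OF U] ga' Rel[OF U(1)] Rst[OF y]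
   span_incl[OF ga_rel[OF U]]]
 show "slin (SX U) (rg y U) (msec PP U) (Pst y) (pm y U)" using p(1) by (simp add: PP_def)
 show "b:B U ==> pm y U (gn U b) = presented_gen (Ox y) (Bst y) (Rst y) (ga y U b)" using p(3) .
qed

lemma pm_res:
 assumes U: "op U" "op V" "V <= U" "y:V" "s:$(msec PP U)"
 shows "pm y V (mres PP U V s) = pm y U s"
proof -
 have yU: "y:U" using U by auto
 have "slin (SX U) (%r. rg y V (res X U V r)) (msec PP U) (Pst y) (%s. pm y V (mres PP U V s))"
  by (rule slin_comp[OF PP_res(1)[OF U(1-3)] pm(1)[OF U(2,4)] res_fun[OF U(1-3)]])
 then have "slin (SX U) (rg y U) (msec PP U) (Pst y) (%s. pm y V (mres PP U V s))"
  unfolding slin_def using rgerm_res[OF U(1-4)] by simp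
 from sec_slin_eq[OF U(1) this pm(1)[OF U(1) yU] Pst_module[OF op_pts[OF U(1) yU]] rgerm_fun[OF U(1) yU] _ U(5)]
 show ?thesis using PP_res(2)[OF U(1-3)] pm(2)[OF U(1) yU] pm(2)[OF U(2,4) phi[OF U(1-3)]] ga_phi[OF U(1-4)] by simp
qed

text \<open>The map from the stalk of the presented presheaf to the module presented by the stalks
  of generators and relations. Its existence shows that passing to the stalk introduces no further
  relations.\<close>

definition Ph :: "'x => ('x, ('b => 'r) set) germ => ('c => ('x, 'r) germ) set" where
 "Ph y a = (SOME v. EX U s. op U & y:U & s:$(msec PP U) & a = mg PP y U s & v = pm y U s)"

lemma Ph:
 assumes U: "op U" "y:U" "s:$(msec PP U)"
 shows "Ph y (mg PP y U s) = pm y U s"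
proof -
 have "EX v. EX V t. op V & y:V & t:$(msec PP V) & mg PP y U s = mg PP y V t & v = pm y V t"
  using U by blast
 from someI_ex[OF this] obtain V t where V: "op V" "y:V" "t:$(msec PP V)"
  "mg PP y U s = mg PP y V t" "Ph y (mg PP y U s) = pm y V t" unfolding Ph_def by blast
 from V(4) obtain W where W: "op W" "y:W" "W <= U" "W <= V" "mres PP U W s = mres PP V W t"
  unfolding mgerm_eq_iff[OF PP_presh U V(1-3)] by auto
 then show ?thesis using pm_res[OF U(1) W(1,3,2) U(3)] pm_res[OF V(1) W(1,4,2) V(3)] V(5) by simp
qed

lemma Ph_lin:
 assumes y: "y:pts X"
 shows "lin (Ox y) (St PP y) (Pst y) (Ph y)"
proof (rule slinI)
 fix a assume "a:$(St PP y)"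
 from mstalk_rep[OF PP_presh this] obtain U s where U: "op U" "y:U" "s:$(msec PP U)" "a = mg PP y U s" by blast
 then show "Ph y a:$(Pst y)" using Ph[OF U(1-3)] slinD(1)[OF pm(1)[OF U(1,2)]] by simp
next
 fix a b assume "a:$(St PP y)" "b:$(St PP y)"
 from mstalk_rep2[OF PP_presh this y] obtain U s t where U: "op U" "y:U" "s:$(msec PP U)"
  "t:$(msec PP U)" "a = mg PP y U s" "b = mg PP y U t" by blast
 interpret module "SX U" "msec PP U" by (rule PP_module[OF U(1)])
 show "Ph y (a +[St PP y] b) = Ph y a +[Pst y] Ph y b"
  using U Ph[OF U(1,2)] slinD(2)[OF pm(1)[OF U(1,2)]] mgerm_op(2)[OF PP_presh U(1-4)] by simp
next
 fix r a assume r: "r:$(Ox y)" and a: "a:$(St PP y)"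
 from mstalk_rep[OF PP_presh a] obtain U s where U: "op U" "y:U" "s:$(msec PP U)" "a = mg PP y U s" by blast
 from stalk_rep[OF r] obtain V q where V: "op V" "y:V" "q:$(SX V)" "r = rg y V q" by blast
 let ?W = "U Int V"
 have W: "op ?W" "y:?W" "?W <= U" "?W <= V" using U V by auto
 have c: "res X V ?W q:$(SX ?W)" "mres PP U ?W s:$(msec PP ?W)"
  using preshD(1)[OF sec_presh V(1) W(1,4) V(3)] mres_closed[OF PP_presh U(1) W(1,3) U(3)] by auto
 have e: "r = rg y ?W (res X V ?W q)" "a = mg PP y ?W (mres PP U ?W s)"
  using rgerm_res[OF V(1) W(1,4,2) V(3)] mgerm_res[OF PP_presh U(1) W(1,3,2) U(3)] U(4) V(4) by auto
 interpret module "SX ?W" "msec PP ?W" by (rule PP_module[OF W(1)])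
 show "Ph y (r *.[St PP y] a) = r *.[Pst y] Ph y a"
  unfolding e using mgerm_op(3)[OF PP_presh W(1,2) c(2,1)] Ph[OF W(1,2)] c slinD(3)[OF pm(1)[OF W(1,2)]] by simp
qed

lemma lext_push:
 assumes U: "op U" "y:U" and f: "f:$(free_module (SX U) (B U))"
 shows "lext (Ox y) (St PP y) (%r. r) (wP y) (push (SX U) (Ox y) (rg y U) (ga y U) f)
  = mg PP y U (pclass (SX U) (B U) (Rel U) f)"
proof -
 have y: "y:pts X" using op_pts U by blast
 have ga': "ga y U:B U -> Bst y" using ga[OF U] by blast
 note P = push_slin[OF sec_cring[OF U(1)] stalk_cring[OF y] rgerm_hom[OF U] ga']
 note L = lext_slin[OF stalk_cring[OF y] stalk_module[OF PP_presh y] id_ring_hom[OF stalk_cring[OF y]] wP_carrier[OF y]]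
 note C = pclass_lin[OF sec_cring[OF U(1)] Rel[OF U(1)], folded PP_sec]
 have idf: "(%r. r):$(SX U) -> $(SX U)" by auto
 note G = slin_comp[OF C mgerm_slin[OF PP_presh U] idf]
 show ?thesis
  by (rule slin_eq_on_span[OF slin_comp[OF P(1) L rgerm_fun[OF U]] G free_module[OF sec_cring[OF U(1)]]
     stalk_module[OF PP_presh y] rgerm_fun[OF U], of "free_gen (SX U) ` B U"])
   (use f in "auto simp: free_span[OF sec_cring[OF U(1)]] free_gen_carrier[OF sec_cring[OF U(1)]] P(2) wP[OF U] ga[OF U]
    lext_gen[OF stalk_cring[OF y] stalk_module[OF PP_presh y] id_ring_hom[OF stalk_cring[OF y]] wP_carrier[OF y]]
    pgen_class[OF sec_cring[OF U(1)] Rel[OF U(1)], symmetric]")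
qed

text \<open>Presentations commute with stalks: each relation of the stalk already holds on a
  neighbourhood, the germs of generators generate since every section is a combination of
  generators, and \<open>Ph\<close> sends them back to the abstract generators.\<close>

lemma PP_pres:
 assumes y: "y:pts X"
 shows "pres (Ox y) (Bst y) (Rst y) (St PP y) (wP y)"
 unfolding pres_def
proof (intro conjI ballI exI[of _ "Ph y"])
 show M: "module (Ox y) (St PP y)" by (rule stalk_module[OF PP_presh y])
 show wc: "wP y:Bst y -> $(St PP y)" by (rule wP_carrier[OF y])
 show "lin (Ox y) (St PP y) (Pst y) (Ph y)" by (rule Ph_lin[OF y])
 fix rh assume "rh:Rst y"
 from ga_rel_surj[OF y this] obtain U rh' where U: "op U" "y:U" "rh':Rel U"
  "rh = push (SX U) (Ox y) (rg y U) (ga y U) rh'" by blast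
 have "rh':$(free_module (SX U) (B U))" using Rel[OF U(1)] U(3) by blast
 from lext_push[OF U(1,2) this] show "lext (Ox y) (St PP y) (%r. r) (wP y) rh = 0[St PP y]"
  using pclass_rel[OF sec_cring[OF U(1)] Rel[OF U(1)] span_incl[OF U(3)]] mgerm_zero[OF PP_presh U(1,2)] U(4)
  by (simp add: PP_sec)
next
 fix c assume "c:Bst y"
 from ga_surj[OF y this] obtain U b where U: "op U" "y:U" "b:B U" "c = ga y U b" by blast
 show "Ph y (wP y c) = presented_gen (Ox y) (Bst y) (Rst y) c"
  unfolding U(4) wP[OF U(1-3)] Ph[OF U(1,2) gn_carrier[OF U(1,3)]] by (rule pm(2)[OF U(1-3)])
next
 have sub: "wP y ` Bst y <= $(St PP y)" using wP_carrier[OF y] by blast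
 note M = stalk_module[OF PP_presh y]
 have "a:module_span (Ox y) (St PP y) (wP y ` Bst y)" if "a:$(St PP y)" for a
 proof -
  from mstalk_rep[OF PP_presh that] obtain U s where U: "op U" "y:U" "s:$(msec PP U)" "a = mg PP y U s" by blast
  have "mg PP y U s:module_span (Ox y) (St PP y) (wP y ` Bst y)"
   by (rule slin_span[OF mgerm_slin[OF PP_presh U(1,2)] PP_module[OF U(1)] M rgerm_fun[OF U(1,2)] span_submodule[OF M sub],
      of "gn U ` B U"])
    (use U(3) gn_span[OF U(1)] gn_carrier[OF U(1)] in "auto simp: wP[OF U(1,2), symmetric] intro!: span_incl imageI ga[OF U(1,2)]")
  then show ?thesis using U(4) by simp
 qed
 then show "module_span (Ox y) (St PP y) (wP y ` Bst y) = $(St PP y)"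
  using span_carrier[OF M sub] by blast
qed

definition ww :: "'x => 'c => ('x, 'x => ('x, ('b => 'r) set) germ) germ" where
 "ww y c = shg PP y (wP y c)"

lemma SS_pres: "y:pts X ==> pres (Ox y) (Bst y) (Rst y) (St SS y) (ww y)"
 unfolding ww_def SS_PP
 by (rule pres_iso[OF PP_pres Rst stalk_module[OF sheafify_presh[OF PP_presh]] shg_lin[OF PP_presh]])
  (simp_all add: bij_betw_def shg_inj[OF PP_presh] shg_image[OF PP_presh])

lemma SS_gen:
 assumes U: "op U" "b:B U"
 shows "lse SS U (%y. ww y (ga y U b))"
 by (rule lsec_cong[OF SS_presh, of U "%y. shg PP y (mg PP y U (gn U b))"])
  (use shg_continuous[OF PP_presh lsec_germ[OF PP_presh U(1) gn_carrier[OF U]], folded SS_PP] in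
   \<open>simp_all add: ww_def wP[OF U(1) _ U(2)]\<close>)

text \<open>Near a point, a section of a presented sheaf comes from one section of the presented
  presheaf, which is a finite combination of generators with functions as coefficients. Local
  sections are closed under such combinations, so a stalkwise linear map has to be tested on
  generators only.\<close>

lemma SS_cont:
 assumes Z: "mp Z" and psi: "!!y. y:U ==> lin (Ox y) (St SS y) (St Z y) (psi y)"
  and g: "!!V b. op V ==> V <= U ==> b:B V ==> lse Z V (%y. psi y (ww y (ga y V b)))"
  and sg: "lse SS U sg"
 shows "lse Z U (%y. psi y (sg y))"
proof (rule lsec_local[OF Z])
 show U: "op U" using lsec_open[OF SS_presh sg] .
 fix y assume "y:U"
 from shg_surj_local[OF PP_presh sg[unfolded SS_PP] this] obtain W t where
  W: "op W" "y:W" "W <= U" "t:$(msec PP W)" "!!z. z:W ==> sg z = shg PP z (mg PP z W t)" by blast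
 define ki where "ki z s = psi z (shg PP z (mg PP z W s))" for z s
 have ki: "slin (SX W) (rg z W) (msec PP W) (St Z z) (ki z)" if z: "z:W" for z
 proof -
  have zp: "z:pts X" "z:U" using op_pts[OF W(1) z] z W(3) by auto
  show ?thesis unfolding ki_def
   by (rule slin_comp[OF mgerm_slin[OF PP_presh W(1) z]
      lin_comp[OF shg_lin[OF PP_presh zp(1)] psi[OF zp(2), unfolded SS_PP]] rgerm_fun[OF W(1) z]])
 qed
 have ag: "abelian_group (msec PP W)" "!!z. z:W ==> abelian_group (St Z z)"
  using module_groups(1) PP_module[OF W(1)] stalk_module[OF Z op_pts[OF W(1)]] by blast+
 have sub: "gn W ` B W <= $(msec PP W)" using gn_carrier[OF W(1)] by blast
 have "lse Z W (%z. ki z s)" if "s:module_span (SX W) (msec PP W) (gn W ` B W)" for s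
  using that PP_module[OF W(1)] sub
 proof (induction rule: span_induct)
  case (gen x)
  then obtain b where b: "b:B W" "x = gn W b" by blast
  show ?case
   by (rule lsec_cong[OF Z g[OF W(1,3) b(1)]]) (simp add: ki_def ww_def wP[OF W(1) _ b(1)] b(2))
 next
  case zero
  show ?case by (rule lsec_cong[OF Z lsec_zero[OF Z W(1)]]) (simp add: slin_zero[OF ki ag(1) ag(2)])
 next
  case (add x y)
  show ?case by (rule lsec_cong[OF Z lsec_add[OF Z add(3,4)]]) (simp add: slinD(2)[OF ki add(1,2)])
 next
  case (smult r x)
  show ?case by (rule lsec_cong[OF Z lsec_smult[OF Z rsec_germ[OF W(1) smult(1)] smult(3)]])
    (simp add: slinD(3)[OF ki smult(1,2)])
 qed
 then have "lse Z W (%z. ki z t)" using W(4) gn_span[OF W(1)] by blast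
 then have "lse Z W (%z. psi z (sg z))" by (rule lsec_cong[OF Z]) (simp add: ki_def W(5))
 then show "EX W. y:W & W <= U & lse Z W (%y. psi y (sg y))" using W by blast
qed

end

section \<open>Tensor products, tensor powers and symmetric powers of sheaves\<close>

text \<open>Only three shapes of relations occur: additivity, compatibility with scalars and
  equality of two generators. Indexing them by tuples of generators lets restriction and germ maps
  act on tuples instead of elements of free modules.\<close>

definition rel3 :: "'r ring => 'b set => 'b \<times> 'b \<times> 'b => 'b => 'r" where
 "rel3 R B t = (case t of (a, b, c) =>
  free_gen R a -[free_module R B] (free_gen R b +[free_module R B] free_gen R c))"

definition rel2 :: "'r ring => 'b set => 'r \<times> 'b \<times> 'b => 'b => 'r" where
 "rel2 R B t = (case t of (r, a, b) =>
  free_gen R a -[free_module R B] (r *.[free_module R B] free_gen R b))"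

definition rel1 :: "'r ring => 'b set => 'b \<times> 'b => 'b => 'r" where
 "rel1 R B t = (case t of (a, b) => free_gen R a -[free_module R B] free_gen R b)"

definition relset :: "'r ring => 'b set => ('b \<times> 'b \<times> 'b) set => ('r \<times> 'b \<times> 'b) set => ('b \<times> 'b) set => ('b => 'r) set" where
 "relset R B T3 T2 T1 = rel3 R B ` T3 Un rel2 R B ` T2 Un rel1 R B ` T1"

lemma module_minus_closed: "module R M ==> x:$M ==> y:$M ==> x -[M] y:$M"
 by (simp add: abelian_group.minus_closed module_groups(1))

lemma module_add_closed: "module R M ==> x:$M ==> y:$M ==> x +[M] y:$M"
 by (simp add: abelian_groupE(1) module_groups(1))

lemma relset_carrier:
 assumes R: "cring R" and T: "T3 <= B \<times> B \<times> B" "T2 <= $R \<times> B \<times> B" "T1 <= B \<times> B"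
 shows "relset R B T3 T2 T1 <= $(free_module R B)"
 using T by (auto simp: relset_def rel3_def rel2_def rel1_def
   intro!: module_minus_closed[OF free_module[OF R]] module_add_closed[OF free_module[OF R]]
    module.smult_closed[OF free_module[OF R]] free_gen_carrier[OF R])

lemma slin_rels:
 assumes R: "cring R" and f: "slin R h (free_module R B) N f" and N: "abelian_group N" and abc: "a:B" "b:B" "c:B" and r: "r:$R"
 shows "f (rel3 R B (a, b, c)) = f (free_gen R a) -[N] (f (free_gen R b) +[N] f (free_gen R c))"
  and "f (rel2 R B (r, a, b)) = f (free_gen R a) -[N] (h r *.[N] f (free_gen R b))"
  and "f (rel1 R B (a, b)) = f (free_gen R a) -[N] f (free_gen R b)"
proof -
 note g = free_gen_carrier[OF R abc(1)] free_gen_carrier[OF R abc(2)] free_gen_carrier[OF R abc(3)]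
 note m = slin_minus[OF f module_groups(1)[OF free_module[OF R]] N]
 note F = free_module[OF R, of B]
 show "f (rel3 R B (a, b, c)) = f (free_gen R a) -[N] (f (free_gen R b) +[N] f (free_gen R c))"
  by (simp add: rel3_def m g module_add_closed[OF F] slinD(2)[OF f])
 show "f (rel2 R B (r, a, b)) = f (free_gen R a) -[N] (h r *.[N] f (free_gen R b))"
  by (simp add: rel2_def m g r module.smult_closed[OF F] slinD(3)[OF f])
 show "f (rel1 R B (a, b)) = f (free_gen R a) -[N] f (free_gen R b)"
  by (simp add: rel1_def m g)
qed

lemma push_rels:
 assumes "cring R" "cring R'" "sg:ring_hom R R'" "phi:B -> B'" "a:B" "b:B" "c:B" "r:$R"
 shows "push R R' sg phi (rel3 R B (a, b, c)) = rel3 R' B' (phi a, phi b, phi c)"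
  and "push R R' sg phi (rel2 R B (r, a, b)) = rel2 R' B' (sg r, phi a, phi b)"
  and "push R R' sg phi (rel1 R B (a, b)) = rel1 R' B' (phi a, phi b)"
 using slin_rels[OF assms(1) push_slin(1)[OF assms(1-4)] module_groups(1)[OF free_module[OF assms(2)]] assms(5-8)]
  push_slin(2)[OF assms(1-4)] assms(5-8)
 by (simp_all add: rel3_def rel2_def rel1_def)

lemma lext_rels:
 assumes N: "module R N" and w: "w:B -> $N" and abc: "a:B" "b:B" "c:B" and r: "r:$R"
 shows "lext R N (%r. r) w (rel3 R B (a, b, c)) = 0[N] <-> w a = w b +[N] w c"
  and "lext R N (%r. r) w (rel2 R B (r, a, b)) = 0[N] <-> w a = r *.[N] w b"
  and "lext R N (%r. r) w (rel1 R B (a, b)) = 0[N] <-> w a = w b"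
proof -
 note R = module_groups(2)[OF N]
 have wc: "w a:$N" "w b:$N" "w c:$N" using w abc by auto
 show "lext R N (%r. r) w (rel3 R B (a, b, c)) = 0[N] <-> w a = w b +[N] w c"
  "lext R N (%r. r) w (rel2 R B (r, a, b)) = 0[N] <-> w a = r *.[N] w b"
  "lext R N (%r. r) w (rel1 R B (a, b)) = 0[N] <-> w a = w b"
  unfolding slin_rels[OF R lext_slin[OF R N id_ring_hom[OF R] w] module_groups(1)[OF N] abc r]
   lext_gen[OF R N id_ring_hom[OF R] w abc(1)] lext_gen[OF R N id_ring_hom[OF R] w abc(2)]
   lext_gen[OF R N id_ring_hom[OF R] w abc(3)]
  using minus_zero_iff[OF module_groups(1)[OF N]] wc module_add_closed[OF N] module.smult_closed[OF N r] by simp_all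
qed

lemma lext_relset:
 assumes N: "module R N" and w: "w:B -> $N" and T: "T3 <= B \<times> B \<times> B" "T2 <= $R \<times> B \<times> B" "T1 <= B \<times> B"
 shows "(ALL rh:relset R B T3 T2 T1. lext R N (%r. r) w rh = 0[N]) <->
  (ALL (a, b, c):T3. w a = w b +[N] w c) & (ALL (r, a, b):T2. w a = r *.[N] w b) & (ALL (a, b):T1. w a = w b)"
proof -
 interpret module R N by fact
 have "lext R N (%r. r) w (rel3 R B t) = 0[N] <-> (case t of (a, b, c) => w a = w b +[N] w c)" if "t:T3" for t
  using that T(1) lext_rels(1)[OF N w _ _ _ R.zero_closed] by (cases t) auto
 moreover have "lext R N (%r. r) w (rel2 R B t) = 0[N] <-> (case t of (r, a, b) => w a = r *.[N] w b)" if "t:T2" for t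
  using that T(2) lext_rels(2)[OF N w] by (cases t) auto
 moreover have "lext R N (%r. r) w (rel1 R B t) = 0[N] <-> (case t of (a, b) => w a = w b)" if "t:T1" for t
  using that T(3) lext_rels(3)[OF N w _ _ _ R.zero_closed] by (cases t) auto
 ultimately show ?thesis unfolding relset_def by (simp add: ball_Un cong: ball_cong)
qed

text \<open>The conditions of \<open>psheaf\<close> on relations follow from conditions on the
  indexing tuples, because \<open>push\<close> acts on a relation by acting on the entries of its
  tuple.\<close>

lemma (in lrs) psheaf_relset:
 fixes B :: "'x set => 'b set" and Bst :: "'x => 'c set" and ga :: "'x => 'x set => 'b => 'c"
 assumes T: "!!U. op U ==> T3 U <= B U \<times> B U \<times> B U" "!!U. op U ==> T2 U <= $(SX U) \<times> B U \<times> B U"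
   "!!U. op U ==> T1 U <= B U \<times> B U"
  and Ts: "!!y. y:pts X ==> T3s y <= Bst y \<times> Bst y \<times> Bst y" "!!y. y:pts X ==> T2s y <= $(Ox y) \<times> Bst y \<times> Bst y"
   "!!y. y:pts X ==> T1s y <= Bst y \<times> Bst y"
  and Tphi: "!!U V a b c. op U ==> op V ==> V <= U ==> (a, b, c):T3 U ==> (phi U V a, phi U V b, phi U V c):T3 V"
   "!!U V r a b. op U ==> op V ==> V <= U ==> (r, a, b):T2 U ==> (res X U V r, phi U V a, phi U V b):T2 V"
   "!!U V a b. op U ==> op V ==> V <= U ==> (a, b):T1 U ==> (phi U V a, phi U V b):T1 V"
  and Tga: "!!U y a b c. op U ==> y:U ==> (a, b, c):T3 U ==> (ga y U a, ga y U b, ga y U c):T3s y"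
   "!!U y r a b. op U ==> y:U ==> (r, a, b):T2 U ==> (rg y U r, ga y U a, ga y U b):T2s y"
   "!!U y a b. op U ==> y:U ==> (a, b):T1 U ==> (ga y U a, ga y U b):T1s y"
  and Tsurj: "!!y a b c. y:pts X ==> (a, b, c):T3s y ==>
    EX U a' b' c'. op U & y:U & (a', b', c'):T3 U & a = ga y U a' & b = ga y U b' & c = ga y U c'"
   "!!y r a b. y:pts X ==> (r, a, b):T2s y ==>
    EX U r' a' b'. op U & y:U & (r', a', b'):T2 U & r = rg y U r' & a = ga y U a' & b = ga y U b'"
   "!!y a b. y:pts X ==> (a, b):T1s y ==>
    EX U a' b'. op U & y:U & (a', b'):T1 U & a = ga y U a' & b = ga y U b'"
  and phi: "!!U V b. op U ==> op V ==> V <= U ==> b:B U ==> phi U V b:B V"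
  and phi_id: "!!U b. op U ==> b:B U ==> phi U U b = b"
  and phi_comp: "!!U V W b. op U ==> op V ==> op W ==> W <= V ==> V <= U ==> b:B U ==> phi V W (phi U V b) = phi U W b"
  and ga: "!!U y b. op U ==> y:U ==> b:B U ==> ga y U b:Bst y"
  and ga_phi: "!!U V y b. op U ==> op V ==> V <= U ==> y:V ==> b:B U ==> ga y V (phi U V b) = ga y U b"
  and ga_eq: "!!U y b V b'. op U ==> y:U ==> b:B U ==> op V ==> y:V ==> b':B V ==> ga y U b = ga y V b' ==>
   EX W. op W & y:W & W <= U Int V & phi U W b = phi V W b'"
  and ga_surj: "!!y c. y:pts X ==> c:Bst y ==> EX U b. op U & y:U & b:B U & c = ga y U b"
 shows "psheaf X B (%U. relset (SX U) (B U) (T3 U) (T2 U) (T1 U)) phi Bst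
  (%y. relset (Ox y) (Bst y) (T3s y) (T2s y) (T1s y)) ga"
proof (unfold_locales, goal_cases)
 case (1 U) show ?case by (rule relset_carrier[OF sec_cring[OF 1] T[OF 1]])
next
 case (5 U V rh)
 have phi': "phi U V:B U -> B V" using phi[OF 5(1-3)] by blast
 note p = push_rels[OF sec_cring[OF 5(1)] sec_cring[OF 5(2)] res_hom[OF 5(1-3)] phi']
 \<comment> \<open>The facts \<open>push_rels\<close> carry a scalar for every shape of relation;
   for the shapes without one, zero serves as a dummy.\<close>
 have z: "0[SX U]:$(SX U)" using sec_cring[OF 5(1)] by (simp add: cring_def ring.ring_simprules)
 from 5(4)[unfolded relset_def] show ?case
 proof (elim UnE imageE)
  fix t assume t: "rh = rel3 (SX U) (B U) t" "t:T3 U"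
  obtain a b c where abc: "t = (a, b, c)" by (metis prod_cases3)
  then have "a:B U" "b:B U" "c:B U" using t T(1)[OF 5(1)] by auto
  then show ?thesis using p(1)[OF _ _ _ z] Tphi(1)[OF 5(1-3)] t abc by (simp add: relset_def)
 next
  fix t assume t: "rh = rel2 (SX U) (B U) t" "t:T2 U"
  obtain r a b where abc: "t = (r, a, b)" by (metis prod_cases3)
  then have "a:B U" "b:B U" "r:$(SX U)" using t T(2)[OF 5(1)] by auto
  then show ?thesis using p(2) Tphi(2)[OF 5(1-3)] t abc by (simp add: relset_def)
 next
  fix t assume t: "rh = rel1 (SX U) (B U) t" "t:T1 U"
  obtain a b where abc: "t = (a, b)" by (metis surj_pair)
  then have "a:B U" "b:B U" using t T(3)[OF 5(1)] by auto
  then show ?thesis using p(3)[OF _ _ _ z] Tphi(3)[OF 5(1-3)] t abc by (simp add: relset_def)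
 qed
next
 case (6 y) show ?case by (rule relset_carrier[OF stalk_cring[OF 6] Ts[OF 6]])
next
 case (11 U y rh)
 have ga': "ga y U:B U -> Bst y" using ga[OF 11(1,2)] by blast
 note p = push_rels[OF sec_cring[OF 11(1)] stalk_cring[OF op_pts[OF 11(1,2)]] rgerm_hom[OF 11(1,2)] ga']
 have z: "0[SX U]:$(SX U)" using sec_cring[OF 11(1)] by (simp add: cring_def ring.ring_simprules)
 from 11(3)[unfolded relset_def] show ?case
 proof (elim UnE imageE)
  fix t assume t: "rh = rel3 (SX U) (B U) t" "t:T3 U"
  obtain a b c where abc: "t = (a, b, c)" by (metis prod_cases3)
  then have "a:B U" "b:B U" "c:B U" using t T(1)[OF 11(1)] by auto
  then show ?thesis using p(1)[OF _ _ _ z] Tga(1)[OF 11(1,2)] t abc by (simp add: relset_def)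
 next
  fix t assume t: "rh = rel2 (SX U) (B U) t" "t:T2 U"
  obtain r a b where abc: "t = (r, a, b)" by (metis prod_cases3)
  then have "a:B U" "b:B U" "r:$(SX U)" using t T(2)[OF 11(1)] by auto
  then show ?thesis using p(2) Tga(2)[OF 11(1,2)] t abc by (simp add: relset_def)
 next
  fix t assume t: "rh = rel1 (SX U) (B U) t" "t:T1 U"
  obtain a b where abc: "t = (a, b)" by (metis surj_pair)
  then have "a:B U" "b:B U" using t T(3)[OF 11(1)] by auto
  then show ?thesis using p(3)[OF _ _ _ z] Tga(3)[OF 11(1,2)] t abc by (simp add: relset_def)
 qed
next
 case (12 y rh)
 have push: "push (SX U) (Ox y) (rg y U) (ga y U) (rel3 (SX U) (B U) (a, b, c)) = rel3 (Ox y) (Bst y) (ga y U a, ga y U b, ga y U c)"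
  "push (SX U) (Ox y) (rg y U) (ga y U) (rel2 (SX U) (B U) (r, a, b)) = rel2 (Ox y) (Bst y) (rg y U r, ga y U a, ga y U b)"
  "push (SX U) (Ox y) (rg y U) (ga y U) (rel1 (SX U) (B U) (a, b)) = rel1 (Ox y) (Bst y) (ga y U a, ga y U b)"
  if "op U" "y:U" "a:B U" "b:B U" "c:B U" "r:$(SX U)" for U a b c r
 proof -
  have ga': "ga y U:B U -> Bst y" using ga[OF that(1,2)] by blast
  note p = push_rels[OF sec_cring[OF that(1)] stalk_cring[OF 12(1)] rgerm_hom[OF that(1,2)] ga' that(3-6)]
  show "push (SX U) (Ox y) (rg y U) (ga y U) (rel3 (SX U) (B U) (a, b, c)) = rel3 (Ox y) (Bst y) (ga y U a, ga y U b, ga y U c)"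
   "push (SX U) (Ox y) (rg y U) (ga y U) (rel2 (SX U) (B U) (r, a, b)) = rel2 (Ox y) (Bst y) (rg y U r, ga y U a, ga y U b)"
   "push (SX U) (Ox y) (rg y U) (ga y U) (rel1 (SX U) (B U) (a, b)) = rel1 (Ox y) (Bst y) (ga y U a, ga y U b)"
   by (rule p)+
 qed
 have z: "0[SX U]:$(SX U)" if "op U" for U using sec_cring[OF that] by (simp add: cring_def ring.ring_simprules)
 from 12(2)[unfolded relset_def] show ?case
 proof (elim UnE imageE)
  fix t assume t: "rh = rel3 (Ox y) (Bst y) t" "t:T3s y"
  obtain a b c where abc: "t = (a, b, c)" by (metis prod_cases3)
  from Tsurj(1)[OF 12(1), of a b c] t abc obtain U a' b' c' where
   U: "op U" "y:U" "(a', b', c'):T3 U" "a = ga y U a'" "b = ga y U b'" "c = ga y U c'" by blast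
  then have "a':B U" "b':B U" "c':B U" using T(1) by auto
  from push(1)[OF U(1,2) this z[OF U(1)]] show ?thesis using U t abc
   by (intro exI[of _ U] exI[of _ "rel3 (SX U) (B U) (a', b', c')"]) (auto simp: relset_def)
 next
  fix t assume t: "rh = rel2 (Ox y) (Bst y) t" "t:T2s y"
  obtain r a b where abc: "t = (r, a, b)" by (metis prod_cases3)
  from Tsurj(2)[OF 12(1), of r a b] t abc obtain U r' a' b' where
   U: "op U" "y:U" "(r', a', b'):T2 U" "r = rg y U r'" "a = ga y U a'" "b = ga y U b'" by blast
  then have "a':B U" "b':B U" "r':$(SX U)" using T(2) by auto
  from push(2)[OF U(1,2) this(1,2,2,3)] show ?thesis using U t abc
   by (intro exI[of _ U] exI[of _ "rel2 (SX U) (B U) (r', a', b')"]) (auto simp: relset_def)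
 next
  fix t assume t: "rh = rel1 (Ox y) (Bst y) t" "t:T1s y"
  obtain a b where abc: "t = (a, b)" by (metis surj_pair)
  from Tsurj(3)[OF 12(1), of a b] t abc obtain U a' b' where
   U: "op U" "y:U" "(a', b'):T1 U" "a = ga y U a'" "b = ga y U b'" by blast
  then have "a':B U" "b':B U" using T(3) by auto
  from push(3)[OF U(1,2) this this(2) z[OF U(1)]] show ?thesis using U t abc
   by (intro exI[of _ U] exI[of _ "rel1 (SX U) (B U) (a', b')"]) (auto simp: relset_def)
 qed
next
 case 2 then show ?case by (rule phi)
next
 case 3 then show ?case by (rule phi_id)
next
 case 4 then show ?case by (rule phi_comp)
next
 case 7 then show ?case by (rule ga)
next
 case 8 then show ?case by (rule ga_phi)
next
 case 9 then show ?case by (rule ga_eq)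
next
 case 10 then show ?case by (rule ga_surj)
qed

text \<open>The flag \<open>s\<close> adds symmetry, so tensor powers (\<open>False\<close>) and
  symmetric powers (\<open>True\<close>) share one development. Stating multilinearity through list
  updates covers degree 0, where the only word is empty, without a case distinction.\<close>

definition mlin :: "bool => 'r ring => nat => ('r, 'm) module => ('r, 'z) module => ('m list => 'z) => bool" where
 "mlin s R n M Z b <-> b:words n M -> $Z &
  (ALL l:words n M. ALL i<n. ALL x:$M. ALL y:$M. b (l[i := x +[M] y]) = b (l[i := x]) +[Z] b (l[i := y])) &
  (ALL l:words n M. ALL i<n. ALL r:$R. ALL x:$M. b (l[i := r *.[M] x]) = r *.[Z] b (l[i := x])) &
  (s --> (ALL l:words n M. ALL l':words n M. mset l = mset l' --> b l = b l'))"

definition bilin :: "'r ring => ('r, 'm) module => ('r, 'n) module => ('r, 'z) module => ('m => 'n => 'z) => bool" where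
 "bilin R M N Z be <-> (ALL x:$M. lin R N Z (be x)) & (ALL y:$N. lin R M Z (%x. be x y))"

lemma mlinD:
 assumes "mlin s R n M Z b"
 shows "l:words n M ==> b l:$Z"
  and "l:words n M ==> i < n ==> x:$M ==> y:$M ==> b (l[i := x +[M] y]) = b (l[i := x]) +[Z] b (l[i := y])"
  and "l:words n M ==> i < n ==> r:$R ==> x:$M ==> b (l[i := r *.[M] x]) = r *.[Z] b (l[i := x])"
  and "s ==> l:words n M ==> l':words n M ==> mset l = mset l' ==> b l = b l'"
proof -
 note a = assms[unfolded mlin_def]
 show "l:words n M ==> b l:$Z" by (rule funcset_mem[OF conjunct1[OF a]])
 show "l:words n M ==> i < n ==> x:$M ==> y:$M ==> b (l[i := x +[M] y]) = b (l[i := x]) +[Z] b (l[i := y])"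
  using a[THEN conjunct2, THEN conjunct1] by simp
 show "l:words n M ==> i < n ==> r:$R ==> x:$M ==> b (l[i := r *.[M] x]) = r *.[Z] b (l[i := x])"
  using a[THEN conjunct2, THEN conjunct2, THEN conjunct1] by simp
 show "s ==> l:words n M ==> l':words n M ==> mset l = mset l' ==> b l = b l'"
  using a[THEN conjunct2, THEN conjunct2, THEN conjunct2] by blast
qed

lemma mlinI:
 assumes "!!l. l:words n M ==> b l:$Z"
  and "!!l i x y. l:words n M ==> i < n ==> x:$M ==> y:$M ==> b (l[i := x +[M] y]) = b (l[i := x]) +[Z] b (l[i := y])"
  and "!!l i r x. l:words n M ==> i < n ==> r:$R ==> x:$M ==> b (l[i := r *.[M] x]) = r *.[Z] b (l[i := x])"
  and "!!l l'. s ==> l:words n M ==> l':words n M ==> mset l = mset l' ==> b l = b l'"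
 shows "mlin s R n M Z b"
 unfolding mlin_def by (intro conjI ballI allI impI funcsetI assms)

lemma words_update: "l:words n M ==> x:$M ==> l[i := x]:words n M"
 unfolding words_def using set_update_subset_insert[of l i x] by auto

lemma words_map: "(!!x. x:$M ==> f x:$N) ==> l:words n M ==> map f l:words n N"
 unfolding words_def by auto

lemma bilinD:
 assumes "bilin R M N Z be"
 shows "x:$M ==> y:$N ==> be x y:$Z"
  and "x:$M ==> x':$M ==> y:$N ==> be (x +[M] x') y = be x y +[Z] be x' y"
  and "x:$M ==> y:$N ==> y':$N ==> be x (y +[N] y') = be x y +[Z] be x y'"
  and "r:$R ==> x:$M ==> y:$N ==> be (r *.[M] x) y = r *.[Z] be x y"
  and "r:$R ==> x:$M ==> y:$N ==> be x (r *.[N] y) = r *.[Z] be x y"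
proof -
 have 1: "x:$M ==> lin R N Z (be x)" for x using assms by (simp add: bilin_def)
 have 2: "y:$N ==> lin R M Z (%x. be x y)" for y using assms by (simp add: bilin_def)
 show "x:$M ==> y:$N ==> be x y:$Z"
  "x:$M ==> y:$N ==> y':$N ==> be x (y +[N] y') = be x y +[Z] be x y'"
  "r:$R ==> x:$M ==> y:$N ==> be x (r *.[N] y) = r *.[Z] be x y"
  using slinD[OF 1] by auto
 show "x:$M ==> x':$M ==> y:$N ==> be (x +[M] x') y = be x y +[Z] be x' y"
  "r:$R ==> x:$M ==> y:$N ==> be (r *.[M] x) y = r *.[Z] be x y"
  using slinD(2,3)[OF 2] by auto
qed

lemma bilinI:
 assumes "!!x y. x:$M ==> y:$N ==> be x y:$Z"
  and "!!x x' y. x:$M ==> x':$M ==> y:$N ==> be (x +[M] x') y = be x y +[Z] be x' y"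
  and "!!x y y'. x:$M ==> y:$N ==> y':$N ==> be x (y +[N] y') = be x y +[Z] be x y'"
  and "!!r x y. r:$R ==> x:$M ==> y:$N ==> be (r *.[M] x) y = r *.[Z] be x y"
  and "!!r x y. r:$R ==> x:$M ==> y:$N ==> be x (r *.[N] y) = r *.[Z] be x y"
 shows "bilin R M N Z be"
 unfolding bilin_def by (intro conjI ballI slinI assms)

definition wT3 :: "nat => ('r, 'm) module => ('m list \<times> 'm list \<times> 'm list) set" where
 "wT3 n M = {(l[i := x +[M] y], l[i := x], l[i := y]) | l i x y.
  l:words n M & i < n & x:$M & y:$M}"

definition wT2 :: "'r ring => nat => ('r, 'm) module => ('r \<times> 'm list \<times> 'm list) set" where
 "wT2 R n M = {(r, l[i := r *.[M] x], l[i := x]) | l i r x.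
  l:words n M & i < n & r:$R & x:$M}"

definition wT1 :: "bool => nat => ('r, 'm) module => ('m list \<times> 'm list) set" where
 "wT1 s n M = {(l, l') | l l'. s & l:words n M & l':words n M & mset l = mset l'}"

definition tT3 :: "('r, 'm) module => ('r, 'n) module => (('m \<times> 'n) \<times> ('m \<times> 'n) \<times> ('m \<times> 'n)) set" where
 "tT3 M N = {((x +[M] x', y), (x, y), (x', y)) | x x' y. x:$M & x':$M & y:$N} \<union>
  {((x, y +[N] y'), (x, y), (x, y')) | x y y'. x:$M & y:$N & y':$N}"

definition tT2 :: "'r ring => ('r, 'm) module => ('r, 'n) module => ('r \<times> ('m \<times> 'n) \<times> ('m \<times> 'n)) set" where
 "tT2 R M N = {(r, (r *.[M] x, y), (x, y)) | r x y. r:$R & x:$M & y:$N} \<union>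
  {(r, (x, r *.[N] y), (x, y)) | r x y. r:$R & x:$M & y:$N}"

abbreviation wrels :: "bool => 'r ring => nat => ('r, 'm) module => ('m list => 'r) set" where
 "wrels s R n M \<equiv> relset R (words n M) (wT3 n M) (wT2 R n M) (wT1 s n M)"

abbreviation trels :: "'r ring => ('r, 'm) module => ('r, 'n) module => ('m \<times> 'n => 'r) set" where
 "trels R M N \<equiv> relset R ($M \<times> $N) (tT3 M N) (tT2 R M N) {}"

lemma image_setcompr2: "f ` {g x y | x y. P x y} = {f (g x y) | x y. P x y}" by blast
lemma image_setcompr3: "f ` {g x y z | x y z. P x y z} = {f (g x y z) | x y z. P x y z}" by blast
lemma image_setcompr4: "f ` {g x y z w | x y z w. P x y z w} = {f (g x y z w) | x y z w. P x y z w}" by blast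

lemma ball_setcompr2: "(ALL t:{g x y | x y. P x y}. Q t) <-> (ALL x y. P x y --> Q (g x y))" by blast
lemma ball_setcompr3: "(ALL t:{g x y z | x y z. P x y z}. Q t) <-> (ALL x y z. P x y z --> Q (g x y z))" by blast
lemma ball_setcompr4: "(ALL t:{g x y z w | x y z w. P x y z w}. Q t) <-> (ALL x y z w. P x y z w --> Q (g x y z w))" by blast

lemma tensor_power_rels_eq: "tensor_power_rels R n M = wrels False R n M"
 unfolding tensor_power_rels_def relset_def wT3_def wT2_def wT1_def Let_def image_setcompr4 image_setcompr2
  rel3_def rel2_def rel1_def by simp

lemma sym_power_rels_eq: "sym_power_rels R n M = wrels True R n M"
 unfolding sym_power_rels_def tensor_power_rels_def relset_def wT3_def wT2_def wT1_def Let_def image_setcompr4 image_setcompr2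
  rel3_def rel2_def rel1_def by simp

lemma tensor_rels_eq: "tensor_rels R M N = trels R M N"
 unfolding tensor_rels_def relset_def tT3_def tT2_def Let_def image_Un image_setcompr3
  rel3_def rel2_def rel1_def by (simp add: Un_assoc)

lemma wT_subset:
 assumes "module R M"
 shows "wT3 n M <= words n M \<times> words n M \<times> words n M" "wT2 R n M <= $R \<times> words n M \<times> words n M"
  "wT1 s n M <= words n M \<times> words n M"
 using module_add_closed[OF assms] module.smult_closed[OF assms]
 by (auto simp: wT3_def wT2_def wT1_def intro!: words_update)

lemma tT_subset:
 assumes "module R M" "module R N"
 shows "tT3 M N <= ($M \<times> $N) \<times> ($M \<times> $N) \<times> ($M \<times> $N)"
  "tT2 R M N <= $R \<times> ($M \<times> $N) \<times> ($M \<times> $N)"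
 using module_add_closed[OF assms(1)] module.smult_closed[OF assms(1)] module_add_closed[OF assms(2)] module.smult_closed[OF assms(2)]
 by (auto simp: tT3_def tT2_def)

lemma wrels_mlin:
 assumes M: "module R M" and Z: "module R Z"
 shows "b:words n M -> $Z & (ALL rh:wrels s R n M. lext R Z (%r. r) b rh = 0[Z]) <-> mlin s R n M Z b"
proof (cases "b:words n M -> $Z")
 case True
 have "(ALL (a, c, d):wT3 n M. b a = b c +[Z] b d) <->
  (ALL l:words n M. ALL i<n. ALL x:$M. ALL y:$M. b (l[i := x +[M] y]) = b (l[i := x]) +[Z] b (l[i := y]))"
  unfolding wT3_def ball_setcompr4 by (simp add: Ball_def) blast
 moreover have "(ALL (r, a, c):wT2 R n M. b a = r *.[Z] b c) <->
  (ALL l:words n M. ALL i<n. ALL r:$R. ALL x:$M. b (l[i := r *.[M] x]) = r *.[Z] b (l[i := x]))"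
  unfolding wT2_def ball_setcompr4 by (simp add: Ball_def) blast
 moreover have "(ALL (a, c):wT1 s n M. b a = b c) <->
  (s --> (ALL l:words n M. ALL l':words n M. mset l = mset l' --> b l = b l'))"
  unfolding wT1_def ball_setcompr2 by (simp add: Ball_def) blast
 ultimately show ?thesis unfolding lext_relset[OF Z True wT_subset[OF M]] mlin_def using True by simp
next
 case False
 then show ?thesis unfolding mlin_def by blast
qed

lemma trels_bilin:
 assumes M: "module R M" and N: "module R N" and Z: "module R Z" and c: "!!x y. x:$M ==> y:$N ==> be x y:$Z"
 shows "(ALL rh:trels R M N. lext R Z (%r. r) (%(x, y). be x y) rh = 0[Z]) <-> bilin R M N Z be"
proof -
 have w: "(%(x, y). be x y):$M \<times> $N -> $Z" using c by auto
 have "(ALL rh:trels R M N. lext R Z (%r. r) (%(x, y). be x y) rh = 0[Z]) <->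
  (ALL x:$M. ALL x':$M. ALL y:$N. be (x +[M] x') y = be x y +[Z] be x' y) &
  (ALL x:$M. ALL y:$N. ALL y':$N. be x (y +[N] y') = be x y +[Z] be x y') &
  (ALL r:$R. ALL x:$M. ALL y:$N. be (r *.[M] x) y = r *.[Z] be x y) &
  (ALL r:$R. ALL x:$M. ALL y:$N. be x (r *.[N] y) = r *.[Z] be x y)"
  unfolding lext_relset[OF Z w tT_subset[OF M N] empty_subsetI]
  unfolding tT3_def tT2_def ball_Un ball_setcompr3 by (simp add: Ball_def) blast
 also have "\<dots> <-> bilin R M N Z be"
  using c by (auto intro!: bilinI dest: bilinD)
 finally show ?thesis .
qed

context lrs
begin

context
 fixes M :: "('x, 'r, 'm) mod_presheaf"
 assumes M: "mp M"
begin

text \<open>Equality of two words of germs is a finite number of equalities of germs, so it is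
  realized on a finite intersection of neighbourhoods.\<close>

lemma mgerm_lists_eq:
 assumes U: "op U" "y:U" and V: "op V" "y:V"
 shows "set ss <= $(msec M U) ==> set ts <= $(msec M V) ==> map (mg M y U) ss = map (mg M y V) ts ==>
  EX W. op W & y:W & W <= U Int V & map (mres M U W) ss = map (mres M V W) ts"
proof (induction ss arbitrary: ts)
 case Nil
 then show ?case using U V by (intro exI[of _ "U Int V"]) auto
next
 case (Cons s ss)
 then obtain t ts' where ts: "ts = t # ts'" by (cases ts) auto
 have pr: "set ss <= $(msec M U)" "set ts' <= $(msec M V)" "map (mg M y U) ss = map (mg M y V) ts'"
  using Cons.prems ts by auto
 from Cons.IH[OF pr] obtain W where W: "op W" "y:W" "W <= U Int V" "map (mres M U W) ss = map (mres M V W) ts'" by blast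
 have st: "s:$(msec M U)" "t:$(msec M V)" "mg M y U s = mg M y V t" using Cons.prems ts by auto
 then obtain W' where W': "op W'" "y:W'" "W' <= U Int V" "mres M U W' s = mres M V W' t"
  unfolding mgerm_eq_iff[OF M U st(1) V st(2)] by blast
 let ?Z = "W Int W'"
 have o: "op ?Z" using W W' by auto
 note c = preshD(3)[OF P'(3)[OF M]]
 have "mres M U ?Z s = mres M V ?Z t"
  using c[OF U(1) W'(1) o _ _ st(1)] c[OF V(1) W'(1) o _ _ st(2)] W' by simp
 moreover have "map (mres M U ?Z) ss = map (mres M W ?Z) (map (mres M U W) ss)"
  "map (mres M V ?Z) ts' = map (mres M W ?Z) (map (mres M V W) ts')"
  using c[OF U(1) W(1) o] c[OF V(1) W(1) o] W(3) Cons.prems ts by (auto simp: subset_iff)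
 ultimately show ?case using W W' o ts by (intro exI[of _ ?Z]) auto
qed

text \<open>Words of germs are germs of words: both a finite list of germs and an equality of two
  such lists are realized on a single neighbourhood. Each defining relation involves only finitely
  many germs and lifts in the same way.\<close>

lemma words_psheaf: "psheaf X (%U. words n (msec M U)) (%U. wrels s (SX U) n (msec M U)) (%U V. map (mres M U V))
  (%y. words n (St M y)) (%y. wrels s (Ox y) n (St M y)) (%y U. map (mg M y U))"
proof (rule psheaf_relset, goal_cases)
 case (1 U) show ?case by (rule wT_subset[OF P'(1)[OF M 1]])
next
 case (2 U) show ?case by (rule wT_subset[OF P'(1)[OF M 2]])
next
 case (3 U) show ?case by (rule wT_subset[OF P'(1)[OF M 3]])
next
 case (4 y) show ?case by (rule wT_subset[OF stalk_module[OF M 4]])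
next
 case (5 y) show ?case by (rule wT_subset[OF stalk_module[OF M 5]])
next
 case (6 y) show ?case by (rule wT_subset[OF stalk_module[OF M 6]])
next
 case (7 U V a b c)
 from 7(4) obtain l i x y where *: "a = l[i := x +[msec M U] y]" "b = l[i := x]" "c = l[i := y]"
  "l:words n (msec M U)" "i < n" "x:$(msec M U)" "y:$(msec M U)" unfolding wT3_def by blast
 note m = mres_closed[OF M 7(1-3)]
 have "map (mres M U V) l:words n (msec M V)" using words_map[OF m *(4)] .
 then show ?case using * m unfolding wT3_def
  by (simp add: map_update slinD(2)[OF P'(2)[OF M 7(1-3)]]) blast
next
 case (8 U V r a b)
 from 8(4) obtain l i x where *: "a = l[i := r *.[msec M U] x]" "b = l[i := x]"
  "l:words n (msec M U)" "i < n" "r:$(SX U)" "x:$(msec M U)" unfolding wT2_def by blast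
 note m = mres_closed[OF M 8(1-3)] ring_hom_closed[OF res_hom[OF 8(1-3)]]
 have "map (mres M U V) l:words n (msec M V)" using words_map[OF m(1) *(3)] .
 then show ?case using * m unfolding wT2_def
  by (simp add: map_update slinD(3)[OF P'(2)[OF M 8(1-3)]]) blast
next
 case (9 U V a b)
 then show ?case using words_map[OF mres_closed[OF M 9(1-3)]]
  by (auto simp: wT1_def)
next
 case (10 U p a b c)
 from 10(3) obtain l i x y where *: "a = l[i := x +[msec M U] y]" "b = l[i := x]" "c = l[i := y]"
  "l:words n (msec M U)" "i < n" "x:$(msec M U)" "y:$(msec M U)" unfolding wT3_def by blast
 note m = mgerm_op(1)[OF M 10(1,2)]
 have "map (mg M p U) l:words n (St M p)" using words_map[OF m *(4)] .
 then show ?case using * m unfolding wT3_def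
  by (simp add: map_update mgerm_op(2)[OF M 10(1,2), symmetric]) blast
next
 case (11 U p r a b)
 from 11(3) obtain l i x where *: "a = l[i := r *.[msec M U] x]" "b = l[i := x]"
  "l:words n (msec M U)" "i < n" "r:$(SX U)" "x:$(msec M U)" unfolding wT2_def by blast
 note m = mgerm_op(1)[OF M 11(1,2)] ring_hom_closed[OF rgerm_hom[OF 11(1,2)]]
 have "map (mg M p U) l:words n (St M p)" using words_map[OF m(1) *(3)] .
 then show ?case using * m unfolding wT2_def
  by (simp add: map_update mgerm_op(3)[OF M 11(1,2), symmetric]) blast
next
 case (12 U p a b)
 then show ?case using words_map[OF mgerm_op(1)[OF M 12(1,2)]]
  by (auto simp: wT1_def)
next
 case (13 p a b c)
 from 13(2) obtain l i x y where *: "a = l[i := x +[St M p] y]" "b = l[i := x]" "c = l[i := y]"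
  "l:words n (St M p)" "i < n" "x:$(St M p)" "y:$(St M p)" unfolding wT3_def by blast
 have "set (x # y # l) <= $(St M p)" using *(4,6,7) by (simp add: words_def)
 from mstalk_list_rep[OF M this 13(1)] obtain U ss where
  U: "op U" "p:U" "set ss <= $(msec M U)" "x # y # l = map (mg M p U) ss" by (elim exE conjE) (rule that)
 have "length ss = Suc (Suc (length l))" using arg_cong[OF U(4), of length] by simp
 then obtain x' y' l' where ss: "ss = x' # y' # l'" by (metis length_Suc_conv)
 have e: "x = mg M p U x'" "y = mg M p U y'" "l = map (mg M p U) l'" using U(4) ss by simp_all
 have c: "x':$(msec M U)" "y':$(msec M U)" "set l' <= $(msec M U)" using U(3) ss by simp_all
 have l': "l':words n (msec M U)" using c(3) e(3) *(4) by (simp add: words_def)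
 have "(l'[i := x' +[msec M U] y'], l'[i := x'], l'[i := y']):wT3 n (msec M U)"
  using l' c(1,2) *(5) unfolding wT3_def by blast
 then show ?case unfolding *(1-3) e
  by (intro exI[of _ U] exI[of _ "l'[i := x' +[msec M U] y']"] exI[of _ "l'[i := x']"] exI[of _ "l'[i := y']"])
   (simp add: map_update mgerm_op(2)[OF M U(1,2)] U(1,2) c)
next
 case (14 p r a b)
 from 14(2) obtain l i x where *: "a = l[i := r *.[St M p] x]" "b = l[i := x]"
  "l:words n (St M p)" "i < n" "x:$(St M p)" "r:$(Ox p)" unfolding wT2_def by blast
 have "set (x # l) <= $(St M p)" using *(3,5) by (simp add: words_def)
 from mstalk_list_rep[OF M this 14(1)] obtain U ss where
  U: "op U" "p:U" "set ss <= $(msec M U)" "x # l = map (mg M p U) ss" by (elim exE conjE) (rule that)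
 have "length ss = Suc (length l)" using arg_cong[OF U(4), of length] by simp
 then obtain x' l' where ss: "ss = x' # l'" by (metis length_Suc_conv)
 have e: "x = mg M p U x'" "l = map (mg M p U) l'" using U(4) ss by simp_all
 have c': "x':$(msec M U)" "set l' <= $(msec M U)" using U(3) ss by simp_all
 from stalk_rep[OF *(6)] obtain V q where V: "op V" "p:V" "q:$(SX V)" "r = rg p V q" by blast
 let ?W = "U Int V"
 have W: "op ?W" "?W <= U" "?W <= V" "p:?W" using U V by auto
 define q' x'' l'' where "q' = res X V ?W q" and "x'' = mres M U ?W x'" and "l'' = map (mres M U ?W) l'"
 have c: "q':$(SX ?W)" "x'':$(msec M ?W)"
  unfolding q'_def x''_def using preshD(1)[OF sec_presh V(1) W(1,3) V(3)] mres_closed[OF M U(1) W(1,2) c'(1)] by blast+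
 have l'': "l'':words n (msec M ?W)"
  using e(2) c'(2) *(3) mres_closed[OF M U(1) W(1,2)] unfolding l''_def by (auto simp: words_def)
 have "map (mg M p ?W) l'' = map (mg M p U) l'"
  unfolding l''_def using c'(2) mgerm_res[OF M U(1) W(1,2,4)] by (simp add: subset_iff)
 then have g: "r = rg p ?W q'" "x = mg M p ?W x''" "l = map (mg M p ?W) l''"
  using rgerm_res[OF V(1) W(1,3,4) V(3)] mgerm_res[OF M U(1) W(1,2,4) c'(1)] e V(4)
  by (simp_all add: q'_def x''_def)
 have "(q', l''[i := q' *.[msec M ?W] x''], l''[i := x'']):wT2 (SX ?W) n (msec M ?W)"
  using l'' c *(4) unfolding wT2_def by blast
 then show ?case unfolding *(1,2) g
  by (intro exI[of _ ?W] exI[of _ q'] exI[of _ "l''[i := q' *.[msec M ?W] x'']"] exI[of _ "l''[i := x'']"])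
   (simp add: map_update mgerm_op(3)[OF M W(1,4)] W(1) W(4)[simplified] c)
next
 case (15 p a b)
 then have *: "s" "a:words n (St M p)" "b:words n (St M p)" "mset b = mset a" by (auto simp: wT1_def)
 have "set a <= $(St M p)" using *(2) by (simp add: words_def)
 from mstalk_list_rep[OF M this 15(1)] obtain U ss where
  U: "op U" "p:U" "set ss <= $(msec M U)" "a = map (mg M p U) ss" by (elim exE conjE) (rule that)
 \<comment> \<open>Two representing words need not have equal multisets of letters even if their
   germs do. Applying the permutation to the representatives of one word yields suitable
   representatives of the other.\<close>
 from mset_eq_permutation[OF *(4)] obtain pe where pe: "pe permutes {..<length a}" "permute_list pe a = b" by blast
 have pe': "pe permutes {..<length ss}" using pe(1) U(4) by simp
 have "b = map (mg M p U) (permute_list pe ss)" unfolding pe(2)[symmetric] U(4) by (rule permute_list_map[OF pe'])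
 moreover have "(ss, permute_list pe ss):wT1 s n (msec M U)"
  using * U pe' by (auto simp: wT1_def words_def)
 ultimately show ?case using U by blast
next
 case (16 U V b) then show ?case by (intro words_map[OF mres_closed[OF M]])
next
 case (17 U b) then show ?case using preshD(2)[OF P'(3)[OF M]] by (auto simp: words_def subset_iff intro: map_idI)
next
 case (18 U V W b) then show ?case using preshD(3)[OF P'(3)[OF M]] by (auto simp: words_def subset_iff)
next
 case (19 U y b) then show ?case by (intro words_map[OF mgerm_op(1)[OF M]])
next
 case (20 U V y b) then show ?case using mgerm_res[OF M] by (auto simp: words_def subset_iff)
next
 case (21 U y b V b') then show ?case using mgerm_lists_eq[of U y V b b'] by (auto simp: words_def)
next
 case (22 y c)
 then have "set c <= $(St M y)" by (simp add: words_def)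
 from mstalk_list_rep[OF M this 22(1)] obtain U ss where
  U: "op U" "y:U" "set ss <= $(msec M U)" "c = map (mg M y U) ss" by (elim exE conjE) (rule that)
 then show ?case using 22 by (intro exI[of _ U] exI[of _ ss]) (auto simp: words_def)
qed

end

end

context lrs
begin

lemma tensor_psheaf:
 fixes M :: "('x, 'r, 'm) mod_presheaf" and N :: "('x, 'r, 'n) mod_presheaf"
 assumes M: "mp M" and N: "mp N"
 shows "psheaf X (%U. $(msec M U) \<times> $(msec N U)) (%U. trels (SX U) (msec M U) (msec N U))
  (%U V. map_prod (mres M U V) (mres N U V))
  (%y. $(St M y) \<times> $(St N y)) (%y. trels (Ox y) (St M y) (St N y))
  (%y U. map_prod (mg M y U) (mg N y U))"
proof (rule psheaf_relset, goal_cases)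
 case (1 U) show ?case by (rule tT_subset[OF P'(1)[OF M 1] P'(1)[OF N 1]])
next
 case (2 U) show ?case by (rule tT_subset[OF P'(1)[OF M 2] P'(1)[OF N 2]])
next
 case (4 y) show ?case by (rule tT_subset[OF stalk_module[OF M 4] stalk_module[OF N 4]])
next
 case (5 y) show ?case by (rule tT_subset[OF stalk_module[OF M 5] stalk_module[OF N 5]])
next
 case (7 U V a b c)
 note m = mres_closed[OF M 7(1-3)] mres_closed[OF N 7(1-3)]
 note s = slinD(2)[OF P'(2)[OF M 7(1-3)]] slinD(2)[OF P'(2)[OF N 7(1-3)]]
 from 7(4) show ?case unfolding tT3_def by (elim UnE CollectE exE conjE) (simp add: m s; blast intro: m)+
next
 case (8 U V r a b)
 note m = mres_closed[OF M 8(1-3)] mres_closed[OF N 8(1-3)] ring_hom_closed[OF res_hom[OF 8(1-3)]]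
 note s = slinD(3)[OF P'(2)[OF M 8(1-3)]] slinD(3)[OF P'(2)[OF N 8(1-3)]]
 from 8(4) show ?case unfolding tT2_def by (elim UnE CollectE exE conjE) (simp add: m s; blast intro: m)+
next
 case (10 U y a b c)
 note m = mgerm_op(1)[OF M 10(1,2)] mgerm_op(1)[OF N 10(1,2)]
 note s = mgerm_op(2)[OF M 10(1,2), symmetric] mgerm_op(2)[OF N 10(1,2), symmetric]
 from 10(3) show ?case unfolding tT3_def by (elim UnE CollectE exE conjE) (simp add: m s; blast intro: m)+
next
 case (11 U y r a b)
 note m = mgerm_op(1)[OF M 11(1,2)] mgerm_op(1)[OF N 11(1,2)] ring_hom_closed[OF rgerm_hom[OF 11(1,2)]]
 note s = mgerm_op(3)[OF M 11(1,2), symmetric] mgerm_op(3)[OF N 11(1,2), symmetric]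
 from 11(3) show ?case unfolding tT2_def by (elim UnE CollectE exE conjE) (simp add: m s; blast intro: m)+
next
 have rep: "EX U m m' n n'. op U & y:U & m:$(msec M U) & m':$(msec M U) &
   n:$(msec N U) & n':$(msec N U) & a = mg M y U m & a' = mg M y U m' &
   b = mg N y U n & b' = mg N y U n'"
  if "y:pts X" "a:$(St M y)" "a':$(St M y)" "b:$(St N y)" "b':$(St N y)"
  for y a a' b b'
 proof -
  from mstalk_rep2[OF M that(2,3,1)] obtain U m m' where U: "op U" "y:U" "m:$(msec M U)" "m':$(msec M U)"
   "a = mg M y U m" "a' = mg M y U m'" .
  from mstalk_rep2[OF N that(4,5,1)] obtain V n n' where V: "op V" "y:V" "n:$(msec N V)" "n':$(msec N V)"
   "b = mg N y V n" "b' = mg N y V n'" .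
  let ?W = "U Int V"
  have W: "op ?W" "?W <= U" "?W <= V" "y:?W" using U V by auto
  show ?thesis
   by (rule exI[of _ ?W], rule exI[of _ "mres M U ?W m"], rule exI[of _ "mres M U ?W m'"],
     rule exI[of _ "mres N V ?W n"], rule exI[of _ "mres N V ?W n'"])
    (simp only: W(1,4) U(5,6) V(5,6) mres_closed[OF M U(1) W(1,2) U(3)] mres_closed[OF M U(1) W(1,2) U(4)]
     mres_closed[OF N V(1) W(1,3) V(3)] mres_closed[OF N V(1) W(1,3) V(4)]
     mgerm_res[OF M U(1) W(1,2,4) U(3)] mgerm_res[OF M U(1) W(1,2,4) U(4)]
     mgerm_res[OF N V(1) W(1,3,4) V(3)] mgerm_res[OF N V(1) W(1,3,4) V(4)] simp_thms)
 qed
 {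
  case (13 y a b c)
  from 13(2) consider (1) x x' z where "a = (x +[St M y] x', z)" "b = (x, z)" "c = (x', z)"
    "x:$(St M y)" "x':$(St M y)" "z:$(St N y)"
   | (2) x z z' where "a = (x, z +[St N y] z')" "b = (x, z)" "c = (x, z')"
    "x:$(St M y)" "z:$(St N y)" "z':$(St N y)"
   unfolding tT3_def by blast
  then show ?case
  proof cases
   case 1
   from rep[OF 13(1) 1(4,5,6,6)] obtain U m m' n where U: "op U" "y:U" "m:$(msec M U)" "m':$(msec M U)"
    "n:$(msec N U)" and e: "x = mg M y U m" "x' = mg M y U m'" "z = mg N y U n" by (elim exE conjE) (rule that)
   have "((m +[msec M U] m', n), (m, n), (m', n)):tT3 (msec M U) (msec N U)"
    using U unfolding tT3_def by blast
   then show ?thesis unfolding 1(1-3) e mgerm_op(2)[OF M U(1,2,3,4)] using U(1,2) by fastforce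
  next
   case 2
   from rep[OF 13(1) 2(4,4,5,6)] obtain U m n n' where U: "op U" "y:U" "m:$(msec M U)" "n:$(msec N U)"
    "n':$(msec N U)" and e: "x = mg M y U m" "z = mg N y U n" "z' = mg N y U n'" by (elim exE conjE) (rule that)
   have "((m, n +[msec N U] n'), (m, n), (m, n')):tT3 (msec M U) (msec N U)"
    using U unfolding tT3_def by blast
   then show ?thesis unfolding 2(1-3) e mgerm_op(2)[OF N U(1,2,4,5)] using U(1,2) by fastforce
  qed
 next
  case (14 y r a b)
  from 14(2) consider (1) x z where "a = (r *.[St M y] x, z)" "b = (x, z)" "r:$(Ox y)"
    "x:$(St M y)" "z:$(St N y)"
   | (2) x z where "a = (x, r *.[St N y] z)" "b = (x, z)" "r:$(Ox y)"
    "x:$(St M y)" "z:$(St N y)"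
   unfolding tT2_def by blast
  then obtain x z where r: "r:$(Ox y)" and xz: "x:$(St M y)" "z:$(St N y)" "b = (x, z)"
   and a: "a = (r *.[St M y] x, z) \<or> a = (x, r *.[St N y] z)" by cases blast+
  from rep[OF 14(1) xz(1,1,2,2)] obtain U m n where U: "op U" "y:U" "m:$(msec M U)" "n:$(msec N U)"
   and e: "x = mg M y U m" "z = mg N y U n" by (elim exE conjE) (rule that)
  from stalk_rep[OF r] obtain V q where V: "op V" "y:V" "q:$(SX V)" "r = rg y V q" .
  let ?W = "U Int V"
  have W: "op ?W" "?W <= U" "?W <= V" "y:?W" using U V by auto
  define q' m' n' where "q' = res X V ?W q" and "m' = mres M U ?W m" and "n' = mres N U ?W n"
  have c: "q':$(SX ?W)" "m':$(msec M ?W)" "n':$(msec N ?W)"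
   unfolding q'_def m'_def n'_def using preshD(1)[OF sec_presh V(1) W(1,3) V(3)]
    mres_closed[OF M U(1) W(1,2) U(3)] mres_closed[OF N U(1) W(1,2) U(4)] by blast+
  have g: "r = rg y ?W q'" "x = mg M y ?W m'" "z = mg N y ?W n'"
   using rgerm_res[OF V(1) W(1,3,4) V(3)] mgerm_res[OF M U(1) W(1,2,4) U(3)] mgerm_res[OF N U(1) W(1,2,4) U(4)] e V(4)
   by (simp_all add: q'_def m'_def n'_def)
  have t: "(q', (q' *.[msec M ?W] m', n'), (m', n')):tT2 (SX ?W) (msec M ?W) (msec N ?W)"
   "(q', (m', q' *.[msec N ?W] n'), (m', n')):tT2 (SX ?W) (msec M ?W) (msec N ?W)"
   using c unfolding tT2_def by blast+
  from a show ?case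
  proof
   assume a: "a = (r *.[St M y] x, z)"
   show ?thesis unfolding a xz(3) g mgerm_op(3)[OF M W(1,4) c(2,1)] using t(1) W(1,4) by fastforce
  next
   assume a: "a = (x, r *.[St N y] z)"
   show ?thesis unfolding a xz(3) g mgerm_op(3)[OF N W(1,4) c(3,1)] using t(2) W(1,4) by fastforce
  qed
 next
  case (22 y c)
  then obtain a b where c: "c = (a, b)" "a:$(St M y)" "b:$(St N y)" by blast
  from rep[OF 22(1) c(2,2,3,3)] obtain U m n where U: "op U" "y:U" "m:$(msec M U)" "n:$(msec N U)"
   and e: "a = mg M y U m" "b = mg N y U n" by (elim exE conjE) (rule that)
  show ?case unfolding c(1) e using U by (intro exI[of _ U] exI[of _ "(m, n)"]) simp
 }
next
 case (16 U V b) then show ?case using mres_closed[OF M 16(1-3)] mres_closed[OF N 16(1-3)] by auto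
next
 case (17 U b) then show ?case using preshD(2)[OF P'(3)[OF M] 17(1)] preshD(2)[OF P'(3)[OF N] 17(1)] by auto
next
 case (18 U V W b)
 then show ?case using preshD(3)[OF P'(3)[OF M] 18(1-5)] preshD(3)[OF P'(3)[OF N] 18(1-5)] by auto
next
 case (19 U y b) then show ?case using mgerm_op(1)[OF M 19(1,2)] mgerm_op(1)[OF N 19(1,2)] by auto
next
 case (20 U V y b)
 obtain m n where b: "b = (m, n)" by (cases b)
 show ?case using mgerm_res[OF M 20(1-4)] mgerm_res[OF N 20(1-4)] 20(5) unfolding b by simp
next
 case (21 U y b V b')
 obtain m n m' n' where b: "b = (m, n)" "b' = (m', n')" by (cases b, cases b')
 have c: "m:$(msec M U)" "n:$(msec N U)" "m':$(msec M V)" "n':$(msec N V)"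
  using 21(3,6) b by simp_all
 have "mg M y U m = mg M y V m'" "mg N y U n = mg N y V n'" using 21(7) b by simp_all
 then obtain A B where A: "op A" "y:A" "A <= U Int V" "mres M U A m = mres M V A m'"
  and B: "op B" "y:B" "B <= U Int V" "mres N U B n = mres N V B n'"
  unfolding mgerm_eq_iff[OF M 21(1,2) c(1) 21(4,5) c(3)] mgerm_eq_iff[OF N 21(1,2) c(2) 21(4,5) c(4)] by blast
 have o: "op (A Int B)" using A B by auto
 have "mres M U (A Int B) m = mres M V (A Int B) m'"
  using preshD(3)[OF P'(3)[OF M] 21(1) A(1) o _ _ c(1)] preshD(3)[OF P'(3)[OF M] 21(4) A(1) o _ _ c(3)] A by simp
 moreover have "mres N U (A Int B) n = mres N V (A Int B) n'"
  using preshD(3)[OF P'(3)[OF N] 21(1) B(1) o _ _ c(2)] preshD(3)[OF P'(3)[OF N] 21(4) B(1) o _ _ c(4)] B by simp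
 ultimately show ?case using A B o b by (intro exI[of _ "A Int B"]) auto
qed auto

end

lemma presD:
 assumes "pres R B Rel S w"
 shows "w:B -> $S" "ALL rh:Rel. lext R S (%r. r) w rh = 0[S]" "module_span R S (w ` B) = $S"
 using assms unfolding pres_def by simp_all

lemma lin_add:
 assumes N: "module R N" and f: "lin R M N f" and g: "lin R M N g"
 shows "lin R M N (%x. f x +[N] g x)"
proof -
 interpret module R N by fact
 show ?thesis
  by (rule slinI) (simp_all add: slinD[OF f] slinD[OF g] M.a_ac smult_r_distr)
qed

lemma lin_smult:
 assumes N: "module R N" and f: "lin R M N f" and r: "r:$R"
 shows "lin R M N (%x. r *.[N] f x)"
proof -
 interpret module R N by fact
 show ?thesis
  by (rule slinI) (simp_all add: slinD[OF f] r smult_r_distr smult_assoc1[symmetric] R.m_comm)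
qed

text \<open>Induction on the length of the initial segment whose letters are arbitrary, all later
  letters being generators. Each step frees one more position by induction over the span.\<close>

lemma words_span_induct:
 assumes M: "module R M" and G: "G <= $M" and span: "module_span R M G = $M"
  and gen: "!!l. l:words n M ==> set l <= G ==> P l"
  and zero: "!!l i. l:words n M ==> i < n ==> P (l[i := 0[M]])"
  and add: "!!l i x y. l:words n M ==> i < n ==> x:$M ==> y:$M ==> P (l[i := x]) ==> P (l[i := y]) ==> P (l[i := x +[M] y])"
  and smult: "!!l i r x. l:words n M ==> i < n ==> r:$R ==> x:$M ==> P (l[i := x]) ==> P (l[i := r *.[M] x])"
  and l: "l:words n M"
 shows "P l"
proof -
 have "ALL l:words n M. (ALL i<n. k <= i --> l ! i:G) --> P l" if "k <= n" for k
  using that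
 proof (induction k)
  case 0
  show ?case using gen by (auto simp: words_def set_conv_nth)
 next
  case (Suc k)
  show ?case
  proof (intro ballI impI)
   fix l assume l: "l:words n M" and lG: "ALL i<n. Suc k <= i --> l ! i:G"
   have k: "k < n" "k < length l" using Suc.prems l by (auto simp: words_def)
   have "P (l[k := x])" if "x:module_span R M G" for x
    using that M G
   proof (induction rule: span_induct)
    case (gen x)
    have "ALL i<n. k <= i --> l[k := x] ! i:G"
     using lG gen k by (auto simp: nth_list_update le_eq_less_or_eq Suc_le_eq)
    then show ?case using Suc.IH Suc.prems words_update[OF l, of x k] gen G by auto
   next
    case zero
    show ?case by (rule assms(5)[OF l k(1)])
   next
    case (add x y) then show ?case by (rule assms(6)[OF l k(1)])
   next
    case (smult r x) then show ?case by (rule assms(7)[OF l k(1)])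
   qed
   moreover have "l ! k:module_span R M G" using span l k by (auto simp: words_def)
   ultimately show "P l" using list_update_id[of l k] by metis
  qed
 qed
 from this[of n] show ?thesis using l by auto
qed

lemma mlin_zero:
 assumes b: "mlin s R n M Z b" and M: "module R M" and Z: "module R Z" and l: "l:words n M" and i: "i < n"
 shows "b (l[i := 0[M]]) = 0[Z]"
proof -
 interpret M: module R M by fact
 interpret Z: module R Z by fact
 have "b (l[i := 0[R] *.[M] 0[M]]) = 0[R] *.[Z] b (l[i := 0[M]])"
  by (rule mlinD(3)[OF b l i]) auto
 then show ?thesis using mlinD(1)[OF b words_update[OF l]] by simp
qed

lemma mlin_eq_on_span:
 assumes b: "mlin s R n M Z b" and c: "mlin t R n M Z c" and M: "module R M" and Z: "module R Z"
  and G: "G <= $M" "module_span R M G = $M"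
  and eq: "!!l. l:words n M ==> set l <= G ==> b l = c l" and l: "l:words n M"
 shows "b l = c l"
 by (rule words_span_induct[OF M G, where P="%l. b l = c l"])
  (use eq l in "simp_all add: mlin_zero[OF b M Z] mlin_zero[OF c M Z] mlinD(2,3)[OF b] mlinD(2,3)[OF c]")

lemma mlin_span:
 assumes b: "mlin s R n M Z b" and M: "module R M" and Z: "module R Z"
  and G: "G <= $M" "module_span R M G = $M" and N: "submodule N R Z"
  and gen: "!!l. l:words n M ==> set l <= G ==> b l:N" and l: "l:words n M"
 shows "b l:N"
 by (rule words_span_induct[OF M G, where P="%l. b l:N"])
  (use gen l in "simp_all add: mlin_zero[OF b M Z] mlinD(2,3)[OF b] submoduleD(2,3,4)[OF Z N]")

lemma mlin_comp:
 assumes b: "mlin s R n M Z b" and f: "lin R Z Z' f" and M: "module R M"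
 shows "mlin s R n M Z' (%l. f (b l))"
proof -
 have c: "x:$M ==> l:words n M ==> b (l[i := x]):$Z" for l i x
  by (intro mlinD(1)[OF b] words_update)
 show ?thesis
 proof (rule mlinI)
  show "f (b l) = f (b l')" if "s" "l:words n M" "l':words n M" "mset l = mset l'" for l l'
   using mlinD(4)[OF b that] by simp
 qed (simp_all add: mlinD(1,2,3)[OF b] slinD[OF f] c)
qed

lemma mlin_map:
 assumes b: "mlin s R n N Z b" and f: "lin R M N f"
 shows "mlin s R n M Z (%l. b (map f l))"
proof (rule mlinI)
 have m: "l:words n M ==> map f l:words n N" for l by (rule words_map[OF slinD(1)[OF f]])
 show "b (map f l):$Z" if "l:words n M" for l using mlinD(1)[OF b m[OF that]] .
 show "b (map f (l[i := x +[M] y])) = b (map f (l[i := x])) +[Z] b (map f (l[i := y]))"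
  if "l:words n M" "i < n" "x:$M" "y:$M" for l i x y
  using mlinD(2)[OF b m[OF that(1)] that(2)] that by (simp add: map_update slinD[OF f])
 show "b (map f (l[i := r *.[M] x])) = r *.[Z] b (map f (l[i := x]))"
  if "l:words n M" "i < n" "r:$R" "x:$M" for l i r x
  using mlinD(3)[OF b m[OF that(1)] that(2)] that by (simp add: map_update slinD[OF f])
 show "b (map f l) = b (map f l')" if "s" "l:words n M" "l':words n M" "mset l = mset l'" for l l'
  by (rule mlinD(4)[OF b that(1) m[OF that(2)] m[OF that(3)]]) (simp add: that(4))
qed

section \<open>Morphisms and bilinear maps of sheaves, given on stalks\<close>

context lrs
begin

text \<open>A morphism of sheaves is recorded by its maps on stalks, with continuity expressed as
  preservation of local sections. Maps out of sheafified powers can then be defined stalk by stalk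
  from universal properties.\<close>

definition smor :: "('x, 'r, 'm) mod_presheaf => ('x, 'r, 'n) mod_presheaf => ('x => ('x, 'm) germ => ('x, 'n) germ) => bool" where
 "smor M N f <-> (ALL y:pts X. lin (Ox y) (St M y) (St N y) (f y)) &
  (ALL U sg. lse M U sg --> lse N U (%y. f y (sg y)))"

definition sbil :: "('x, 'r, 'm) mod_presheaf => ('x, 'r, 'n) mod_presheaf => ('x, 'r, 'z) mod_presheaf =>
  ('x => ('x, 'm) germ => ('x, 'n) germ => ('x, 'z) germ) => bool" where
 "sbil M N Z be <-> (ALL y:pts X. bilin (Ox y) (St M y) (St N y) (St Z y) (be y)) &
  (ALL U sg ta. lse M U sg --> lse N U ta --> lse Z U (%y. be y (sg y) (ta y)))"

lemma smorD: "smor M N f ==> y:pts X ==> lin (Ox y) (St M y) (St N y) (f y)"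
 "smor M N f ==> lse M U sg ==> lse N U (%y. f y (sg y))"
 by (simp_all add: smor_def)

lemma sbilD: "sbil M N Z be ==> y:pts X ==> bilin (Ox y) (St M y) (St N y) (St Z y) (be y)"
 "sbil M N Z be ==> lse M U sg ==> lse N U ta ==> lse Z U (%y. be y (sg y) (ta y))"
 by (simp_all add: sbil_def)

lemma smorI:
 assumes "!!y. y:pts X ==> lin (Ox y) (St M y) (St N y) (f y)"
  "!!U sg. lse M U sg ==> lse N U (%y. f y (sg y))"
 shows "smor M N f"
 using assms by (simp add: smor_def)

lemma sbil_comp1:
 assumes "smor L M f" "sbil M N Z be"
 shows "sbil L N Z (%y a. be y (f y a))"
 unfolding sbil_def
proof (intro conjI ballI allI impI)
 fix y assume y: "y:pts X"
 show "bilin (Ox y) (St L y) (St N y) (St Z y) (%a. be y (f y a))"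
  by (rule bilinI) (simp_all add: slinD[OF smorD(1)[OF assms(1) y]] bilinD[OF sbilD(1)[OF assms(2) y]])
qed (rule sbilD(2)[OF assms(2) smorD(2)[OF assms(1)]])

lemma rstalk_fun: "(%r. r):$(Ox y) -> $(Ox y)" by simp

subsection \<open>Words\<close>

definition wsh :: "bool => nat => ('x, 'r, 'm) mod_presheaf => ('x, 'r, 'x => ('x, ('m list => 'r) set) germ) mod_presheaf" where
 "wsh s n M = presented_sheaf X (%U. words n (msec M U)) (%U. wrels s (SX U) n (msec M U)) (%U V. map (mres M U V))"

lemma sym_power_wsh: "sym_power_sheaf X n M = wsh True n M"
 by (simp add: wsh_def sym_power_sheaf_def sym_power_rels_eq)

lemma tensor_power_wsh: "tensor_power_sheaf X n M = wsh False n M"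
 by (simp add: wsh_def tensor_power_sheaf_def tensor_power_rels_eq)

definition wd :: "bool => nat => ('x, 'r, 'm) mod_presheaf => 'x => ('x, 'm) germ list => ('x, 'x => ('x, ('m list => 'r) set) germ) germ" where
 "wd s n M = psheaf.ww X (%U. words n (msec M U)) (%U. wrels s (SX U) n (msec M U)) (%U V. map (mres M U V))
  (%y U. map (mg M y U))"

context
 fixes M :: "('x, 'r, 'm) mod_presheaf"
 assumes M: "mp M"
begin

lemmas wps = words_psheaf[OF M]

lemma wsh_sheaf: "module_sheaf X (wsh s n M)"
 unfolding wsh_def by (rule psheaf.SS_sheaf[OF wps])

lemmas wsh_presh = sheaf_presh[OF wsh_sheaf]

lemma wsh_module: "y:pts X ==> module (Ox y) (St (wsh s n M) y)"
 by (rule stalk_module[OF wsh_presh])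

lemma wd_pres: "y:pts X ==> pres (Ox y) (words n (St M y)) (wrels s (Ox y) n (St M y)) (St (wsh s n M) y) (wd s n M y)"
 unfolding wsh_def wd_def by (rule psheaf.SS_pres[OF wps])

lemma wd_mlin: "y:pts X ==> mlin s (Ox y) n (St M y) (St (wsh s n M) y) (wd s n M y)"
 by (rule iffD1[OF wrels_mlin[OF stalk_module[OF M] wsh_module] conjI[OF presD(1,2)[OF wd_pres]]])

lemma wd_span: "y:pts X ==> module_span (Ox y) (St (wsh s n M) y) (wd s n M y ` words n (St M y)) = $(St (wsh s n M) y)"
 by (rule presD(3)[OF wd_pres])

lemma wd_carrier: "y:pts X ==> l:words n (St M y) ==> wd s n M y l:$(St (wsh s n M) y)"
 by (rule mlinD(1)[OF wd_mlin])

lemma wd_image: "y:pts X ==> wd s n M y ` words n (St M y) <= $(St (wsh s n M) y)"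
 using wd_carrier by blast

definition wl :: "bool => nat => (('x, 'r) germ, 'z) module => 'x => (('x, 'm) germ list => 'z) => ('x, 'x => ('x, ('m list => 'r) set) germ) germ => 'z" where
 "wl s n Z y b = (SOME psi. lin (Ox y) (St (wsh s n M) y) Z psi & (ALL l:words n (St M y). psi (wd s n M y l) = b l))"

lemma wl:
 assumes y: "y:pts X" and Z: "module (Ox y) Z" and b: "mlin s (Ox y) n (St M y) Z b"
 shows "lin (Ox y) (St (wsh s n M) y) Z (wl s n Z y b)"
  and "l:words n (St M y) ==> wl s n Z y b (wd s n M y l) = b l"
proof -
 have My: "module (Ox y) (St M y)" by (rule stalk_module[OF M y])
 have "EX psi. lin (Ox y) (St (wsh s n M) y) Z psi & (ALL l:words n (St M y). psi (wd s n M y l) = b l)"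
  by (rule pres_lift[OF wd_pres[OF y] relset_carrier[OF stalk_cring[OF y] wT_subset[OF My]] Z])
   (use b wrels_mlin[OF My Z] in blast)+
 from someI_ex[OF this] show "lin (Ox y) (St (wsh s n M) y) Z (wl s n Z y b)"
  "l:words n (St M y) ==> wl s n Z y b (wd s n M y l) = b l" unfolding wl_def[symmetric] by blast+
qed

lemma wsh_eq:
 assumes y: "y:pts X" and Z: "module (Ox y) Z" and f: "lin (Ox y) (St (wsh s n M) y) Z f" "lin (Ox y) (St (wsh s n M) y) Z g"
  and eq: "!!l. l:words n (St M y) ==> f (wd s n M y l) = g (wd s n M y l)" and p: "p:$(St (wsh s n M) y)"
 shows "f p = g p"
 by (rule slin_eq_on_span[OF f wsh_module[OF y] Z rstalk_fun wd_image[OF y]]) (use eq p wd_span[OF y] in auto)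

lemma wd_lsec:
 assumes U: "op U" and sgs: "length sgs = n" "!!sg. sg:set sgs ==> lse M U sg"
 shows "lse (wsh s n M) U (%y. wd s n M y (map (%sg. sg y) sgs))"
proof (rule lsec_local[OF wsh_presh U])
 fix y assume y: "y:U"
 have "EX W ss. op W & y:W & W <= U & length ss = length sgs & set ss <= $(msec M W) &
   (ALL z:W. map (%sg. sg z) sgs = map (mg M z W) ss)"
  by (rule lsec_list[OF M U _ y]) (rule sgs(2))
 then obtain W ss where W: "op W" "y:W" "W <= U" "length ss = length sgs"
  "set ss <= $(msec M W)" "ALL z:W. map (%sg. sg z) sgs = map (mg M z W) ss" by (elim exE conjE) (rule that)
 have "ss:words n (msec M W)" using W(4,5) sgs(1) by (simp add: words_def)
 from psheaf.SS_gen[OF wps W(1) this, of s] have "lse (wsh s n M) W (%y. wd s n M y (map (mg M y W) ss))"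
  unfolding wsh_def wd_def .
 then have "lse (wsh s n M) W (%y. wd s n M y (map (%sg. sg y) sgs))"
  by (rule lsec_cong[OF wsh_presh]) (simp only: W(6)[rule_format])
 then show "EX W. y:W & W <= U & lse (wsh s n M) W (%y. wd s n M y (map (%sg. sg y) sgs))" using W by blast
qed

lemma wd_cont:
 assumes Z: "mp Z" and psi: "!!y. y:U ==> lin (Ox y) (St (wsh s n M) y) (St Z y) (psi y)"
  and g: "!!V sgs. op V ==> V <= U ==> length sgs = n ==> (!!sg. sg:set sgs ==> lse M V sg) ==>
   lse Z V (%y. psi y (wd s n M y (map (%sg. sg y) sgs)))"
  and sg: "lse (wsh s n M) U sg"
 shows "lse Z U (%y. psi y (sg y))"
proof (rule psheaf.SS_cont[OF wps Z psi[unfolded wsh_def] _ sg[unfolded wsh_def]])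
 fix V b assume V: "op V" "V <= U" and b: "b:words n (msec M V)"
 have "lse Z V (%y. psi y (wd s n M y (map (%sg. sg y) (map (%t y. mg M y V t) b))))"
  by (rule g[OF V]) (use b lsec_germ[OF M V(1)] in "auto simp: words_def")
 then show "lse Z V (%y. psi y (psheaf.ww X (%U. words n (msec M U)) (%U. wrels s (SX U) n (msec M U))
   (%U V. map (mres M U V)) (%y U. map (mg M y U)) y (map (mg M y V) b)))"
  by (simp add: wd_def comp_def)
qed

end

lemma wl_cont:
 assumes M: "mp M" and Z: "mp Z" and U: "op U"
  and b: "!!y. y:U ==> mlin s (Ox y) n (St M y) (St Z y) (b y)"
  and c: "!!V sgs. op V ==> V <= U ==> length sgs = n ==> (!!sg. sg:set sgs ==> lse M V sg) ==>
   lse Z V (%y. b y (map (%sg. sg y) sgs))"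
  and sg: "lse (wsh s n M) U sg"
 shows "lse Z U (%y. wl M s n (St Z y) y (b y) (sg y))"
proof (rule wd_cont[OF M Z _ _ sg])
 have yU: "y:U ==> y:pts X" for y using op_pts[OF U] .
 show "lin (Ox y) (St (wsh s n M) y) (St Z y) (wl M s n (St Z y) y (b y))" if "y:U" for y
  by (rule wl(1)[OF M yU[OF that] stalk_module[OF Z yU[OF that]] b[OF that]])
 fix V sgs assume V: "op V" "V <= U" and sgs: "length sgs = n" "!!sg. sg:set sgs ==> lse M V sg"
 have w: "map (%sg. sg y) sgs:words n (St M y)" if "y:V" for y
  using lsec_carrier[OF M sgs(2) that] sgs(1) by (auto simp: words_def)
 show "lse Z V (%y. wl M s n (St Z y) y (b y) (wd s n M y (map (%sg. sg y) sgs)))"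
  by (rule lsec_cong[OF Z c[OF V sgs]])
   (use V(2) yU w wl(2)[OF M _ stalk_module[OF Z] b] in "simp_all add: subset_iff")
qed

lemma wl_smor:
 assumes M: "mp M" and Z: "mp Z"
  and b: "!!y. y:pts X ==> mlin s (Ox y) n (St M y) (St Z y) (b y)"
  and c: "!!V sgs. op V ==> length sgs = n ==> (!!sg. sg:set sgs ==> lse M V sg) ==>
   lse Z V (%y. b y (map (%sg. sg y) sgs))"
 shows "smor (wsh s n M) Z (%y. wl M s n (St Z y) y (b y))"
proof (rule smorI)
 show "lin (Ox y) (St (wsh s n M) y) (St Z y) (wl M s n (St Z y) y (b y))" if "y:pts X" for y
  by (rule wl(1)[OF M that stalk_module[OF Z that] b[OF that]])
 fix U sg assume sg: "lse (wsh s n M) U sg"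
 show "lse Z U (%y. wl M s n (St Z y) y (b y) (sg y))"
  by (rule wl_cont[OF M Z lsec_open[OF wsh_presh[OF M] sg] b c sg]) (use op_pts[OF lsec_open[OF wsh_presh[OF M] sg]] in auto)
qed

subsection \<open>Tensor products\<close>

abbreviation tsh where "tsh M N \<equiv> tensor_sheaf X M N"

definition td :: "('x, 'r, 'm) mod_presheaf => ('x, 'r, 'n) mod_presheaf => 'x => ('x, 'm) germ => ('x, 'n) germ =>
  ('x, 'x => ('x, ('m \<times> 'n => 'r) set) germ) germ" where
 "td M N y a b = psheaf.ww X (%U. $(msec M U) \<times> $(msec N U)) (%U. trels (SX U) (msec M U) (msec N U))
  (%U V. map_prod (mres M U V) (mres N U V)) (%y U. map_prod (mg M y U) (mg N y U)) y (a, b)"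

context
 fixes M :: "('x, 'r, 'm) mod_presheaf" and N :: "('x, 'r, 'n) mod_presheaf"
 assumes M: "mp M" and N: "mp N"
begin

lemmas tps = tensor_psheaf[OF M N]

lemma tsh_presented: "tsh M N = presented_sheaf X (%U. $(msec M U) \<times> $(msec N U))
  (%U. trels (SX U) (msec M U) (msec N U)) (%U V. map_prod (mres M U V) (mres N U V))"
 by (simp add: tensor_sheaf_def tensor_rels_eq)

lemma tsh_sheaf: "module_sheaf X (tsh M N)"
 unfolding tsh_presented by (rule psheaf.SS_sheaf[OF tps])

lemmas tsh_presh = sheaf_presh[OF tsh_sheaf]

lemma td_case: "(%(a, b). td M N y a b) = psheaf.ww X (%U. $(msec M U) \<times> $(msec N U)) (%U. trels (SX U) (msec M U) (msec N U))
  (%U V. map_prod (mres M U V) (mres N U V)) (%y U. map_prod (mg M y U) (mg N y U)) y"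
 by (simp add: td_def fun_eq_iff split: prod.split)

lemma td_pres: "y:pts X ==> pres (Ox y) ($(St M y) \<times> $(St N y)) (trels (Ox y) (St M y) (St N y))
  (St (tsh M N) y) (%(a, b). td M N y a b)"
 unfolding td_case tsh_presented by (rule psheaf.SS_pres[OF tps])

lemma td_bilin:
 assumes y: "y:pts X"
 shows "bilin (Ox y) (St M y) (St N y) (St (tsh M N) y) (td M N y)"
proof -
 have c: "td M N y a b:$(St (tsh M N) y)" if "a:$(St M y)" "b:$(St N y)" for a b
  using funcset_mem[OF presD(1)[OF td_pres[OF y]], of "(a, b)"] that by simp
 show ?thesis
  by (rule iffD1[OF trels_bilin[OF stalk_module[OF M y] stalk_module[OF N y] stalk_module[OF tsh_presh y] c] presD(2)[OF td_pres[OF y]]])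
qed

lemma td_span: "y:pts X ==> module_span (Ox y) (St (tsh M N) y)
  ((%(a, b). td M N y a b) ` ($(St M y) \<times> $(St N y))) = $(St (tsh M N) y)"
 by (rule presD(3)[OF td_pres])

lemma td_lift:
 assumes y: "y:pts X" and Z: "module (Ox y) Z" and b: "bilin (Ox y) (St M y) (St N y) Z be"
 shows "EX psi. lin (Ox y) (St (tsh M N) y) Z psi & (ALL a:$(St M y). ALL b:$(St N y). psi (td M N y a b) = be a b)"
proof -
 note My = stalk_module[OF M y] and Ny = stalk_module[OF N y]
 have w: "(%(a, b). be a b):$(St M y) \<times> $(St N y) -> $Z"
  using bilinD(1)[OF b] by auto
 have z: "ALL rh:trels (Ox y) (St M y) (St N y). lext (Ox y) Z (%r. r) (%(a, b). be a b) rh = 0[Z]"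
  by (rule iffD2[OF trels_bilin[OF My Ny Z bilinD(1)[OF b]] b])
 have "EX psi. lin (Ox y) (St (tsh M N) y) Z psi &
   (ALL x:$(St M y) \<times> $(St N y). psi ((%(a, b). td M N y a b) x) = (%(a, b). be a b) x)"
  by (rule pres_lift[OF td_pres[OF y] relset_carrier[OF stalk_cring[OF y] tT_subset[OF My Ny] empty_subsetI] Z w z[rule_format]])
 then show ?thesis by simp
qed

lemma td_lsec:
 assumes sg: "lse M U sg" and ta: "lse N U ta"
 shows "lse (tsh M N) U (%y. td M N y (sg y) (ta y))"
proof (rule lsec_local[OF tsh_presh lsec_open[OF M sg]])
 fix y assume y: "y:U"
 from lsecD[OF M sg y] obtain V s where V: "op V" "y:V" "V <= U" "s:$(msec M V)" "!!z. z:V ==> sg z = mg M z V s" by metis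
 from lsecD[OF N ta y] obtain W t where W: "op W" "y:W" "W <= U" "t:$(msec N W)" "!!z. z:W ==> ta z = mg N z W t" by metis
 let ?Z = "V Int W"
 have o: "op ?Z" "?Z <= V" "?Z <= W" "?Z <= U" "y:?Z" using V W by auto
 have "(mres M V ?Z s, mres N W ?Z t):$(msec M ?Z) \<times> $(msec N ?Z)"
  using mres_closed[OF M V(1) o(1,2) V(4)] mres_closed[OF N W(1) o(1,3) W(4)] by simp
 from psheaf.SS_gen[OF tps o(1) this]
 have "lse (tsh M N) ?Z (%y. td M N y (mg M y ?Z (mres M V ?Z s)) (mg N y ?Z (mres N W ?Z t)))"
  unfolding tsh_presented td_def by simp
 then have "lse (tsh M N) ?Z (%y. td M N y (sg y) (ta y))"
  by (rule lsec_cong[OF tsh_presh])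
   (simp add: mgerm_res[OF M V(1) o(1,2) _ V(4)] mgerm_res[OF N W(1) o(1,3) _ W(4)] V(5) W(5))
 then show "EX W. y:W & W <= U & lse (tsh M N) W (%y. td M N y (sg y) (ta y))" using o by blast
qed

lemma td_cont:
 assumes Z: "mp Z" and psi: "!!y. y:U ==> lin (Ox y) (St (tsh M N) y) (St Z y) (psi y)"
  and g: "!!V sg ta. op V ==> V <= U ==> lse M V sg ==> lse N V ta ==> lse Z V (%y. psi y (td M N y (sg y) (ta y)))"
  and sg: "lse (tsh M N) U sg"
 shows "lse Z U (%y. psi y (sg y))"
proof (rule psheaf.SS_cont[OF tps Z psi[unfolded tsh_presented] _ sg[unfolded tsh_presented]])
 fix V b assume V: "op V" "V <= U" and b: "b:$(msec M V) \<times> $(msec N V)"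
 then obtain s t where st: "b = (s, t)" "s:$(msec M V)" "t:$(msec N V)" by blast
 show "lse Z V (%y. psi y (psheaf.ww X (%U. $(msec M U) \<times> $(msec N U)) (%U. trels (SX U) (msec M U) (msec N U))
  (%U V. map_prod (mres M U V) (mres N U V)) (%y U. map_prod (mg M y U) (mg N y U)) y (map_prod (mg M y V) (mg N y V) b)))"
  using g[OF V lsec_germ[OF M V(1) st(2)] lsec_germ[OF N V(1) st(3)]] by (simp add: st(1) td_def)
qed

end

end

section \<open>Natural maps between symmetric powers\<close>

lemma words_append: "l:words i M ==> l':words j M ==> l @ l':words (i + j) M"
 by (auto simp: words_def)

lemma mlin_append:
 assumes b: "mlin s R (i + j) M Z b" and l': "l':words j M"
 shows "mlin s R i M Z (%l. b (l @ l'))"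
proof (rule mlinI)
 show "b (l @ l'):$Z" if "l:words i M" for l using mlinD(1)[OF b words_append[OF that l']] .
 show "b (l[k := x +[M] y] @ l') = b (l[k := x] @ l') +[Z] b (l[k := y] @ l')"
  if "l:words i M" "k < i" "x:$M" "y:$M" for l k x y
  using mlinD(2)[OF b words_append[OF that(1) l'], of k x y] that by (simp add: list_update_append words_def)
 show "b (l[k := r *.[M] x] @ l') = r *.[Z] b (l[k := x] @ l')"
  if "l:words i M" "k < i" "r:$R" "x:$M" for l k r x
  using mlinD(3)[OF b words_append[OF that(1) l'], of k r x] that by (simp add: list_update_append words_def)
 show "b (l1 @ l') = b (l2 @ l')" if "s" "l1:words i M" "l2:words i M" "mset l1 = mset l2" for l1 l2
  by (rule mlinD(4)[OF b that(1) words_append[OF that(2) l'] words_append[OF that(3) l']]) (simp add: that(4))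
qed

lemma mlin_append2:
 assumes b: "mlin s R (i + j) M Z b" and l: "l:words i M"
 shows "mlin s R j M Z (%l'. b (l @ l'))"
proof (rule mlinI)
 show "b (l @ l'):$Z" if "l':words j M" for l' using mlinD(1)[OF b words_append[OF l that]] .
 show "b (l @ l'[k := x +[M] y]) = b (l @ l'[k := x]) +[Z] b (l @ l'[k := y])"
  if "l':words j M" "k < j" "x:$M" "y:$M" for l' k x y
  using mlinD(2)[OF b words_append[OF l that(1)], of "i + k" x y] that l by (simp add: list_update_append words_def)
 show "b (l @ l'[k := r *.[M] x]) = r *.[Z] b (l @ l'[k := x])"
  if "l':words j M" "k < j" "r:$R" "x:$M" for l' k r x
  using mlinD(3)[OF b words_append[OF l that(1)], of "i + k" r x] that l by (simp add: list_update_append words_def)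
 show "b (l @ l1) = b (l @ l2)" if "s" "l1:words j M" "l2:words j M" "mset l1 = mset l2" for l1 l2
  by (rule mlinD(4)[OF b that(1) words_append[OF l that(2)] words_append[OF l that(3)]]) (simp add: that(4))
qed

lemma words_chunks:
 "l:words (m * q) M ==> EX ls. length ls = m & set ls <= words q M & l = concat ls"
proof (induction m arbitrary: l)
 case (Suc m)
 have l: "drop q l:words (m * q) M" "take q l:words q M"
  using Suc.prems set_drop_subset[of q l] set_take_subset[of q l] unfolding words_def by (simp_all add: subset_iff)
 from Suc.IH[OF l(1)] obtain ls where ls: "length ls = m" "set ls <= words q M" "drop q l = concat ls" by blast
 have "l = take q l @ concat ls" using append_take_drop_id[of q l] ls(3) by simp
 then show ?case using ls(1,2) l(2) by (intro exI[of _ "take q l # ls"]) simp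
qed (auto simp: words_def)

context lrs
begin

abbreviation Sy where "Sy \<equiv> wsh True"
abbreviation sw where "sw \<equiv> wd True"

lemma words_lsec:
 assumes "mp M" "ALL sg:set sgs. lse M V sg" "y:V" "length sgs = n"
 shows "map (%sg. sg y) sgs:words n (St M y)"
 using lsec_carrier[OF assms(1) assms(2)[rule_format] assms(3)] assms(4) by (auto simp: words_def)

lemma lsec_finsum:
 assumes M: "mp M" and U: "op U" and A: "finite A" and sg: "!!a. a:A ==> lse M U (sg a)"
 shows "lse M U (%y. finsum (St M y) (%a. sg a y) A)"
 using A sg
proof (induction A)
 case empty
 have "0[St M y] = finsum (St M y) (%a. sg a y) {}" if "y:U" for y
 proof -
  interpret module "Ox y" "St M y" using stalk_module[OF M op_pts[OF U that]] .
  show ?thesis by simp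
 qed
 then show ?case by (rule lsec_cong[OF M lsec_zero[OF M U]])
next
 case (insert a A)
 have "sg a y +[St M y] finsum (St M y) (%a. sg a y) A = finsum (St M y) (%a. sg a y) (insert a A)" if "y:U" for y
 proof -
  interpret module "Ox y" "St M y" using stalk_module[OF M op_pts[OF U that]] .
  have "!!b. b:insert a A ==> sg b y:$(St M y)" using lsec_carrier[OF M insert.prems that] .
  then show ?thesis using insert.hyps by (subst M.finsum_insert) auto
 qed
 moreover have "lse M U (%y. sg a y +[St M y] finsum (St M y) (%a. sg a y) A)"
  using lsec_add[OF M insert.prems[of a] insert.IH] insert.prems by simp
 ultimately show ?case by (rule lsec_cong[OF M, rotated])
qed

subsection \<open>Functoriality\<close>

definition smap :: "nat => ('x, 'r, 'm) mod_presheaf => ('x, 'r, 'n) mod_presheaf => ('x => ('x, 'm) germ => ('x, 'n) germ) => 'x =>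
  ('x, 'x => ('x, ('m list => 'r) set) germ) germ => ('x, 'x => ('x, ('n list => 'r) set) germ) germ" where
 "smap n M N f y = wl M True n (St (Sy n N) y) y (%l. sw n N y (map (f y) l))"

lemma smap:
 assumes M: "mp M" and N: "mp N" and f: "smor M N f"
 shows "smor (Sy n M) (Sy n N) (smap n M N f)"
  and "y:pts X ==> l:words n (St M y) ==> smap n M N f y (sw n M y l) = sw n N y (map (f y) l)"
proof -
 have b: "mlin True (Ox y) n (St M y) (St (Sy n N) y) (%l. sw n N y (map (f y) l))" if "y:pts X" for y
  by (rule mlin_map[OF wd_mlin[OF N that] smorD(1)[OF f that]])
 show "smor (Sy n M) (Sy n N) (smap n M N f)"
  unfolding smap_def
 proof (rule wl_smor[OF M wsh_presh[OF N] b])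
  fix V sgs assume V: "op V" and sgs: "length sgs = n" "!!sg. sg:set sgs ==> lse M V sg"
  have "lse (Sy n N) V (%y. sw n N y (map (%sg. sg y) (map (%sg y. f y (sg y)) sgs)))"
   by (rule wd_lsec[OF N V]) (use sgs smorD(2)[OF f] in auto)
  then show "lse (Sy n N) V (%y. sw n N y (map (f y) (map (%sg. sg y) sgs)))" by (simp add: comp_def)
 qed
 show "y:pts X ==> l:words n (St M y) ==> smap n M N f y (sw n M y l) = sw n N y (map (f y) l)"
  unfolding smap_def by (rule wl(2)[OF M _ wsh_module[OF N] b])
qed

subsection \<open>Bilinear maps out of two symmetric powers\<close>

text \<open>The map \<open>b\<close> is extended first in the left variable with the right word
  fixed, then in the right variable. This replaces a universal property of a product of two
  symmetric powers.\<close>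

definition wl2 :: "nat => ('x, 'r, 'm) mod_presheaf => nat => ('x, 'r, 'n) mod_presheaf => (('x, 'r) germ, 'z) module => 'x =>
  (('x, 'm) germ list => ('x, 'n) germ list => 'z) => ('x, 'x => ('x, ('m list => 'r) set) germ) germ =>
  ('x, 'x => ('x, ('n list => 'r) set) germ) germ => 'z" where
 "wl2 i M j N Z y b p q = wl N True j Z y (%l'. wl M True i Z y (%l. b l l') p) q"

lemma wl2:
 assumes M: "mp M" and N: "mp N" and y: "y:pts X" and Z: "module (Ox y) Z"
  and b1: "!!l'. l':words j (St N y) ==> mlin True (Ox y) i (St M y) Z (%l. b l l')"
  and b2: "!!l. l:words i (St M y) ==> mlin True (Ox y) j (St N y) Z (b l)"
 shows "bilin (Ox y) (St (Sy i M) y) (St (Sy j N) y) Z (wl2 i M j N Z y b)"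
  and "l:words i (St M y) ==> l':words j (St N y) ==> wl2 i M j N Z y b (sw i M y l) (sw j N y l') = b l l'"
proof -
 define B where "B l' = wl M True i Z y (%l. b l l')" for l'
 have B: "lin (Ox y) (St (Sy i M) y) Z (B l')" "!!l. l:words i (St M y) ==> B l' (sw i M y l) = b l l'"
  if "l':words j (St N y)" for l'
  unfolding B_def using wl[OF M y Z b1[OF that]] by auto
 note Bc = slinD(1)[OF B(1)]
 have eq: "f p = g p" if "lin (Ox y) (St (Sy i M) y) Z f" "lin (Ox y) (St (Sy i M) y) Z g"
  "!!l. l:words i (St M y) ==> f (sw i M y l) = g (sw i M y l)" "p:$(St (Sy i M) y)" for f g p
  using wsh_eq[OF M y Z that] .
 have u: "l'[k := x]:words j (St N y)" if "l':words j (St N y)" "x:$(St N y)" for l' k x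
  using words_update[OF that] .
 interpret N: module "Ox y" "St N y" by (rule stalk_module[OF N y])
 \<comment> \<open>After the extension in the left variable, multilinearity and symmetry in the
   right one must survive. Each is an equality of linear maps in \<open>p\<close>, so it is enough
   to compare them on words, where it is the hypothesis on \<open>b\<close>.\<close>
 have Bm: "mlin True (Ox y) j (St N y) Z (%l'. B l' p)" if p: "p:$(St (Sy i M) y)" for p
 proof (rule mlinI)
  fix l' k v w assume l': "l':words j (St N y)" and k: "k < j" and v: "v:$(St N y)" and w: "w:$(St N y)"
  show "B (l'[k := v +[St N y] w]) p = B (l'[k := v]) p +[Z] B (l'[k := w]) p"
   by (rule eq[OF B(1) lin_add[OF Z B(1) B(1)] _ p])
    (simp_all add: B(2) u l' v w mlinD(2)[OF b2 l' k v w])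
 next
  fix l' k r v assume l': "l':words j (St N y)" and k: "k < j" and r: "r:$(Ox y)" and v: "v:$(St N y)"
  show "B (l'[k := r *.[St N y] v]) p = r *.[Z] B (l'[k := v]) p"
   by (rule eq[OF B(1) lin_smult[OF Z B(1) r] _ p])
    (simp_all add: B(2) u l' v r mlinD(3)[OF b2 l' k r v])
 next
  fix l1 l2 assume l: "l1:words j (St N y)" "l2:words j (St N y)" "mset l1 = mset l2"
  show "B l1 p = B l2 p"
  proof (rule eq[OF B(1)[OF l(1)] B(1)[OF l(2)] _ p])
   fix l assume "l:words i (St M y)"
   then show "B l1 (sw i M y l) = B l2 (sw i M y l)"
    using B(2)[OF l(1)] B(2)[OF l(2)] mlinD(4)[OF b2 TrueI l] by simp
  qed
 qed (rule Bc[OF _ p])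
 define C where "C p = wl N True j Z y (%l'. B l' p)" for p
 have C: "lin (Ox y) (St (Sy j N) y) Z (C p)" "!!l'. l':words j (St N y) ==> C p (sw j N y l') = B l' p"
  if "p:$(St (Sy i M) y)" for p
  unfolding C_def using wl[OF N y Z Bm[OF that]] by auto
 have wC: "wl2 i M j N Z y b = C" by (simp add: wl2_def[abs_def] C_def[abs_def] B_def)
 interpret SM: module "Ox y" "St (Sy i M) y" by (rule wsh_module[OF M y])
 show "bilin (Ox y) (St (Sy i M) y) (St (Sy j N) y) Z (wl2 i M j N Z y b)"
  unfolding wC bilin_def
 proof (intro conjI ballI)
  show "lin (Ox y) (St (Sy j N) y) Z (C p)" if "p:$(St (Sy i M) y)" for p using C(1)[OF that] .
  fix q assume q: "q:$(St (Sy j N) y)"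
  show "lin (Ox y) (St (Sy i M) y) Z (%p. C p q)"
  proof (rule slinI)
   fix p p' assume p: "p:$(St (Sy i M) y)" and p': "p':$(St (Sy i M) y)"
   show "C (p +[St (Sy i M) y] p') q = C p q +[Z] C p' q"
    by (rule wsh_eq[OF N y Z C(1) lin_add[OF Z C(1) C(1)] _ q])
     (simp_all add: p p' C(2) slinD(2)[OF B(1)])
  next
   fix r p assume r: "r:$(Ox y)" and p: "p:$(St (Sy i M) y)"
   show "C (r *.[St (Sy i M) y] p) q = r *.[Z] C p q"
    by (rule wsh_eq[OF N y Z C(1) lin_smult[OF Z C(1) r] _ q])
     (simp_all add: p r C(2) slinD(3)[OF B(1)])
  qed (rule slinD(1)[OF C(1) q])
 qed
 show "l:words i (St M y) ==> l':words j (St N y) ==> wl2 i M j N Z y b (sw i M y l) (sw j N y l') = b l l'"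
  unfolding wC using C(2)[OF wd_carrier[OF M y]] B(2) by simp
qed

text \<open>Continuity is tested on generators in one variable at a time, the other section being
  held fixed as a family; this leaves the case of two words of local sections.\<close>

lemma wl2_sbil:
 assumes M: "mp M" and N: "mp N" and Z: "mp Z"
  and b1: "!!y l'. y:pts X ==> l':words j (St N y) ==> mlin True (Ox y) i (St M y) (St Z y) (%l. b y l l')"
  and b2: "!!y l. y:pts X ==> l:words i (St M y) ==> mlin True (Ox y) j (St N y) (St Z y) (b y l)"
  and c: "!!V sgs tas. op V ==> length sgs = i ==> length tas = j ==> (!!sg. sg:set sgs ==> lse M V sg) ==> (!!ta. ta:set tas ==> lse N V ta) ==>
   lse Z V (%y. b y (map (%sg. sg y) sgs) (map (%ta. ta y) tas))"
 shows "sbil (Sy i M) (Sy j N) Z (%y. wl2 i M j N (St Z y) y (b y))"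
 unfolding sbil_def
proof (intro conjI ballI allI impI)
 let ?w = "%y. wl2 i M j N (St Z y) y (b y)"
 have bl: "bilin (Ox y) (St (Sy i M) y) (St (Sy j N) y) (St Z y) (?w y)" if y: "y:pts X" for y
  by (rule wl2(1)[OF M N y stalk_module[OF Z y] b1[OF y] b2[OF y]])
 then show "bilin (Ox y) (St (Sy i M) y) (St (Sy j N) y) (St Z y) (?w y)" if "y:pts X" for y
  using that by blast
 fix U sg ta assume sg: "lse (Sy i M) U sg" and ta: "lse (Sy j N) U ta"
 have U: "op U" using lsec_open[OF wsh_presh[OF M] sg] .
 have l1: "lin (Ox y) (St (Sy i M) y) (St Z y) (%p. ?w y p q)" if "y:pts X" "q:$(St (Sy j N) y)" for y q
  using bl[OF that(1)] that(2) by (simp add: bilin_def)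
 have l2: "lin (Ox y) (St (Sy j N) y) (St Z y) (?w y p)" if "y:pts X" "p:$(St (Sy i M) y)" for y p
  using bl[OF that(1)] that(2) by (simp add: bilin_def)
 show "lse Z U (%y. ?w y (sg y) (ta y))"
 proof (rule wd_cont[OF M Z _ _ sg, where psi="%y p. ?w y p (ta y)"])
  show "lin (Ox y) (St (Sy i M) y) (St Z y) (%p. ?w y p (ta y))" if "y:U" for y
   by (rule l1[OF op_pts[OF U that] lsec_carrier[OF wsh_presh[OF N] ta that]])
  fix V sgs assume V: "op V" "V <= U" and sgs: "length sgs = i" "!!sg. sg:set sgs ==> lse M V sg"
  have w: "map (%sg. sg y) sgs:words i (St M y)" if "y:V" for y
   using words_lsec[OF M _ that sgs(1)] sgs(2) by blast
  show "lse Z V (%y. ?w y (sw i M y (map (%sg. sg y) sgs)) (ta y))"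
  proof (rule wd_cont[OF N Z _ _ lsec_subset[OF wsh_presh[OF N] ta V]])
   show "lin (Ox y) (St (Sy j N) y) (St Z y) (?w y (sw i M y (map (%sg. sg y) sgs)))" if "y:V" for y
    by (rule l2[OF op_pts[OF V(1) that] wd_carrier[OF M op_pts[OF V(1) that] w[OF that]]])
   fix W tas assume W: "op W" "W <= V" and tas: "length tas = j" "!!ta. ta:set tas ==> lse N W ta"
   have sgsW: "!!sg. sg:set sgs ==> lse M W sg" using lsec_subset[OF M sgs(2) W] .
   have w': "map (%ta. ta y) tas:words j (St N y)" if "y:W" for y
    using words_lsec[OF N _ that tas(1)] tas(2) by blast
   show "lse Z W (%y. ?w y (sw i M y (map (%sg. sg y) sgs)) (sw j N y (map (%ta. ta y) tas)))"
   proof (rule lsec_cong[OF Z c[OF W(1) sgs(1) tas(1) sgsW tas(2)]])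
    fix y assume y: "y:W"
    then have yp: "y:pts X" "y:V" using op_pts[OF W(1)] W(2) by auto
    show "b y (map (%sg. sg y) sgs) (map (%ta. ta y) tas) = ?w y (sw i M y (map (%sg. sg y) sgs)) (sw j N y (map (%ta. ta y) tas))"
     by (rule wl2(2)[OF M N yp(1) stalk_module[OF Z yp(1)] b1[OF yp(1)] b2[OF yp(1)] w[OF yp(2)] w'[OF y], symmetric])
   qed
  qed
 qed
qed

subsection \<open>Multiplication\<close>

context
 fixes M :: "('x, 'r, 'm) mod_presheaf"
 assumes M: "mp M"
begin

definition smul where
 "smul i j y = wl2 i M j M (St (Sy (i + j) M) y) y (%l l'. sw (i + j) M y (l @ l'))"

lemma smul_sbil: "sbil (Sy i M) (Sy j M) (Sy (i + j) M) (smul i j)"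
 unfolding smul_def
proof (rule wl2_sbil[OF M M wsh_presh[OF M]])
 show "mlin True (Ox y) i (St M y) (St (Sy (i + j) M) y) (%l. sw (i + j) M y (l @ l'))"
  if "y:pts X" "l':words j (St M y)" for y l' by (rule mlin_append[OF wd_mlin[OF M that(1)] that(2)])
 show "mlin True (Ox y) j (St M y) (St (Sy (i + j) M) y) (%l'. sw (i + j) M y (l @ l'))"
  if "y:pts X" "l:words i (St M y)" for y l by (rule mlin_append2[OF wd_mlin[OF M that(1)] that(2)])
 fix V sgs tas assume V: "op V" and *: "length sgs = i" "length tas = j" "!!sg. sg:set sgs ==> lse M V sg" "!!ta. ta:set tas ==> lse M V ta"
 have "lse (Sy (i + j) M) V (%y. sw (i + j) M y (map (%sg. sg y) (sgs @ tas)))"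
  by (rule wd_lsec[OF M V]) (use * in auto)
 then show "lse (Sy (i + j) M) V (%y. sw (i + j) M y (map (%sg. sg y) sgs @ map (%ta. ta y) tas))" by simp
qed

lemma smul_sw:
 assumes "y:pts X" "l:words i (St M y)" "l':words j (St M y)"
 shows "smul i j y (sw i M y l) (sw j M y l') = sw (i + j) M y (l @ l')"
 unfolding smul_def
 by (rule wl2(2)[OF M M assms(1) wsh_module[OF M assms(1)] mlin_append[OF wd_mlin[OF M assms(1)]]
    mlin_append2[OF wd_mlin[OF M assms(1)]] assms(2,3)])

text \<open>The iterated product of a list of elements of the \<open>q\<close>-th symmetric power,
  starting from the empty word. Writing the degree as \<open>length ps * q\<close> makes
  \<open>q + length ps * q\<close> the same as \<open>Suc (length ps) * q\<close>, so the types of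
  degrees match in the recursion.\<close>

fun fl where
 "fl q y [] = sw 0 M y []"
| "fl q y (p # ps) = smul q (length ps * q) y p (fl q y ps)"

lemma fl_sw:
 assumes y: "y:pts X"
 shows "set ls <= words q (St M y) ==> fl q y (map (sw q M y) ls) = sw (length ls * q) M y (concat ls)"
proof (induction ls)
 case (Cons l ls)
 have "concat ls:words (length ls * q) (St M y)"
  using Cons.prems by (induction ls) (auto simp: words_def)
 then show ?case using Cons smul_sw[OF y, of l q "concat ls" "length ls * q"] by simp
qed simp

lemma fl_mlin:
 assumes y: "y:pts X"
 shows "mlin False (Ox y) m (St (Sy q M) y) (St (Sy (m * q) M) y) (fl q y)"
proof (induction m)
 case 0
 have "[]:words 0 (St M y)" by (simp add: words_def)
 then show ?case using wd_carrier[OF M y, of "[]" 0 True] by (intro mlinI) (auto simp: words_def)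
next
 case (Suc m)
 note B = bilinD[OF sbilD(1)[OF smul_sbil y]]
 have split: "EX p ps. l = p # ps & p:$(St (Sy q M) y) & ps:words m (St (Sy q M) y) & length ps = m"
  if "l:words (Suc m) (St (Sy q M) y)" for l
  using that by (cases l) (auto simp: words_def)
 note c = mlinD(1)[OF Suc.IH]
 have len: "length (ps[i := x]) = m" if "length ps = m" for ps i x using that by simp
 show ?case
 proof (rule mlinI)
  fix l assume "l:words (Suc m) (St (Sy q M) y)"
  from split[OF this] obtain p ps where l: "l = p # ps" "p:$(St (Sy q M) y)" "ps:words m (St (Sy q M) y)" "length ps = m"
   by blast
  show "fl q y l:$(St (Sy (Suc m * q) M) y)"
   using B(1)[OF l(2) c[OF l(3)]] l by simp
 next
  fix l i v w assume "l:words (Suc m) (St (Sy q M) y)" and i: "i < Suc m"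
   and v: "v:$(St (Sy q M) y)" and w: "w:$(St (Sy q M) y)"
  from split[OF this(1)] obtain p ps where l: "l = p # ps" "p:$(St (Sy q M) y)" "ps:words m (St (Sy q M) y)" "length ps = m"
   by blast
  show "fl q y (l[i := v +[St (Sy q M) y] w]) = fl q y (l[i := v]) +[St (Sy (Suc m * q) M) y] fl q y (l[i := w])"
  proof (cases i)
   case 0
   then show ?thesis using B(2)[OF v w c[OF l(3)]] l by simp
  next
   case (Suc k)
   then show ?thesis using i l B(3)[OF l(2) c[OF words_update[OF l(3) v]] c[OF words_update[OF l(3) w]]]
     mlinD(2)[OF Suc.IH l(3) _ v w] by simp
  qed
 next
  fix l i r v assume "l:words (Suc m) (St (Sy q M) y)" and i: "i < Suc m"
   and r: "r:$(Ox y)" and v: "v:$(St (Sy q M) y)"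
  from split[OF this(1)] obtain p ps where l: "l = p # ps" "p:$(St (Sy q M) y)" "ps:words m (St (Sy q M) y)" "length ps = m"
   by blast
  show "fl q y (l[i := r *.[St (Sy q M) y] v]) = r *.[St (Sy (Suc m * q) M) y] fl q y (l[i := v])"
  proof (cases i)
   case 0
   then show ?thesis using B(4)[OF r v c[OF l(3)]] l by simp
  next
   case (Suc k)
   then show ?thesis using i l B(5)[OF r l(2) c[OF words_update[OF l(3) v]]] mlinD(3)[OF Suc.IH l(3) _ r v] by simp
  qed
 qed simp
qed

end

end

section \<open>Permuting the letters of words\<close>

lemma permute_list_update:
 assumes pe: "pe permutes {..<length l}" and i: "i < length l"
 shows "permute_list pe (l[i := x]) = (permute_list pe l)[inv_into UNIV pe i := x]"
proof (rule nth_equalityI)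
 fix k assume "k < length (permute_list pe (l[i := x]))"
 then have k: "k < length l" by simp
 have pe': "pe permutes {..<length (l[i := x])}" using pe by simp
 have "pe k < length l" using permutes_in_image[OF pe, of k] k by simp
 moreover have "i = pe k <-> inv_into UNIV pe i = k" using permutes_inverses[OF pe] by metis
 ultimately show "permute_list pe (l[i := x]) ! k = (permute_list pe l)[inv_into UNIV pe i := x] ! k"
  using permute_list_nth[OF pe', of k] permute_list_nth[OF pe k] k by (auto simp: nth_list_update)
qed simp

lemma permute_list_words: "pe permutes {..<n} ==> l:words n M ==> permute_list pe l:words n M"
 by (auto simp: words_def)

lemma mlin_permute:
 assumes b: "mlin s R n M Z b" and pe: "pe permutes {..<n}"
 shows "mlin s R n M Z (%l. b (permute_list pe l))"
proof (rule mlinI)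
 note w = permute_list_words[OF pe]
 have inv: "i < n ==> inv_into UNIV pe i < n" for i using permutes_in_image[OF permutes_inv[OF pe], of i] by simp
 have up: "permute_list pe (l[i := x]) = (permute_list pe l)[inv_into UNIV pe i := x]" if "l:words n M" "i < n" for l i x
  using permute_list_update[of pe l i x] pe that by (simp add: words_def)
 show "b (permute_list pe l):$Z" if "l:words n M" for l using mlinD(1)[OF b w[OF that]] .
 show "b (permute_list pe (l[i := x +[M] y])) = b (permute_list pe (l[i := x])) +[Z] b (permute_list pe (l[i := y]))"
  if "l:words n M" "i < n" "x:$M" "y:$M" for l i x y
  unfolding up[OF that(1,2)] by (rule mlinD(2)[OF b w[OF that(1)] inv[OF that(2)] that(3,4)])
 show "b (permute_list pe (l[i := r *.[M] x])) = r *.[Z] b (permute_list pe (l[i := x]))"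
  if "l:words n M" "i < n" "r:$R" "x:$M" for l i r x
  unfolding up[OF that(1,2)] by (rule mlinD(3)[OF b w[OF that(1)] inv[OF that(2)] that(3,4)])
 show "b (permute_list pe l) = b (permute_list pe l')" if "s" "l:words n M" "l':words n M" "mset l = mset l'" for l l'
  by (rule mlinD(4)[OF b that(1) w[OF that(2)] w[OF that(3)]]) (use that pe in "simp add: words_def")
qed

lemma mlin_symI:
 assumes b: "mlin False R n M Z b" and s: "!!pe l. pe permutes {..<n} ==> l:words n M ==> b (permute_list pe l) = b l"
 shows "mlin True R n M Z b"
proof (rule mlinI)
 show "b l = b l'" if "l:words n M" "l':words n M" "mset l = mset l'" for l l'
 proof -
  from mset_eq_permutation[OF that(3)] obtain pe where "pe permutes {..<length l'}" "permute_list pe l' = l" by blast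
  then show ?thesis using s[of pe l'] that(2) by (auto simp: words_def)
 qed
qed (use mlinD[OF b] in auto)

lemma mlin_finsum:
 assumes Z: "module R Z" and A: "finite A" and b: "!!a. a:A ==> mlin s R n M Z (b a)"
 shows "mlin False R n M Z (%l. finsum Z (%a. b a l) A)"
proof -
 interpret Z: module R Z by fact
 have c: "l:words n M ==> (%a. b a l):A -> $Z" for l using mlinD(1)[OF b] by blast
 show ?thesis
 proof (rule mlinI)
  show "finsum Z (%a. b a l) A:$Z" if "l:words n M" for l by (rule Z.M.finsum_closed[OF c[OF that]])
  show "finsum Z (%a. b a (l[i := x +[M] y])) A = finsum Z (%a. b a (l[i := x])) A +[Z] finsum Z (%a. b a (l[i := y])) A"
   if "l:words n M" "i < n" "x:$M" "y:$M" for l i x y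
  proof -
   have w: "l[i := x]:words n M" "l[i := y]:words n M" using words_update[OF that(1)] that(3,4) by blast+
   have "finsum Z (%a. b a (l[i := x +[M] y])) A = finsum Z (%a. b a (l[i := x]) +[Z] b a (l[i := y])) A"
    by (rule Z.M.finsum_cong') (use c[OF w(1)] c[OF w(2)] mlinD(2)[OF b that] in auto)
   then show ?thesis using Z.M.finsum_addf[OF c[OF w(1)] c[OF w(2)]] by simp
  qed
  show "finsum Z (%a. b a (l[i := r *.[M] x])) A = r *.[Z] finsum Z (%a. b a (l[i := x])) A"
   if "l:words n M" "i < n" "r:$R" "x:$M" for l i r x
  proof -
   have w: "l[i := x]:words n M" using words_update[OF that(1,4)] .
   have "finsum Z (%a. b a (l[i := r *.[M] x])) A = finsum Z (%a. r *.[Z] b a (l[i := x])) A"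
    by (rule Z.M.finsum_cong') (use c[OF w] that(3) mlinD(3)[OF b that] in auto)
   then show ?thesis using Z.finsum_smult_ldistr[OF A that(3) c[OF w]] by simp
  qed
 qed simp
qed

lemma finsum_permute:
 assumes Z: "abelian_group Z" and F: "F:A -> $Z" and h: "bij_betw h A A"
 shows "finsum Z (%a. F (h a)) A = finsum Z F A"
proof -
 interpret abelian_group Z by fact
 show ?thesis using finsum_reindex[of F h A] F h by (simp add: bij_betw_def)
qed

lemma permutations_bij:
 assumes "q permutes S"
 shows "bij_betw (%p. q \<circ> p) {p. p permutes S} {p. p permutes S}" "bij_betw (%p. p \<circ> q) {p. p permutes S} {p. p permutes S}"
proof -
 have "inj_on (%p. q \<circ> p) {p. p permutes S}"
  using permutes_inv_o(2)[OF assms] by (intro inj_on_inverseI[of _ "%p. inv_into UNIV q \<circ> p"]) (simp add: o_assoc)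
 then show "bij_betw (%p. q \<circ> p) {p. p permutes S} {p. p permutes S}"
  using image_compose_permutations_left[OF assms] by (auto simp: bij_betw_def)
 have "inj_on (%p. p \<circ> q) {p. p permutes S}"
  using permutes_inv_o(1)[OF assms] by (intro inj_on_inverseI[of _ "%p. p \<circ> inv_into UNIV q"]) (simp add: o_assoc[symmetric])
 then show "bij_betw (%p. p \<circ> q) {p. p permutes S} {p. p permutes S}"
  using image_compose_permutations_right[OF assms] by (auto simp: bij_betw_def)
qed

lemma map2_permute:
 assumes "pe permutes {..<n}" "length l = n" "length k = n"
 shows "map2 f (permute_list pe l) (permute_list pe k) = permute_list pe (map2 f l k)"
proof -
 have "pe permutes {..<length (zip l k)}" using assms by simp
 note m = permute_list_map[OF this, of "%(x, y). f x y"]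
 have "permute_list pe (zip l k) = zip (permute_list pe l) (permute_list pe k)"
  by (rule permute_list_zip[OF assms(1)]) (simp_all add: assms)
 with m show ?thesis by (simp only:)
qed

lemma map2_words:
 assumes "bilin R M N Z f" "l:words n M" "k:words n N"
 shows "map2 f l k:words n Z"
proof -
 have "f x y:$Z" if "(x, y):set (zip l k)" for x y
 proof -
  from that have "x:set l" "y:set k" by (auto dest: set_zip_leftD set_zip_rightD)
  then show ?thesis using bilinD(1)[OF assms(1)] assms(2,3) by (auto simp: words_def)
 qed
 then show ?thesis using assms(2,3) by (auto simp: words_def)
qed

lemma map2_update1: "length k = length l ==> i < length l ==> map2 f (l[i := x]) k = (map2 f l k)[i := f x (k ! i)]"
 by (rule nth_equalityI) (auto simp: nth_list_update)

lemma map2_update2: "length k = length l ==> i < length l ==> map2 f l (k[i := x]) = (map2 f l k)[i := f (l ! i) x]"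
 by (rule nth_equalityI) (auto simp: nth_list_update)

lemma mlin_map2:
 assumes b: "mlin s R n Z Y b" and f: "bilin R M N Z f"
 shows "k:words n N ==> mlin False R n M Y (%l. b (map2 f l k))"
  and "l:words n M ==> mlin False R n N Y (%k. b (map2 f l k))"
proof -
 note B = bilinD[OF f] and w = map2_words[OF f]
 have kc: "k ! i:$N" if "k:words n N" "i < n" for k i using that by (auto simp: words_def)
 have lc: "l ! i:$M" if "l:words n M" "i < n" for l i using that by (auto simp: words_def)
 have len: "l:words n M ==> length l = n" "k:words n N ==> length k = n" for l k by (auto simp: words_def)
 show "mlin False R n M Y (%l. b (map2 f l k))" if k: "k:words n N"
 proof (rule mlinI)
  show "b (map2 f l k):$Y" if "l:words n M" for l using mlinD(1)[OF b w[OF that k]] .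
  show "b (map2 f (l[i := x +[M] y]) k) = b (map2 f (l[i := x]) k) +[Y] b (map2 f (l[i := y]) k)"
   if "l:words n M" "i < n" "x:$M" "y:$M" for l i x y
   using that k len by (simp add: map2_update1 B kc mlinD(2)[OF b w])
  show "b (map2 f (l[i := r *.[M] x]) k) = r *.[Y] b (map2 f (l[i := x]) k)"
   if "l:words n M" "i < n" "r:$R" "x:$M" for l i r x
   using that k len by (simp add: map2_update1 B kc mlinD(3)[OF b w])
 qed simp
 show "mlin False R n N Y (%k. b (map2 f l k))" if l: "l:words n M"
 proof (rule mlinI)
  show "b (map2 f l k):$Y" if "k:words n N" for k using mlinD(1)[OF b w[OF l that]] .
  show "b (map2 f l (k[i := x +[N] y])) = b (map2 f l (k[i := x])) +[Y] b (map2 f l (k[i := y]))"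
   if "k:words n N" "i < n" "x:$N" "y:$N" for k i x y
   using that l len by (simp add: map2_update2 B lc mlinD(2)[OF b w])
  show "b (map2 f l (k[i := r *.[N] x])) = r *.[Y] b (map2 f l (k[i := x]))"
   if "k:words n N" "i < n" "r:$R" "x:$N" for k i r x
   using that l len by (simp add: map2_update2 B lc mlinD(3)[OF b w])
 qed simp
qed

lemma set_subset_imageE:
 assumes "set k <= f ` A"
 obtains ls where "k = map f ls" "set ls <= A"
proof -
 have "EX ls. k = map f ls & set ls <= A" using assms
 proof (induction k)
  case (Cons x k)
  then obtain ls a where "k = map f ls" "set ls <= A" "x = f a" "a:A" by auto
  then show ?case by (intro exI[of _ "a # ls"]) simp
 qed simp
 then show thesis using that by blast
qed

lemma mset_concat_cong:
 assumes "mset xs = mset ys"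
 shows "mset (concat xs) = mset (concat ys)"
proof -
 have "mset (concat zs) = sum_mset (image_mset mset (mset zs))" for zs :: "'a list list"
  by (induction zs) auto
 then show ?thesis using assms by simp
qed

context lrs
begin

context
 fixes M :: "('x, 'r, 'm) mod_presheaf"
 assumes M: "mp M"
begin

text \<open>By multilinearity, symmetry has to be checked only for lists of word classes. There the
  product is the class of a concatenation, and permuting the pieces does not change the multiset of
  letters.\<close>

lemma fl_sym_mlin:
 assumes y: "y:pts X"
 shows "mlin True (Ox y) m (St (Sy q M) y) (St (Sy (m * q) M) y) (fl M q y)"
proof (rule mlin_symI[OF fl_mlin[OF M y]])
 fix pe l assume pe: "pe permutes {..<m}" and l: "l:words m (St (Sy q M) y)"
 show "fl M q y (permute_list pe l) = fl M q y l"
 proof (rule mlin_eq_on_span[OF mlin_permute[OF fl_mlin[OF M y] pe] fl_mlin[OF M y] wsh_module[OF M y] wsh_module[OF M y]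
    wd_image[OF M y] wd_span[OF M y] _ l])
  fix k assume k: "k:words m (St (Sy q M) y)" "set k <= sw q M y ` words q (St M y)"
  from set_subset_imageE[OF k(2)] obtain ls where ls: "k = map (sw q M y) ls" "set ls <= words q (St M y)" by metis
  have len: "length ls = m" using k ls by (simp add: words_def)
  have pe': "pe permutes {..<length ls}" using pe len by simp
  have pls: "set (permute_list pe ls) <= words q (St M y)" using ls(2) pe' by simp
  have cw: "concat ks:words (m * q) (St M y)" if "set ks <= words q (St M y)" "length ks = m" for ks
   using that by (induction ks arbitrary: m) (auto simp: words_def)
  have "mset (concat (permute_list pe ls)) = mset (concat ls)"
   by (rule mset_concat_cong[OF mset_permute_list[OF pe']])
  then have "sw (m * q) M y (concat (permute_list pe ls)) = sw (m * q) M y (concat ls)"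
   by (intro mlinD(4)[OF wd_mlin[OF M y] TrueI cw cw]) (use pls ls len in simp_all)
  then show "fl M q y (permute_list pe k) = fl M q y k"
   unfolding ls(1) permute_list_map[OF pe'] fl_sw[OF M y pls] fl_sw[OF M y ls(2)] by (simp add: len)
 qed
qed

text \<open>The multiplication map from S^m S^q to S^(m q). It passes from the iterated powers in
  the base loci to the single powers in which degrees can be added.\<close>

definition sflat where
 "sflat m q y = wl (Sy q M) True m (St (Sy (m * q) M) y) y (fl M q y)"

lemma fl_lsec:
 assumes V: "op V"
 shows "(ALL sg:set sgs. lse (Sy q M) V sg) ==> lse (Sy (length sgs * q) M) V (%y. fl M q y (map (%sg. sg y) sgs))"
proof (induction sgs)
 case Nil
 show ?case using wd_lsec[OF M V, of "[]" 0 True] by (simp add: fl.simps[OF M])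
next
 case (Cons sg sgs)
 then show ?case using sbilD(2)[OF smul_sbil[OF M], of q V sg "length sgs * q"] by (simp add: fl.simps[OF M])
qed

lemma sflat_smor: "smor (Sy m (Sy q M)) (Sy (m * q) M) (sflat m q)"
 unfolding sflat_def
 by (rule wl_smor[OF wsh_presh[OF M] wsh_presh[OF M] fl_sym_mlin]) (use fl_lsec in blast)+

text \<open>A word of length \<open>m * q\<close> can be cut into \<open>m\<close> words of length
  \<open>q\<close>, and word classes generate.\<close>

lemma sflat_surj:
 assumes y: "y:pts X"
 shows "sflat m q y ` $(St (Sy m (Sy q M)) y) = $(St (Sy (m * q) M) y)"
proof
 note f = smorD(1)[OF sflat_smor y, of m q]
 note S = wsh_presh[OF M]
 show "sflat m q y ` $(St (Sy m (Sy q M)) y) <= $(St (Sy (m * q) M) y)"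
  using slinD(1)[OF f] by blast
 have sub: "submodule (sflat m q y ` $(St (Sy m (Sy q M)) y)) (Ox y) (St (Sy (m * q) M) y)"
  by (rule submodule_image[OF f wsh_module[OF S y] wsh_module[OF M y] module.carrier_is_submodule[OF wsh_module[OF S y]]])
 have "sw (m * q) M y l:sflat m q y ` $(St (Sy m (Sy q M)) y)" if l: "l:words (m * q) (St M y)" for l
 proof -
  from words_chunks[OF l] obtain ls where ls: "length ls = m" "set ls <= words q (St M y)" "l = concat ls" by blast
  have w: "map (sw q M y) ls:words m (St (Sy q M) y)" using ls wd_carrier[OF M y] by (auto simp: words_def)
  have "sflat m q y (sw m (Sy q M) y (map (sw q M y) ls)) = sw (m * q) M y l"
   unfolding sflat_def wl(2)[OF S y wsh_module[OF M y] fl_sym_mlin[OF y] w] fl_sw[OF M y ls(2)] by (simp add: ls)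
  then show ?thesis using wd_carrier[OF S y w] by (metis imageI)
 qed
 then show "$(St (Sy (m * q) M) y) <= sflat m q y ` $(St (Sy m (Sy q M)) y)"
  unfolding wd_span[OF M y, symmetric] by (intro span_least[OF sub]) blast
qed

end

subsection \<open>The polarized product\<close>

context
 fixes M :: "('x, 'r, 'm) mod_presheaf" and N :: "('x, 'r, 'n) mod_presheaf" and Z :: "('x, 'r, 'z) mod_presheaf"
  and be :: "'x => ('x, 'm) germ => ('x, 'n) germ => ('x, 'z) germ"
 assumes M: "mp M" and N: "mp N" and Z: "mp Z" and be: "sbil M N Z be"
begin

text \<open>The polarized product: all ways of pairing the letters of \<open>l\<close> with those of
  \<open>k\<close> are summed. Permuting only \<open>k\<close> meets every pairing once, since the
  order of the pairs is immaterial in a symmetric power. No division by the factorial is made here,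
  so the map exists over every ring.\<close>

definition pb where
 "pb j y l k = finsum (St (Sy j Z) y) (%pe. sw j Z y (map2 (be y) l (permute_list pe k))) {pe. pe permutes {..<j}}"

lemma pb_mlin:
 assumes y: "y:pts X"
 shows "k:words j (St N y) ==> mlin True (Ox y) j (St M y) (St (Sy j Z) y) (%l. pb j y l k)"
  and "l:words j (St M y) ==> mlin True (Ox y) j (St N y) (St (Sy j Z) y) (pb j y l)"
proof -
 note Zy = wsh_module[OF Z y] and B = sbilD(1)[OF be y]
 note sm = wd_mlin[OF Z y]
 have fin: "finite {pe. pe permutes {..<j}}" by (simp add: finite_permutations)
 have len: "l:words j (St M y) ==> length l = j" "k:words j (St N y) ==> length k = j" for l k
  by (auto simp: words_def)
 have F: "(%pe. sw j Z y (map2 (be y) l (permute_list pe k))):{pe. pe permutes {..<j}} -> $(St (Sy j Z) y)"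
  if "l:words j (St M y)" "k:words j (St N y)" for l k
  using wd_carrier[OF Z y map2_words[OF B that(1) permute_list_words[OF _ that(2)]]] by blast
 note ag = module_groups(1)[OF Zy]
 show "mlin True (Ox y) j (St M y) (St (Sy j Z) y) (%l. pb j y l k)" if k: "k:words j (St N y)"
 proof (rule mlin_symI)
  show "mlin False (Ox y) j (St M y) (St (Sy j Z) y) (%l. pb j y l k)"
   unfolding pb_def by (rule mlin_finsum[OF Zy fin mlin_map2(1)[OF sm B permute_list_words[OF _ k]]]) simp
  fix rh l assume rh: "rh permutes {..<j}" and l: "l:words j (St M y)"
  \<comment> \<open>Permuting both words simultaneously only permutes the pairs and leaves the class
    unchanged. A permutation of \<open>l\<close> is therefore the inverse permutation of
    \<open>k\<close>, which is absorbed by reindexing the sum.\<close>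
  have "sw j Z y (map2 (be y) (permute_list rh l) (permute_list pe k)) = sw j Z y (map2 (be y) l (permute_list (pe \<circ> inv_into UNIV rh) k))"
   if pe: "pe permutes {..<j}" for pe
  proof -
   have pe': "pe \<circ> inv_into UNIV rh permutes {..<j}" by (rule permutes_compose[OF permutes_inv[OF rh] pe])
   have "permute_list pe k = permute_list rh (permute_list (pe \<circ> inv_into UNIV rh) k)"
    using permute_list_compose[of rh k "pe \<circ> inv_into UNIV rh"] rh len(2)[OF k] permutes_inv_o(2)[OF rh] by (simp add: comp_assoc)
   then have e: "map2 (be y) (permute_list rh l) (permute_list pe k) = permute_list rh (map2 (be y) l (permute_list (pe \<circ> inv_into UNIV rh) k))"
    using map2_permute[OF rh len(1)[OF l], of "permute_list (pe \<circ> inv_into UNIV rh) k" "be y"] len(2)[OF k] by simp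
   have w: "map2 (be y) l (permute_list (pe \<circ> inv_into UNIV rh) k):words j (St Z y)"
    by (rule map2_words[OF B l permute_list_words[OF pe' k]])
   then have rh': "rh permutes {..<length (map2 (be y) l (permute_list (pe \<circ> inv_into UNIV rh) k))}" using rh by (simp add: words_def)
   show ?thesis unfolding e
    by (rule mlinD(4)[OF sm TrueI permute_list_words[OF rh w] w mset_permute_list[OF rh']])
  qed
  then have "pb j y (permute_list rh l) k = finsum (St (Sy j Z) y) (%pe. sw j Z y (map2 (be y) l (permute_list (pe \<circ> inv_into UNIV rh) k))) {pe. pe permutes {..<j}}"
   unfolding pb_def by (intro abelian_monoid.finsum_cong'[OF abelian_group.axioms(1)[OF ag]])
    (use wd_carrier[OF Z y map2_words[OF B l permute_list_words[OF permutes_compose[OF permutes_inv[OF rh]] k]]] in auto)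
  also have "\<dots> = pb j y l k"
   unfolding pb_def by (rule finsum_permute[OF ag F[OF l k] permutations_bij(2)[OF permutes_inv[OF rh]]])
  finally show "pb j y (permute_list rh l) k = pb j y l k" .
 qed
 show "mlin True (Ox y) j (St N y) (St (Sy j Z) y) (pb j y l)" if l: "l:words j (St M y)"
 proof (rule mlin_symI)
  show "mlin False (Ox y) j (St N y) (St (Sy j Z) y) (pb j y l)"
   unfolding pb_def[abs_def] by (rule mlin_finsum[OF Zy fin mlin_permute[OF mlin_map2(2)[OF sm B l]]]) simp
  fix rh k assume rh: "rh permutes {..<j}" and k: "k:words j (St N y)"
  have "permute_list pe (permute_list rh k) = permute_list (rh \<circ> pe) k" if "pe permutes {..<j}" for pe
   using permute_list_compose[of pe k rh] that len(2)[OF k] by simp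
  then have "pb j y l (permute_list rh k) = finsum (St (Sy j Z) y) (%pe. sw j Z y (map2 (be y) l (permute_list (rh \<circ> pe) k))) {pe. pe permutes {..<j}}"
   unfolding pb_def by (intro abelian_monoid.finsum_cong'[OF abelian_group.axioms(1)[OF ag]])
    (use wd_carrier[OF Z y map2_words[OF B l permute_list_words[OF permutes_compose[OF _ rh] k]]] in auto)
  also have "\<dots> = pb j y l k"
   unfolding pb_def by (rule finsum_permute[OF ag F[OF l k] permutations_bij(1)[OF rh]])
  finally show "pb j y l (permute_list rh k) = pb j y l k" .
 qed
qed

lemma pb_lsec:
 assumes V: "op V" and l: "length sgs = j" "length tas = j" and sgs: "!!sg. sg:set sgs ==> lse M V sg" and tas: "!!ta. ta:set tas ==> lse N V ta"
 shows "lse (Sy j Z) V (%y. pb j y (map (%sg. sg y) sgs) (map (%ta. ta y) tas))"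
 unfolding pb_def
proof (rule lsec_finsum[OF wsh_presh[OF Z] V])
 fix pe assume "pe:{pe. pe permutes {..<j}}"
 then have pe: "pe permutes {..<length tas}" using l by simp
 have "lse (Sy j Z) V (%y. sw j Z y (map (%rh. rh y) (map2 (%sg ta y. be y (sg y) (ta y)) sgs (permute_list pe tas))))"
 proof (rule wd_lsec[OF Z V])
  fix rh assume "rh:set (map2 (%sg ta y. be y (sg y) (ta y)) sgs (permute_list pe tas))"
  then obtain sg ta where "(sg, ta):set (zip sgs (permute_list pe tas))" "rh = (%y. be y (sg y) (ta y))" by auto
  moreover from this(1) have "sg:set sgs" "ta:set (permute_list pe tas)" by (auto dest: set_zip_leftD set_zip_rightD)
  ultimately show "lse Z V rh" using sbilD(2)[OF be sgs tas] pe by simp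
 qed (use l in simp)
 moreover have "map (%rh. rh y) (map2 (%sg ta y. be y (sg y) (ta y)) sgs (permute_list pe tas)) =
   map2 (be y) (map (%sg. sg y) sgs) (permute_list pe (map (%ta. ta y) tas))" for y
  unfolding permute_list_map[OF pe] by (rule nth_equalityI) auto
 ultimately show "lse (Sy j Z) V (%y. sw j Z y (map2 (be y) (map (%sg. sg y) sgs) (permute_list pe (map (%ta. ta y) tas))))" by simp
qed (simp add: finite_permutations)

definition sperm where
 "sperm j y = wl2 j M j N (St (Sy j Z) y) y (pb j y)"

lemma sperm_sbil: "sbil (Sy j M) (Sy j N) (Sy j Z) (sperm j)"
 unfolding sperm_def by (rule wl2_sbil[OF M N wsh_presh[OF Z] pb_mlin pb_lsec])

text \<open>For two constant words every pairing yields the same word, and there are j! pairings.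
  This is the origin of the factorials that have to be inverted.\<close>

lemma sperm_replicate:
 assumes y: "y:pts X" and a: "a:$(St M y)" and b: "b:$(St N y)"
 shows "sperm j y (sw j M y (replicate j a)) (sw j N y (replicate j b)) =
  add_pow (St (Sy j Z) y) (fact j :: nat) (sw j Z y (replicate j (be y a b)))"
proof -
 interpret S: module "Ox y" "St (Sy j Z) y" by (rule wsh_module[OF Z y])
 have w: "replicate j a:words j (St M y)" "replicate j b:words j (St N y)"
  using a b by (auto simp: words_def)
 have c: "sw j Z y (replicate j (be y a b)):$(St (Sy j Z) y)"
  by (rule wd_carrier[OF Z y]) (use bilinD(1)[OF sbilD(1)[OF be y] a b] in "auto simp: words_def")
 have e: "map2 (be y) (replicate j a) (permute_list pe (replicate j b)) = replicate j (be y a b)" if "pe permutes {..<j}" for pe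
  using that permute_list_nth[of pe "replicate j b"] permutes_in_image[OF that] by (intro nth_equalityI) auto
 have "sperm j y (sw j M y (replicate j a)) (sw j N y (replicate j b)) = pb j y (replicate j a) (replicate j b)"
  unfolding sperm_def by (rule wl2(2)[OF M N y S.module_axioms pb_mlin[OF y] w])
 also have "\<dots> = finsum (St (Sy j Z) y) (%pe. sw j Z y (replicate j (be y a b))) {pe. pe permutes {..<j}}"
  unfolding pb_def by (rule S.M.finsum_cong') (use c e in auto)
 also have "\<dots> = add_pow (St (Sy j Z) y) (fact j :: nat) (sw j Z y (replicate j (be y a b)))"
  using S.M.add.finprod_const[OF c, of "{pe. pe permutes {..<j}}"] card_permutations[of "{..<j}" j] by simp
 finally show ?thesis .
qed

end

end

section \<open>Fibres\<close>

lemma span_image_iff: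
 assumes f: "lin R M N f" and M: "module R M" and N: "module R N" and surj: "f ` $M = $N" and S: "S <= $M"
 shows "module_span R N (f ` S) = f ` module_span R M S"
proof
 have fS: "f ` S <= $N" using S surj by blast
 show "module_span R N (f ` S) <= f ` module_span R M S"
  by (rule span_least[OF submodule_image[OF f M N span_submodule[OF M S]]]) (use span_superset[of S R M] in blast)
 have "f x:module_span R N (f ` S)" if "x:module_span R M S" for x
  by (rule slin_span[OF f M N _ span_submodule[OF N fS] S _ that]) (simp_all add: span_incl)
 then show "f ` module_span R M S <= module_span R N (f ` S)" by blast
qed

lemma residue_field_module_simps:
 "$(residue_field_module R) = {max_ideal R +>\<^bsub>R\<^esub> r | r. r:$R}"
 "1[residue_field_module R] = max_ideal R +>\<^bsub>R\<^esub> 1[R]" "0[residue_field_module R] = max_ideal R"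
 "add (residue_field_module R) = add (R Quot max_ideal R)" "$(residue_field_module R) = $(R Quot max_ideal R)"
 "r *.[residue_field_module R] C = (max_ideal R +>\<^bsub>R\<^esub> r) *[R Quot max_ideal R] C"
 "0[residue_field_module R] = 0[R Quot max_ideal R]" "1[residue_field_module R] = 1[R Quot max_ideal R]"
 by (auto simp: residue_field_module_def Let_def FactRing_def A_RCOSETS_def')

text \<open>The fibre is the quotient of \<open>M\<close> by the maximal ideal times
  \<open>M\<close>. The map \<open>ta\<close>, sending \<open>v\<close> to the tensor of
  \<open>v\<close> with 1, is onto because a residue class acts through a representative, and it
  kills multiples by the maximal ideal; so the span in the fibre is the image of the span in
  \<open>M\<close> with these multiples added.\<close>

lemma fiber_span_iff:
 fixes R :: "'r ring" and M :: "('r, 'm) module"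
 assumes R: "cring R" and I: "ideal (max_ideal R) R" and M: "module R M" and S: "S <= $M"
 defines "K \<equiv> residue_field_module R"
 defines "T \<equiv> tensor_module R M K"
 shows "module_span R T ((%s. pure_tensor R M K s 1[K]) ` S) = $T <->
  module_span R M ({mu *.[M] v | mu v. mu:max_ideal R & v:$M} Un S) = $M"
  (is "?L <-> module_span R M ?G = $M")
proof -
 let ?I = "max_ideal R"
 interpret R: cring R by fact
 interpret I: ideal ?I R by fact
 interpret M: module R M by fact
 interpret Q: cring "R Quot ?I" by (rule I.quotient_is_cring[OF R])
 interpret h: ring_hom_cring R "R Quot ?I" "(+>\<^bsub>R\<^esub>) ?I" by (rule I.rcos_ring_hom_cring[OF R])
 note Kc = residue_field_module_simps(1-5)[of R, folded K_def] and Ks = residue_field_module_simps(6)[of R, folded K_def]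
  and Kz = residue_field_module_simps(7,8)[of R, folded K_def]
 have Kab: "abelian_group K"
  by (rule abelian_groupI) (use Q.l_neg Q.a_inv_closed in "auto simp: Kc(4,5) Kz Q.a_ac")
 have K: "module R K"
  by (rule moduleI[OF R Kab]) (simp_all add: Kc(4,5) Ks Q.l_distr Q.r_distr Q.m_assoc)
 have smK: "r *.[K] (?I +>\<^bsub>R\<^esub> s) = ?I +>\<^bsub>R\<^esub> (r *[R] s)" if "r:$R" "s:$R" for r s
  using that by (simp add: Ks)
 have oneK: "1[K]:$K" by (simp add: Kc(5) Kz)
 let ?B = "$M \<times> $K"
 let ?pt = "pure_tensor R M K"
 have Te: "T = presented_module R ?B (trels R M K)" and pt: "?pt a b = presented_gen R ?B (trels R M K) (a, b)" for a b
  unfolding T_def tensor_module_def pure_tensor_def tensor_rels_eq by auto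
 note rc = relset_carrier[OF R tT_subset[OF M K] empty_subsetI]
 have T: "module R T" unfolding Te by (rule presented_module[OF R rc])
 have ptc: "?pt a b:$T" if "a:$M" "b:$K" for a b
  unfolding Te pt by (rule pgen_carrier[OF R rc]) (use that in simp)
 have "(%x. presented_gen R ?B (trels R M K) x) = (%(a, b). ?pt a b)" by (simp add: fun_eq_iff pt)
 have lx: "lext R T (%r. r) (%(a, b). ?pt a b) rh = 0[T]" if rh: "rh:trels R M K" for rh
 proof -
  have w: "(%(a, b). ?pt a b):?B -> $T" using ptc by auto
  have "pclass R ?B (trels R M K) rh = lext R T (%r. r) (%(a, b). ?pt a b) rh"
   by (rule free_ext_unique[OF R T id_ring_hom[OF R] w])
    (use pclass_lin[OF R rc] rh rc in "auto simp: Te pgen_class[OF R rc] pt")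
  then show ?thesis using pclass_rel[OF R rc span_incl[OF rh]] by (simp add: Te)
 qed
 have bl: "bilin R M K T ?pt"
  by (rule iffD1[OF trels_bilin[OF M K T, of ?pt]]) (use ptc lx in simp_all)
 note B = bilinD[OF bl]
 define ta where "ta v = ?pt v 1[K]" for v
 have ta: "lin R M T ta" unfolding ta_def using bl oneK by (simp add: bilin_def)
 have ptr: "?pt v (?I +>\<^bsub>R\<^esub> r) = ta (r *.[M] v)" if "v:$M" "r:$R" for v r
 proof -
  have "?I +>\<^bsub>R\<^esub> r = r *.[K] 1[K]" using smK[of r "1[R]"] that Kc(2) by simp
  then show ?thesis unfolding ta_def using B(4,5) that oneK by simp
 qed
 have img: "ta ` $M = $T"
 proof
  show "ta ` $M <= $T" using slinD(1)[OF ta] by blast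
  have "presented_gen R ?B (trels R M K) ` ?B <= ta ` $M"
  proof (intro image_subsetI)
   fix x assume "x:?B"
   then obtain v r where x: "x = (v, ?I +>\<^bsub>R\<^esub> r)" "v:$M" "r:$R" using Kc(1) by auto
   have "presented_gen R ?B (trels R M K) x = ta (r *.[M] v)" unfolding x(1) pt[symmetric] by (rule ptr[OF x(2,3)])
   then show "presented_gen R ?B (trels R M K) x:ta ` $M" using x by simp
  qed
  then show "$T <= ta ` $M"
   using span_least[OF submodule_image[OF ta M T M.carrier_is_submodule]] pgen_span[OF R rc] unfolding Te by blast
 qed
 have taI: "ta (mu *.[M] v) = 0[T]" if "mu:?I" "v:$M" for mu v
 proof -
  interpret T: module R T by (rule T)
  have mu: "mu:$R" using that(1) I.a_subset by blast
  have "0[K] = ?I +>\<^bsub>R\<^esub> mu" using I.a_rcos_const[OF that(1)] Kc(3) by simp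
  then have "ta (mu *.[M] v) = ?pt v (0[R] *.[K] 1[K])"
   using ptr[OF that(2) mu] module.smult_l_null[OF K oneK] by simp
  also have "\<dots> = 0[T]" using B(5)[of "0[R]" v "1[K]"] that oneK ptc by simp
  finally show ?thesis .
 qed
 have Gc: "?G <= $M" using S I.a_subset by auto
 have "module_span R T (ta ` S) = module_span R T (ta ` ?G)"
 proof
  show "module_span R T (ta ` S) <= module_span R T (ta ` ?G)" by (rule span_mono) blast
  have sub: "submodule (module_span R T (ta ` S)) R T"
   using span_submodule[OF T, of "ta ` S"] S img by blast
  have "ta g:module_span R T (ta ` S)" if "g:?G" for g
   using that
  proof
   assume "g:S" then show ?thesis by (simp add: span_incl)
  next
   assume "g:{mu *.[M] v | mu v. mu:?I & v:$M}"
   then show ?thesis using taI submoduleD(2)[OF T sub] by auto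
  qed
  then show "module_span R T (ta ` ?G) <= module_span R T (ta ` S)" by (intro span_least[OF sub]) blast
 qed
 also have "\<dots> = ta ` module_span R M ?G" by (rule span_image_iff[OF ta M T img Gc])
 finally have eq: "module_span R T ((%s. ?pt s 1[K]) ` S) = ta ` module_span R M ?G" unfolding ta_def .
 let ?N = "module_span R M ?G"
 have N: "submodule ?N R M" by (rule span_submodule[OF M Gc])
 note q = quot_module[OF M N] and qa = quot_add[OF M N] and qs = quot_smult[OF M N]
 \<comment> \<open>Modulo \<open>?N\<close> the map \<open>ta\<close> has a left inverse: the
   pairing of \<open>v\<close> and the class of \<open>r\<close> to the class of \<open>r v\<close>
   is well defined and bilinear, because \<open>?N\<close> contains the multiples by the maximal
   ideal. No description of the full kernel of \<open>ta\<close> is required.\<close>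
 have ker: "v:?N" if v: "v:$M" and vN: "ta v:ta ` ?N" for v
 proof -
  have well: "?N +>\<^bsub>M\<^esub> (r *.[M] v) = ?N +>\<^bsub>M\<^esub> (r' *.[M] v)"
   if "r:$R" "r':$R" "r -[R] r':?I" "v:$M" for r r' v
  proof -
   have "(r *.[M] v) -[M] (r' *.[M] v) = (r -[R] r') *.[M] v"
    using that by (simp add: a_minus_def M.smult_l_distr M.smult_l_minus)
   also have "\<dots>:?N" by (rule span_incl) (use that in blast)
   finally show ?thesis using quot_eq_iff[OF M N] that by simp
  qed
  define rep where "rep C = (SOME r. r:C)" for C :: "'r set"
  have rep: "rep (?I +>\<^bsub>R\<^esub> r):$R" "rep (?I +>\<^bsub>R\<^esub> r) -[R] r:?I" if "r:$R" for r
  proof -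
   have "rep (?I +>\<^bsub>R\<^esub> r):?I +>\<^bsub>R\<^esub> r" unfolding rep_def by (rule someI[of _ r]) (rule I.a_rcos_self[OF that])
   then show "rep (?I +>\<^bsub>R\<^esub> r):$R" "rep (?I +>\<^bsub>R\<^esub> r) -[R] r:?I"
    using I.a_elemrcos_carrier[OF that] I.a_rcos_module_minus[OF R.ring_axioms that] by blast+
  qed
  define b where "b v C = ?N +>\<^bsub>M\<^esub> (rep C *.[M] v)" for v C
  have b: "b v (?I +>\<^bsub>R\<^esub> r) = ?N +>\<^bsub>M\<^esub> (r *.[M] v)" if "r:$R" "v:$M" for r v
   unfolding b_def by (rule well[OF rep(1)[OF that(1)] that(1) rep(2)[OF that(1)] that(2)])
  have bb: "bilin R M K (quot_module M ?N) b"
  proof (rule bilinI)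
   fix x C assume x: "x:$M" and "C:$K"
   then obtain r where r: "C = ?I +>\<^bsub>R\<^esub> r" "r:$R" using Kc(1) by blast
   show "b x C:$(quot_module M ?N)" unfolding r(1) b[OF r(2) x] using x r by (auto simp: quot_carrier[OF M N])
   show "b (x +[M] x') C = b x C +[quot_module M ?N] b x' C" if "x':$M" for x'
    unfolding r(1) using x that r by (simp add: b qa M.smult_r_distr)
   show "b (s *.[M] x) C = s *.[quot_module M ?N] b x C" if "s:$R" for s
    unfolding r(1) using x that r by (simp add: b qs M.smult_assoc1[symmetric] R.m_comm)
   show "b x (s *.[K] C) = s *.[quot_module M ?N] b x C" if "s:$R" for s
    unfolding r(1) smK[OF that r(2)] b[OF R.m_closed[OF that r(2)] x] b[OF r(2) x]
    using x that r by (simp add: qs M.smult_assoc1)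
   fix C' assume "C':$K"
   then obtain s where s: "C' = ?I +>\<^bsub>R\<^esub> s" "s:$R" using Kc(1) by blast
   have "C +[K] C' = ?I +>\<^bsub>R\<^esub> (r +[R] s)" unfolding Kc(4) r s using r s by simp
   then show "b x (C +[K] C') = b x C +[quot_module M ?N] b x C'"
    using x r s b[OF R.a_closed[OF r(2) s(2)] x] b[OF r(2) x] b[OF s(2) x] by (simp only: qa M.smult_closed M.smult_l_distr)
  qed
  have w: "(%(x, y). b x y):?B -> $(quot_module M ?N)" using bilinD(1)[OF bb] by auto
  have z: "ALL rh:trels R M K. lext R (quot_module M ?N) (%r. r) (%(x, y). b x y) rh = 0[quot_module M ?N]"
   by (rule iffD2[OF trels_bilin[OF M K q bilinD(1)[OF bb]] bb])
  from presented_lift[OF R rc q id_ring_hom[OF R] w z[rule_format]] obtain psi where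
   psi: "lin R T (quot_module M ?N) psi" "!!x. x:?B ==> psi (presented_gen R ?B (trels R M K) x) = (%(x, y). b x y) x"
   unfolding Te by blast
  have psita: "psi (ta v) = ?N +>\<^bsub>M\<^esub> v" if "v:$M" for v
   using psi(2)[of "(v, 1[K])"] that oneK b[of "1[R]" v] by (simp add: ta_def pt Kc(2))
  from vN obtain n where n: "n:?N" "ta v = ta n" by blast
  have nc: "n:$M" using n(1) submoduleD(1)[OF M N] by blast
  have "?N +>\<^bsub>M\<^esub> v = ?N +>\<^bsub>M\<^esub> n" using psita[OF v] psita[OF nc] n(2) by simp
  then have "v -[M] n:?N" using quot_eq_iff[OF M N v nc] by simp
  then have "(v -[M] n) +[M] n:?N" by (rule submoduleD(3)[OF M N _ n(1)])
  then show ?thesis using v nc by (simp add: a_minus_def M.a_assoc M.l_neg)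
 qed
 show ?thesis
 proof
  assume ?L
  then have "ta ` ?N = $T" using eq by simp
  then have "$M <= ?N" using ker slinD(1)[OF ta] by blast
  then show "?N = $M" using submoduleD(1)[OF M N] by blast
 next
  assume "?N = $M"
  then show ?L using eq img by simp
 qed
qed

context lrs
begin

lemma stalk_maximal: "y:pts X ==> maximalideal (max_ideal (Ox y)) (Ox y)"
 using stalk_local[of y] theI'[of "%m. maximalideal m (Ox y)"] by (simp add: local_ring_def max_ideal_def)

lemma stalk_ideal: "y:pts X ==> ideal (max_ideal (Ox y)) (Ox y)"
 using stalk_maximal maximalideal.axioms(1) by blast

definition mprod where
 "mprod x M = {mu *.[M] v | mu v. mu:max_ideal (Ox x) & v:$M}"

lemma mprod_carrier: "x:pts X ==> module (Ox x) M ==> mprod x M <= $M"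
 using ideal.Icarr[OF stalk_ideal] module.smult_closed by (fastforce simp: mprod_def)

lemma Bs_iff:
 assumes V: "mp V" and x: "x:pts X"
 shows "x \<notin> Bs X V <-> module_span (Ox x) (St V x)
  (mprod x (St V x) Un mg V x (pts X) ` $(msec V (pts X))) = $(St V x)"
proof -
 have S: "mg V x (pts X) ` $(msec V (pts X)) <= $(St V x)"
  using mgerm_op(1)[OF V _ x] by auto
 show ?thesis
  using fiber_span_iff[OF stalk_cring[OF x] stalk_ideal[OF x] stalk_module[OF V x] S] x
  by (simp add: Bs_def fiber_def fiber_eval_def[abs_def] image_image mprod_def)
qed

end

section \<open>Twisting by a line bundle\<close>

definition basis1 :: "'r ring => ('r, 'm) module => 'm => bool" where
 "basis1 R L g <-> g:$L & (ALL m:$L. EX! r. r:$R & m = r *.[L] g)"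

definition coef :: "'r ring => ('r, 'm) module => 'm => 'm => 'r" where
 "coef R L g m = (THE r. r:$R & m = r *.[L] g)"

lemma coef:
 assumes "basis1 R L g" "m:$L"
 shows "coef R L g m:$R" "coef R L g m *.[L] g = m"
  and "r:$R ==> m = r *.[L] g ==> coef R L g m = r"
proof -
 have ex: "EX! r. r:$R & m = r *.[L] g" using assms by (simp add: basis1_def)
 from theI'[OF this] show "coef R L g m:$R" "coef R L g m *.[L] g = m" by (simp_all add: coef_def)
 then show "r:$R ==> m = r *.[L] g ==> coef R L g m = r" using ex by metis
qed

lemma coef_smult:
 assumes b: "basis1 R L g" and L: "module R L" and r: "r:$R"
 shows "coef R L g (r *.[L] g) = r"
proof -
 have "r *.[L] g:$L" using b r module.smult_closed[OF L] by (simp add: basis1_def)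
 from coef(3)[OF b this r] show ?thesis by simp
qed

lemma coef_hom:
 assumes b: "basis1 R L g" and L: "module R L" and m: "m:$L" "n:$L" and r: "r:$R"
 shows "coef R L g (m +[L] n) = coef R L g m +[R] coef R L g n" "coef R L g (r *.[L] m) = r *[R] coef R L g m"
proof -
 interpret module R L by fact
 have g: "g:$L" using b by (simp add: basis1_def)
 note c = coef(1,2)[OF b m(1)] coef(1,2)[OF b m(2)]
 show "coef R L g (m +[L] n) = coef R L g m +[R] coef R L g n"
  by (rule coef(3)[OF b]) (use m c g in "simp_all add: smult_l_distr")
 show "coef R L g (r *.[L] m) = r *[R] coef R L g m"
  by (rule coef(3)[OF b]) (use m r c g in "simp_all add: smult_assoc1")
qed

lemma basis1_ratio:
 assumes L: "module R L" and g: "basis1 R L g" and h: "basis1 R L h"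
 shows "coef R L g h:Units R"
proof -
 interpret module R L by fact
 have gc: "g:$L" "h:$L" using g h by (simp_all add: basis1_def)
 let ?u = "coef R L g h" and ?v = "coef R L h g"
 note u = coef(1,2)[OF g gc(2)] and v = coef(1,2)[OF h gc(1)]
 have "(?v *[R] ?u) *.[L] g = ?v *.[L] (?u *.[L] g)" by (rule smult_assoc1[OF v(1) u(1) gc(1)])
 also have "\<dots> = 1[R] *.[L] g" unfolding u(2) v(2) smult_one[OF gc(1)] ..
 finally have "?v *[R] ?u = 1[R]"
  using coef_smult[OF g L R.m_closed[OF v(1) u(1)]] coef_smult[OF g L R.one_closed] by metis
 then show ?thesis unfolding Units_def using u(1) v(1) R.m_comm[OF v(1) u(1)]
  by (intro CollectI conjI bexI[of _ ?v]) metis+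
qed

lemma mlin_replicate:
 assumes b: "mlin s R n M Z b" and M: "module R M" and Z: "module R Z" and r: "r:$R" and x: "x:$M"
 shows "b (replicate n (r *.[M] x)) = r [^]\<^bsub>R\<^esub> n *.[Z] b (replicate n x)"
proof -
 interpret Z: module R Z by fact
 interpret M: module R M by fact
 have rx: "r *.[M] x:$M" using r x by simp
 have "b (replicate k (r *.[M] x) @ replicate (n - k) x) = r [^]\<^bsub>R\<^esub> k *.[Z] b (replicate n x)" if "k <= n" for k
  using that
 proof (induction k)
  case 0
  have "replicate n x:words n M" using x by (auto simp: words_def)
  then show ?case using mlinD(1)[OF b] by simp
 next
  case (Suc k)
  let ?l = "replicate k (r *.[M] x) @ replicate (n - k) x"
  have nk: "n - k = Suc (n - Suc k)" using Suc.prems by simp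
  have l: "?l:words n M" using x rx Suc.prems by (auto simp: words_def)
  have l0: "replicate n x:words n M" using x by (auto simp: words_def)
  have u: "?l[k := z] = replicate k (r *.[M] x) @ z # replicate (n - Suc k) x" for z
   unfolding nk by (simp add: list_update_append)
  have "?l[k := x] = ?l" "?l[k := r *.[M] x] = replicate (Suc k) (r *.[M] x) @ replicate (n - Suc k) x"
   unfolding u unfolding nk by (simp_all add: replicate_append_same[symmetric])
  then show ?case
   using mlinD(3)[OF b l _ r x, of k] Suc mlinD(1)[OF b l0] r
   by (simp add: Z.smult_assoc1[symmetric] Z.R.m_comm)
 qed
 from this[of n] show ?thesis by simp
qed

section \<open>Frames of sheaves that are locally free of rank one\<close>

context lrs
begin

text \<open>A trivialization over \<open>U\<close>, recorded by a section instead of an isomorphism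
  with the structure sheaf. Requiring a basis over every smaller open set makes it pass directly to
  restrictions and to germs.\<close>

definition gframe :: "('x, 'r, 'm) mod_presheaf => 'x set => 'm => bool" where
 "gframe M U a <-> op U & a:$(msec M U) &
  (ALL W. op W & W <= U --> basis1 (SX W) (msec M W) (mres M U W a))"

lemma gframe_germ:
 assumes Mp: "mp M" and f: "gframe M U a" and y: "y:U"
 shows "basis1 (Ox y) (St M y) (mg M y U a)"
proof -
 have U: "op U" "a:$(msec M U)" and ba: "!!W. op W ==> W <= U ==> basis1 (SX W) (msec M W) (mres M U W a)"
  using f by (auto simp: gframe_def)
 have yp: "y:pts X" using op_pts[OF U(1) y] .
 show ?thesis unfolding basis1_def
 proof (intro conjI ballI)
  show "mg M y U a:$(St M y)" by (rule mgerm_op(1)[OF Mp U(1) y U(2)])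
  fix m assume "m:$(St M y)"
  from mstalk_rep[OF Mp this] obtain V s where V: "op V" "y:V" "s:$(msec M V)" "m = mg M y V s" by metis
  let ?W = "U Int V"
  have W: "op ?W" "?W <= U" "?W <= V" "y:?W" using U V y by auto
  have sW: "mres M V ?W s:$(msec M ?W)" by (rule mres_closed[OF Mp V(1) W(1,3) V(3)])
  have aW: "mres M U ?W a:$(msec M ?W)" by (rule mres_closed[OF Mp U(1) W(1,2) U(2)])
  define c where "c = coef (SX ?W) (msec M ?W) (mres M U ?W a) (mres M V ?W s)"
  have c: "c:$(SX ?W)" "c *.[msec M ?W] mres M U ?W a = mres M V ?W s"
   unfolding c_def using coef(1,2)[OF ba[OF W(1,2)] sW] by auto
  have g: "mg M y U a = mg M y ?W (mres M U ?W a)" "m = mg M y ?W (mres M V ?W s)"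
   using mgerm_res[OF Mp U(1) W(1,2,4) U(2)] mgerm_res[OF Mp V(1) W(1,3,4) V(3)] V(4) by auto
  have "m = rg y ?W c *.[St M y] mg M y U a"
   unfolding g mgerm_op(3)[OF Mp W(1,4) aW c(1)] c(2) ..
  \<comment> \<open>An equality of germs holds on some smaller open set \<open>T\<close>; there the
    restriction of \<open>a\<close> is still a basis, so the two coefficients agree on
    \<open>T\<close> and have the same germ.\<close>
  moreover have "r = r'" if r: "r:$(Ox y)" "r':$(Ox y)"
   "r *.[St M y] mg M y U a = r' *.[St M y] mg M y U a" for r r'
  proof -
   from mstalk_rep2[OF OX_presh, unfolded OX_stalk, OF r(1,2) yp] obtain Q q q' where
    Q: "op Q" "y:Q" "q:$(SX Q)" "q':$(SX Q)" "r = rg y Q q" "r' = rg y Q q'"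
    unfolding OX_carrier rgerm_mgerm by metis
   let ?Z = "U Int Q"
   have Z: "op ?Z" "?Z <= U" "?Z <= Q" "y:?Z" using U Q y by auto
   have qc: "res X Q ?Z q:$(SX ?Z)" "res X Q ?Z q':$(SX ?Z)"
    using preshD(1)[OF sec_presh Q(1) Z(1,3)] Q(3,4) by auto
   have aZ: "mres M U ?Z a:$(msec M ?Z)" by (rule mres_closed[OF Mp U(1) Z(1,2) U(2)])
   have qg: "r = rg y ?Z (res X Q ?Z q)" "r' = rg y ?Z (res X Q ?Z q')" "mg M y U a = mg M y ?Z (mres M U ?Z a)"
    using rgerm_res[OF Q(1) Z(1,3,4)] mgerm_res[OF Mp U(1) Z(1,2,4) U(2)] Q(3-6) by auto
   interpret MZ: module "SX ?Z" "msec M ?Z" by (rule P'(1)[OF Mp Z(1)])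
   have "mg M y ?Z (res X Q ?Z q *.[msec M ?Z] mres M U ?Z a) = mg M y ?Z (res X Q ?Z q' *.[msec M ?Z] mres M U ?Z a)"
    using r(3) unfolding qg mgerm_op(3)[OF Mp Z(1,4) aZ qc(1)] mgerm_op(3)[OF Mp Z(1,4) aZ qc(2)] .
   then obtain T where T: "op T" "y:T" "T <= ?Z"
    "mres M ?Z T (res X Q ?Z q *.[msec M ?Z] mres M U ?Z a) = mres M ?Z T (res X Q ?Z q' *.[msec M ?Z] mres M U ?Z a)"
    using mgerm_eq_iff[OF Mp Z(1,4) MZ.smult_closed[OF qc(1) aZ] Z(1,4) MZ.smult_closed[OF qc(2) aZ]] by auto
   have TU: "T <= U" "T <= Q" using T by auto
   have "res X Q T q *.[msec M T] mres M U T a = res X Q T q' *.[msec M T] mres M U T a"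
    using T(4) slinD(3)[OF P'(2)[OF Mp Z(1) T(1,3)] qc(1) aZ] slinD(3)[OF P'(2)[OF Mp Z(1) T(1,3)] qc(2) aZ]
     preshD(3)[OF sec_presh Q(1) Z(1) T(1,3) Z(3) Q(3)] preshD(3)[OF sec_presh Q(1) Z(1) T(1,3) Z(3) Q(4)]
     preshD(3)[OF P'(3)[OF Mp] U(1) Z(1) T(1,3) Z(2) U(2)] by simp
   then have "res X Q T q = res X Q T q'"
    using coef_smult[OF ba[OF T(1) TU(1)] P'(1)[OF Mp T(1)]] preshD(1)[OF sec_presh Q(1) T(1) TU(2)] Q(3,4) by metis
   then show ?thesis using rgerm_res[OF Q(1) T(1) TU(2) T(2)] Q(3-6) by metis
  qed
  ultimately show "EX! r. r:$(Ox y) & m = r *.[St M y] mg M y U a"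
   using rgerm_op(1)[OF W(1,4) c(1) c(1)] by metis
 qed
qed

text \<open>Near each point the section is represented over an open set on which \<open>a\<close>
  restricts to a basis. The coefficient found there represents the coefficients at all nearby
  points, so the coefficient function is itself local.\<close>

lemma gframe_lsec:
 assumes Mp: "mp M" and f: "gframe M U a" and W: "W <= U" and sg: "lse M W sg"
 shows "EX c. lse OX W c & (ALL y:W. sg y = c y *.[St M y] mg M y U a)"
proof -
 have U: "op U" "a:$(msec M U)" and ba: "!!W. op W ==> W <= U ==> basis1 (SX W) (msec M W) (mres M U W a)"
  using f by (auto simp: gframe_def)
 define c where "c y = coef (Ox y) (St M y) (mg M y U a) (sg y)" for y
 have c: "sg y = c y *.[St M y] mg M y U a" if "y:W" for y
  unfolding c_def using coef(2)[OF gframe_germ[OF Mp f] lsec_carrier[OF Mp sg that]] W that by auto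
 have "lse OX W c"
 proof (rule lsecI[OF OX_presh lsec_open[OF Mp sg]])
  fix y assume y: "y:W"
  obtain Q t where Q: "op Q" "y:Q" "Q <= W" "t:$(msec M Q)" "!!z. z:Q ==> sg z = mg M z Q t"
   using lsecD[OF Mp sg y] by metis
  have QU: "Q <= U" using Q(3) W by simp
  note b = ba[OF Q(1) QU]
  let ?k = "coef (SX Q) (msec M Q) (mres M U Q a) t"
  note k = coef(1,2)[OF b Q(4)] and aQ = mres_closed[OF Mp U(1) Q(1) QU U(2)]
  have "c z = rg z Q ?k" if z: "z:Q" for z
  proof -
   have zU: "z:U" using z QU by auto
   have "sg z = rg z Q ?k *.[St M z] mg M z U a"
    using Q(5)[OF z] mgerm_op(3)[OF Mp Q(1) z aQ k(1)] k(2) mgerm_res[OF Mp U(1) Q(1) QU z U(2)] by simp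
   then show ?thesis unfolding c_def
    using coef_smult[OF gframe_germ[OF Mp f zU] stalk_module[OF Mp op_pts[OF U(1) zU]] rgerm_op(1)[OF Q(1) z k(1) k(1)]] by simp
  qed
  then show "EX W' t. op W' & y:W' & W' <= W & t:$(msec OX W') & (ALL z:W'. c z = mg OX z W' t)"
   using Q(1-3) k(1) by (intro exI[of _ Q] exI[of _ ?k]) (simp add: OX_carrier rgerm_mgerm)
 qed
 then show ?thesis using c by blast
qed

end

locale line_bundle = lrs X for X :: "('x, 'r) ringed_space" +
 fixes A :: "('x, 'r, 'l) mod_presheaf"
 assumes A: "locally_free X 1 A"
begin

lemma A_sheaf: "module_sheaf X A" using A by (simp add: locally_free_def)
lemmas A_presh = sheaf_presh[OF A_sheaf]

abbreviation "frame \<equiv> gframe A"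
lemmas frame_germ = gframe_germ[OF A_presh] and frame_lsec = gframe_lsec[OF A_presh]

text \<open>The frame is the preimage of the constant section 1 under a local trivialization; it
  stays a basis on smaller open sets because the trivialization commutes with restriction.\<close>

lemma frame_exists:
 assumes y: "y:pts X"
 shows "EX U a. frame U a & y:U"
proof -
 from A y obtain U phi where U: "op U" "y:U" and phi: "mod_hom X U A (free_sheaf X 1) phi"
  and bij: "!!W. W:opens_in X U ==> bij_betw (phi W) ($(msec A W)) ($(msec (free_sheaf X 1) W))"
  unfolding locally_free_def mod_iso_on_def by blast
 have fc: "$(msec (free_sheaf X 1) W) = {..<1} \<rightarrow>\<^sub>E $(SX W)" for W by (simp add: free_sheaf_def)
 have oneU: "1[SX W]:$(SX W)" if "op W" for W using sec_cring[OF that] by (simp add: cring_def ring.ring_simprules)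
 define e where "e W = (\<lambda>i\<in>{..<1::nat}. 1[SX W])" for W
 have e: "e W:$(msec (free_sheaf X 1) W)" if "op W" for W unfolding fc e_def using oneU[OF that] by (simp add: PiE_def)
 have UU: "U:opens_in X U" using U by (simp add: opens_in_def)
 from bij[OF UU] e[OF U(1)] obtain a where a: "a:$(msec A U)" "phi U a = e U" unfolding bij_betw_def by (metis imageE)
 have "basis1 (SX W) (msec A W) (mres A U W a)" if W: "op W" "W <= U" for W
 proof -
  have WU: "W:opens_in X U" using W by (simp add: opens_in_def)
  note m = P'(1)[OF A_presh W(1)]
  interpret M: module "SX W" "msec A W" by (rule m)
  note ph = phi[unfolded mod_hom_def, rule_format, OF WU] phi[unfolded mod_hom_def, rule_format, OF UU]
  have aW: "mres A U W a:$(msec A W)" by (rule mres_closed[OF A_presh U(1) W a(1)])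
  have "phi W (mres A U W a) = mres (free_sheaf X 1) U W (phi U a)" using ph(2) WU a(1) by blast
  then have phia: "phi W (mres A U W a) = e W"
   unfolding a(2) using ring_hom_one[OF res_hom[OF U(1) W]] by (simp add: free_sheaf_def e_def restrict_def fun_eq_iff)
  have phic: "phi W (c *.[msec A W] mres A U W a) = (\<lambda>i\<in>{..<1}. c)" if "c:$(SX W)" for c
  proof -
   have "phi W (c *.[msec A W] mres A U W a) = c *.[msec (free_sheaf X 1) W] e W" using ph(1) that aW phia by metis
   also have "\<dots> = (\<lambda>i\<in>{..<1}. c)" using that by (simp add: free_sheaf_def e_def restrict_def fun_eq_iff)
   finally show ?thesis .
  qed
  have inj: "inj_on (phi W) ($(msec A W))" using bij[OF WU] by (simp add: bij_betw_def)
  show ?thesis unfolding basis1_def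
  proof (intro conjI ballI)
   show "mres A U W a:$(msec A W)" by (rule aW)
   fix s assume s: "s:$(msec A W)"
   have f: "phi W s:{..<1} \<rightarrow>\<^sub>E $(SX W)" using bij[OF WU] s fc unfolding bij_betw_def by blast
   define c where "c = phi W s 0"
   have c: "c:$(SX W)" using f by (auto simp: c_def PiE_def Pi_def)
   have "phi W s = (\<lambda>i\<in>{..<1}. c)"
    by (rule extensionalityI[of _ "{..<1}"]) (use f in "auto simp: c_def PiE_def")
   then have "phi W s = phi W (c *.[msec A W] mres A U W a)" using phic[OF c] by simp
   then have "s = c *.[msec A W] mres A U W a" using inj s c aW by (meson M.smult_closed inj_onD)
   moreover have "c' = c" if "c':$(SX W)" "s = c' *.[msec A W] mres A U W a" for c'
    using phic[OF that(1)] that(2) by (simp add: c_def)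
   ultimately show "EX! c. c:$(SX W) & s = c *.[msec A W] mres A U W a" using c by blast
  qed
 qed
 then show ?thesis using U a unfolding gframe_def by blast
qed

text \<open>A generator \<open>al y\<close> of each stalk of \<open>A\<close> is fixed. A frame is \<open>uu\<close> times \<open>al\<close>, and twisted
 sections are described by families in the stalks of \<open>V\<close> that become local sections of \<open>V\<close> after
 multiplication by powers of \<open>uu\<close>. This makes twisted sections multiply without tensor products.\<close>

definition fr :: "'x => 'x set \<times> 'l" where
 "fr y = (SOME p. frame (fst p) (snd p) & y:fst p)"

lemma fr: "y:pts X ==> frame (fst (fr y)) (snd (fr y)) & y:fst (fr y)"
 unfolding fr_def using frame_exists[of y] by (intro someI_ex[of "%p. frame (fst p) (snd p) & y:fst p"]) auto

definition al :: "'x => ('x, 'l) germ" where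
 "al y = mg A y (fst (fr y)) (snd (fr y))"

lemma al_basis: "y:pts X ==> basis1 (Ox y) (St A y) (al y)"
 unfolding al_def using frame_germ fr by blast

definition uu :: "'x set => 'l => 'x => ('x, 'r) germ" where
 "uu U a y = coef (Ox y) (St A y) (al y) (mg A y U a)"

text \<open>The power is taken in the group of units of the stalk, so that negative exponents are
  available. They express twists by the dual of \<open>A\<close>.\<close>

definition up :: "'x set => 'l => int => 'x => ('x, 'r) germ" where
 "up U a d y = uu U a y [^]\<^bsub>units_of (Ox y)\<^esub> d"

lemma frame_op: "frame U a ==> op U" by (simp add: gframe_def)
lemma frame_pts: "frame U a ==> y:U ==> y:pts X" using frame_op op_pts by blast

lemma uu:
 assumes f: "frame U a" and y: "y:U"
 shows "uu U a y:Units (Ox y)" "uu U a y *.[St A y] al y = mg A y U a"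
proof -
 have yp: "y:pts X" using frame_pts[OF f y] .
 show "uu U a y:Units (Ox y)"
  unfolding uu_def by (rule basis1_ratio[OF stalk_module[OF A_presh yp] al_basis[OF yp] frame_germ[OF f y]])
 show "uu U a y *.[St A y] al y = mg A y U a"
  unfolding uu_def by (rule coef(2)[OF al_basis[OF yp]]) (use frame_germ[OF f y] in "simp add: basis1_def")
qed

lemma up:
 assumes f: "frame U a" and y: "y:U"
 shows "up U a d y:$(Ox y)" "up U a d y:Units (Ox y)" "up U a (d + e) y = up U a d y *[Ox y] up U a e y"
  "up U a 0 y = 1[Ox y]" "up U a 1 y = uu U a y" "up U a d y [^]\<^bsub>Ox y\<^esub> n = up U a (int n * d) y"
  "up U a d y *[Ox y] up U a (- d) y = 1[Ox y]" "up U a (- d) y *[Ox y] up U a d y = 1[Ox y]"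
proof -
 interpret R: cring "Ox y" by (rule stalk_cring[OF frame_pts[OF f y]])
 interpret G: group "units_of (Ox y)" by (rule R.units_group)
 have u: "uu U a y:$(units_of (Ox y))" using uu(1)[OF f y] by (simp add: units_of_carrier)
 show U: "up U a d y:Units (Ox y)" for d using G.int_pow_closed[OF u] by (simp add: up_def units_of_carrier)
 then show "up U a d y:$(Ox y)" by blast
 show add: "up U a (d + e) y = up U a d y *[Ox y] up U a e y" for d e
  using G.int_pow_mult[OF u] by (simp add: up_def units_of_mult)
 show z: "up U a 0 y = 1[Ox y]" by (simp add: up_def units_of_one)
 show "up U a 1 y = uu U a y" using u by (simp add: up_def)
 show "up U a d y [^]\<^bsub>Ox y\<^esub> n = up U a (int n * d) y"
 proof (induction n)
  case (Suc n)
  then show ?case using add[of "int n * d" d] by (simp add: algebra_simps)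
 qed (simp add: z)
 show "up U a d y *[Ox y] up U a (- d) y = 1[Ox y]" "up U a (- d) y *[Ox y] up U a d y = 1[Ox y]"
  using add[of d "- d"] add[of "- d" d] z by simp_all
qed

lemma up_smult:
 assumes f: "frame U a" and y: "y:U" and M: "module (Ox y) M" and m: "m:$M"
 shows "up U a d y *.[M] (up U a e y *.[M] m) = up U a (d + e) y *.[M] m" "up U a 0 y *.[M] m = m"
  "up U a d y *.[M] m:$M"
 using module.smult_assoc1[OF M] module.smult_one[OF M m] module.smult_closed[OF M _ m] m by (simp_all add: up[OF f y])

text \<open>\<open>TS V d s\<close>: the family \<open>s\<close> is a global section of \<open>V \<otimes> A\<^sup>d\<close>, where \<open>d\<close> may be negative.\<close>

definition TS :: "('x, 'r, 'm) mod_presheaf => int => ('x => ('x, 'm) germ) => bool" where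
 "TS V d s <-> (ALL y:pts X. s y:$(St V y)) &
  (ALL U a. frame U a --> lse V U (%y. up U a (- d) y *.[St V y] s y))"

lemma TSD: "TS V d s ==> y:pts X ==> s y:$(St V y)"
 "TS V d s ==> frame U a ==> lse V U (%y. up U a (- d) y *.[St V y] s y)"
 by (simp_all add: TS_def)

definition GG :: "'x => ('x, 'r, 'm) mod_presheaf => int => ('x, 'm) germ set" where
 "GG x V d = module_span (Ox x) (St V x) (mprod x (St V x) Un {s x | s. TS V d s})"

text \<open>By Nakayama, \<open>full x V d\<close> says that \<open>V \<otimes> A\<^sup>d\<close> is globally generated at \<open>x\<close>.\<close>

definition full :: "'x => ('x, 'r, 'm) mod_presheaf => int => bool" where
 "full x V d <-> GG x V d = $(St V x)"

lemma GG_gens: "mp V ==> x:pts X ==> mprod x (St V x) Un {s x | s. TS V d s} <= $(St V x)"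
 using mprod_carrier[OF _ stalk_module] TSD(1) by blast

lemma GG_sub: "mp V ==> x:pts X ==> submodule (GG x V d) (Ox x) (St V x)"
 unfolding GG_def by (rule span_submodule[OF stalk_module GG_gens])

lemma GG_TS: "TS V d s ==> s x:GG x V d"
 unfolding GG_def by (rule span_incl) blast

lemma GG_mprod: "mu:max_ideal (Ox x) ==> v:$(St V x) ==> mu *.[St V x] v:GG x V d"
 unfolding GG_def mprod_def by (rule span_incl) blast

lemma TS_smor:
 assumes s: "TS V d s" and f: "smor V W f" and W: "mp W"
 shows "TS W d (%y. f y (s y))"
 unfolding TS_def
proof (intro conjI ballI allI impI)
 show "f y (s y):$(St W y)" if "y:pts X" for y
  using slinD(1)[OF smorD(1)[OF f that] TSD(1)[OF s that]] .
 fix U a assume fr: "frame U a"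
 show "lse W U (%y. up U a (- d) y *.[St W y] f y (s y))"
  by (rule lsec_cong[OF W smorD(2)[OF f TSD(2)[OF s fr]]])
   (simp add: slinD(3)[OF smorD(1)[OF f frame_pts[OF fr]] up(1)[OF fr] TSD(1)[OF s frame_pts[OF fr]]])
qed

text \<open>The correcting power of \<open>uu\<close> is pulled out of each argument by bilinearity
  and the exponents add. This is how sections of different twists are multiplied without tensor
  products of powers of \<open>A\<close>.\<close>

lemma TS_sbil:
 assumes s: "TS V d s" and t: "TS W e t" and be: "sbil V W Z be"
  and W: "mp W" and Z: "mp Z"
 shows "TS Z (d + e) (%y. be y (s y) (t y))"
 unfolding TS_def
proof (intro conjI ballI allI impI)
 show "be y (s y) (t y):$(St Z y)" if "y:pts X" for y
  using bilinD(1)[OF sbilD(1)[OF be that] TSD(1)[OF s that] TSD(1)[OF t that]] .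
 fix U a assume fr: "frame U a"
 show "lse Z U (%y. up U a (- (d + e)) y *.[St Z y] be y (s y) (t y))"
 proof (rule lsec_cong[OF Z sbilD(2)[OF be TSD(2)[OF s fr] TSD(2)[OF t fr]]])
  fix y assume y: "y:U"
  have yp: "y:pts X" using frame_pts[OF fr y] .
  note B = bilinD[OF sbilD(1)[OF be yp]]
  have sy: "s y:$(St V y)" and ty: "t y:$(St W y)" using TSD(1) s t yp by auto
  have V: "up U a (- e) y *.[St W y] t y:$(St W y)"
   using lsec_carrier[OF W TSD(2)[OF t fr] y] .
  show "be y (up U a (- d) y *.[St V y] s y) (up U a (- e) y *.[St W y] t y) = up U a (- (d + e)) y *.[St Z y] be y (s y) (t y)"
   unfolding B(4)[OF up(1)[OF fr y] sy V] B(5)[OF up(1)[OF fr y] sy ty]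
    up_smult(1)[OF fr y stalk_module[OF Z yp] B(1)[OF sy ty]] by simp
 qed
qed

end

section \<open>Generation in a given degree under morphisms and products\<close>

context line_bundle
begin

lemma GG_smor:
 assumes V: "mp V" and W: "mp W" and f: "smor V W f" and x: "x:pts X" and v: "v:GG x V d"
 shows "f x v:GG x W d"
proof (rule slin_span[OF smorD(1)[OF f x] stalk_module[OF V x] stalk_module[OF W x] rstalk_fun GG_sub[OF W x] GG_gens[OF V x] _ v[unfolded GG_def]])
 fix v assume "v:mprod x (St V x) Un {s x | s. TS V d s}"
 then show "f x v:GG x W d"
 proof
  assume "v:mprod x (St V x)"
  then obtain mu w where w: "mu:max_ideal (Ox x)" "w:$(St V x)" "v = mu *.[St V x] w" by (auto simp: mprod_def)
  have mu: "mu:$(Ox x)" using w(1) stalk_ideal[OF x] by (rule ideal.Icarr[rotated])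
  show ?thesis unfolding w(3) slinD(3)[OF smorD(1)[OF f x] mu w(2)]
   by (rule GG_mprod[OF w(1) slinD(1)[OF smorD(1)[OF f x] w(2)]])
 next
  assume "v:{s x | s. TS V d s}"
  then obtain s where s: "TS V d s" "v = s x" unfolding mem_Collect_eq by metis
  show ?thesis unfolding s(2) by (rule GG_TS[OF TS_smor[OF s(1) f W]])
 qed
qed

lemma full_surj:
 assumes V: "mp V" and W: "mp W" and f: "smor V W f" and x: "x:pts X"
  and s: "f x ` $(St V x) = $(St W x)" and v: "full x V d"
 shows "full x W d"
 unfolding full_def
proof (rule subset_antisym[OF submoduleD(1)[OF stalk_module[OF W x] GG_sub[OF W x]]])
 show "$(St W x) <= GG x W d"
  unfolding s[symmetric] using GG_smor[OF V W f x, of _ d] v unfolding full_def by (intro image_subsetI) metis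
qed

lemma bilin_lin:
 assumes "bilin R M N Z be"
 shows "a:$M ==> lin R N Z (be a)" "b:$N ==> lin R M Z (%a. be a b)"
 using assms by (simp_all add: bilin_def)

text \<open>Bilinearity reduces to generators in both variables. If one generator is a multiple by
  the maximal ideal, so is the product; otherwise both are values of twisted sections, whose product
  is one in degree \<open>d + e\<close>.\<close>

lemma GG_sbil:
 assumes V: "mp V" and W: "mp W" and Z: "mp Z" and be: "sbil V W Z be" and x: "x:pts X"
  and v: "v:GG x V d" and w: "w:GG x W e"
 shows "be x v w:GG x Z (d + e)"
proof -
 note B = sbilD(1)[OF be x] and m = stalk_module[OF V x] stalk_module[OF W x] stalk_module[OF Z x]
 note G = GG_gens[OF V x] GG_gens[OF W x] and S = GG_sub[OF Z x]
 have mc: "mu:$(Ox x)" if "mu:max_ideal (Ox x)" for mu using that stalk_ideal[OF x] by (rule ideal.Icarr[rotated])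
 have w': "w:$(St W x)" using w submoduleD(1)[OF m(2) GG_sub[OF W x]] by blast
 have 1: "be x v w:GG x Z (d + e)" if v: "v:mprod x (St V x)" and w: "w:$(St W x)" for v w
 proof -
  from v obtain mu a where a: "mu:max_ideal (Ox x)" "a:$(St V x)" "v = mu *.[St V x] a" by (auto simp: mprod_def)
  show ?thesis unfolding a(3) bilinD(4)[OF B mc[OF a(1)] a(2) w] by (rule GG_mprod[OF a(1) bilinD(1)[OF B a(2) w]])
 qed
 have 2: "be x v w:GG x Z (d + e)" if w: "w:mprod x (St W x)" and v: "v:$(St V x)" for v w
 proof -
  from w obtain mu a where a: "mu:max_ideal (Ox x)" "a:$(St W x)" "w = mu *.[St W x] a" by (auto simp: mprod_def)
  show ?thesis unfolding a(3) bilinD(5)[OF B mc[OF a(1)] v a(2)] by (rule GG_mprod[OF a(1) bilinD(1)[OF B v a(2)]])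
 qed
 show ?thesis
 proof (rule slin_span[OF bilin_lin(2)[OF B w'] m(1,3) rstalk_fun S G(1) _ v[unfolded GG_def]])
  fix v assume v: "v:mprod x (St V x) Un {s x | s. TS V d s}"
  then have v': "v:$(St V x)" using G(1) by blast
  show "be x v w:GG x Z (d + e)"
  proof (rule slin_span[OF bilin_lin(1)[OF B v'] m(2,3) rstalk_fun S G(2) _ w[unfolded GG_def]])
   fix w assume w: "w:mprod x (St W x) Un {s x | s. TS W e s}"
   then have w': "w:$(St W x)" using G(2) by blast
   show "be x v w:GG x Z (d + e)"
   proof (cases "v:mprod x (St V x) \<or> w:mprod x (St W x)")
    case True
    then show ?thesis using 1 2 v' w' by blast
   next
    case False
    then obtain s t where s: "TS V d s" "v = s x" and t: "TS W e t" "w = t x" using v w unfolding Un_iff mem_Collect_eq by metis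
    show ?thesis unfolding s(2) t(2) by (rule GG_TS[OF TS_sbil[OF s(1) t(1) be W Z]])
   qed
  qed
 qed
qed

lemma section_smor:
 assumes V: "mp V" and ta: "lse V (pts X) ta"
 shows "smor OX V (%y r. r *.[St V y] ta y)"
proof (rule smorI)
 fix y assume y: "y:pts X"
 interpret V: module "Ox y" "St V y" by (rule stalk_module[OF V y])
 have t: "ta y:$(St V y)" by (rule lsec_carrier[OF V ta y])
 show "lin (Ox y) (St OX y) (St V y) (%r. r *.[St V y] ta y)"
  by (rule slinI) (use t in "simp_all add: OX_stalk V.smult_l_distr V.smult_assoc1")
next
 fix U r assume r: "lse OX U r"
 have U: "op U" by (rule lsec_open[OF OX_presh r])
 show "lse V U (%y. r y *.[St V y] ta y)"
  by (rule lsec_smult[OF V r lsec_subset[OF V ta U]]) (use U op_pts in blast)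
qed

text \<open>A global section of \<open>V\<close> defines a morphism from \<open>OX\<close>, which
  carries generation of \<open>OX\<close> in degree \<open>d\<close> to the value of the section.
  Surplus positive degree can thus always be used up, since \<open>OX\<close> is generated in all
  large degrees.\<close>

lemma GG_section:
 assumes V: "mp V" and ta: "lse V (pts X) ta" and x: "x:pts X" and O: "full x OX d"
 shows "ta x:GG x V d"
proof -
 have "1[Ox x]:GG x OX d" using O stalk_cring[OF x] by (simp add: full_def OX_stalk cring_def ring.ring_simprules)
 from GG_smor[OF OX_presh V section_smor[OF V ta] x this] show ?thesis
  using module.smult_one[OF stalk_module[OF V x] lsec_carrier[OF V ta x]] by simp
qed

lemma pts_op: "op (pts X)" by simp

lemma section_empty_word:
 assumes V: "mp V"
 shows "lse (Sy 0 V) (pts X) (%y. sw 0 V y [])"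
 using wd_lsec[OF V pts_op, of "[]" 0] by simp

lemma section_power:
 assumes V: "mp V" and ta: "lse V (pts X) ta"
 shows "lse (Sy j V) (pts X) (%y. sw j V y (replicate j (ta y)))"
 using wd_lsec[OF V pts_op, of "replicate j ta" j] ta by simp

lemma single_word_smor:
 assumes V: "mp V"
 shows "smor V (Sy 1 V) (%y v. sw 1 V y [v])"
proof (rule smorI)
 fix y assume y: "y:pts X"
 have w: "[v]:words 1 (St V y)" if "v:$(St V y)" for v using that by (simp add: words_def)
 note b = mlinD[OF wd_mlin[OF V y, where s = True and n = 1]]
 show "lin (Ox y) (St V y) (St (Sy 1 V) y) (%v. sw 1 V y [v])"
 proof (rule slinI)
  fix v w' assume v: "v:$(St V y)" "w':$(St V y)"
  show "sw 1 V y [v]:$(St (Sy 1 V) y)" by (rule b(1)[OF w[OF v(1)]])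
  show "sw 1 V y [v +[St V y] w'] = sw 1 V y [v] +[St (Sy 1 V) y] sw 1 V y [w']"
   using b(2)[OF w[OF v(1)] _ v, of 0] by simp
 next
  fix r v assume v: "r:$(Ox y)" "v:$(St V y)"
  show "sw 1 V y [r *.[St V y] v] = r *.[St (Sy 1 V) y] sw 1 V y [v]"
   using b(3)[OF w[OF v(2)] _ v, of 0] by simp
 qed
next
 fix U sg assume "lse V U sg"
 then show "lse (Sy 1 V) U (%y. sw 1 V y [sg y])"
  using wd_lsec[OF V lsec_open[OF V], of U sg "[sg]" 1 True] by simp
qed

lemma words_in_full:
 assumes V: "mp V" and x: "x:pts X" and w: "!!l. l:words n (St V x) ==> sw n V x l:GG x (Sy n V) d"
 shows "full x (Sy n V) d"
 unfolding full_def
 using span_least[OF GG_sub[OF wsh_presh[OF V] x]] wd_span[OF V x, of True n] w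
  submoduleD(1)[OF wsh_module[OF V x] GG_sub[OF wsh_presh[OF V] x]]
 by (metis image_subsetI subset_antisym)

lemma full_Sy_add:
 assumes V: "mp V" and x: "x:pts X" and i: "full x (Sy i V) d" and j: "full x (Sy j V) e"
 shows "full x (Sy (i + j) V) (d + e)"
proof (rule words_in_full[OF V x])
 fix l assume l: "l:words (i + j) (St V x)"
 have w: "take i l:words i (St V x)" "drop i l:words j (St V x)" using l set_take_subset[of i l] set_drop_subset[of i l] by (auto simp: words_def)
 have "sw i V x (take i l):GG x (Sy i V) d" "sw j V x (drop i l):GG x (Sy j V) e"
  using i j wd_carrier[OF V x w(1)] wd_carrier[OF V x w(2)] by (simp_all add: full_def)
 from GG_sbil[OF wsh_presh[OF V] wsh_presh[OF V] wsh_presh[OF V] smul_sbil[OF V] x this]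
 show "sw (i + j) V x l:GG x (Sy (i + j) V) (d + e)" using smul_sw[OF V x w] by simp
qed

lemma full_Sy_0:
 assumes V: "mp V" and x: "x:pts X" and O: "full x OX d"
 shows "full x (Sy 0 V) d"
 using GG_section[OF wsh_presh[OF V] section_empty_word[OF V] x O] by (intro words_in_full[OF V x]) (simp add: words_def)

lemma full_Sy_1:
 assumes V: "mp V" and x: "x:pts X" and v: "full x V d"
 shows "full x (Sy 1 V) d"
proof (rule words_in_full[OF V x])
 fix l assume "l:words 1 (St V x)"
 then obtain a where a: "l = [a]" "a:$(St V x)" by (auto simp: words_def length_Suc_conv)
 show "sw 1 V x l:GG x (Sy 1 V) d"
  unfolding a(1) by (rule GG_smor[OF V wsh_presh[OF V] single_word_smor[OF V] x]) (use v a(2) in "simp add: full_def")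
qed

text \<open>The empty product contributes the degree \<open>e\<close> of \<open>OX\<close>. It stays
  free in the statement, so the total degree can be adjusted afterwards.\<close>

lemma full_Sy_mult:
 assumes V: "mp V" and x: "x:pts X" and O: "full x OX e" and v: "full x (Sy N V) M"
 shows "full x (Sy (a * N) V) (int a * M + e)"
proof (induction a)
 case (Suc a)
 from full_Sy_add[OF V x v Suc] show ?case by (simp add: algebra_simps)
qed (simp add: full_Sy_0[OF V x O])

text \<open>The slope is real because it arises as a quotient of a degree by a power. The constant
  may depend on the point and the bundle but not on \<open>j\<close>, so only the slope counts for
  large \<open>j\<close>.\<close>

definition rate :: "'x => ('x, 'r, 'm) mod_presheaf => real => bool" where
 "rate x V tt <-> (EX c. ALL j d. tt * real j + c <= real_of_int d --> full x (Sy j V) d)"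

lemma rate_mono: "rate x V tt ==> tt <= tt' ==> rate x V tt'"
 unfolding rate_def by (meson add_right_mono mult_right_mono of_nat_0_le_iff order_trans)

text \<open>Write \<open>j = a N + i\<close> with \<open>i < N\<close>. The \<open>a\<close> blocks
  of length \<open>N\<close> are generated in degree \<open>M\<close> each, the \<open>i\<close>
  remaining letters in degree \<open>n1\<close> each, and whatever degree is left over is supplied
  by \<open>OX\<close>, for which it must be at least \<open>n0\<close>.\<close>

lemma rate_full:
 assumes V: "mp V" and x: "x:pts X" and O: "!!d. n0 <= d ==> full x OX d" and F: "full x V n1"
  and N: "N >= 1" and v: "full x (Sy N V) M"
 shows "rate x V (real_of_int M / real N)"
 unfolding rate_def
proof (intro exI allI impI)
 \<comment> \<open>The summands pay for the rounding of \<open>j\<close> to a multiple of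
   \<open>N\<close> (at most the absolute value of \<open>M\<close>), for the at most
   \<open>N\<close> leftover letters, and for two uses of \<open>OX\<close>, one with each factor: a
   fixed degree with the blocks, the remaining degree \<open>e\<close> with the leftover
   letters.\<close>
 define c where "c = \<bar>real_of_int M\<bar> + 2 * \<bar>real_of_int n0\<bar> + real N * \<bar>real_of_int n1\<bar>"
 fix j d assume d: "real_of_int M / real N * real j + c <= real_of_int d"
 define a i where "a = j div N" and "i = j mod N"
 have j: "j = i + a * N" and i: "i < N" using N by (auto simp: a_def i_def)
 define e where "e = d - int i * n1 - int a * M - \<bar>n0\<bar>"
 have 1: "real_of_int M / real N * real j = real_of_int M * real a + real_of_int M * (real i / real N)" using N by (simp add: j field_simps)
 have "real i / real N <= 1" using i by simp
 then have "\<bar>real_of_int M * (real i / real N)\<bar> <= \<bar>real_of_int M\<bar>" unfolding abs_mult by (intro mult_left_le) simp_all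
 moreover have "\<bar>real i * real_of_int n1\<bar> <= real N * \<bar>real_of_int n1\<bar>" unfolding abs_mult using i by (intro mult_right_mono) auto
 ultimately have 2: "- \<bar>real_of_int M\<bar> <= real_of_int M * (real i / real N)" "real i * real_of_int n1 <= real N * \<bar>real_of_int n1\<bar>"
  unfolding abs_le_iff by linarith+
 have "real_of_int e = real_of_int d - real i * real_of_int n1 - real_of_int M * real a - \<bar>real_of_int n0\<bar>" by (simp add: e_def)
 then have "real_of_int n0 <= real_of_int e" using d 1 2 abs_ge_self[of "real_of_int n0"] unfolding c_def by linarith
 then have e: "full x OX e" using O by simp
 have "full x (Sy (i * 1) V) (int i * n1 + e)" by (rule full_Sy_mult[OF V x e full_Sy_1[OF V x F]])
 from full_Sy_add[OF V x this full_Sy_mult[OF V x O v, of "\<bar>n0\<bar>" a]]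
 show "full x (Sy j V) d" by (simp add: j e_def algebra_simps)
qed

end

section \<open>Degrees that generate the powers of a single germ\<close>

context line_bundle
begin

text \<open>The analogue of \<open>rate\<close> for the powers of one germ. This is the notion that
  is compatible with products, since the polarized product controls powers of products and not
  arbitrary elements of the symmetric power.\<close>

definition prate :: "'x => ('x, 'r, 'm) mod_presheaf => real => ('x, 'm) germ => bool" where
 "prate x V tt v <-> v:$(St V x) &
  (EX c. ALL j d. tt * real j + c <= real_of_int d --> sw j V x (replicate j v):GG x (Sy j V) d)"

lemma replicate_words: "v:$M ==> replicate n v:words n M" by (auto simp: words_def)

lemma rate_prate:
 assumes "mp V" "x:pts X" "rate x V tt" "v:$(St V x)"
 shows "prate x V tt v"
proof -
 from assms(3) obtain c where c: "!!j d. tt * real j + c <= real_of_int d ==> full x (Sy j V) d" unfolding rate_def by metis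
 have "sw j V x (replicate j v):GG x (Sy j V) d" if "tt * real j + c <= real_of_int d" for j d
  using c[OF that] wd_carrier[OF assms(1,2) replicate_words[OF assms(4)]] unfolding full_def by metis
 then show ?thesis using assms(4) unfolding prate_def by metis
qed

lemma prate_smor:
 assumes V: "mp V" and W: "mp W" and f: "smor V W f" and x: "x:pts X" and v: "prate x V tt v"
 shows "prate x W tt (f x v)"
proof -
 from v obtain c where vc: "v:$(St V x)" and
  c: "!!j d. tt * real j + c <= real_of_int d ==> sw j V x (replicate j v):GG x (Sy j V) d" unfolding prate_def by metis
 have "sw j W x (replicate j (f x v)):GG x (Sy j W) d" if "tt * real j + c <= real_of_int d" for j d
  using GG_smor[OF wsh_presh[OF V] wsh_presh[OF W] smap(1)[OF V W f] x c[OF that]] smap(2)[OF V W f x replicate_words[OF vc]] by simp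
 then show ?thesis using slinD(1)[OF smorD(1)[OF f x] vc] unfolding prate_def by metis
qed

lemma prate_empty:
 assumes V: "mp V" and x: "x:pts X" and O: "!!d. n0 <= d ==> full x OX d"
 shows "prate x (Sy 0 V) 0 (sw 0 V x [])"
proof -
 have "sw j (Sy 0 V) x (replicate j (sw 0 V x [])):GG x (Sy j (Sy 0 V)) d" if "0 * real j + real_of_int n0 <= real_of_int d" for j d
  by (rule GG_section[OF wsh_presh[OF wsh_presh[OF V]] section_power[OF wsh_presh[OF V] section_empty_word[OF V]] x O]) (use that in simp)
 then show ?thesis using lsec_carrier[OF wsh_presh[OF V] section_empty_word[OF V] x] unfolding prate_def by blast
qed

text \<open>Degrees are integers while the bounds are real: the first degree is rounded up, and the
  additional 1 pays for that.\<close>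

lemma split_rate:
 fixes tt tt' c c' :: real
 assumes "(tt + tt') * real j + (c + c' + 1) <= real_of_int d"
 obtains d1 d2 where "d = d1 + d2" "tt * real j + c <= real_of_int d1" "tt' * real j + c' <= real_of_int d2"
proof (rule that[of "\<lceil>tt * real j + c\<rceil>" "d - \<lceil>tt * real j + c\<rceil>"])
 show "tt' * real j + c' <= real_of_int (d - \<lceil>tt * real j + c\<rceil>)"
  using assms of_int_ceiling_le_add_one[of "tt * real j + c"] unfolding distrib_right of_int_diff by linarith
qed simp_all

lemma add_pow_smult:
 assumes M: "module R M" and v: "v:$M"
 shows "add_pow M (n::nat) v = add_pow R n 1[R] *.[M] v"
proof -
 interpret module R M by fact
 show ?thesis using v by (induction n) (simp_all add: smult_l_distr smult_l_null)
qed

end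

text \<open>The form in which characteristic zero enters the estimates: factorials are invertible in
  every stalk, so the factor from the polarized product can be cancelled.\<close>

locale char0_line_bundle = line_bundle X A for X :: "('x, 'r) ringed_space" and A :: "('x, 'r, 'l) mod_presheaf" +
 assumes fact_unit: "y:pts X ==> add_pow (Ox y) (fact j :: nat) 1[Ox y]:Units (Ox y)"
begin

lemma divide_fact:
 assumes x: "x:pts X" and M: "module (Ox x) M" and N: "submodule N (Ox x) M" and v: "v:$M"
  and N': "add_pow M (fact j :: nat) v:N"
 shows "v:N"
proof -
 interpret module "Ox x" M by (rule M)
 let ?u = "add_pow (Ox x) (fact j :: nat) 1[Ox x]"
 note u = fact_unit[OF x, of j]
 have i: "inv\<^bsub>Ox x\<^esub> ?u:$(Ox x)" "inv\<^bsub>Ox x\<^esub> ?u *[Ox x] ?u = 1[Ox x]" "?u:$(Ox x)"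
  using R.Units_inv_closed[OF u] R.Units_l_inv[OF u] R.Units_closed[OF u] by auto
 have "inv\<^bsub>Ox x\<^esub> ?u *.[M] (?u *.[M] v):N"
  by (rule submoduleD(4)[OF M N i(1)]) (use N' add_pow_smult[OF M v, of "fact j"] in simp)
 then show ?thesis unfolding smult_assoc1[OF i(1,3) v, symmetric] i(2) smult_one[OF v] .
qed

lemma prate_mult:
 assumes V: "mp V" and W: "mp W" and Z: "mp Z" and be: "sbil V W Z be" and x: "x:pts X"
  and v: "prate x V tt v" and w: "prate x W tt' w"
 shows "prate x Z (tt + tt') (be x v w)"
proof -
 from v obtain c where vc: "v:$(St V x)" and
  c: "!!j d. tt * real j + c <= real_of_int d ==> sw j V x (replicate j v):GG x (Sy j V) d" unfolding prate_def by metis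
 from w obtain c' where wc: "w:$(St W x)" and
  c': "!!j d. tt' * real j + c' <= real_of_int d ==> sw j W x (replicate j w):GG x (Sy j W) d" unfolding prate_def by metis
 note bc = bilinD(1)[OF sbilD(1)[OF be x] vc wc]
 have "sw j Z x (replicate j (be x v w)):GG x (Sy j Z) d" if d: "(tt + tt') * real j + (c + c' + 1) <= real_of_int d" for j d
 proof -
  obtain d1 d2 where d12: "d = d1 + d2" "tt * real j + c <= real_of_int d1" "tt' * real j + c' <= real_of_int d2" using split_rate[OF d] .
  show ?thesis
  proof (rule divide_fact[OF x wsh_module[OF Z x] GG_sub[OF wsh_presh[OF Z] x] wd_carrier[OF Z x replicate_words[OF bc]]])
   show "add_pow (St (Sy j Z) x) (fact j :: nat) (sw j Z x (replicate j (be x v w))):GG x (Sy j Z) d"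
    unfolding sperm_replicate[OF V W Z be x vc wc, symmetric] d12(1)
    by (rule GG_sbil[OF wsh_presh[OF V] wsh_presh[OF W] wsh_presh[OF Z] sperm_sbil[OF V W Z be] x c[OF d12(2)] c'[OF d12(3)]])
  qed
 qed
 then show ?thesis using bc unfolding prate_def by metis
qed

lemma prate_word:
 assumes V: "mp V" and x: "x:pts X" and O: "!!d. n0 <= d ==> full x OX d"
 shows "(ALL v:set l. prate x V tt v) ==> prate x (Sy (length l) V) (real (length l) * tt) (sw (length l) V x l)"
proof (induction l)
 case Nil
 show ?case using prate_empty[OF V x O] by simp
next
 case (Cons v l)
 let ?be = "%y a. smul V 1 (length l) y (sw 1 V y [a])"
 have b: "sbil V (Sy (length l) V) (Sy (1 + length l) V) ?be" by (rule sbil_comp1[OF single_word_smor[OF V] smul_sbil[OF V]])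
 have w: "[v]:words 1 (St V x)" "l:words (length l) (St V x)" using Cons.prems by (auto simp: words_def prate_def)
 have "prate x (Sy (1 + length l) V) (tt + real (length l) * tt) (?be x v (sw (length l) V x l))"
  by (rule prate_mult[OF V wsh_presh[OF V] wsh_presh[OF V] b x]) (use Cons in simp_all)
 then show ?case unfolding smul_sw[OF V x w] by (simp add: algebra_simps)
qed

text \<open>Induction on \<open>T\<close>: collecting all occurrences of one letter \<open>t\<close>
  at the front, which is allowed in a symmetric power, writes a word as a power of \<open>t\<close>
  times a word over the other letters. Each letter adds its own constant and 1 for rounding,
  independently of the length of the word.\<close>

lemma words_rate:
 assumes V: "mp V" and x: "x:pts X" and O: "!!d. n0 <= d ==> full x OX d" and T: "finite T"
 shows "(!!t. t:T ==> prate x V tt t) ==>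
  EX c. ALL l d. set l <= T --> tt * real (length l) + c <= real_of_int d --> sw (length l) V x l:GG x (Sy (length l) V) d"
 using T
proof (induction T)
 case empty
 have "sw 0 V x []:GG x (Sy 0 V) d" if "n0 <= d" for d
  by (rule GG_section[OF wsh_presh[OF V] section_empty_word[OF V] x O[OF that]])
 then show ?case by (intro exI[of _ "real_of_int n0"]) auto
next
 case (insert t T)
 from insert.IH insert.prems obtain c where
  c: "!!l d. set l <= T ==> tt * real (length l) + c <= real_of_int d ==> sw (length l) V x l:GG x (Sy (length l) V) d" by blast
 from insert.prems[of t] obtain c' where tc: "t:$(St V x)" and
  c': "!!j d. tt * real j + c' <= real_of_int d ==> sw j V x (replicate j t):GG x (Sy j V) d" unfolding prate_def by auto
 have Tc: "insert t T <= $(St V x)" using insert.prems unfolding prate_def by blast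
 have "sw (length l) V x l:GG x (Sy (length l) V) d" if l: "set l <= insert t T" and d: "tt * real (length l) + (c + c' + 1) <= real_of_int d" for l d
 proof -
  define j l' where "j = count_list l t" and "l' = filter (%s. s ~= t) l"
  have rj: "replicate j t = filter (%s. s = t) l" unfolding j_def by (induction l) auto
  have ms: "mset l = mset (replicate j t @ l')" unfolding rj l'_def by (induction l) auto
  then have len: "length l = j + length l'" by (metis length_append length_replicate mset_eq_length)
  have l': "set l' <= T" using l by (auto simp: l'_def)
  have w: "l':words (length l') (St V x)" "l:words (j + length l') (St V x)" using l l' Tc len by (auto simp: words_def)
  note w2 = words_append[OF replicate_words[OF tc, of j] w(1)]
  define d1 where "d1 = \<lceil>tt * real j + c'\<rceil>"
  have "tt * real j + c' <= real_of_int d1" "tt * real (length l') + c <= real_of_int (d - d1)"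
   using d of_int_ceiling_le_add_one[of "tt * real j + c'"] le_of_int_ceiling[of "tt * real j + c'"]
   unfolding d1_def len of_nat_add distrib_left of_int_diff by linarith+
  note g = GG_sbil[OF wsh_presh[OF V] wsh_presh[OF V] wsh_presh[OF V] smul_sbil[OF V] x c'[OF this(1)] c[OF l' this(2)]]
  have "sw (j + length l') V x l = sw (j + length l') V x (replicate j t @ l')" by (rule mlinD(4)[OF wd_mlin[OF V x] _ w(2) w2 ms]) simp
  with g show ?thesis unfolding smul_sw[OF V x replicate_words[OF tc] w(1)] len by simp
 qed
 then show ?case by blast
qed

lemma generators_rate:
 assumes V: "mp V" and x: "x:pts X" and O: "!!d. n0 <= d ==> full x OX d" and T: "finite T"
  and p: "!!t. t:T ==> prate x V tt t" and s: "module_span (Ox x) (St V x) T = $(St V x)"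
 shows "rate x V tt"
proof -
 have Tc: "T <= $(St V x)" using p unfolding prate_def by blast
 from words_rate[OF V x O T p] obtain c where
  c: "!!l d. set l <= T ==> tt * real (length l) + c <= real_of_int d ==> sw (length l) V x l:GG x (Sy (length l) V) d" by metis
 have "full x (Sy m V) d" if d: "tt * real m + c <= real_of_int d" for m d
 proof (rule words_in_full[OF V x])
  fix l assume l: "l:words m (St V x)"
  show "sw m V x l:GG x (Sy m V) d"
   by (rule mlin_span[OF wd_mlin[OF V x] stalk_module[OF V x] wsh_module[OF V x] Tc s GG_sub[OF wsh_presh[OF V] x] _ l])
    (use c d in "auto simp: words_def")
 qed
 then show ?thesis unfolding rate_def by blast
qed

text \<open>Every monomial of degree \<open>q\<close> in the generators collects the slope
  \<open>tt\<close> from each of its \<open>q\<close> letters. The monomials are finite in number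
  and generate, so \<open>generators_rate\<close> applies to the symmetric power itself.\<close>

lemma Sy_rate:
 assumes V: "mp V" and x: "x:pts X" and O: "!!d. n0 <= d ==> full x OX d" and T: "finite T"
  and p: "!!t. t:T ==> prate x V tt t" and s: "module_span (Ox x) (St V x) T = $(St V x)"
 shows "rate x (Sy q V) (real q * tt)"
proof -
 have Tc: "T <= $(St V x)" using p unfolding prate_def by blast
 let ?L = "{l. set l <= T & length l = q}"
 have Lw: "sw q V x ` ?L <= $(St (Sy q V) x)" using wd_carrier[OF V x] Tc by (force simp: words_def)
 show ?thesis
 proof (rule generators_rate[OF wsh_presh[OF V] x O])
  show "finite (sw q V x ` ?L)" using finite_lists_length_eq[OF T] by simp
  show "prate x (Sy q V) (real q * tt) t" if "t:sw q V x ` ?L" for t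
  proof -
   from that obtain l where l: "set l <= T" "length l = q" "t = sw q V x l" by (elim imageE CollectE conjE)
   show ?thesis using prate_word[OF V x O, where l = l and tt = tt] p l by blast
  qed
  note S = span_submodule[OF wsh_module[OF V x] Lw]
  have "sw q V x l:module_span (Ox x) (St (Sy q V) x) (sw q V x ` ?L)" if "l:words q (St V x)" for l
   by (rule mlin_span[OF wd_mlin[OF V x] stalk_module[OF V x] wsh_module[OF V x] Tc s S _ that])
    (rule span_incl, rule imageI, simp add: words_def)
  then show "module_span (Ox x) (St (Sy q V) x) (sw q V x ` ?L) = $(St (Sy q V) x)"
   using span_least[OF S, of "sw q V x ` words q (St V x)"] wd_span[OF V x, of True q] span_carrier[OF wsh_module[OF V x] Lw]
   by (intro subset_antisym) (simp_all add: image_subset_iff)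
 qed
qed

end

section \<open>Multilinear maps on a free module of rank one\<close>

definition cprod :: "'r ring => ('r, 'm) module => 'm => 'm list => 'r" where
 "cprod R L g l = foldr (%a r. coef R L g a *[R] r) l 1[R]"

context
 fixes R :: "'r ring" and L :: "('r, 'm) module" and g
 assumes L: "module R L" and g: "basis1 R L g"
begin

interpretation module R L by (rule L)

lemma basis_carrier: "g:$L" using g by (simp add: basis1_def)

lemma coef_basis: "coef R L g g = 1[R]"
 using coef_smult[OF g L R.one_closed] smult_one[OF basis_carrier] by simp

lemma cprod_closed: "set l <= $L ==> cprod R L g l:$R"
 by (induction l) (simp_all add: cprod_def coef(1)[OF g])

lemma cprod_update:
 "set l <= $L ==> i < length l ==> x:$L ==> cprod R L g (l[i := x]) = coef R L g x *[R] cprod R L g (l[i := g])"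
proof (induction l arbitrary: i)
 case (Cons a l)
 note c = coef(1)[OF g]
 have cl: "cprod R L g (l[j := g]):$R" for j
  using Cons.prems(1) set_update_subset_insert[of l j g] basis_carrier by (intro cprod_closed) auto
 show ?case
 proof (cases i)
  case 0
  then show ?thesis using Cons.prems c[of x] cprod_closed[of l] by (simp add: cprod_def coef_basis)
 next
  case (Suc j)
  have "coef R L g a *[R] (coef R L g x *[R] cprod R L g (l[j := g])) = coef R L g x *[R] (coef R L g a *[R] cprod R L g (l[j := g]))"
   using c[of a] c[of x] cl[of j] Cons.prems by (simp add: R.m_lcomm)
  then show ?thesis using Cons Suc by (simp add: cprod_def)
 qed
qed simp

text \<open>The target is any module record with the carrier and operations of the ring. This covers
  the stalk of \<open>OX\<close> and also an ad hoc copy of \<open>R\<close> as a module over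
  itself.\<close>

lemma cprod_mlin:
 assumes M: "$M = $R" "add M = add R" "!!r a. r *.[M] a = r *[R] a"
 shows "mlin False R n L M (cprod R L g)"
proof (rule mlinI)
 fix l i assume l: "l:words n L" and i: "i < n"
 then have ls: "set l <= $L" "i < length l" by (auto simp: words_def)
 have cl: "cprod R L g (l[i := g]):$R"
  using ls set_update_subset_insert[of l i g] basis_carrier by (intro cprod_closed) auto
 note u = cprod_update[OF ls]
 show "cprod R L g (l[i := x +[L] y]) = cprod R L g (l[i := x]) +[M] cprod R L g (l[i := y])"
  if "x:$L" "y:$L" for x y
  unfolding M(2) u[OF that(1)] u[OF that(2)] u[OF add.m_closed[OF that]]
  using coef_hom(1)[OF g L that R.one_closed] coef(1)[OF g that(1)] coef(1)[OF g that(2)] cl by (simp add: R.l_distr)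
 show "cprod R L g (l[i := r *.[L] x]) = r *.[M] cprod R L g (l[i := x])"
  if "r:$R" "x:$L" for r x
  unfolding M(3) u[OF that(2)] u[OF smult_closed[OF that]]
  using coef_hom(2)[OF g L that(2,2,1)] coef(1)[OF g that(2)] cl that by (simp add: R.m_assoc)
qed (use cprod_closed M in "auto simp: words_def")

lemma cprod_replicate: "cprod R L g (replicate n g) = 1[R]"
 by (induction n) (simp_all add: cprod_def coef_basis)

lemma basis_span: "module_span R L {g} = $L"
proof
 show "module_span R L {g} <= $L" using basis_carrier by (intro span_carrier[OF L]) simp
 show "$L <= module_span R L {g}"
 proof
  fix m assume m: "m:$L"
  show "m:module_span R L {g}"
   using submoduleD(4)[OF L span_submodule[OF L, of "{g}"] coef(1)[OF g m], of g] span_incl[of g "{g}" R L] basis_carrier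
   unfolding coef(2)[OF g m] by simp
 qed
qed

text \<open>One basis vector generates, so both sides need to agree only on the constant word in
  \<open>g\<close>, where the product of coefficients is 1. No symmetry of \<open>b\<close> is
  involved; hence this applies to tensor powers.\<close>

lemma mlin_cprod:
 assumes b: "mlin False R n L Z b" and Z: "module R Z" and l: "l:words n L"
 shows "b l = cprod R L g l *.[Z] b (replicate n g)"
proof (rule mlin_eq_on_span[OF b _ L Z _ basis_span _ l])
 let ?M = "\<lparr>carrier = $R, monoid.mult = undefined, one = undefined, zero = 0[R], add = add R, smult = monoid.mult R\<rparr>"
 have gw: "replicate n g:words n L" using basis_carrier by (auto simp: words_def)
 note bg = mlinD(1)[OF b gw]
 interpret Z: module R Z by (rule Z)
 show "mlin False R n L Z (%l. cprod R L g l *.[Z] b (replicate n g))"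
 proof (rule mlin_comp[where b = "cprod R L g" and Z = ?M and f = "%r. r *.[Z] b (replicate n g)", OF _ _ L])
  show "mlin False R n L ?M (cprod R L g)" by (rule cprod_mlin) simp_all
  show "lin R ?M Z (%r. r *.[Z] b (replicate n g))"
   by (rule slinI) (simp_all add: Z.smult_l_distr[OF _ _ bg] Z.smult_assoc1[OF _ _ bg] Z.smult_closed[OF _ bg])
 qed
 fix l assume "l:words n L" "set l <= {g}"
 then have "l = replicate n g" by (auto simp: words_def intro!: replicate_eqI)
 then show "b l = cprod R L g l *.[Z] b (replicate n g)" using Z.smult_one[OF bg] by (simp add: cprod_replicate)
qed (use basis_carrier in simp)

end

context line_bundle
begin

lemma lsec_pts: "mp V ==> lse V (pts X) ta ==> op U ==> lse V U ta"
 by (rule lsec_subset) (use op_pts in auto)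

section \<open>Sections of V tensor L^m as twisted families, for L the bundle A
  (\<open>ep = 1\<close>) or its dual (\<open>ep = -1\<close>)\<close>

context
 fixes L :: "('x, 'r, 'b) mod_presheaf" and ep :: int and lb
 assumes Lp: "mp L" and lb: "!!y. y:pts X ==> basis1 (Ox y) (St L y) (lb y)"
  and lb_lsec: "!!U a. frame U a ==> lse L U (%y. up U a ep y *.[St L y] lb y)"
  and coef_lsec: "!!U a W sg. frame U a ==> W <= U ==> lse L W sg ==>
   lse OX W (%y. up U a (- ep) y *[Ox y] coef (Ox y) (St L y) (lb y) (sg y))"
begin

abbreviation "LL m \<equiv> wsh False m L"
abbreviation "pw m y \<equiv> wd False m L y (replicate m (lb y))"
abbreviation "cpr m y \<equiv> wl L False m (St OX y) y (cprod (Ox y) (St L y) (lb y))"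

lemma cprod_OX_mlin: "y:pts X ==> mlin False (Ox y) m (St L y) (St OX y) (cprod (Ox y) (St L y) (lb y))"
 by (rule cprod_mlin[OF stalk_module[OF Lp] lb]) (simp_all add: OX_stalk)

text \<open>Together these facts say that \<open>pw m y\<close> is a basis of the stalk of the
  tensor power and that \<open>cpr m y\<close> is the coordinate with respect to it.\<close>

lemma cpr:
 assumes y: "y:pts X"
 shows "lin (Ox y) (St (LL m) y) (St OX y) (cpr m y)"
  and "l:words m (St L y) ==> cpr m y (wd False m L y l) = cprod (Ox y) (St L y) (lb y) l"
  and "p:$(St (LL m) y) ==> cpr m y p *.[St (LL m) y] pw m y = p"
  and "cpr m y (pw m y) = 1[Ox y]" and "pw m y:$(St (LL m) y)"
proof -
 note My = stalk_module[OF Lp y] and Wy = wsh_module[OF Lp y, of False m]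
 interpret W: module "Ox y" "St (LL m) y" by (rule Wy)
 note w = wl[OF Lp y stalk_module[OF OX_presh y] cprod_OX_mlin[OF y, of m]]
 show l: "lin (Ox y) (St (LL m) y) (St OX y) (cpr m y)" by (rule w(1))
 show v: "cpr m y (wd False m L y l) = cprod (Ox y) (St L y) (lb y) l" if "l:words m (St L y)" for l by (rule w(2)[OF that])
 have gw: "replicate m (lb y):words m (St L y)" by (rule replicate_words[OF basis_carrier[OF My lb[OF y]]])
 show "cpr m y (pw m y) = 1[Ox y]" unfolding v[OF gw] by (rule cprod_replicate[OF My lb[OF y]])
 show pc: "pw m y:$(St (LL m) y)" by (rule wd_carrier[OF Lp y gw])
 show "cpr m y p *.[St (LL m) y] pw m y = p" if "p:$(St (LL m) y)"
 proof (rule wsh_eq[OF Lp y Wy _ _ _ that])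
  show "lin (Ox y) (St (LL m) y) (St (LL m) y) (%p. cpr m y p *.[St (LL m) y] pw m y)"
   by (rule slinI) (use slinD[OF l] pc in "simp_all add: OX_stalk W.smult_l_distr W.smult_assoc1")
  show "lin (Ox y) (St (LL m) y) (St (LL m) y) (%p. p)" by (simp add: slin_def)
  show "cpr m y (wd False m L y l) *.[St (LL m) y] pw m y = wd False m L y l" if l: "l:words m (St L y)" for l
   unfolding v[OF l] by (rule mlin_cprod[OF My lb[OF y] wd_mlin[OF Lp y] Wy l, symmetric])
 qed
qed

text \<open>On words of local sections the coordinate is a product of coefficients. Each factor
  becomes local after multiplication by the power \<open>- ep\<close> of \<open>uu\<close>, and the
  exponents add up over the \<open>m\<close> letters.\<close>

lemma cpr_lsec:
 assumes f: "frame U a" and W: "W <= U" and sg: "lse (LL m) W sg"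
 shows "lse OX W (%y. up U a (- (ep * int m)) y *[Ox y] cpr m y (sg y))"
proof (rule wd_cont[OF Lp OX_presh _ _ sg])
 fix y assume "y:W"
 then have y: "y:U" "y:pts X" using W frame_pts[OF f] by auto
 interpret cring "Ox y" by (rule stalk_cring[OF y(2)])
 show "lin (Ox y) (St (LL m) y) (St OX y) (%p. up U a (- (ep * int m)) y *[Ox y] cpr m y p)"
  using slinD[OF cpr(1)[OF y(2), of m]] up(1)[OF f y(1)] by (intro slinI) (simp_all add: OX_stalk r_distr m_lcomm)
next
 fix V sgs assume V: "op V" "V <= W" and len: "length sgs = m" and s: "!!sg. sg:set sgs ==> lse L V sg"
 let ?c = "%y. coef (Ox y) (St L y) (lb y)"
 have VU: "V <= U" using V W by auto
 have "lse OX V (%y. up U a (- (ep * int (length sgs))) y *[Ox y] cprod (Ox y) (St L y) (lb y) (map (%sg. sg y) sgs))"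
  using s
 proof (induction sgs)
  case Nil
  have "up U a 0 y *[Ox y] 1[Ox y] = 1[Ox y]" if "y:V" for y
   using up(4)[OF f] VU that cring.cring_simprules(12)[OF stalk_cring[OF op_pts[OF V(1) that]]] cring.cring_simprules(6)[OF stalk_cring[OF op_pts[OF V(1) that]]] by auto
  then show ?case using lsec_cong[OF OX_presh rsec_one[OF V(1)]] by (simp add: cprod_def)
 next
  case (Cons ta sgs)
  have ta: "lse L V ta" using Cons.prems by simp
  show ?case
  proof (rule lsec_cong[OF OX_presh rsec_mult[OF coef_lsec[OF f VU ta] Cons.IH]])
   fix y assume y: "y:V"
   have yU: "y:U" and yp: "y:pts X" using y VU frame_pts[OF f] by auto
   interpret cring "Ox y" by (rule stalk_cring[OF yp])
   have tay: "?c y (ta y):$(Ox y)" by (rule coef(1)[OF lb[OF yp] lsec_carrier[OF Lp ta y]])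
   have "set (map (%sg. sg y) sgs) <= $(St L y)" using lsec_carrier[OF Lp _ y] Cons.prems by auto
   note cc = cprod_closed[OF stalk_module[OF Lp yp] lb[OF yp] this]
   have e: "up U a (- (ep * int (length (ta # sgs)))) y = up U a (- ep) y *[Ox y] up U a (- (ep * int (length sgs))) y"
    unfolding up(3)[OF f yU, symmetric] by (simp add: algebra_simps)
   show "up U a (- ep) y *[Ox y] ?c y (ta y) *[Ox y] (up U a (- (ep * int (length sgs))) y *[Ox y] cprod (Ox y) (St L y) (lb y) (map (%sg. sg y) sgs)) =
     up U a (- (ep * int (length (ta # sgs)))) y *[Ox y] cprod (Ox y) (St L y) (lb y) (map (%sg. sg y) (ta # sgs))"
    unfolding e using up(1)[OF f yU] tay cc by (simp add: cprod_def m_ac)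
  qed (use Cons.prems in simp)
 qed
 then show "lse OX V (%y. up U a (- (ep * int m)) y *[Ox y] cpr m y (wd False m L y (map (%sg. sg y) sgs)))"
  unfolding len
 proof (elim lsec_cong[OF OX_presh])
  fix y assume y: "y:V"
  have "map (%sg. sg y) sgs:words m (St L y)" by (rule words_lsec[OF Lp _ y len]) (use s in simp)
  from cpr(2)[OF op_pts[OF V(1) y] this] show "up U a (- (ep * int m)) y *[Ox y] cprod (Ox y) (St L y) (lb y) (map (%sg. sg y) sgs) =
   up U a (- (ep * int m)) y *[Ox y] cpr m y (wd False m L y (map (%sg. sg y) sgs))" by simp
 qed
qed

lemma pw_lsec:
 assumes f: "frame U a"
 shows "lse (LL m) U (%y. up U a (ep * int m) y *.[St (LL m) y] pw m y)"
proof (rule lsec_cong[OF wsh_presh[OF Lp] wd_lsec[OF Lp frame_op[OF f], of "replicate m (%y. up U a ep y *.[St L y] lb y)" m]])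
 fix y assume y: "y:U"
 note yp = frame_pts[OF f y]
 show "wd False m L y (map (%sg. sg y) (replicate m (%y. up U a ep y *.[St L y] lb y))) = up U a (ep * int m) y *.[St (LL m) y] pw m y"
  using mlin_replicate[OF wd_mlin[OF Lp yp] stalk_module[OF Lp yp] wsh_module[OF Lp yp] up(1)[OF f y] basis_carrier[OF stalk_module[OF Lp yp] lb[OF yp]], of False m ep]
  by (simp add: up(6)[OF f y] mult.commute)
qed (use lb_lsec[OF f] in auto)

context
 fixes V :: "('x, 'r, 'm) mod_presheaf" and m :: nat
 assumes V: "mp V"
begin

lemmas Tp = tsh_presh[OF V wsh_presh[OF Lp, of False m]]
abbreviation "tw \<equiv> %y v. td V (LL m) y v (pw m y)"

text \<open>The inverse on stalks of tensoring with \<open>pw m y\<close>: the second factor is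
  replaced by its coordinate.\<close>

lemma untwist:
 "EX g. ALL y:pts X. lin (Ox y) (St (tsh V (LL m)) y) (St V y) (g y) &
  (ALL v:$(St V y). ALL p:$(St (LL m) y). g y (td V (LL m) y v p) = cpr m y p *.[St V y] v)"
proof (rule bchoice, rule ballI)
 fix y assume y: "y:pts X"
 interpret V: module "Ox y" "St V y" by (rule stalk_module[OF V y])
 have "bilin (Ox y) (St V y) (St (LL m) y) (St V y) (%v p. cpr m y p *.[St V y] v)"
  unfolding bilin_def using slinD[OF cpr(1)[OF y, of m]]
  by (auto intro!: slinI simp: OX_stalk V.smult_l_distr V.smult_r_distr V.smult_assoc1[symmetric] V.R.m_comm)
 from td_lift[OF V wsh_presh[OF Lp] y stalk_module[OF V y] this]
 show "EX psi. lin (Ox y) (St (tsh V (LL m)) y) (St V y) psi &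
  (ALL v:$(St V y). ALL p:$(St (LL m) y). psi (td V (LL m) y v p) = cpr m y p *.[St V y] v)" .
qed

lemma tw_lin: "y:pts X ==> lin (Ox y) (St V y) (St (tsh V (LL m)) y) (tw y)"
 by (rule bilin_lin(2)[OF td_bilin[OF V wsh_presh[OF Lp]] cpr(5)])

text \<open>Neither the family \<open>s\<close> nor the chosen generators need be local sections.
  Over a frame both become so after multiplication by opposite powers of \<open>uu\<close>, which
  cancel in the tensor product.\<close>

lemma twist_lsec:
 assumes s: "TS V (ep * int m) s"
 shows "lse (tsh V (LL m)) (pts X) (%y. tw y (s y))"
proof (rule lsec_local[OF Tp pts_op])
 fix y assume y: "y:pts X"
 from frame_exists[OF y] obtain U a where f: "frame U a" and yU: "y:U" by metis
 have "lse (tsh V (LL m)) U (%y. tw y (s y))"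
 proof (rule lsec_cong[OF Tp td_lsec[OF V wsh_presh[OF Lp] TSD(2)[OF s f] pw_lsec[OF f, of m]]])
  fix z assume z: "z:U"
  note zp = frame_pts[OF f z]
  note B = bilinD[OF td_bilin[OF V wsh_presh[OF Lp, of False m] zp]] and sz = TSD(1)[OF s zp] and p = cpr(5)[OF zp, of m]
  note c = up(1)[OF f z]
  have pc: "up U a (ep * int m) z *.[St (LL m) z] pw m z:$(St (LL m) z)"
   by (rule up_smult(3)[OF f z wsh_module[OF Lp zp] p])
  show "td V (LL m) z (up U a (- (ep * int m)) z *.[St V z] s z) (up U a (ep * int m) z *.[St (LL m) z] pw m z) = tw z (s z)"
   unfolding B(4)[OF c sz pc] B(5)[OF c sz p] up_smult(1)[OF f z stalk_module[OF Tp zp] B(1)[OF sz p]]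
   using up_smult(2)[OF f z stalk_module[OF Tp zp] B(1)[OF sz p]] by simp
 qed
 then show "EX W. y:W & W <= pts X & lse (tsh V (LL m)) W (%y. tw y (s y))"
  using yU frame_pts[OF f] by (intro exI[of _ U]) blast
qed

text \<open>Tensoring with the generator \<open>pw m x\<close> identifies the stalks of
  \<open>V\<close> and of the twisted sheaf. It carries the multiples by the maximal ideal to each
  other, and the values of twisted families to the values of global sections; the condition on
  fibres is then the same on both sides.\<close>

theorem Bs_twist:
 assumes x: "x:pts X"
 shows "x \<notin> Bs X (tsh V (LL m)) <-> full x V (ep * int m)"
proof -
 let ?T = "tsh V (LL m)"
 from untwist obtain g where g: "!!y. y:pts X ==> lin (Ox y) (St ?T y) (St V y) (g y)"
  "!!y v p. y:pts X ==> v:$(St V y) ==> p:$(St (LL m) y) ==> g y (td V (LL m) y v p) = cpr m y p *.[St V y] v"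
  by metis
 have gt: "g y (tw y v) = v" if "y:pts X" "v:$(St V y)" for y v
  using g(2)[OF that cpr(5)[OF that(1)]] cpr(4)[OF that(1)] module.smult_one[OF stalk_module[OF V that(1)] that(2)] by simp
 have tg: "tw y (g y t) = t" if y: "y:pts X" and t: "t:$(St ?T y)" for y t
 proof (rule slin_eq_on_span[OF lin_comp[OF g(1)[OF y] tw_lin[OF y]] _ stalk_module[OF Tp y] stalk_module[OF Tp y] rstalk_fun])
  note B = bilinD[OF td_bilin[OF V wsh_presh[OF Lp, of False m] y]]
  show "lin (Ox y) (St ?T y) (St ?T y) (%t. t)" by (simp add: slin_def)
  let ?G = "(%(a, b). td V (LL m) y a b) ` ($(St V y) \<times> $(St (LL m) y))"
  show "?G <= $(St ?T y)" using B(1) by auto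
  show "t:module_span (Ox y) (St ?T y) ?G" using t td_span[OF V wsh_presh[OF Lp] y] by simp
  fix t assume "t:?G"
  then obtain v p where v: "v:$(St V y)" and p: "p:$(St (LL m) y)" and t: "t = td V (LL m) y v p" by auto
  have c: "cpr m y p:$(Ox y)" using slinD(1)[OF cpr(1)[OF y] p] by (simp add: OX_stalk)
  show "tw y (g y t) = t"
   unfolding t g(2)[OF y v p] B(4)[OF c v cpr(5)[OF y]] B(5)[OF c v cpr(5)[OF y], symmetric] cpr(3)[OF y p] ..
 qed
 let ?S = "mprod x (St V x) Un {s x | s. TS V (ep * int m) s}"
 have bij: "bij_betw (tw x) ($(St V x)) ($(St ?T x))"
  by (rule bij_betwI[of _ _ _ "g x"]) (use slinD(1)[OF tw_lin[OF x]] slinD(1)[OF g(1)[OF x]] gt[OF x] tg[OF x] in auto)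
 then have surj: "tw x ` $(St V x) = $(St ?T x)" and inj: "inj_on (tw x) ($(St V x))"
  by (simp_all add: bij_betw_def)
 have mp: "tw x ` mprod x (St V x) = mprod x (St ?T x)"
 proof -
  have mc: "mu:$(Ox x)" if "mu:max_ideal (Ox x)" for mu using that stalk_ideal[OF x] by (rule ideal.Icarr[rotated])
  have "mprod x (St ?T x) = (%(mu, t). mu *.[St ?T x] t) ` (max_ideal (Ox x) \<times> tw x ` $(St V x))"
   unfolding surj mprod_def by auto
  also have "\<dots> = tw x ` mprod x (St V x)"
   unfolding mprod_def using slinD(3)[OF tw_lin[OF x] mc] by (auto simp: image_iff) metis+
  finally show ?thesis ..
 qed
 have ts: "tw x ` {s x | s. TS V (ep * int m) s} = mg ?T x (pts X) ` $(msec ?T (pts X))"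
 proof (intro equalityI subsetI)
  fix t assume "t:tw x ` {s x | s. TS V (ep * int m) s}"
  then obtain s where s: "TS V (ep * int m) s" "t = tw x (s x)" by (elim imageE CollectE exE conjE) simp
  show "t:mg ?T x (pts X) ` $(msec ?T (pts X))"
   using sheaf_lsec[OF tsh_sheaf[OF V wsh_presh[OF Lp]] twist_lsec[OF s(1)]] x s(2) by (metis imageI)
 next
  fix t assume "t:mg ?T x (pts X) ` $(msec ?T (pts X))"
  then obtain b where b: "b:$(msec ?T (pts X))" "t = mg ?T x (pts X) b" by (elim imageE)
  define ta where "ta y = mg ?T y (pts X) b" for y
  have ta: "lse ?T (pts X) ta" unfolding ta_def by (rule lsec_germ[OF Tp pts_op b(1)])
  \<comment> \<open>A global section of the twisted sheaf is untwisted point by point. Linearity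
    reduces the required continuity to pure tensors, where it is that of the coordinate
    \<open>cpr\<close>.\<close>
  have "TS V (ep * int m) (%y. g y (ta y))"
   unfolding TS_def
  proof (intro conjI ballI allI impI)
   show "g y (ta y):$(St V y)" if y: "y:pts X" for y by (rule slinD(1)[OF g(1)[OF y] lsec_carrier[OF Tp ta y]])
   fix U a assume f: "frame U a"
   show "lse V U (%y. up U a (- (ep * int m)) y *.[St V y] g y (ta y))"
   proof (rule td_cont[OF V wsh_presh[OF Lp] V _ _ lsec_pts[OF Tp ta frame_op[OF f]]])
    show "lin (Ox y) (St ?T y) (St V y) (%t. up U a (- (ep * int m)) y *.[St V y] g y t)" if "y:U" for y
     by (rule lin_smult[OF stalk_module[OF V frame_pts[OF f that]] g(1)[OF frame_pts[OF f that]] up(1)[OF f that]])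
    fix W sg p assume W: "op W" "W <= U" and sg: "lse V W sg" and p: "lse (LL m) W p"
    show "lse V W (%y. up U a (- (ep * int m)) y *.[St V y] g y (td V (LL m) y (sg y) (p y)))"
    proof (rule lsec_cong[OF V lsec_smult[OF V cpr_lsec[OF f W(2) p] sg]])
     fix y assume y: "y:W"
     have yU: "y:U" and yp: "y:pts X" using y W op_pts by auto
     have sy: "sg y:$(St V y)" and py: "p y:$(St (LL m) y)" 
      by (rule lsec_carrier[OF V sg y], rule lsec_carrier[OF wsh_presh[OF Lp] p y])
     have c: "cpr m y (p y):$(Ox y)" using slinD(1)[OF cpr(1)[OF yp] py] by (simp add: OX_stalk)
     show "(up U a (- (ep * int m)) y *[Ox y] cpr m y (p y)) *.[St V y] sg y = up U a (- (ep * int m)) y *.[St V y] g y (td V (LL m) y (sg y) (p y))"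
      unfolding g(2)[OF yp sy py] by (rule module.smult_assoc1[OF stalk_module[OF V yp] up(1)[OF f yU] c sy])
    qed
   qed
  qed
  moreover have "t = tw x (g x (ta x))" using tg[OF x] lsec_carrier[OF Tp ta x] by (simp add: ta_def b(2))
  ultimately show "t:tw x ` {s x | s. TS V (ep * int m) s}" by (intro image_eqI[of _ _ "g x (ta x)"]) auto
 qed
 have "x \<notin> Bs X ?T <-> module_span (Ox x) (St ?T x) (tw x ` ?S) = $(St ?T x)"
  unfolding Bs_iff[OF Tp x] image_Un mp ts ..
 also have "\<dots> <-> tw x ` GG x V (ep * int m) = tw x ` $(St V x)"
  unfolding span_image_iff[OF tw_lin[OF x] stalk_module[OF V x] stalk_module[OF Tp x] surj GG_gens[OF V x]] surj GG_def ..
 also have "\<dots> <-> full x V (ep * int m)"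
  unfolding full_def using inj_on_image_eq_iff[OF inj submoduleD(1)[OF stalk_module[OF V x] GG_sub[OF V x]] subset_refl] .
 finally show ?thesis .
qed

end

end

theorem Bs_twist_A:
 assumes V: "mp V" and x: "x:pts X"
 shows "x \<notin> Bs X (tsh V (wsh False m A)) <-> full x V (int m)"
proof -
 have "x \<notin> Bs X (tsh V (wsh False m A)) <-> full x V (1 * int m)"
 proof (rule Bs_twist[OF A_presh _ _ _ V x])
  show "basis1 (Ox y) (St A y) (al y)" if "y:pts X" for y by (rule al_basis[OF that])
  show "lse A U (%y. up U a 1 y *.[St A y] al y)" if f: "frame U a" for U a
   by (rule lsec_cong[OF A_presh lsec_germ[OF A_presh frame_op[OF f]]]) (use f in "simp_all add: up(5) uu(2) gframe_def")
  fix U a W sg assume f: "frame U a" and W: "W <= U" and sg: "lse A W sg"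
  from frame_lsec[OF f W sg] obtain c where c: "lse OX W c" "!!y. y:W ==> sg y = c y *.[St A y] mg A y U a" by metis
  show "lse OX W (%y. up U a (- 1) y *[Ox y] coef (Ox y) (St A y) (al y) (sg y))"
  proof (rule lsec_cong[OF OX_presh c(1)])
   fix y assume y: "y:W"
   have yU: "y:U" and yp: "y:pts X" using y W frame_pts[OF f] by auto
   interpret cring "Ox y" by (rule stalk_cring[OF yp])
   have cy: "c y:$(Ox y)" by (rule rsec_carrier[OF c(1) y])
   note u = up(1)[OF f yU]
   have "sg y = (c y *[Ox y] up U a 1 y) *.[St A y] al y"
    unfolding c(2)[OF y] uu(2)[OF f yU, symmetric] up(5)[OF f yU, symmetric]
    by (rule module.smult_assoc1[OF stalk_module[OF A_presh yp] cy u basis_carrier[OF stalk_module[OF A_presh yp] al_basis[OF yp]], symmetric])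
   then have "coef (Ox y) (St A y) (al y) (sg y) = c y *[Ox y] up U a 1 y"
    using coef_smult[OF al_basis[OF yp] stalk_module[OF A_presh yp] m_closed[OF cy u]] by simp
   then show "c y = up U a (- 1) y *[Ox y] coef (Ox y) (St A y) (al y) (sg y)"
    using up(8)[OF f yU, of 1] cy u by (simp add: m_lcomm)
  qed
 qed
 then show ?thesis by simp
qed

end

section \<open>The dual of a line bundle\<close>

context lrs
begin

context
 fixes M :: "('x, 'r, 'm) mod_presheaf"
 assumes M: "mp M"
begin

text \<open>The normal form of a section of the dual: \<open>dual_sheaf\<close> demands fixed
  default values for meaningless arguments, and \<open>dr\<close> enforces them. Equalities then
  have to be checked on meaningful arguments only.\<close>

definition dr :: "'x set => ('x set => 'm => 'r) => 'x set => 'm => 'r" where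
 "dr U f = (\<lambda>W\<in>opens_in X U. \<lambda>a\<in>$(msec M W). f W a)"

abbreviation "DM \<equiv> dual_sheaf X M"

lemma dr_app: "op W ==> W <= U ==> a:$(msec M W) ==> dr U f W a = f W a"
 by (simp add: dr_def opens_in_def)

lemma dr_eq: "(!!W a. op W ==> W <= U ==> a:$(msec M W) ==> f W a = g W a) ==> dr U f = dr U g"
 unfolding dr_def by (intro restrict_ext) (simp add: opens_in_def)

lemma dual_simps:
 "0[msec DM U] = dr U (%W a. 0[SX W])"
 "phi +[msec DM U] psi = dr U (%W a. phi W a +[SX W] psi W a)"
 "r *.[msec DM U] phi = dr U (%W a. res X U W r *[SX W] phi W a)"
 "mres DM U V phi = restrict phi (opens_in X V)"
 by (simp_all add: dual_sheaf_def dr_def)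

lemma dualD:
 assumes "phi:$(msec DM U)"
 shows "op W ==> W <= U ==> a:$(msec M W) ==> phi W a:$(SX W)"
  and "op W ==> W <= U ==> a:$(msec M W) ==> b:$(msec M W) ==> phi W (a +[msec M W] b) = phi W a +[SX W] phi W b"
  and "op W ==> W <= U ==> r:$(SX W) ==> a:$(msec M W) ==> phi W (r *.[msec M W] a) = r *[SX W] phi W a"
  and "op W ==> W <= U ==> op W' ==> W' <= W ==> a:$(msec M W) ==> phi W' (mres M W W' a) = res X W W' (phi W a)"
  and "phi = dr U phi"
proof -
 have e: "phi:extensional (opens_in X U)" "!!W. W:opens_in X U ==> phi W:extensional ($(msec M W))"
  and h: "mod_hom X U M OX phi" using assms by (simp_all add: dual_sheaf_def)
 note h = h[unfolded mod_hom_def, rule_format, unfolded opens_in_def mem_Collect_eq]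
 show "op W ==> W <= U ==> a:$(msec M W) ==> phi W a:$(SX W)" using h[of W] by (auto simp: OX_carrier)
 show "op W ==> W <= U ==> a:$(msec M W) ==> b:$(msec M W) ==> phi W (a +[msec M W] b) = phi W a +[SX W] phi W b"
  "op W ==> W <= U ==> r:$(SX W) ==> a:$(msec M W) ==> phi W (r *.[msec M W] a) = r *[SX W] phi W a"
  "op W ==> W <= U ==> op W' ==> W' <= W ==> a:$(msec M W) ==> phi W' (mres M W W' a) = res X W W' (phi W a)"
  using h[of W] by (simp_all add: structure_module_def)
 show "phi = dr U phi" unfolding dr_def
  by (rule extensionalityI[OF e(1)]) (use extensional_restrict[OF e(2)] in auto)
qed

lemma dr_carrier:
 assumes "!!W a. op W ==> W <= U ==> a:$(msec M W) ==> f W a:$(SX W)"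
  and "!!W a b. op W ==> W <= U ==> a:$(msec M W) ==> b:$(msec M W) ==> f W (a +[msec M W] b) = f W a +[SX W] f W b"
  and "!!W r a. op W ==> W <= U ==> r:$(SX W) ==> a:$(msec M W) ==> f W (r *.[msec M W] a) = r *[SX W] f W a"
  and "!!W W' a. op W ==> W <= U ==> op W' ==> W' <= W ==> a:$(msec M W) ==> f W' (mres M W W' a) = res X W W' (f W a)"
 shows "dr U f:$(msec DM U)"
proof -
 have W: "!!W. W:opens_in X U ==> op W & W <= U" by (simp add: opens_in_def)
 have c: "a +[msec M W] b:$(msec M W)" "r *.[msec M W] a:$(msec M W)"
  if "op W" "a:$(msec M W)" "b:$(msec M W)" "r:$(SX W)" for W a b r
  using abelian_groupE(1)[OF module_groups(1)[OF P'(1)[OF M that(1)]]] module.smult_closed[OF P'(1)[OF M that(1)]] that by auto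
 have z: "0[SX W]:$(SX W)" if "op W" for W using sec_cring[OF that] by (simp add: cring_def ring.ring_simprules)
 have "mod_hom X U M OX (dr U f)"
  unfolding mod_hom_def
 proof (intro ballI conjI funcsetI)
  fix V assume V: "V:opens_in X U"
  note o = W[OF V, THEN conjunct1] W[OF V, THEN conjunct2]
  fix a assume a: "a:$(msec M V)"
  show "dr U f V a:$(msec OX V)" using assms(1)[OF o a] by (simp add: dr_app[OF o a] OX_carrier)
  show "dr U f V (a +[msec M V] b) = dr U f V a +[msec OX V] dr U f V b" if "b:$(msec M V)" for b
   using assms(2)[OF o a that] c(1)[OF o(1) a that z[OF o(1)]] by (simp add: dr_app[OF o] a that structure_module_def)
  show "dr U f V (r *.[msec M V] a) = r *.[msec OX V] dr U f V a" if "r:$(SX V)" for r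
   using assms(3)[OF o that a] c(2)[OF o(1) a a that] by (simp add: dr_app[OF o] a that structure_module_def)
  fix V' assume "V':opens_in X V"
  then have V': "op V'" "V' <= V" "V' <= U" using o by (auto simp: opens_in_def)
  show "dr U f V' (mres M V V' a) = mres OX V V' (dr U f V a)"
   using assms(4)[OF o V'(1,2) a] by (simp add: dr_app[OF o a] dr_app[OF V'(1,3) mres_closed[OF M o(1) V'(1,2) a]] structure_module_def)
 qed
 then show ?thesis by (simp add: dual_sheaf_def dr_def)
qed

lemma res_ring:
 assumes "op W" "op W'" "W' <= W" "r:$(SX W)"
 shows "res X W W' r:$(SX W')"
  and "s:$(SX W) ==> res X W W' (r +[SX W] s) = res X W W' r +[SX W'] res X W W' s"
  and "s:$(SX W) ==> res X W W' (r *[SX W] s) = res X W W' r *[SX W'] res X W W' s"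
 using ring_hom_add[OF res_hom[OF assms(1-3)] assms(4)] ring_hom_mult[OF res_hom[OF assms(1-3)] assms(4)]
  ring_hom_closed[OF res_hom[OF assms(1-3)] assms(4)] by simp_all

lemma dual_smult_closed:
 assumes U: "op U" and r: "r:$(SX U)" and phi: "phi:$(msec DM U)"
 shows "r *.[msec DM U] phi:$(msec DM U)"
 unfolding dual_simps
proof (rule dr_carrier)
 fix W assume W: "op W" "W <= U"
 interpret cring "SX W" by (rule sec_cring[OF W(1)])
 note rW = res_ring(1)[OF U W r]
 fix a assume a: "a:$(msec M W)"
 note f = dualD(1)[OF phi W]
 show "res X U W r *[SX W] phi W a:$(SX W)" using f[OF a] rW by simp
 show "res X U W r *[SX W] phi W (a +[msec M W] b) = res X U W r *[SX W] phi W a +[SX W] res X U W r *[SX W] phi W b"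
  if "b:$(msec M W)" for b using f[OF a] f[OF that] rW dualD(2)[OF phi W a that] by (simp add: r_distr)
 show "res X U W r *[SX W] phi W (q *.[msec M W] a) = q *[SX W] (res X U W r *[SX W] phi W a)"
  if "q:$(SX W)" for q using f[OF a] that rW dualD(3)[OF phi W that a] by (simp add: m_lcomm)
 fix W' assume W': "op W'" "W' <= W"
 show "res X U W' r *[SX W'] phi W' (mres M W W' a) = res X W W' (res X U W r *[SX W] phi W a)"
  using res_ring(3)[OF W(1) W' rW f[OF a]] dualD(4)[OF phi W W' a] preshD(3)[OF sec_presh U W(1) W'(1,2) W(2) r] by simp
qed

lemma dual_add_closed:
 assumes U: "op U" and phi: "phi:$(msec DM U)" and psi: "psi:$(msec DM U)"
 shows "phi +[msec DM U] psi:$(msec DM U)"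
 unfolding dual_simps
proof (rule dr_carrier)
 fix W assume W: "op W" "W <= U"
 interpret cring "SX W" by (rule sec_cring[OF W(1)])
 fix a assume a: "a:$(msec M W)"
 note f = dualD(1)[OF phi W] dualD(1)[OF psi W]
 show "phi W a +[SX W] psi W a:$(SX W)" using f[OF a] by simp
 show "phi W (a +[msec M W] b) +[SX W] psi W (a +[msec M W] b) = phi W a +[SX W] psi W a +[SX W] (phi W b +[SX W] psi W b)"
  if "b:$(msec M W)" for b using f[OF a] f[OF that] dualD(2)[OF phi W a that] dualD(2)[OF psi W a that] by (simp add: a_ac)
 show "phi W (q *.[msec M W] a) +[SX W] psi W (q *.[msec M W] a) = q *[SX W] (phi W a +[SX W] psi W a)"
  if "q:$(SX W)" for q using f[OF a] that dualD(3)[OF phi W that a] dualD(3)[OF psi W that a] by (simp add: r_distr)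
 fix W' assume W': "op W'" "W' <= W"
 show "phi W' (mres M W W' a) +[SX W'] psi W' (mres M W W' a) = res X W W' (phi W a +[SX W] psi W a)"
  using res_ring(2)[OF W(1) W' f(1)[OF a] f(2)[OF a]] dualD(4)[OF phi W W' a] dualD(4)[OF psi W W' a] by simp
qed

lemma dual_zero_closed:
 assumes U: "op U"
 shows "0[msec DM U]:$(msec DM U)"
 unfolding dual_simps
proof (rule dr_carrier)
 fix W assume W: "op W" "W <= U"
 interpret cring "SX W" by (rule sec_cring[OF W(1)])
 show "0[SX W]:$(SX W)" "0[SX W] = 0[SX W] +[SX W] 0[SX W]" by simp_all
 show "0[SX W] = r *[SX W] 0[SX W]" if "r:$(SX W)" for r using that by simp
 show "0[SX W'] = res X W W' 0[SX W]" if "op W'" "W' <= W" for W'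
  using ring_hom_zero[OF res_hom[OF W(1) that]] sec_cring[OF W(1)] sec_cring[OF that(1)] by (simp add: cring_def)
qed

lemma dual_module:
 assumes U: "op U"
 shows "module (SX U) (msec DM U)"
proof -
 note s = dual_simps
 have e: "phi = psi" if "phi:$(msec DM U)" "psi:$(msec DM U)"
   "!!W a. op W ==> W <= U ==> a:$(msec M W) ==> phi W a = psi W a" for phi psi
 proof -
  have "dr U phi = dr U psi" by (rule dr_eq) (rule that(3))
  then show ?thesis using dualD(5)[OF that(1)] dualD(5)[OF that(2)] by simp
 qed
 have R: "cring (SX W)" if "op W" for W by (rule sec_cring[OF that])
 note r = cring.cring_simprules
 note c = dual_zero_closed[OF U] dual_add_closed[OF U] dual_smult_closed[OF U]
 interpret U: cring "SX U" by (rule R[OF U])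
 show ?thesis
 proof (rule moduleI[OF R[OF U] abelian_groupI])
  fix phi psi ki assume h: "phi:$(msec DM U)" "psi:$(msec DM U)" "ki:$(msec DM U)"
  show "phi +[msec DM U] psi +[msec DM U] ki = phi +[msec DM U] (psi +[msec DM U] ki)"
   by (rule e) (simp_all add: c h, simp add: s dr_app dualD(1)[OF h(1)] dualD(1)[OF h(2)] dualD(1)[OF h(3)] r(7)[OF R])
 next
  fix phi psi assume h: "phi:$(msec DM U)" "psi:$(msec DM U)"
  show "phi +[msec DM U] psi:$(msec DM U)" by (rule c(2)[OF h])
  show "phi +[msec DM U] psi = psi +[msec DM U] phi"
   unfolding s by (rule dr_eq) (rule r(10)[OF R]; simp add: dualD(1)[OF h(1)] dualD(1)[OF h(2)])
 next
  fix phi assume h: "phi:$(msec DM U)"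
  show "0[msec DM U] +[msec DM U] phi = phi"
   by (rule e) (simp_all add: c h, simp add: s dr_app dualD(1)[OF h] r(8)[OF R])
  show "EX psi:$(msec DM U). psi +[msec DM U] phi = 0[msec DM U]"
  proof (intro bexI e)
   let ?n = "(-[SX U] 1[SX U]) *.[msec DM U] phi"
   show n: "?n:$(msec DM U)" by (rule c(3)) (simp_all add: h)
   show "?n +[msec DM U] phi:$(msec DM U)" "0[msec DM U]:$(msec DM U)" by (rule c(2)[OF n h], rule c(1))
   fix W a assume W: "op W" "W <= U" "a:$(msec M W)"
   interpret W: cring "SX W" by (rule R[OF W(1)])
   have "res X U W (-[SX U] 1[SX U]) = -[SX W] 1[SX W]"
    using ring_hom_cring.hom_a_inv[OF ring_hom_cringI[OF ring_hom_ringI2[OF U.ring_axioms W.ring_axioms res_hom[OF U W(1,2)]] U.is_cring W.is_cring], of "1[SX U]"]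
     ring_hom_one[OF res_hom[OF U W(1,2)]] by simp
   then show "(?n +[msec DM U] phi) W a = 0[msec DM U] W a"
    using dualD(1)[OF h W] by (simp add: s dr_app[OF W] W.l_minus W.l_neg)
  qed
  show "1[SX U] *.[msec DM U] phi = phi"
   by (rule e) (simp_all add: c h, simp add: s dr_app dualD(1)[OF h] ring_hom_one[OF res_hom[OF U]] r(12)[OF R])
 next
  fix q phi assume h: "q:$(SX U)" "phi:$(msec DM U)"
  show "q *.[msec DM U] phi:$(msec DM U)" by (rule c(3)[OF h])
 next
  fix q q' phi assume h: "q:$(SX U)" "q':$(SX U)" "phi:$(msec DM U)"
  show "(q +[SX U] q') *.[msec DM U] phi = q *.[msec DM U] phi +[msec DM U] q' *.[msec DM U] phi"
   by (rule e) (simp_all add: c h, simp add: s dr_app dualD(1)[OF h(3)] res_ring[OF U] h r(13)[OF R])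
  show "(q *[SX U] q') *.[msec DM U] phi = q *.[msec DM U] (q' *.[msec DM U] phi)"
   by (rule e) (simp_all add: c h, simp add: s dr_app dualD(1)[OF h(3)] res_ring[OF U] h r(11)[OF R])
 next
  fix q phi psi assume h: "q:$(SX U)" "phi:$(msec DM U)" "psi:$(msec DM U)"
  show "q *.[msec DM U] (phi +[msec DM U] psi) = q *.[msec DM U] phi +[msec DM U] q *.[msec DM U] psi"
   by (rule e) (simp_all add: c h, simp add: s dr_app dualD(1)[OF h(2)] dualD(1)[OF h(3)] res_ring[OF U] h r(25)[OF R])
 qed (rule c(1))
qed

end

end

context lrs
begin

context
 fixes M :: "('x, 'r, 'm) mod_presheaf"
 assumes M: "mp M"
begin

lemma dual_res:
 assumes "V <= U" "phi:$(msec (DM M) U)"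
 shows "mres (DM M) U V phi = dr M V phi"
proof -
 have "restrict (dr M U phi) (opens_in X V) = dr M V phi" using assms(1) by (auto simp: dr_def[OF M] opens_in_def fun_eq_iff)
 then show ?thesis using dualD(5)[OF M assms(2)] by (simp add: dual_simps[OF M])
qed

lemma dual_res_app: "W <= V ==> op W ==> mres (DM M) U V phi W = phi W"
 by (simp add: dual_simps[OF M] opens_in_def)

lemma dual_res_closed:
 assumes V: "V <= U" and phi: "phi:$(msec (DM M) U)"
 shows "mres (DM M) U V phi:$(msec (DM M) V)"
 unfolding dual_res[OF assms] using dualD(1-4)[OF M phi _ subset_trans[OF _ V]] by (intro dr_carrier[OF M])

lemma dual_eqI:
 assumes "phi:$(msec (DM M) U)" "psi:$(msec (DM M) U)"
  "!!W a. op W ==> W <= U ==> a:$(msec M W) ==> phi W a = psi W a"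
 shows "phi = psi"
proof -
 have "dr M U phi = dr M U psi" by (rule dr_eq[OF M]) (rule assms(3))
 then show ?thesis using dualD(5)[OF M assms(1)] dualD(5)[OF M assms(2)] by simp
qed

lemma dual_presh: "mp (DM M)"
 unfolding mod_presh_def
proof (intro conjI allI impI)
 show "op U ==> module (SX U) (msec (DM M) U)" for U by (rule dual_module[OF M])
next
 fix U V assume h: "op U & op V & V <= U"
 have V: "op U" "op V" "V <= U" using h by auto
 show "slin (SX U) (res X U V) (msec (DM M) U) (msec (DM M) V) (mres (DM M) U V)"
 proof (rule slinI)
  fix phi assume phi: "phi:$(msec (DM M) U)"
  show "mres (DM M) U V phi:$(msec (DM M) V)" by (rule dual_res_closed[OF V(3) phi])
  show "mres (DM M) U V (phi +[msec (DM M) U] psi) = mres (DM M) U V phi +[msec (DM M) V] mres (DM M) U V psi"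
   if psi: "psi:$(msec (DM M) U)" for psi
   unfolding dual_res[OF V(3) dual_add_closed[OF M V(1) phi psi]] unfolding dual_simps(2)[OF M]
   by (rule dr_eq[OF M]) (simp add: dr_app[OF M _ subset_trans[OF _ V(3)]] dual_res_app)
  show "mres (DM M) U V (r *.[msec (DM M) U] phi) = res X U V r *.[msec (DM M) V] mres (DM M) U V phi"
   if r: "r:$(SX U)" for r
   unfolding dual_res[OF V(3) dual_smult_closed[OF M V(1) r phi]] unfolding dual_simps(3)[OF M]
   by (rule dr_eq[OF M]) (simp add: dr_app[OF M _ subset_trans[OF _ V(3)]] dual_res_app preshD(3)[OF sec_presh V(1,2) _ _ V(3) r])
 qed
next
 show "presh (topo X) (%U. $(msec (DM M) U)) (mres (DM M))"
  unfolding presh_def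
 proof (intro conjI allI impI ballI)
  show "mres (DM M) U V:$(msec (DM M) U) -> $(msec (DM M) V)" if "op U & op V & V <= U" for U V
   using dual_res_closed that by (intro funcsetI) metis
  show "mres (DM M) U U phi = phi" if "op U" "phi:$(msec (DM M) U)" for U phi
   using dual_res[OF subset_refl that(2)] dualD(5)[OF M that(2)] by simp
  show "mres (DM M) V W (mres (DM M) U V phi) = mres (DM M) U W phi" if "op U & op V & op W & W <= V & V <= U" for U V W phi
   using that by (auto simp: dual_simps[OF M] restrict_def opens_in_def fun_eq_iff)
 qed
qed

end

end

context line_bundle
begin

abbreviation "DA \<equiv> dual_sheaf X A"
text \<open>The dual frame, that is, the functional that takes the value 1 on
  \<open>a\<close>.\<close>

definition "dfr U a = dr A U (%W. coef (SX W) (msec A W) (mres A U W a))"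

text \<open>A functional on a free module of rank one is determined by its value on the basis
  vector, and this value is its coefficient with respect to the dual frame.\<close>

lemma frame_dual:
 assumes f: "frame U a"
 shows "gframe DA U (dfr U a)"
proof -
 have U: "op U" "a:$(msec A U)" and ba: "!!W. op W ==> W <= U ==> basis1 (SX W) (msec A W) (mres A U W a)"
  using f by (auto simp: gframe_def)
 note m = P'(1)[OF A_presh]
 have one: "1[SX W]:$(SX W)" if "op W" for W using sec_cring[OF that] by (simp add: cring_def ring.ring_simprules)
 have d: "dfr U a:$(msec DA U)"
  unfolding dfr_def
 proof (rule dr_carrier[OF A_presh])
  fix W s assume W: "op W" "W <= U" and s: "s:$(msec A W)"
  note b = ba[OF W]
  show "coef (SX W) (msec A W) (mres A U W a) s:$(SX W)" by (rule coef(1)[OF b s])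
  show "coef (SX W) (msec A W) (mres A U W a) (s +[msec A W] t) = coef (SX W) (msec A W) (mres A U W a) s +[SX W] coef (SX W) (msec A W) (mres A U W a) t"
   if "t:$(msec A W)" for t by (rule coef_hom(1)[OF b m[OF W(1)] s that one[OF W(1)]])
  show "coef (SX W) (msec A W) (mres A U W a) (r *.[msec A W] s) = r *[SX W] coef (SX W) (msec A W) (mres A U W a) s"
   if "r:$(SX W)" for r by (rule coef_hom(2)[OF b m[OF W(1)] s s that])
  fix W' assume W': "op W'" "W' <= W"
  show "coef (SX W') (msec A W') (mres A U W' a) (mres A W W' s) = res X W W' (coef (SX W) (msec A W) (mres A U W a) s)"
  proof (rule coef(3)[OF ba[OF W'(1)]])
   have aW: "mres A U W a:$(msec A W)" by (rule mres_closed[OF A_presh U(1) W U(2)])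
   have "mres A W W' (coef (SX W) (msec A W) (mres A U W a) s *.[msec A W] mres A U W a) =
    res X W W' (coef (SX W) (msec A W) (mres A U W a) s) *.[msec A W'] mres A W W' (mres A U W a)"
    by (rule slinD(3)[OF P'(2)[OF A_presh W(1) W'] coef(1)[OF b s] aW])
   then show "mres A W W' s = res X W W' (coef (SX W) (msec A W) (mres A U W a) s) *.[msec A W'] mres A U W' a"
    unfolding coef(2)[OF b s] preshD(3)[OF P'(3)[OF A_presh] U(1) W(1) W' W(2) U(2)] .
   show "res X W W' (coef (SX W) (msec A W) (mres A U W a) s):$(SX W')"
    by (rule res_ring(1)[OF A_presh W(1) W' coef(1)[OF b s]])
   show "mres A W W' s:$(msec A W')" by (rule mres_closed[OF A_presh W(1) W' s])
  qed (use W W' in blast)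
 qed
 have "basis1 (SX W) (msec DA W) (mres DA U W (dfr U a))" if W: "op W" "W <= U" for W
  unfolding basis1_def
 proof (intro conjI ballI)
  note dW = dual_res_closed[OF A_presh W(2) d]
  show "mres DA U W (dfr U a):$(msec DA W)" by (rule dW)
  have app: "(r *.[msec DA W] mres DA U W (dfr U a)) T s = res X W T r *[SX T] coef (SX T) (msec A T) (mres A U T a) s"
   if "op T" "T <= W" "s:$(msec A T)" for T s r
   using that W(2) by (simp add: dual_simps(3)[OF A_presh] dr_app[OF A_presh] dual_res_app[OF A_presh] dfr_def)
  have aW: "mres A U W a:$(msec A W)" by (rule mres_closed[OF A_presh U(1) W U(2)])
  fix psi assume psi: "psi:$(msec DA W)"
  let ?r = "psi W (mres A U W a)"
  note rc = dualD(1)[OF A_presh psi W(1) subset_refl aW]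
  show "EX! r. r:$(SX W) & psi = r *.[msec DA W] mres DA U W (dfr U a)"
  proof (rule ex1I[of _ ?r])
   show "?r:$(SX W) & psi = ?r *.[msec DA W] mres DA U W (dfr U a)"
   proof (rule conjI[OF rc dual_eqI[OF A_presh psi dual_smult_closed[OF A_presh W(1) rc dW]]])
    fix T s assume T: "op T" "T <= W" and s: "s:$(msec A T)"
    note b = ba[OF T(1) subset_trans[OF T(2) W(2)]]
    have aT: "mres A U T a = mres A W T (mres A U W a)" using preshD(3)[OF P'(3)[OF A_presh] U(1) W(1) T W(2) U(2)] by simp
    interpret cring "SX T" by (rule sec_cring[OF T(1)])
    have "psi T s = psi T (coef (SX T) (msec A T) (mres A U T a) s *.[msec A T] mres A U T a)" unfolding coef(2)[OF b s] ..
    also have "\<dots> = coef (SX T) (msec A T) (mres A U T a) s *[SX T] psi T (mres A U T a)"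
     using dualD(3)[OF A_presh psi T coef(1)[OF b s]] mres_closed[OF A_presh U(1) T(1) subset_trans[OF T(2) W(2)] U(2)] by blast
    also have "psi T (mres A U T a) = res X W T ?r" unfolding aT by (rule dualD(4)[OF A_presh psi W(1) subset_refl T aW])
    finally show "psi T s = (?r *.[msec DA W] mres DA U W (dfr U a)) T s"
     unfolding app[OF T s] using coef(1)[OF b s] res_ring(1)[OF A_presh W(1) T rc] by (simp add: m_comm)
   qed
   fix r assume r: "r:$(SX W) & psi = r *.[msec DA W] mres DA U W (dfr U a)"
   interpret cring "SX W" by (rule sec_cring[OF W(1)])
   have "?r = res X W W r *[SX W] coef (SX W) (msec A W) (mres A U W a) (mres A U W a)"
    using app[OF W(1) subset_refl aW] r by metis
   then show "r = ?r" using coef_basis[OF m[OF W(1)] ba[OF W]] preshD(2)[OF sec_presh W(1)] r by simp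
  qed
 qed
 then show ?thesis unfolding gframe_def using U(1) d by blast
qed

text \<open>Multiplying a frame by a unit multiplies its dual frame by the inverse unit. Here the
  second frame is one whose germ is the chosen generator \<open>al y\<close>, and the unit relating
  the two frames has germ \<open>uu\<close>.\<close>

lemma dfr_change:
 assumes f: "frame U a" and f': "frame U' a'" and y: "y:U" "y:U'" and al: "al y = mg A y U' a'"
 shows "mg DA y U (dfr U a) = up U a (- 1) y *.[St DA y] mg DA y U' (dfr U' a')"
proof -
 have U: "op U" "a:$(msec A U)" and ba: "!!W. op W ==> W <= U ==> basis1 (SX W) (msec A W) (mres A U W a)"
  using f by (auto simp: gframe_def)
 have U': "op U'" "a':$(msec A U')" and ba': "!!W. op W ==> W <= U' ==> basis1 (SX W) (msec A W) (mres A U' W a')"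
  using f' by (auto simp: gframe_def)
 note D = dual_presh[OF A_presh]
 have d: "dfr U a:$(msec DA U)" "dfr U' a':$(msec DA U')" using frame_dual[OF f] frame_dual[OF f'] by (simp_all add: gframe_def)
 define W where "W = U Int U'"
 have W: "op W" "W <= U" "W <= U'" "y:W" using U U' y by (auto simp: W_def)
 have yp: "y:pts X" by (rule frame_pts[OF f y(1)])
 define c where "c = coef (SX W) (msec A W) (mres A U W a) (mres A U' W a')"
 have aW: "mres A U W a:$(msec A W)" "mres A U' W a':$(msec A W)"
  using mres_closed[OF A_presh] U U' W by simp_all
 have c: "c:$(SX W)" "c *.[msec A W] mres A U W a = mres A U' W a'"
  unfolding c_def by (rule coef(1)[OF ba[OF W(1,2)] aW(2)], rule coef(2)[OF ba[OF W(1,2)] aW(2)])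
 note dW = dual_res_closed[OF A_presh W(2) d(1)] dual_res_closed[OF A_presh W(3) d(2)]
 have e: "mres DA U W (dfr U a) = c *.[msec DA W] mres DA U' W (dfr U' a')"
 proof (rule dual_eqI[OF A_presh dW(1) dual_smult_closed[OF A_presh W(1) c(1) dW(2)]])
  fix T s assume T: "op T" "T <= W" and s: "s:$(msec A T)"
  have TU: "T <= U" "T <= U'" using T W by auto
  note b = ba[OF T(1) TU(1)] ba'[OF T(1) TU(2)]
  let ?k = "coef (SX T) (msec A T) (mres A U' T a') s"
  note k = coef(1,2)[OF b(2) s] and cT = res_ring(1)[OF A_presh W(1) T c(1)]
  have aT: "mres A U T a:$(msec A T)" using b(1) by (simp add: basis1_def)
  have aT': "mres A U' T a' = res X W T c *.[msec A T] mres A U T a"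
   using slinD(3)[OF P'(2)[OF A_presh W(1) T] c(1) aW(1)] preshD(3)[OF P'(3)[OF A_presh] U(1) W(1) T W(2) U(2)]
    preshD(3)[OF P'(3)[OF A_presh] U'(1) W(1) T W(3) U'(2)] unfolding c(2) by simp
  interpret cring "SX T" by (rule sec_cring[OF T(1)])
  have "s = (res X W T c *[SX T] ?k) *.[msec A T] mres A U T a"
   unfolding m_comm[OF cT k(1)] module.smult_assoc1[OF P'(1)[OF A_presh T(1)] k(1) cT aT] aT'[symmetric] k(2) ..
  from coef(3)[OF b(1) s m_closed[OF cT k(1)] this]
  show "mres DA U W (dfr U a) T s = (c *.[msec DA W] mres DA U' W (dfr U' a')) T s"
   using T TU s by (simp add: dual_simps(3)[OF A_presh] dr_app[OF A_presh] dual_res_app[OF A_presh] dfr_def)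
 qed
 interpret S: cring "Ox y" by (rule stalk_cring[OF yp])
 let ?c = "rg y W c"
 have cc: "?c:$(Ox y)" by (rule rgerm_op(1)[OF W(1,4) c(1) c(1)])
 note u = up(1)[OF f y(1)]
 have "al y = ?c *.[St A y] mg A y U a"
  unfolding al using mgerm_op(3)[OF A_presh W(1,4) aW(1) c(1)] c(2) mgerm_res[OF A_presh U(1) W(1,2,4) U(2)] mgerm_res[OF A_presh U'(1) W(1,3,4) U'(2)] by simp
 also have "\<dots> = (?c *[Ox y] up U a 1 y) *.[St A y] al y"
  unfolding uu(2)[OF f y(1), symmetric] up(5)[OF f y(1), symmetric]
  by (rule module.smult_assoc1[OF stalk_module[OF A_presh yp] cc u basis_carrier[OF stalk_module[OF A_presh yp] al_basis[OF yp]], symmetric])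
 finally have "?c *[Ox y] up U a 1 y = 1[Ox y]"
  using coef_smult[OF al_basis[OF yp] stalk_module[OF A_presh yp] S.m_closed[OF cc u]] coef_basis[OF stalk_module[OF A_presh yp] al_basis[OF yp]] by metis
 then have "?c = up U a (- 1) y"
  using up(7)[OF f y(1), of 1] cc u by (metis S.m_assoc S.l_one S.r_one)
 then show ?thesis
  using mgerm_op(3)[OF D W(1,4) dW(2) c(1)] mgerm_res[OF D U(1) W(1,2,4) d(1)] mgerm_res[OF D U'(1) W(1,3,4) d(2)] e by simp
qed

theorem Bs_twist_dual:
 assumes V: "mp V" and x: "x:pts X"
 shows "x \<notin> Bs X (tsh V (wsh False m DA)) <-> full x V (- int m)"
proof -
 note D = dual_presh[OF A_presh]
 define lb where "lb y = mg DA y (fst (fr y)) (dfr (fst (fr y)) (snd (fr y)))" for y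
 have b: "basis1 (Ox y) (St DA y) (lb y)" if "y:pts X" for y
  unfolding lb_def using gframe_germ[OF D frame_dual] fr[OF that] by blast
 have ch: "mg DA y U (dfr U a) = up U a (- 1) y *.[St DA y] lb y" if f: "frame U a" and y: "y:U" for U a y
  unfolding lb_def by (rule dfr_change[OF f]) (use fr[OF frame_pts[OF f y]] y in "simp_all add: al_def")
 have "x \<notin> Bs X (tsh V (wsh False m DA)) <-> full x V ((- 1) * int m)"
 proof (rule Bs_twist[OF D b _ _ V x])
  show "lse DA U (%y. up U a (- 1) y *.[St DA y] lb y)" if f: "frame U a" for U a
   by (rule lsec_cong[OF D lsec_germ[OF D frame_op[OF f]] ch[OF f]]) (use frame_dual[OF f] in "simp_all add: gframe_def")
  fix U a W sg assume f: "frame U a" and W: "W <= U" and sg: "lse DA W sg"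
  from gframe_lsec[OF D frame_dual[OF f] W sg] obtain c where
   c: "lse OX W c" "!!y. y:W ==> sg y = c y *.[St DA y] mg DA y U (dfr U a)" by metis
  show "lse OX W (%y. up U a (- (- 1)) y *[Ox y] coef (Ox y) (St DA y) (lb y) (sg y))"
  proof (rule lsec_cong[OF OX_presh c(1)])
   fix y assume y: "y:W"
   have yU: "y:U" and yp: "y:pts X" using y W frame_pts[OF f] by auto
   interpret cring "Ox y" by (rule stalk_cring[OF yp])
   have cy: "c y:$(Ox y)" by (rule rsec_carrier[OF c(1) y])
   note u = up(1)[OF f yU]
   have "sg y = (c y *[Ox y] up U a (- 1) y) *.[St DA y] lb y"
    unfolding c(2)[OF y] ch[OF f yU]
    by (rule module.smult_assoc1[OF stalk_module[OF D yp] cy u basis_carrier[OF stalk_module[OF D yp] b[OF yp]], symmetric])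
   then have "coef (Ox y) (St DA y) (lb y) (sg y) = c y *[Ox y] up U a (- 1) y"
    using coef_smult[OF b[OF yp] stalk_module[OF D yp] m_closed[OF cy u]] by simp
   then show "c y = up U a (- (- 1)) y *[Ox y] coef (Ox y) (St DA y) (lb y) (sg y)"
    using up(7)[OF f yU, of 1] cy u by (simp add: m_lcomm)
  qed
 qed
 then show ?thesis by simp
qed

end

section \<open>Nakayama's lemma and generization\<close>

text \<open>If 1 - a were not a unit, its principal ideal would be proper and Zorn's lemma would
  place it in a maximal ideal. The unique maximal ideal also contains \<open>a\<close>, hence it
  would contain 1.\<close>

lemma local_ring_unit:
 assumes R: "local_ring R" and a: "a:max_ideal R"
 shows "1[R] -[R] a:Units R"
proof (rule ccontr)
 interpret cring R using R by (simp add: local_ring_def)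
 have m: "maximalideal (max_ideal R) R" unfolding max_ideal_def by (rule theI') (use R in "simp add: local_ring_def")
 then have mi: "ideal (max_ideal R) R" by (simp add: maximalideal_def)
 have ac: "a:$R" using a mi ideal.Icarr by metis
 let ?u = "1[R] -[R] a"
 assume nu: "?u \<notin> Units R"
 have uc: "?u:$R" using ac by simp
 define S where "S = {I. ideal I R & ?u:I & 1[R] \<notin> I}"
 have "PIdl\<^bsub>R\<^esub> ?u:S"
 proof -
  have "1[R] \<notin> PIdl\<^bsub>R\<^esub> ?u"
  proof
   assume "1[R]:PIdl\<^bsub>R\<^esub> ?u"
   then obtain r where "r:$R" "1[R] = r *[R] ?u" unfolding cgenideal_def by blast
   then show False using nu uc m_comm unfolding Units_def by force
  qed
  then show ?thesis unfolding S_def using cgenideal_ideal[OF uc] cgenideal_self[OF uc] by simp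
 qed
 then have "EX M:S. ALL I:S. M <= I --> I = M"
 proof (intro subset_Zorn_nonempty)
  fix C assume C: "C ~= {}" "subset.chain S C"
  have CS: "I:S" if "I:C" for I using C(2) that by (auto simp: subset.chain_def)
  have ch: "I <= J \<or> J <= I" if "I:C" "J:C" for I J using C(2) that by (auto simp: subset_chain_def)
  have i: "ideal I R" if "I:C" for I using CS[OF that] by (simp add: S_def)
  have "ideal (\<Union>C) R"
  proof (rule idealI[OF ring_axioms])
   show "subgroup (\<Union>C) (add_monoid R)"
   proof (rule add.subgroupI)
    show "\<Union>C <= $R" using ideal.Icarr[OF i] by blast
    show "\<Union>C ~= {}" using C(1) CS by (auto simp: S_def)
    show "-[R] b:\<Union>C" if "b:\<Union>C" for b
     using that additive_subgroup.a_inv_closed[OF ideal.axioms(1)[OF i]] by blast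
    show "b +[R] c:\<Union>C" if "b:\<Union>C" "c:\<Union>C" for b c
    proof -
     obtain I J where I: "I:C" "b:I" "J:C" "c:J" using \<open>b \<in> \<Union>C\<close> \<open>c \<in> \<Union>C\<close> by blast
     then obtain K where "K:C" "b:K" "c:K" using ch[OF I(1,3)] by blast
     then show ?thesis using additive_subgroup.a_closed[OF ideal.axioms(1)[OF i]] by blast
    qed
   qed
   show "x *[R] b:\<Union>C" "b *[R] x:\<Union>C" if "b:\<Union>C" "x:$R" for b x
    using that ideal.I_l_closed[OF i] ideal.I_r_closed[OF i] by blast+
  qed
  then show "\<Union>C:S" using C(1) CS unfolding S_def by blast
 qed blast
 then obtain M where M: "M:S" "!!I. I:S ==> M <= I ==> I = M" by blast
 have Mi: "ideal M R" "?u:M" "1[R] \<notin> M" using M(1) by (simp_all add: S_def)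
 have "maximalideal M R"
 proof (rule maximalidealI[OF Mi(1)])
  show "$R ~= M" using Mi(3) by auto
  fix J assume J: "ideal J R" "M <= J" "J <= $R"
  show "J = M \<or> J = $R"
  proof (cases "1[R]:J")
   case True then show ?thesis using ideal.one_imp_carrier[OF J(1)] by blast
  next
   case False then show ?thesis using M(2)[of J] J Mi(2) by (auto simp: S_def)
  qed
 qed
 then have "M = max_ideal R" using R m unfolding local_ring_def by blast
 then have "?u +[R] a:M" using additive_subgroup.a_closed[OF ideal.axioms(1)[OF Mi(1)] Mi(2)] a by blast
 then show False using Mi(3) ac by (simp add: minus_eq a_assoc l_neg)
qed

context lrs
begin

text \<open>One element \<open>g\<close> of \<open>G\<close> is removed at a time: it is shown to
  have the form a g + h with \<open>a\<close> in the maximal ideal and \<open>h\<close> in the span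
  of the remaining generators, and 1 - a is invertible.\<close>

lemma nakayama:
 assumes x: "x:pts X" and M: "module (Ox x) M" and T: "T <= $M" and m: "module_span (Ox x) M (mprod x M Un T) = $M"
  and G: "finite G"
 shows "G <= $M ==> module_span (Ox x) M (G Un T) = $M ==> module_span (Ox x) M T = $M"
 using G
proof (induction G)
 case (insert g G)
 interpret module "Ox x" M by (rule M)
 let ?H = "module_span (Ox x) M (G Un T)"
 have g: "g:$M" and GT: "G Un T <= $M" using insert.prems T by auto
 note H = span_submodule[OF M GT] and HD = submoduleD[OF M span_submodule[OF M GT]]
 note mi = stalk_ideal[OF x]
 interpret mi: ideal "max_ideal (Ox x)" "Ox x" by (rule mi)
 \<comment> \<open>This submodule contains \<open>T\<close>, and it contains the multiples by the
   maximal ideal because every vector is a multiple of \<open>g\<close> plus an element of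
   \<open>?H\<close>. By hypothesis it is then the whole module, and in particular it contains
   \<open>g\<close>.\<close>
 let ?K = "{(a *.[M] g) +[M] h | a h. a:max_ideal (Ox x) & h:?H}"
 have Kc: "EX a h. a:max_ideal (Ox x) & a:$(Ox x) & h:?H & h:$M & k = (a *.[M] g) +[M] h" if "k:?K" for k
  using that HD(1) mi.Icarr by blast
 have KI: "(a *.[M] g) +[M] h:?K" if "a:max_ideal (Ox x)" "h:?H" for a h using that by blast
 have K: "submodule ?K (Ox x) M"
 proof (rule submoduleI'[OF M])
  show "?K <= $M"
  proof
   fix k assume "k:?K"
   from Kc[OF this] show "k:$M" using g by (elim exE conjE) simp
  qed
  show "0[M]:?K" using KI[OF mi.zero_closed HD(2)] unfolding smult_l_null[OF g] M.l_zero[OF M.zero_closed] .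
  fix k l assume k: "k:?K" and l: "l:?K"
  from Kc[OF k] obtain a h where a: "a:max_ideal (Ox x)" "a:$(Ox x)" "h:?H" "h:$M" "k = (a *.[M] g) +[M] h" by (elim exE conjE) (rule that)
  from Kc[OF l] obtain b i where b: "b:max_ideal (Ox x)" "b:$(Ox x)" "i:?H" "i:$M" "l = (b *.[M] g) +[M] i" by (elim exE conjE) (rule that)
  have "k +[M] l = ((a +[Ox x] b) *.[M] g) +[M] (h +[M] i)" using a b g by (simp add: smult_l_distr M.a_ac)
  then show "k +[M] l:?K" using KI[OF mi.a_closed[OF a(1) b(1)] HD(3)[OF a(3) b(3)]] by simp
 next
  fix r k assume r: "r:$(Ox x)" and k: "k:?K"
  from Kc[OF k] obtain a h where a: "a:max_ideal (Ox x)" "a:$(Ox x)" "h:?H" "h:$M" "k = (a *.[M] g) +[M] h" by (elim exE conjE) (rule that)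
  have "r *.[M] k = ((r *[Ox x] a) *.[M] g) +[M] (r *.[M] h)" using a r g by (simp add: smult_r_distr smult_assoc1)
  then show "r *.[M] k:?K" using KI[OF mi.I_l_closed[OF a(1) r] HD(4)[OF r a(3)]] by simp
 qed
 have "mprod x M Un T <= ?K"
 proof
  fix v assume "v:mprod x M Un T"
  then show "v:?K"
  proof
   assume "v:T"
   then have v: "v:?H" "v:$M" using span_incl[of v "G Un T"] T by auto
   show ?thesis using KI[OF mi.zero_closed v(1)] unfolding smult_l_null[OF g] M.l_zero[OF v(2)] .
  next
   assume "v:mprod x M"
   then obtain mu w where mu: "mu:max_ideal (Ox x)" "w:$M" "v = mu *.[M] w" by (auto simp: mprod_def)
   have "insert g (G Un T) <= $M" "w:module_span (Ox x) M (insert g (G Un T))" using g GT mu(2) insert.prems by auto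
   from span_finite_insert[OF M this] obtain r h where r: "r:$(Ox x)" "h:?H" "w = (r *.[M] g) +[M] h" by blast
   have muc: "mu:$(Ox x)" and hc: "h:$M" using mi.Icarr[OF mu(1)] r(2) HD(1) by auto
   have "v = ((mu *[Ox x] r) *.[M] g) +[M] (mu *.[M] h)" using muc hc r g mu(3) by (simp add: smult_r_distr smult_assoc1)
   then show ?thesis using KI[OF mi.I_r_closed[OF mu(1) r(1)] HD(4)[OF muc r(2)]] by simp
  qed
 qed
 from span_least[OF K this] have "g:?K" unfolding m using g by blast
 from Kc[OF this] obtain a h where a: "a:max_ideal (Ox x)" "a:$(Ox x)" "h:?H" "h:$M" "g = (a *.[M] g) +[M] h" by (elim exE conjE) (rule that)
 let ?u = "1[Ox x] -[Ox x] a"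
 have uc: "?u:$(Ox x)" using a(2) by simp
 have iu: "inv\<^bsub>Ox x\<^esub> ?u:$(Ox x)" "inv\<^bsub>Ox x\<^esub> ?u *[Ox x] ?u = 1[Ox x]"
  using local_ring_unit[OF stalk_local[OF x] a(1)] by simp_all
 have ag: "a *.[M] g:$M" using a(2) g by simp
 have "?u *.[M] g = g +[M] (-[M] (a *.[M] g))" using a(2) g by (simp add: R.minus_eq smult_l_distr smult_l_minus)
 also have "\<dots> = ((a *.[M] g) +[M] h) +[M] (-[M] (a *.[M] g))" using a(5) by (rule arg_cong)
 also have "\<dots> = h" using ag a(4) by (simp add: M.a_ac M.r_neg2 M.r_neg1 M.r_neg)
 finally have "inv\<^bsub>Ox x\<^esub> ?u *.[M] (?u *.[M] g):?H" using HD(4)[OF iu(1) a(3)] by simp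
 then have "g:?H" unfolding smult_assoc1[OF iu(1) uc g, symmetric] iu(2) smult_one[OF g] .
 then have "insert g G Un T <= ?H" using span_superset[of "G Un T"] by blast
 from span_least[OF H this] have "?H = $M" using insert.prems(2) HD(1) by blast
 then show ?case using insert.IH insert.prems(1) by blast
qed simp

definition lgen :: "('x, 'r, 'm) mod_presheaf => 'x set => ('x => ('x, 'm) germ) set => bool" where
 "lgen V U Ga <-> finite Ga & (ALL ga:Ga. lse V U ga) &
  (ALL y:U. module_span (Ox y) (St V y) ((%ga. ga y) ` Ga) = $(St V y))"

lemma lgen_Sy:
 assumes V: "mp V" and o: "op U" and g: "lgen V U Ga"
 shows "EX Ga'. lgen (Sy n V) U Ga'"
proof
 let ?L = "{gas. set gas <= Ga & length gas = n}"
 let ?w = "%gas y. sw n V y (map (%ga. ga y) gas)"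
 have g': "finite Ga" "!!ga. ga:Ga ==> lse V U ga"
  "!!y. y:U ==> module_span (Ox y) (St V y) ((%ga. ga y) ` Ga) = $(St V y)" using g by (simp_all add: lgen_def)
 show "lgen (Sy n V) U (?w ` ?L)"
  unfolding lgen_def
 proof (intro conjI ballI)
  show "finite (?w ` ?L)" using finite_lists_length_eq[OF g'(1)] by simp
  show "lse (Sy n V) U ga" if "ga:?w ` ?L" for ga
  proof -
   from that obtain gas where gas: "set gas <= Ga" "length gas = n" "ga = ?w gas" by (elim imageE CollectE conjE)
   show ?thesis unfolding gas(3) by (rule wd_lsec[OF V o gas(2)]) (use gas(1) g'(2) in blast)
  qed
  fix y assume y: "y:U"
  note yp = op_pts[OF o y]
  let ?G = "(%ga. ga y) ` ?w ` ?L"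
  have Gac: "(%ga. ga y) ` Ga <= $(St V y)" using lsec_carrier[OF V g'(2) y] by (intro image_subsetI)
  have Gc: "?G <= $(St (Sy n V) y)"
   unfolding image_image
  proof (rule image_subsetI)
   fix l assume "l:?L"
   then have "map (%ga. ga y) l:words n (St V y)" using Gac by (auto simp: words_def)
   then show "sw n V y (map (%ga. ga y) l):$(St (Sy n V) y)" by (rule wd_carrier[OF V yp])
  qed
  note S = span_submodule[OF wsh_module[OF V yp] Gc]
  have "sw n V y l:module_span (Ox y) (St (Sy n V) y) ?G" if l: "l:words n (St V y)" for l
  proof (rule mlin_span[OF wd_mlin[OF V yp] stalk_module[OF V yp] wsh_module[OF V yp] Gac g'(3)[OF y] S _ l])
   fix k assume k: "k:words n (St V y)" "set k <= (%ga. ga y) ` Ga"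
   from set_subset_imageE[OF k(2)] obtain gas where gas: "k = map (%ga. ga y) gas" "set gas <= Ga" by metis
   have "length gas = n" using k(1) gas(1) by (simp add: words_def)
   then show "sw n V y k:module_span (Ox y) (St (Sy n V) y) ?G"
    unfolding gas(1) image_image using gas(2) by (intro span_incl image_eqI[of _ _ gas]) simp_all
  qed
  then show "module_span (Ox y) (St (Sy n V) y) ?G = $(St (Sy n V) y)"
   using span_least[OF S, of "sw n V y ` words n (St V y)"] wd_span[OF V yp, of True n] span_carrier[OF wsh_module[OF V yp] Gc]
   by (intro subset_antisym) (simp_all add: image_subset_iff)
 qed
qed

lemma stalk_lsec:
 assumes y: "y:pts X" and r: "r:$(Ox y)"
 obtains W rh where "op W" "y:W" "lse OX W rh" "rh y = r"
proof -
 from stalk_rep[OF r] obtain W s where W: "op W" "y:W" "s:$(SX W)" "r = rg y W s" by metis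
 show ?thesis by (rule that[OF W(1,2) rsec_germ[OF W(1,3)]]) (simp add: W(4))
qed

end

section \<open>Spreading generation from a point to its generizations\<close>

context line_bundle
begin

text \<open>A combination of values of twisted sections has finitely many coefficients, and these
  extend to a neighbourhood. The resulting local section of \<open>V\<close> is generated by twisted
  sections at all nearby points and not only at \<open>x\<close>.\<close>

lemma TS_span_extend:
 assumes V: "mp V" and f: "frame U a" and x: "x:U"
  and v: "v:module_span (Ox x) (St V x) {s x | s. TS V d s}"
 shows "EX W sg. op W & x:W & W <= U & lse V W sg & sg x = v & (ALL z:W. sg z:GG z V d)"
proof -
 note xp = frame_pts[OF f x]
 note Vx = stalk_module[OF V]
 have Tc: "{s x | s. TS V d s} <= $(St V x)" using TSD(1)[OF _ xp] by blast
 let ?P = "%v. EX W sg. op W & x:W & W <= U & lse V W sg & sg x = v & (ALL z:W. sg z:GG z V d)"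
 have sm: "?P (r *.[St V x] v)" if r: "r:$(Ox x)" and v: "?P v" for r v
 proof -
  from v obtain W sg where W: "op W" "x:W" "W <= U" "lse V W sg" "sg x = v" "!!z. z:W ==> sg z:GG z V d" by blast
  from stalk_lsec[OF xp r] obtain Q rh where Q: "op Q" "x:Q" "lse OX Q rh" "rh x = r" .
  have WQ: "op (W Int Q)" "W Int Q <= W" "W Int Q <= Q" using W Q by auto
  have "lse V (W Int Q) (%z. rh z *.[St V z] sg z)"
   by (rule lsec_smult[OF V lsec_subset[OF OX_presh Q(3) WQ(1,3)] lsec_subset[OF V W(4) WQ(1,2)]])
  moreover have "rh z *.[St V z] sg z:GG z V d" if z: "z:W Int Q" for z
  proof -
   have zp: "z:pts X" by (rule op_pts[OF WQ(1) z])
   show ?thesis by (rule submoduleD(4)[OF Vx[OF zp] GG_sub[OF V zp] rsec_carrier[OF Q(3)] W(6)]) (use z in auto)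
  qed
  ultimately show ?thesis using W(2,3,5) Q(2,4) WQ(1) by (intro exI[of _ "W Int Q"] exI[of _ "%z. rh z *.[St V z] sg z"]) auto
 qed
 from v Vx[OF xp] Tc show ?thesis
 proof (induction rule: span_induct)
  case (gen w)
  then obtain s where s: "TS V d s" "w = s x" unfolding mem_Collect_eq by metis
  \<comment> \<open>The family \<open>s\<close> need not be a local section, but its multiple by
    this power of \<open>uu\<close> is. The inverse power is then restored through the closure under
    scalars, which extends the germ of the scalar at \<open>x\<close> locally.\<close>
  have "?P (up U a (- d) x *.[St V x] s x)"
  proof (intro exI conjI ballI)
   show "lse V U (%y. up U a (- d) y *.[St V y] s y)" by (rule TSD(2)[OF s(1) f])
   show "up U a (- d) z *.[St V z] s z:GG z V d" if z: "z:U" for z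
    by (rule submoduleD(4)[OF Vx[OF frame_pts[OF f z]] GG_sub[OF V frame_pts[OF f z]] up(1)[OF f z] GG_TS[OF s(1)]])
  qed (use frame_op[OF f] x in simp_all)
  from sm[OF up(1)[OF f x, of d] this]
  show ?case unfolding s(2) up_smult(1)[OF f x Vx[OF xp] TSD(1)[OF s(1) xp]] by (simp add: up_smult(2)[OF f x Vx[OF xp] TSD(1)[OF s(1) xp]])
 next
  case zero
  have "0[St V z]:GG z V d" if "z:U" for z using submoduleD(2)[OF Vx GG_sub[OF V]] frame_pts[OF f that] by blast
  then show ?case using frame_op[OF f] x lsec_zero[OF V frame_op[OF f]] by (intro exI[of _ U] exI[of _ "%y. 0[St V y]"]) simp
 next
  case (add v w)
  from add(3) obtain W sg where W: "op W" "x:W" "W <= U" "lse V W sg" "sg x = v" "!!z. z:W ==> sg z:GG z V d" by blast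
  from add(4) obtain Q ta where Q: "op Q" "x:Q" "lse V Q ta" "ta x = w" "!!z. z:Q ==> ta z:GG z V d" by blast
  have WQ: "op (W Int Q)" "W Int Q <= W" "W Int Q <= Q" using W Q by auto
  have "lse V (W Int Q) (%z. sg z +[St V z] ta z)"
   by (rule lsec_add[OF V lsec_subset[OF V W(4) WQ(1,2)] lsec_subset[OF V Q(3) WQ(1,3)]])
  moreover have "sg z +[St V z] ta z:GG z V d" if z: "z:W Int Q" for z
  proof -
   have zp: "z:pts X" by (rule op_pts[OF WQ(1) z])
   show ?thesis by (rule submoduleD(3)[OF Vx[OF zp] GG_sub[OF V zp] W(6) Q(5)]) (use z in auto)
  qed
  ultimately show ?case using W(2,3,5) Q(2,4) WQ(1) by (intro exI[of _ "W Int Q"] exI[of _ "%z. sg z +[St V z] ta z"]) auto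
 next
  case (smult r v)
  then show ?case using sm by metis
 qed
qed

text \<open>By Nakayama, the finitely many local generators of \<open>V\<close> are at
  \<open>x\<close> honest combinations of twisted sections. These expressions persist on a
  neighbourhood of \<open>x\<close>, and \<open>et\<close> lies in every such neighbourhood.\<close>

lemma full_generization:
 assumes V: "mp V" and U: "op U" "x:U" and g: "lgen V U Ga" and F: "full x V d"
  and et: "!!W. op W ==> x:W ==> et:W"
 shows "full et V d"
proof -
 have xp: "x:pts X" and etp: "et:pts X" using op_pts[OF U] op_pts[OF U(1) et[OF U]] by auto
 from frame_exists[OF xp] obtain U0 a where f: "frame U0 a" "x:U0" by metis
 let ?T = "{s x | s. TS V d s}"
 have Tc: "?T <= $(St V x)" using TSD(1)[OF _ xp] by blast
 have g': "finite Ga" "!!ga. ga:Ga ==> lse V U ga"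
  "!!y. y:U ==> module_span (Ox y) (St V y) ((%ga. ga y) ` Ga) = $(St V y)" using g by (simp_all add: lgen_def)
 have Gac: "(%ga. ga x) ` Ga <= $(St V x)" using lsec_carrier[OF V g'(2) U(2)] by (intro image_subsetI)
 note m = stalk_module[OF V xp]
 have "module_span (Ox x) (St V x) ((%ga. ga x) ` Ga Un ?T) = $(St V x)"
 proof (rule subset_antisym)
  show "module_span (Ox x) (St V x) ((%ga. ga x) ` Ga Un ?T) <= $(St V x)" by (rule span_carrier[OF m]) (use Gac Tc in simp)
  show "$(St V x) <= module_span (Ox x) (St V x) ((%ga. ga x) ` Ga Un ?T)"
   using span_mono[of "(%ga. ga x) ` Ga" "(%ga. ga x) ` Ga Un ?T" "Ox x" "St V x"] g'(3)[OF U(2)] by simp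
 qed
 from nakayama[OF xp m Tc F[unfolded full_def GG_def] finite_imageI[OF g'(1)] Gac this]
 have sp: "module_span (Ox x) (St V x) ?T = $(St V x)" .
 have "ga et:GG et V d" if ga: "ga:Ga" for ga
 proof -
  have "ga x:module_span (Ox x) (St V x) ?T" unfolding sp by (rule lsec_carrier[OF V g'(2)[OF ga] U(2)])
  from TS_span_extend[OF V f this] obtain W sg where
   W: "op W" "x:W" "lse V W sg" "sg x = ga x" "!!z. z:W ==> sg z:GG z V d" by metis
  have WU: "op (W Int U)" "W Int U <= W" "W Int U <= U" "x:W Int U" using W U by auto
  from lsec_agree[OF V lsec_subset[OF V W(3) WU(1,2)] lsec_subset[OF V g'(2)[OF ga] WU(1,3)] WU(4) W(4)] obtain Q
   where Q: "op Q" "x:Q" "!!z. z:Q ==> sg z = ga z" by metis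
  show ?thesis using W(5)[OF et[OF W(1,2)]] Q(3)[OF et[OF Q(1,2)]] by simp
 qed
 then have "module_span (Ox et) (St V et) ((%ga. ga et) ` Ga) <= GG et V d"
  by (intro span_least[OF GG_sub[OF V etp]] image_subsetI)
 then show ?thesis unfolding full_def using g'(3)[OF et[OF U]] submoduleD(1)[OF stalk_module[OF V etp] GG_sub[OF V etp]] by (intro subset_antisym) simp_all
qed

end

section \<open>Direct sums and locally free sheaves\<close>

context lrs
begin

text \<open>The map on stalks takes the germ of a section to the germ of its image; naturality makes
  this independent of the section chosen to represent the germ.\<close>

lemma mod_hom_smor:
 assumes M: "mp M" and N: "mp N" and phi: "mod_hom X (pts X) M N phi"
 shows "EX f. smor M N f & (ALL y U s. op U --> y:U --> s:$(msec M U) --> f y (mg M y U s) = mg N y U (phi U s))"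
proof -
 have o: "W:opens_in X (pts X)" if "op W" for W using that openin_subset by (auto simp: opens_in_def)
 note h = phi[unfolded mod_hom_def, rule_format, OF o]
 have c: "phi W a:$(msec N W)" if "op W" "a:$(msec M W)" for W a using h[OF that(1)] that(2) by blast
 have ad: "phi W (a +[msec M W] b) = phi W a +[msec N W] phi W b" if "op W" "a:$(msec M W)" "b:$(msec M W)" for W a b
  using h[OF that(1)] that by blast
 have sm: "phi W (r *.[msec M W] a) = r *.[msec N W] phi W a" if "op W" "r:$(SX W)" "a:$(msec M W)" for W a r
  using h[OF that(1)] that by blast
 have nt: "phi W' (mres M W W' a) = mres N W W' (phi W a)" if "op W" "op W'" "W' <= W" "a:$(msec M W)" for W W' a
  using h[OF that(1)] that by (simp add: opens_in_def)
 define P where "P y g v <-> (EX U s. op U & y:U & s:$(msec M U) & g = mg M y U s & v = mg N y U (phi U s))" for y g v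
 define f where "f y g = (SOME v. P y g v)" for y g
 have v: "f y (mg M y U s) = mg N y U (phi U s)" if U: "op U" "y:U" "s:$(msec M U)" for y U s
 proof -
  have "P y (mg M y U s) (mg N y U (phi U s))" unfolding P_def using U by metis
  then have "P y (mg M y U s) (f y (mg M y U s))" unfolding f_def by (rule someI)
  then obtain V t where V: "op V" "y:V" "t:$(msec M V)" "mg M y U s = mg M y V t"
   "f y (mg M y U s) = mg N y V (phi V t)" unfolding P_def by metis
  from V(4) obtain W where W: "op W" "y:W" "W <= U Int V" "mres M U W s = mres M V W t"
   unfolding mgerm_eq_iff[OF M U V(1-3)] by metis
  have "mres N U W (phi U s) = mres N V W (phi V t)"
   using nt[OF U(1) W(1) _ U(3)] nt[OF V(1) W(1) _ V(3)] W by simp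
  then have "mg N y U (phi U s) = mg N y V (phi V t)"
   using mgerm_eq_iff[OF N U(1,2) c[OF U(1,3)] V(1,2) c[OF V(1,3)]] W by metis
  then show ?thesis using V(5) by simp
 qed
 have "smor M N f"
 proof (rule smorI)
  fix y assume y: "y:pts X"
  show "lin (Ox y) (St M y) (St N y) (f y)"
  proof (rule slinI)
   fix a b assume ab: "a:$(St M y)" "b:$(St M y)"
   from mstalk_rep2[OF M ab y] obtain U s t where U: "op U" "y:U" "s:$(msec M U)" "t:$(msec M U)"
    "a = mg M y U s" "b = mg M y U t" by metis
   have st: "s +[msec M U] t:$(msec M U)" by (rule abelian_groupE(1)[OF module_groups(1)[OF P'(1)[OF M U(1)]] U(3,4)])
   show "f y a:$(St N y)" unfolding U(5) v[OF U(1-3)] by (rule mgerm_op(1)[OF N U(1,2) c[OF U(1,3)]])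
   show "f y (a +[St M y] b) = f y a +[St N y] f y b"
    unfolding U(5,6) mgerm_op(2)[OF M U(1-4)] v[OF U(1,2,3)] v[OF U(1,2,4)] v[OF U(1,2) st] ad[OF U(1,3,4)]
    by (rule mgerm_op(2)[OF N U(1,2) c[OF U(1,3)] c[OF U(1,4)], symmetric])
  next
   fix r a assume r: "r:$(Ox y)" and a: "a:$(St M y)"
   from stalk_rep[OF r] obtain V q where V: "op V" "y:V" "q:$(SX V)" "r = rg y V q" by metis
   from mstalk_rep[OF M a] obtain U s where U: "op U" "y:U" "s:$(msec M U)" "a = mg M y U s" by metis
   have W: "op (U Int V)" "U Int V <= U" "U Int V <= V" "y:U Int V" using U V by auto
   note s = mres_closed[OF M U(1) W(1,2) U(3)] and q = preshD(1)[OF sec_presh V(1) W(1,3) V(3)]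
   have a': "a = mg M y (U Int V) (mres M U (U Int V) s)" "r = rg y (U Int V) (res X V (U Int V) q)"
    using mgerm_res[OF M U(1) W(1,2,4) U(3)] rgerm_res[OF V(1) W(1,3,4) V(3)] U(4) V(4) by simp_all
   show "f y (r *.[St M y] a) = r *.[St N y] f y a"
    unfolding a' mgerm_op(3)[OF M W(1,4) s q] v[OF W(1,4) s] v[OF W(1,4) module.smult_closed[OF P'(1)[OF M W(1)] q s]] sm[OF W(1) q s]
    by (rule mgerm_op(3)[OF N W(1,4) c[OF W(1) s] q, symmetric])
  qed
 next
  fix U sg assume sg: "lse M U sg"
  show "lse N U (%y. f y (sg y))"
  proof (rule lsecI[OF N lsec_open[OF M sg]])
   fix y assume y: "y:U"
   obtain W t where W: "op W" "y:W" "W <= U" "t:$(msec M W)" "!!z. z:W ==> sg z = mg M z W t" using lsecD[OF M sg y] by metis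
   show "EX W t. op W & y:W & W <= U & t:$(msec N W) & (ALL z:W. f z (sg z) = mg N z W t)"
    using W c[OF W(1,4)] by (intro exI[of _ W] exI[of _ "phi W t"]) (simp add: v)
  qed
 qed
 then show ?thesis using v by metis
qed

lemma direct_sum_presh:
 assumes Ep: "mp E" and Fp: "mp F"
 shows "mp (direct_sum_sheaf E F)"
proof -
 let ?W = "direct_sum_sheaf E F"
 have s: "$(msec ?W U) = $(msec E U) \<times> $(msec F U)" "mres ?W U V = map_prod (mres E U V) (mres F U V)"
  "(a, b) +[msec ?W U] (a', b') = (a +[msec E U] a', b +[msec F U] b')" "r *.[msec ?W U] (a, b) = (r *.[msec E U] a, r *.[msec F U] b)"
  "0[msec ?W U] = (0[msec E U], 0[msec F U])" for U V a b a' b' r by (simp_all add: direct_sum_sheaf_def)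
 show ?thesis unfolding mod_presh_def
 proof (intro conjI allI impI)
  fix U assume U: "op U"
  interpret E: module "SX U" "msec E U" by (rule P'(1)[OF Ep U])
  interpret F: module "SX U" "msec F U" by (rule P'(1)[OF Fp U])
  show "module (SX U) (msec ?W U)"
  proof (rule moduleI[OF sec_cring[OF U] abelian_groupI])
   show "EX y:$(msec ?W U). y +[msec ?W U] x = 0[msec ?W U]" if "x:$(msec ?W U)" for x
    using that by (intro bexI[of _ "(-[msec E U] fst x, -[msec F U] snd x)"]) (auto simp: s E.M.l_neg F.M.l_neg)
  qed (auto simp: s E.M.a_ac F.M.a_ac E.smult_l_distr F.smult_l_distr E.smult_r_distr F.smult_r_distr E.smult_assoc1 F.smult_assoc1)
 next
  fix U V assume "op U & op V & V <= U"
  then have V: "op U" "op V" "V <= U" by auto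
  note e = slinD[OF P'(2)[OF Ep V]] and f = slinD[OF P'(2)[OF Fp V]]
  show "slin (SX U) (res X U V) (msec ?W U) (msec ?W V) (mres ?W U V)"
   by (rule slinI; clarsimp simp: s e f)
 next
  show "presh (topo X) (%U. $(msec ?W U)) (mres ?W)"
   unfolding presh_def s
   by (intro conjI allI impI ballI funcsetI; elim conjE SigmaE; hypsubst)
    (simp_all add: preshD[OF P'(3)[OF Ep]] preshD[OF P'(3)[OF Fp]])
 qed
qed

lemma direct_sum_maps:
 assumes Ep: "mp E" and Fp: "mp F"
 defines "W \<equiv> direct_sum_sheaf E F"
 obtains i1 i2 p1 p2 where "smor E W i1" "smor F W i2" "smor W E p1" "smor W F p2"
  "!!y a. a:$(St E y) ==> p1 y (i1 y a) = a" "!!y b. b:$(St F y) ==> p2 y (i2 y b) = b"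
  "!!y w. w:$(St W y) ==> w = i1 y (p1 y w) +[St W y] i2 y (p2 y w)"
proof -
 have Wp: "mp W" unfolding W_def by (rule direct_sum_presh[OF Ep Fp])
 have s: "$(msec W U) = $(msec E U) \<times> $(msec F U)" "mres W U V = map_prod (mres E U V) (mres F U V)"
  "(a, b) +[msec W U] (a', b') = (a +[msec E U] a', b +[msec F U] b')" "r *.[msec W U] (a, b) = (r *.[msec E U] a, r *.[msec F U] b)"
  for U V a b a' b' r by (simp_all add: W_def direct_sum_sheaf_def)
 have z: "0[msec E U]:$(msec E U)" "0[msec F U]:$(msec F U)"
  "0[msec E U] +[msec E U] 0[msec E U] = 0[msec E U]" "0[msec F U] +[msec F U] 0[msec F U] = 0[msec F U]"
  "r:$(SX U) ==> r *.[msec E U] 0[msec E U] = 0[msec E U]" "r:$(SX U) ==> r *.[msec F U] 0[msec F U] = 0[msec F U]"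
  "a:$(msec E U) ==> a +[msec E U] 0[msec E U] = a" "b:$(msec F U) ==> 0[msec F U] +[msec F U] b = b"
  if U: "op U" for U a b r
 proof -
  interpret E: module "SX U" "msec E U" by (rule P'(1)[OF Ep U])
  interpret F: module "SX U" "msec F U" by (rule P'(1)[OF Fp U])
  show "0[msec E U]:$(msec E U)" "0[msec F U]:$(msec F U)"
   "0[msec E U] +[msec E U] 0[msec E U] = 0[msec E U]" "0[msec F U] +[msec F U] 0[msec F U] = 0[msec F U]"
   "r:$(SX U) ==> r *.[msec E U] 0[msec E U] = 0[msec E U]" "r:$(SX U) ==> r *.[msec F U] 0[msec F U] = 0[msec F U]"
   "a:$(msec E U) ==> a +[msec E U] 0[msec E U] = a" "b:$(msec F U) ==> 0[msec F U] +[msec F U] b = b" by simp_all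
 qed
 have rz: "mres E U V 0[msec E U] = 0[msec E V]" "mres F U V 0[msec F U] = 0[msec F V]" if "op U" "op V" "V <= U" for U V
  by (rule slin_zero[OF P'(2)[OF Ep that] module_groups(1)[OF P'(1)[OF Ep that(1)]] module_groups(1)[OF P'(1)[OF Ep that(2)]]],
   rule slin_zero[OF P'(2)[OF Fp that] module_groups(1)[OF P'(1)[OF Fp that(1)]] module_groups(1)[OF P'(1)[OF Fp that(2)]]])
 have "mod_hom X (pts X) E W (%U a. (a, 0[msec F U]))" "mod_hom X (pts X) F W (%U b. (0[msec E U], b))"
  "mod_hom X (pts X) W E (%U. fst)" "mod_hom X (pts X) W F (%U. snd)"
  unfolding mod_hom_def opens_in_def by (auto simp: s z rz)
 note h = this
 obtain i1 where m1: "smor E W i1" and v1: "!!y U a. op U ==> y:U ==> a:$(msec E U) ==> i1 y (mg E y U a) = mg W y U (a, 0[msec F U])"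
  using mod_hom_smor[OF Ep Wp h(1)] by metis
 obtain i2 where m2: "smor F W i2" and v2: "!!y U b. op U ==> y:U ==> b:$(msec F U) ==> i2 y (mg F y U b) = mg W y U (0[msec E U], b)"
  using mod_hom_smor[OF Fp Wp h(2)] by metis
 obtain p1 where m3: "smor W E p1" and v3: "!!y U w. op U ==> y:U ==> w:$(msec W U) ==> p1 y (mg W y U w) = mg E y U (fst w)"
  using mod_hom_smor[OF Wp Ep h(3)] by metis
 obtain p2 where m4: "smor W F p2" and v4: "!!y U w. op U ==> y:U ==> w:$(msec W U) ==> p2 y (mg W y U w) = mg F y U (snd w)"
  using mod_hom_smor[OF Wp Fp h(4)] by metis
 have i1: "p1 y (i1 y a) = a" if a: "a:$(St E y)" for y a
  using mstalk_rep[OF Ep a] by (metis v1 v3 s(1) z(2) mem_Sigma_iff fst_conv)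
 have i2: "p2 y (i2 y b) = b" if b: "b:$(St F y)" for y b
  using mstalk_rep[OF Fp b] by (metis v2 v4 s(1) z(1) mem_Sigma_iff snd_conv)
 have i3: "w = i1 y (p1 y w) +[St W y] i2 y (p2 y w)" if w: "w:$(St W y)" for y w
 proof -
  from mstalk_rep[OF Wp w] obtain U c where U: "op U" "y:U" "c:$(msec W U)" "w = mg W y U c" by metis
  then obtain a b where c: "c = (a, b)" "a:$(msec E U)" "b:$(msec F U)" by (auto simp: s)
  have h: "(a, 0[msec F U]):$(msec W U)" "(0[msec E U], b):$(msec W U)" using c z(1,2)[OF U(1)] by (simp_all add: s)
  show ?thesis unfolding U(4) v3[OF U(1-3)] v4[OF U(1-3)] using c z(7,8)[OF U(1)]
   by (simp add: v1[OF U(1,2)] v2[OF U(1,2)] mgerm_op(2)[OF Wp U(1,2) h] s)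
 qed
 show thesis by (rule that[OF m1 m2 m3 m4 i1 i2 i3])
qed

text \<open>The standard basis of the free sheaf is pulled back over a trivializing open set. Its
  restrictions generate the sections over every smaller open set, and therefore its germs generate
  the stalks.\<close>

lemma locally_free_gens:
 assumes E: "locally_free X n E" and x: "x:pts X"
 shows "EX U Ga. op U & x:U & lgen E U Ga"
proof -
 have Ep: "mp E" by (rule sheaf_presh) (use E in "simp add: locally_free_def")
 from E x obtain U phi where U: "op U" "x:U" and phi: "mod_hom X U E (free_sheaf X n) phi"
  and bij: "!!W. W:opens_in X U ==> bij_betw (phi W) ($(msec E W)) ($(msec (free_sheaf X n) W))"
  unfolding locally_free_def mod_iso_on_def by blast
 have fc: "$(msec (free_sheaf X n) W) = {..<n} \<rightarrow>\<^sub>E $(SX W)" for W by (simp add: free_sheaf_def)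
 define de where "de W i = (\<lambda>j\<in>{..<n}. if j = i then 1[SX W] else 0[SX W])" for W and i :: nat
 have c01: "1[SX W]:$(SX W)" "0[SX W]:$(SX W)" if "op W" for W using sec_cring[OF that] by (simp_all add: cring_def ring.ring_simprules)
 have UU: "U:opens_in X U" using U by (simp add: opens_in_def)
 have "EX e. e:$(msec E U) & phi U e = de U i" for i
 proof -
  have "de U i:$(msec (free_sheaf X n) U)" unfolding fc de_def using c01[OF U(1)] by (simp add: PiE_def)
  then show ?thesis using bij[OF UU] unfolding bij_betw_def by (metis imageE)
 qed
 then obtain e where e: "!!i. e i:$(msec E U)" "!!i. phi U (e i) = de U i" by metis
 have sp: "module_span (SX W) (msec E W) ((%i. mres E U W (e i)) ` {..<n}) = $(msec E W)" if W: "op W" "W <= U" for W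
 proof -
  have WU: "W:opens_in X U" using W by (simp add: opens_in_def)
  interpret M: module "SX W" "msec E W" by (rule P'(1)[OF Ep W(1)])
  let ?G = "(%i. mres E U W (e i)) ` {..<n}"
  have G: "?G <= $(msec E W)" using mres_closed[OF Ep U(1) W e(1)] by blast
  note ph = phi[unfolded mod_hom_def, rule_format, OF WU] phi[unfolded mod_hom_def, rule_format, OF UU]
  have phie: "phi W (mres E U W (e i)) = de W i" for i
  proof -
   have "phi W (mres E U W (e i)) = mres (free_sheaf X n) U W (phi U (e i))" using ph(2) WU e(1) by blast
   then show ?thesis unfolding e(2) using ring_hom_one[OF res_hom[OF U(1) W]] ring_hom_zero[OF res_hom[OF U(1) W]] sec_cring[OF U(1)] sec_cring[OF W(1)]
    by (auto simp: free_sheaf_def de_def restrict_def fun_eq_iff cring_def)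
  qed
  note S = span_submodule[OF P'(1)[OF Ep W(1)] G] and SD = submoduleD[OF P'(1)[OF Ep W(1)] span_submodule[OF P'(1)[OF Ep W(1)] G]]
  have "$(msec E W) <= module_span (SX W) (msec E W) ?G"
  proof
   fix s assume s: "s:$(msec E W)"
   let ?f = "phi W s"
   have f: "?f:{..<n} \<rightarrow>\<^sub>E $(SX W)" using bij[OF WU] s fc unfolding bij_betw_def by blast
   have fi: "?f i:$(SX W)" if "i < n" for i using f that by (auto simp: PiE_def Pi_def)
   \<comment> \<open>Induction on the number of coordinates kept: the vector truncated to its first
     \<open>k\<close> coordinates is the image of an element of the span.\<close>
   have "EX t:module_span (SX W) (msec E W) ?G. phi W t = (\<lambda>j\<in>{..<n}. if j < k then ?f j else 0[SX W])" if "k <= n" for k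
    using that
   proof (induction k)
    case 0
    have "phi W (0[SX W] *.[msec E W] s) = 0[SX W] *.[msec (free_sheaf X n) W] ?f" using ph(1) s M.R.zero_closed by blast
    then have "phi W 0[msec E W] = (\<lambda>j\<in>{..<n}. 0[SX W])" using fi by (auto simp: M.smult_l_null[OF s] free_sheaf_def restrict_def fun_eq_iff)
    then show ?case using SD(2) by (intro bexI[of _ "0[msec E W]"]) simp_all
   next
    case (Suc k)
    then have k: "k < n" by simp
    from Suc.IH[OF less_imp_le[OF k]] obtain t where t: "t:module_span (SX W) (msec E W) ?G" "phi W t = (\<lambda>j\<in>{..<n}. if j < k then ?f j else 0[SX W])"
     by (elim bexE) (rule that)
    let ?u = "?f k *.[msec E W] mres E U W (e k)"
    have u: "?u:module_span (SX W) (msec E W) ?G" by (rule SD(4)[OF fi[OF k] span_incl]) (use k in simp)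
    have tu: "t:$(msec E W)" "?u:$(msec E W)" using t(1) u SD(1) by auto
    have eW: "mres E U W (e k):$(msec E W)" by (rule mres_closed[OF Ep U(1) W e(1)])
    have "phi W (t +[msec E W] ?u) = phi W t +[msec (free_sheaf X n) W] phi W ?u" using ph(1) tu by blast
    also have "phi W ?u = ?f k *.[msec (free_sheaf X n) W] de W k" using ph(1) eW fi[OF k] phie by metis
    finally have "phi W (t +[msec E W] ?u) = (\<lambda>j\<in>{..<n}. if j < Suc k then ?f j else 0[SX W])"
     unfolding t(2) using fi k by (auto simp: free_sheaf_def de_def restrict_def fun_eq_iff less_Suc_eq)
    then show ?case using SD(3)[OF t(1) u] by blast
   qed
   from this[OF order_refl] obtain t where t: "t:module_span (SX W) (msec E W) ?G" "phi W t = (\<lambda>j\<in>{..<n}. if j < n then ?f j else 0[SX W])"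
    by (elim bexE) (rule that)
   have "phi W t = ?f" unfolding t(2) by (rule extensionalityI[of _ "{..<n}"]) (use f in "auto simp: PiE_def")
   then have "t = s" using bij[OF WU] s t(1) SD(1) unfolding bij_betw_def inj_on_def by blast
   then show "s:module_span (SX W) (msec E W) ?G" using t(1) by simp
  qed
  then show ?thesis using SD(1) by blast
 qed
 let ?Ga = "(%i y. mg E y U (e i)) ` {..<n}"
 have "lgen E U ?Ga" unfolding lgen_def
 proof (intro conjI ballI)
  show "lse E U ga" if "ga:?Ga" for ga using that lsec_germ[OF Ep U(1) e(1)] by (elim imageE) simp
  fix y assume y: "y:U"
  note yp = op_pts[OF U(1) y]
  let ?G = "(%ga. ga y) ` ?Ga"
  have G: "?G <= $(St E y)" unfolding image_image using mgerm_op(1)[OF Ep U(1) y e(1)] by blast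
  note S = span_submodule[OF stalk_module[OF Ep yp] G]
  show "module_span (Ox y) (St E y) ?G = $(St E y)"
  proof (rule subset_antisym[OF span_carrier[OF stalk_module[OF Ep yp] G] subsetI])
   fix g assume "g:$(St E y)"
   from mstalk_rep[OF Ep this] obtain V s where V: "op V" "y:V" "s:$(msec E V)" "g = mg E y V s" by metis
   have W: "op (U Int V)" "U Int V <= U" "U Int V <= V" "y:U Int V" using U V y by auto
   let ?s = "mres E V (U Int V) s"
   have s: "?s:module_span (SX (U Int V)) (msec E (U Int V)) ((%i. mres E U (U Int V) (e i)) ` {..<n})"
    unfolding sp[OF W(1,2)] by (rule mres_closed[OF Ep V(1) W(1,3) V(3)])
   have "mg E y (U Int V) ?s:module_span (Ox y) (St E y) ?G"
   proof (rule slin_span[OF mgerm_slin[OF Ep W(1,4)] P'(1)[OF Ep W(1)] stalk_module[OF Ep yp] _ S _ _ s])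
    show "rg y (U Int V):$(SX (U Int V)) -> $(Ox y)" using rgerm_op(1)[OF W(1,4)] by blast
    show "(%i. mres E U (U Int V) (e i)) ` {..<n} <= $(msec E (U Int V))" using mres_closed[OF Ep U(1) W(1,2) e(1)] by blast
    fix t assume "t:(%i. mres E U (U Int V) (e i)) ` {..<n}"
    then obtain i where i: "i < n" "t = mres E U (U Int V) (e i)" by blast
    show "mg E y (U Int V) t:module_span (Ox y) (St E y) ?G"
     unfolding i(2) mgerm_res[OF Ep U(1) W(1,2,4) e(1)] image_image by (rule span_incl) (use i(1) in blast)
   qed
   then show "g:module_span (Ox y) (St E y) ?G" unfolding V(4) mgerm_res[OF Ep V(1) W(1,3,4) V(3)] .
  qed
 qed simp
 then show ?thesis using U by blast
qed

end

section \<open>Integral schemes\<close>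

context
 fixes R :: "'r ring" and p
 assumes p: "primeideal p R"
begin

interpretation p: primeideal p R by (rule p)

lemma prime_mult: "a:$R - p ==> b:$R - p ==> a *[R] b:$R - p"
 using p.I_prime by auto

lemma prime_one: "1[R]:$R - p"
 using p.one_imp_carrier p.I_notcarr by auto

lemma fraction_self: "a:$R ==> b:$R - p ==> (a, b):fraction R ($R - p) a b"
 using prime_one by (auto simp: fraction_def)

lemma fraction_eq:
 assumes a: "a:$R" "b:$R - p" and c: "(c, d):fraction R ($R - p) a b"
 shows "fraction R ($R - p) c d = fraction R ($R - p) a b"
proof -
 have tr: "(e, f):fraction R ($R - p) a b"
  if "a:$R" "b:$R - p" "(c, d):fraction R ($R - p) a b" "(e, f):fraction R ($R - p) c d" for a b c d e f
 proof -
  note h = that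
  obtain t where t: "t:$R - p" "t *[R] (a *[R] d) = t *[R] (c *[R] b)" and c: "c:$R" "d:$R - p"
   using h(3) by (auto simp: fraction_def)
  obtain u where u: "u:$R - p" "u *[R] (c *[R] f) = u *[R] (e *[R] d)" and e: "e:$R" "f:$R - p"
   using h(4) by (auto simp: fraction_def)
  \<comment> \<open>Besides the two multipliers, the middle denominator \<open>d\<close> is needed
    to clear the common fraction; primality keeps the product outside \<open>p\<close>.\<close>
  let ?w = "(t *[R] u) *[R] d"
  have k: "a:$R" "b:$R" "c:$R" "d:$R" "e:$R" "f:$R" "t:$R" "u:$R" using that c e t u by auto
  have "?w *[R] (a *[R] f) = (u *[R] f) *[R] (t *[R] (a *[R] d))" using k by (simp add: p.m_ac)
  also have "\<dots> = (t *[R] b) *[R] (u *[R] (c *[R] f))" unfolding t(2) using k by (simp add: p.m_ac)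
  also have "\<dots> = ?w *[R] (e *[R] b)" unfolding u(2) using k by (simp add: p.m_ac)
  finally show ?thesis using prime_mult[OF prime_mult[OF t(1) u(1)] c(2)] e unfolding fraction_def by blast
 qed
 obtain t where c1: "c:$R" "d:$R - p" and t: "t:$R - p" "t *[R] (a *[R] d) = t *[R] (c *[R] b)"
  using c by (auto simp: fraction_def)
 have c': "c:$R" "d:$R - p" "(a, b):fraction R ($R - p) c d"
  using c1 a t(1) t(2)[symmetric] unfolding fraction_def by blast+
 show ?thesis using tr[OF a c] tr[OF c'] by auto
qed

lemma fraction_zero_iff:
 assumes "a:$R" "b:$R - p"
 shows "fraction R ($R - p) a b = fraction R ($R - p) 0[R] 1[R] <-> (EX t:$R - p. t *[R] a = 0[R])"
proof -
 have "fraction R ($R - p) a b = fraction R ($R - p) 0[R] 1[R] <-> (0[R], 1[R]):fraction R ($R - p) a b"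
  using fraction_eq[OF assms] fraction_self[OF p.zero_closed prime_one] by metis
 also have "\<dots> <-> (EX t:$R - p. t *[R] a = 0[R])"
  using assms prime_one by (auto simp: fraction_def)
 finally show ?thesis .
qed

lemma fraction_mult:
 assumes a: "a:$R" "b:$R - p" and c: "c:$R" "d:$R - p"
 shows "fraction R ($R - p) a b *[localization R ($R - p)] fraction R ($R - p) c d = fraction R ($R - p) (a *[R] c) (b *[R] d)"
proof -
 let ?f = "fraction R ($R - p)"
 have "?f (a' *[R] c') (b' *[R] d') = ?f (a *[R] c) (b *[R] d)" if "(a', b'):?f a b" "(c', d'):?f c d" for a' b' c' d'
 proof (rule fraction_eq)
  note h = that
  obtain t u where t: "t:$R - p" "t *[R] (a *[R] b') = t *[R] (a' *[R] b)" "a':$R" "b':$R - p"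
   and u: "u:$R - p" "u *[R] (c *[R] d') = u *[R] (c' *[R] d)" "c':$R" "d':$R - p"
   using h by (auto simp: fraction_def)
  have k: "a:$R" "b:$R" "c:$R" "d:$R" "a':$R" "b':$R" "c':$R" "d':$R" "t:$R" "u:$R"
   using a c t u by auto
  have "(t *[R] u) *[R] ((a *[R] c) *[R] (b' *[R] d')) = (t *[R] (a *[R] b')) *[R] (u *[R] (c *[R] d'))" using k by (simp add: p.m_ac)
  also have "\<dots> = (t *[R] u) *[R] ((a' *[R] c') *[R] (b *[R] d))" unfolding t(2) u(2) using k by (simp add: p.m_ac)
  finally show "(a' *[R] c', b' *[R] d'):?f (a *[R] c) (b *[R] d)"
   unfolding fraction_def using prime_mult[OF t(1) u(1)] prime_mult[OF t(4) u(4)] t(3) u(3) by blast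
 qed (use a c prime_mult in auto)
 then have "(\<Union>(a', b')\<in>?f a b. \<Union>(c', d')\<in>?f c d. ?f (a' *[R] c') (b' *[R] d')) = ?f (a *[R] c) (b *[R] d)"
  using fraction_self[OF a] fraction_self[OF c] by fast
 then show ?thesis by (simp add: localization_def)
qed

end

lemma Spec_simps:
 "topo (Spec R) = topology_generated_by {{p. primeideal p R & f \<notin> p} | f. f:$R}"
 "res (Spec R) U V s = restrict s V"
 "s:$(sec (Spec R) U) <-> s:extensional U & (ALL p:U. EX W a b. openin (topo (Spec R)) W & p:W & W <= U &
  a:$R & b:$R & (ALL q:W. b \<notin> q & s q = fraction R ($R - q) a b))"
 "s *[sec (Spec R) U] t = (\<lambda>p\<in>U. s p *[localization R ($R - p)] t p)"
 by (simp_all add: Spec_def fraction_space_def Let_def)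

lemma Spec_pts:
 fixes R :: "'r ring"
 assumes "cring R"
 shows "pts (Spec R) = {p. primeideal p R}"
proof -
 interpret cring R by fact
 have "EX f:$R. f \<notin> p" if "primeideal p R" for p
  using prime_one[OF that] by blast
 then show ?thesis unfolding Spec_simps topology_generated_by_topspace by blast
qed

text \<open>The kernel of \<open>R \<rightarrow> \<O>(Spec R)\<close> is prime as soon as \<open>\<O>(Spec R)\<close> is a domain, and is then
 the generic point.\<close>

lemma Spec_generic:
 fixes R :: "'r ring"
 assumes R: "cring R" and ne: "pts (Spec R) ~= {}"
  and D: "!!V a b. openin (topo (Spec R)) V ==> V ~= {} ==> a:$R ==> b:$R ==>
   (ALL p:V. EX t:$R - p. t *[R] (a *[R] b) = 0[R]) ==>
   (ALL p:V. EX t:$R - p. t *[R] a = 0[R]) \<or> (ALL p:V. EX t:$R - p. t *[R] b = 0[R])"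
 shows "EX N. (ALL V. openin (topo (Spec R)) V --> V ~= {} --> N:V) &
  (ALL V s. openin (topo (Spec R)) V --> s:$(sec (Spec R) V) --> s N = fraction R ($R - N) 0[R] 1[R] --> N:V -->
   (ALL p:V. s p = fraction R ($R - p) 0[R] 1[R]))"
proof -
 interpret cring R by fact
 note P = Spec_pts[OF R]
 let ?P = "pts (Spec R)"
 have oP: "openin (topo (Spec R)) ?P" by simp
 have pr: "primeideal p R" if "p:?P" for p using that P by simp
 have sub: "primeideal p R" if "openin (topo (Spec R)) V" "p:V" for V p using openin_subset[OF that(1)] that(2) P by blast
 \<comment> \<open>The annihilator is allowed to vary with the point, which is exactly when all
   fractions with numerator \<open>a\<close> vanish locally. Primality of \<open>N\<close> is then
   the hypothesis \<open>D\<close> for the whole spectrum.\<close>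
 define N where "N = {a:$R. ALL p:?P. EX t:$R - p. t *[R] a = 0[R]}"
 have Nm: "r *[R] a:N" if "a:N" "r:$R" for a r
 proof -
  have a: "a:$R" and r: "r:$R" using that by (auto simp: N_def)
  have "EX t:$R - p. t *[R] (r *[R] a) = 0[R]" if p: "p:?P" for p
  proof -
   from \<open>a \<in> N\<close> p obtain t where t: "t:$R - p" "t *[R] a = 0[R]" unfolding N_def by blast
   then have "t *[R] (r *[R] a) = 0[R]" using m_lcomm[of t r a] a r by simp
   then show ?thesis using t(1) by blast
  qed
  then show ?thesis using a r by (simp add: N_def)
 qed
 have Na: "a +[R] b:N" if a: "a:N" and b: "b:N" for a b
 proof -
  have "EX t:$R - p. t *[R] (a +[R] b) = 0[R]" if p: "p:?P" for p
  proof -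
   from a p obtain t where t: "t:$R - p" "t *[R] a = 0[R]" unfolding N_def by blast
   from b p obtain u where u: "u:$R - p" "u *[R] b = 0[R]" unfolding N_def by blast
   have k: "a:$R" "b:$R" "t:$R" "u:$R" using a b t u by (auto simp: N_def)
   have "(t *[R] u) *[R] (a +[R] b) = u *[R] (t *[R] a) +[R] t *[R] (u *[R] b)"
    using k by (simp add: r_distr m_ac)
   then have "(t *[R] u) *[R] (a +[R] b) = 0[R]" unfolding t(2) u(2) using t(1) u(1) by simp
   then show ?thesis using prime_mult[OF pr[OF p] t(1) u(1)] by blast
  qed
  then show ?thesis using a b by (simp add: N_def)
 qed
 obtain p0 where p0: "p0:?P" using ne by blast
 have N: "primeideal N R"
 proof (rule primeidealI[OF idealI R])
  show "ring R" by (rule ring_axioms)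
  show "subgroup N (add_monoid R)"
  proof (rule add.subgroupI)
   show "N <= $R" by (auto simp: N_def)
   have "0[R]:N" unfolding N_def using prime_one[OF pr] by fastforce
   then show "N ~= {}" by blast
   show "-[R] a:N" if "a:N" for a using Nm[OF that, of "-[R] 1[R]"] that by (simp add: l_minus N_def)
  qed (rule Na)
  show "a *[R] r:N" "r *[R] a:N" if "a:N" "r:$R" for a r
   using Nm[OF that] that m_comm[of a r] by (simp_all add: N_def)
  show "$R ~= N"
  proof
   assume "$R = N"
   then obtain t where "t:$R - p0" "t *[R] 1[R] = 0[R]" using p0 one_closed unfolding N_def by blast
   then show False using additive_subgroup.zero_closed[OF ideal.axioms(1)[OF primeideal.axioms(1)[OF pr[OF p0]]]] by simp
  qed
  show "a:N \<or> b:N" if "a:$R" "b:$R" "a *[R] b:N" for a b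
   using D[OF oP ne that(1,2)] that unfolding N_def by blast
 qed
 have Nz: "t *[R] f ~= 0[R]" if "primeideal p R" "t:$R - p" "f:$R - p" for p t f
  using prime_mult[OF that] additive_subgroup.zero_closed[OF ideal.axioms(1)[OF primeideal.axioms(1)[OF that(1)]]] by auto
 have NV: "N:V" if V: "openin (topo (Spec R)) V" "p:V" for V p
 proof -
  have "generate_topology_on {{p. primeideal p R & f \<notin> p} | f. f:$R} V"
   using V(1) unfolding Spec_simps openin_topology_generated_by_iff .
  then show ?thesis using V(2)
  proof (induction V)
   case (Basis s)
   then obtain f where f: "f:$R" "s = {p. primeideal p R & f \<notin> p}" by blast
   \<comment> \<open>An element of \<open>N\<close> is annihilated by something outside
     \<open>p\<close>. If it lay outside \<open>p\<close> too, primality would put the product,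
     which is 0, outside \<open>p\<close>.\<close>
   have "f \<notin> N" using Basis(2) Nz[of p _ f] f P unfolding N_def by blast
   then show ?case using f N by simp
  qed auto
 qed
 have "s p = fraction R ($R - p) 0[R] 1[R]"
  if V: "openin (topo (Spec R)) V" and s: "s:$(sec (Spec R) V)" and sN: "s N = fraction R ($R - N) 0[R] 1[R]" and p: "p:V" for V s p
 proof -
  from s[unfolded Spec_simps(3)] p obtain W a b where W: "openin (topo (Spec R)) W" "p:W" and a: "a:$R" "b:$R"
   and f: "!!q. q:W ==> b \<notin> q & s q = fraction R ($R - q) a b" by metis
  note NW = NV[OF W]
  \<comment> \<open>Vanishing at \<open>N\<close> yields one annihilator \<open>t\<close> of the
    numerator outside \<open>N\<close>. The product of \<open>t\<close> and \<open>a\<close> is zero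
    throughout \<open>W\<close>, and \<open>t\<close> does not vanish at the point \<open>N\<close>
    of \<open>W\<close>; so \<open>D\<close> on \<open>W\<close> makes \<open>a\<close> vanish at
    every point of \<open>W\<close>.\<close>
  obtain t where t: "t:$R - N" "t *[R] a = 0[R]"
   using fraction_zero_iff[OF N a(1), of b] f[OF NW] sN a(2) by auto
  have "EX u:$R - q. u *[R] (t *[R] a) = 0[R]" if "q:W" for q
   unfolding t(2) using prime_one[OF sub[OF W(1) that]] by (intro bexI[of _ "1[R]"]) simp_all
  then have "(ALL q:W. EX u:$R - q. u *[R] t = 0[R]) \<or> (ALL q:W. EX u:$R - q. u *[R] a = 0[R])"
   using D[OF W(1) _ _ a(1), of t] W(2) t(1) by blast
  moreover have "\<not> (ALL q:W. EX u:$R - q. u *[R] t = 0[R])" using Nz[OF N _ t(1)] NW by blast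
  ultimately have "EX u:$R - p. u *[R] a = 0[R]" using W(2) by blast
  then show ?thesis using fraction_zero_iff[OF sub[OF W] a(1), of b] f[OF W(2)] a(2) by auto
 qed
 then show ?thesis using NV by (intro exI[of _ N]) blast
qed

section \<open>Irreducibility and the generic point of an integral scheme\<close>

locale integral_lrs = lrs X for X :: "('x, 'r) ringed_space" +
 assumes int: "integral_scheme X"
begin

lemma sec_domain: "op U ==> U ~= {} ==> domain (SX U)"
 using int by (simp add: integral_scheme_def)

lemma sec_empty:
 assumes "r:$(SX {})" "s:$(SX {})"
 shows "r = s"
 by (rule set_sheaf_eq[OF sec_sheaf openin_empty assms]) simp

text \<open>On a union of two disjoint nonempty open sets, the functions (1, 0) and (0, 1) are
  nonzero with product zero.\<close>

lemma irreducible: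
 assumes U: "op U" "U ~= {}" and V: "op V" "V ~= {}"
 shows "U Int V ~= {}"
proof
 assume e: "U Int V = {}"
 then have UV: "U ~= V" using U by auto
 have c01: "1[SX W]:$(SX W)" "0[SX W]:$(SX W)" if "op W" for W using sec_cring[OF that] by (simp_all add: cring_def ring.ring_simprules)
 have glue: "EX t:$(SX (U Un V)). res X (U Un V) U t = a & res X (U Un V) V t = b"
  if "a:$(SX U)" "b:$(SX V)" for a b
 proof -
  let ?s = "%W. if W = U then a else b"
  have "EX t:$(SX (\<Union>{U, V})). ALL W:{U, V}. res X (\<Union>{U, V}) W t = ?s W"
  proof (rule set_sheaf_glue[OF sec_sheaf])
   show oW: "op W" if "W:{U, V}" for W using that U V by auto
   show c: "?s W:$(SX W)" if "W:{U, V}" for W using that \<open>a \<in> _\<close> \<open>b \<in> _\<close> UV by auto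
   show "res X W (W Int Q) (?s W) = res X Q (W Int Q) (?s Q)" if "W:{U, V}" "Q:{U, V}" for W Q
   proof (cases "W = Q")
    case False
    then have e': "W Int Q = {}" using that e by auto
    show ?thesis unfolding e'
     by (rule sec_empty[OF preshD(1)[OF sec_presh oW[OF that(1)] openin_empty empty_subsetI c[OF that(1)]]
      preshD(1)[OF sec_presh oW[OF that(2)] openin_empty empty_subsetI c[OF that(2)]]])
   qed simp
  qed
  then show ?thesis using UV by auto
 qed
 from glue[OF c01(1)[OF U(1)] c01(2)[OF V(1)]] obtain s where s: "s:$(SX (U Un V))" "res X (U Un V) U s = 1[SX U]" "res X (U Un V) V s = 0[SX V]" by metis
 from glue[OF c01(2)[OF U(1)] c01(1)[OF V(1)]] obtain t where t: "t:$(SX (U Un V))" "res X (U Un V) U t = 0[SX U]" "res X (U Un V) V t = 1[SX V]" by metis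
 have o: "op (U Un V)" "U Un V ~= {}" using U V by auto
 interpret D: domain "SX (U Un V)" by (rule sec_domain[OF o])
 interpret U: domain "SX U" by (rule sec_domain[OF U])
 interpret V: domain "SX V" by (rule sec_domain[OF V])
 have h: "res X (U Un V) U:ring_hom (SX (U Un V)) (SX U)" "res X (U Un V) V:ring_hom (SX (U Un V)) (SX V)"
  using res_hom[OF o(1)] U V by simp_all
 note hz = ring_hom_zero[OF h(1) D.ring_axioms U.ring_axioms] ring_hom_zero[OF h(2) D.ring_axioms V.ring_axioms]
 have "s *[SX (U Un V)] t = 0[SX (U Un V)]"
 proof (rule set_sheaf_eq[OF sec_sheaf o(1)])
  fix y assume "y:U Un V"
  then show "EX W. op W & y:W & W <= U Un V & res X (U Un V) W (s *[SX (U Un V)] t) = res X (U Un V) W 0[SX (U Un V)]"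
   using U(1) V(1) ring_hom_mult[OF h(1) s(1) t(1)] ring_hom_mult[OF h(2) s(1) t(1)] hz s t by (elim UnE; intro exI[of _ U] exI[of _ V]) auto
 qed (use s(1) t(1) in auto)
 then have "s = 0[SX (U Un V)] \<or> t = 0[SX (U Un V)]" using D.integral s(1) t(1) by blast
 then show False using s t hz U.one_not_zero V.one_not_zero by auto
qed

text \<open>This keeps of an affine open set only what the global argument uses: a generic point and
  injectivity of restriction.\<close>

definition chart :: "'x set => 'x => bool" where
 "chart U et <-> op U & (ALL V. op V --> V ~= {} --> V <= U --> et:V) &
  (ALL V W r. op V --> op W --> W ~= {} --> W <= V --> V <= U --> r:$(SX V) --> res X V W r = 0[SX W] --> r = 0[SX V])"

lemma chart_exists:
 assumes x: "x:pts X"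
 shows "EX U et. x:U & chart U et"
proof -
 from int x obtain U and R :: "'r ring" where U: "op U" "x:U" and R: "cring R" and iso: "lrs_isomorphic (open_subspace X U) (Spec R)"
  unfolding integral_scheme_def scheme_def by blast
 let ?Y = "Spec R" and ?X = "open_subspace X U"
 have X: "topo ?X = subtopology (topo X) U" "sec ?X = SX" "res ?X = res X" by (simp_all add: open_subspace_def)
 have pU: "pts ?X = U" using U openin_subset[OF U(1)] by (auto simp: X)
 have oX: "openin (topo ?X) V <-> op V & V <= U" for V unfolding X using openin_open_subtopology[OF U(1)] by blast
 from iso obtain f phi where m: "lrs_morphism ?X ?Y f phi" and h: "homeomorphic_map (topo ?X) (topo ?Y) f"
  and b: "!!V. openin (topo ?Y) V ==> bij_betw (phi V) ($(sec ?Y V)) ($(SX (preim ?X f V)))"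
  unfolding lrs_isomorphic_def X(2) by blast
 have fi: "f ` U = pts ?Y" "inj_on f U" using homeomorphic_imp_surjective_map[OF h] homeomorphic_imp_injective_map[OF h] pU by auto
 have fo: "openin (topo ?Y) (f ` V)" if "op V" "V <= U" for V
  using homeomorphic_imp_open_map[OF h] that oX unfolding open_map_def by blast
 have pf: "preim ?X f (f ` V) = V" if "V <= U" for V
  unfolding preim_def pU using inj_on_image_mem_iff[OF fi(2) _ that] that by auto
 note m1 = m[unfolded lrs_morphism_def, THEN conjunct1] and m2 = m[unfolded lrs_morphism_def, THEN conjunct2, THEN conjunct1, rule_format]
  and m3 = m[unfolded lrs_morphism_def, THEN conjunct2, THEN conjunct2, THEN conjunct1, rule_format]
 have po: "op (preim ?X f V)" "preim ?X f V <= U" "V ~= {} ==> preim ?X f V ~= {}" if "openin (topo ?Y) V" for V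
 proof -
  have "openin (topo ?X) (preim ?X f V)" unfolding preim_def by (rule openin_continuous_map_preimage[OF m1 that])
  then show "op (preim ?X f V)" "preim ?X f V <= U" unfolding oX by simp_all
  assume "V ~= {}"
  then obtain p where p: "p:V" by blast
  then have "p:f ` U" using openin_subset[OF that] unfolding fi(1) by blast
  then show "preim ?X f V ~= {}" unfolding preim_def pU using p by blast
 qed
 have phih: "phi V:ring_hom (sec ?Y V) (SX (preim ?X f V))" if "openin (topo ?Y) V" for V using m2[OF that] by (simp add: X)
 have phir: "phi W (restrict s W) = res X (preim ?X f V) (preim ?X f W) (phi V s)" if "openin (topo ?Y) V" "openin (topo ?Y) W" "W <= V" "s:$(sec ?Y V)" for V W s
  using m3[of V W s] that by (simp add: X Spec_simps(2))
 interpret R: cring R by (rule R)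
 have pr: "primeideal p R" if "openin (topo ?Y) V" "p:V" for V p using openin_subset[OF that(1)] that(2) Spec_pts[OF R] by blast
 \<comment> \<open>The section \<open>a/1\<close> of the structure sheaf of the spectrum.\<close>
 define hat where "hat V a = (\<lambda>p\<in>V. fraction R ($R - p) a 1[R])" for V a
 have hc: "hat V a:$(sec ?Y V)" if V: "openin (topo ?Y) V" and a: "a:$R" for V a
  unfolding Spec_simps(3)
 proof (intro conjI ballI)
  show "hat V a:extensional V" by (simp add: hat_def)
  fix p assume "p:V"
  then show "EX W b c. openin (topo ?Y) W & p:W & W <= V & b:$R & c:$R & (ALL q:W. c \<notin> q & hat V a q = fraction R ($R - q) b c)"
   using V a prime_one[OF pr[OF V]] by (intro exI[of _ V] exI[of _ a] exI[of _ "1[R]"]) (auto simp: hat_def)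
 qed
 have hm: "hat V a *[sec ?Y V] hat V c = hat V (a *[R] c)" if V: "openin (topo ?Y) V" and a: "a:$R" "c:$R" for V a c
  unfolding Spec_simps(4) hat_def
  by (rule restrict_ext) (use fraction_mult[OF pr[OF V] a(1) prime_one[OF pr[OF V]] a(2) prime_one[OF pr[OF V]]] in simp)
 \<comment> \<open>That sections over the spectrum form a ring has not been established, so
   preservation of zero is obtained from multiplicativity alone: for a preimage \<open>z\<close> of
   0, the product of \<open>hat V 0\<close> and \<open>z\<close> is again \<open>hat V 0\<close>,
   and its image is a multiple of 0.\<close>
 have h0: "phi V (hat V 0[R]) = 0[SX (preim ?X f V)]" if V: "openin (topo ?Y) V" for V
 proof -
  interpret S: cring "SX (preim ?X f V)" by (rule sec_cring[OF po(1)[OF V]])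
  from b[OF V] S.zero_closed obtain z where z: "z:$(sec ?Y V)" "phi V z = 0[SX (preim ?X f V)]" unfolding bij_betw_def by (metis imageE)
  have "hat V 0[R] *[sec ?Y V] z = hat V 0[R]"
   unfolding Spec_simps(4) hat_def
  proof (rule restrict_ext)
   fix p assume p: "p:V"
   from z(1)[unfolded Spec_simps(3)] p obtain a c W where a: "a:$R" "c:$R" "p:W" "ALL q:W. c \<notin> q & z q = fraction R ($R - q) a c" by metis
   then have zp: "c:$R - p" "z p = fraction R ($R - p) a c" by auto
   note P = pr[OF V p] and o = prime_one[OF pr[OF V p]]
   have "fraction R ($R - p) (0[R] *[R] a) (1[R] *[R] c) = fraction R ($R - p) 0[R] 1[R]"
    using fraction_zero_iff[OF P R.zero_closed, of "1[R] *[R] c"] zp(1) a(1) o by auto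
   then show "(\<lambda>p\<in>V. fraction R ($R - p) 0[R] 1[R]) p *[localization R ($R - p)] z p = fraction R ($R - p) 0[R] 1[R]"
    using fraction_mult[OF P R.zero_closed o a(1) zp(1)] zp(2) p by simp
  qed
  then show ?thesis using ring_hom_mult[OF phih[OF V] hc[OF V R.zero_closed] z(1)] z(2) ring_hom_closed[OF phih[OF V] hc[OF V R.zero_closed]] by simp
 qed
 have hz: "hat V a = hat V 0[R] <-> (ALL p:V. EX t:$R - p. t *[R] a = 0[R])" if V: "openin (topo ?Y) V" and a: "a:$R" for V a
  using fraction_zero_iff[OF pr[OF V] a prime_one[OF pr[OF V]]] by (auto simp: hat_def restrict_def fun_eq_iff)
 have ne: "pts ?Y ~= {}" using fi(1) U(2) by auto
 have "EX N. (ALL V. openin (topo ?Y) V --> V ~= {} --> N:V) &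
  (ALL V s. openin (topo ?Y) V --> s:$(sec ?Y V) --> s N = fraction R ($R - N) 0[R] 1[R] --> N:V -->
   (ALL p:V. s p = fraction R ($R - p) 0[R] 1[R]))"
 \<comment> \<open>If the product of two elements vanishes throughout \<open>V\<close>, then so does
   the product of the images of their sections under \<open>phi V\<close>. These live in a domain,
   and injectivity of \<open>phi V\<close> brings the vanishing of one factor back to
   \<open>V\<close>.\<close>
 proof (rule Spec_generic[OF R ne])
  fix V a c assume V: "openin (topo ?Y) V" "V ~= {}" and a: "a:$R" and c: "c:$R"
   and z: "ALL p:V. EX t:$R - p. t *[R] (a *[R] c) = 0[R]"
  interpret S: domain "SX (preim ?X f V)" by (rule sec_domain[OF po(1)[OF V(1)] po(3)[OF V]])
  note cl = ring_hom_closed[OF phih[OF V(1)] hc[OF V(1) a]] ring_hom_closed[OF phih[OF V(1)] hc[OF V(1) c]]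
  have "hat V (a *[R] c) = hat V 0[R]" using hz[OF V(1) R.m_closed[OF a c]] z by simp
  then have "phi V (hat V a) *[SX (preim ?X f V)] phi V (hat V c) = 0[SX (preim ?X f V)]"
   using ring_hom_mult[OF phih[OF V(1)] hc[OF V(1) a] hc[OF V(1) c]] hm[OF V(1) a c] h0[OF V(1)] by simp
  then have "phi V (hat V a) = phi V (hat V 0[R]) \<or> phi V (hat V c) = phi V (hat V 0[R])" using S.integral[OF _ cl] h0[OF V(1)] by simp
  then have "hat V a = hat V 0[R] \<or> hat V c = hat V 0[R]"
   using inj_onD[OF bij_betw_imp_inj_on[OF b[OF V(1)]] _ hc[OF V(1) a] hc[OF V(1) R.zero_closed]]
    inj_onD[OF bij_betw_imp_inj_on[OF b[OF V(1)]] _ hc[OF V(1) c] hc[OF V(1) R.zero_closed]] by metis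
  then show "(ALL p:V. EX t:$R - p. t *[R] a = 0[R]) \<or> (ALL p:V. EX t:$R - p. t *[R] c = 0[R])"
   using hz[OF V(1) a] hz[OF V(1) c] by simp
 qed
 then obtain N where N: "!!V. openin (topo ?Y) V ==> V ~= {} ==> N:V"
  "!!V s p. openin (topo ?Y) V ==> s:$(sec ?Y V) ==> s N = fraction R ($R - N) 0[R] 1[R] ==> N:V ==>
   p:V ==> s p = fraction R ($R - p) 0[R] 1[R]" by metis
 from N(1)[OF openin_topspace ne] fi(1) obtain et where et: "et:U" "f et = N" by (metis imageE)
 have "chart U et"
  unfolding chart_def
 proof (intro conjI allI impI)
  show "op U" by (rule U(1))
  show "et:V" if "op V" "V ~= {}" "V <= U" for V
   using N(1)[OF fo[OF that(1,3)]] that(2) inj_on_image_mem_iff[OF fi(2) et(1) that(3)] et(2) by simp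
  fix V W r assume V: "op V" and W: "op W" "W ~= {}" "W <= V" and VU: "V <= U" and r: "r:$(SX V)" and z: "res X V W r = 0[SX W]"
  have WU: "W <= U" using W(3) VU by simp
  note oV = fo[OF V VU] and oW = fo[OF W(1) WU] and p = pf[OF VU] pf[OF WU]
  from b[OF oV] r obtain s where s: "s:$(sec ?Y (f ` V))" "phi (f ` V) s = r" unfolding p bij_betw_def by (metis imageE)
  have sW: "restrict s (f ` W):$(sec ?Y (f ` W))"
  proof -
   have "EX Q a b. openin (topo ?Y) Q & p:Q & Q <= f ` W & a:$R & b:$R & (ALL q:Q. b \<notin> q & restrict s (f ` W) q = fraction R ($R - q) a b)"
    if p: "p:f ` W" for p
   proof -
    have "p:f ` V" using p W(3) by blast
    with s(1)[unfolded Spec_simps(3)] obtain Q a b where Q: "openin (topo ?Y) Q" "p:Q" "a:$R" "b:$R" "ALL q:Q. b \<notin> q & s q = fraction R ($R - q) a b" by metis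
    then show ?thesis using oW p by (intro exI[of _ "Q Int f ` W"] exI[of _ a] exI[of _ b]) auto
   qed
   then show ?thesis unfolding Spec_simps(3) by simp
  qed
  have "phi (f ` W) (restrict s (f ` W)) = phi (f ` W) (hat (f ` W) 0[R])"
   using phir[OF oV oW image_mono[OF W(3)] s(1)] h0[OF oW] z s(2) unfolding p by simp
  from inj_onD[OF bij_betw_imp_inj_on[OF b[OF oW]] this sW hc[OF oW R.zero_closed]] have e: "restrict s (f ` W) = hat (f ` W) 0[R]" .
  have NW: "N:f ` W" using N(1)[OF oW] W(2) by blast
  then have NV: "N:f ` V" using W(3) by blast
  \<comment> \<open>Every nonempty open set contains \<open>N\<close>, so a section that vanishes on
    the smaller set vanishes at \<open>N\<close>, and this forces it to vanish on the larger
    set.\<close>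
  have sN: "s N = fraction R ($R - N) 0[R] 1[R]" using fun_cong[OF e, of N] NW by (simp add: hat_def)
  have "s = hat (f ` V) 0[R]" unfolding hat_def
   by (rule extensionalityI[of _ "f ` V"]) (use s(1) N(2)[OF oV s(1) sN NV] in "simp_all add: Spec_simps(3)")
  then show "r = 0[SX V]" using h0[OF oV] s(2) unfolding p by simp
 qed
 then show ?thesis using U(2) by blast
qed

text \<open>Vanishing is checked in a chart around each point of \<open>V\<close>. By irreducibility
  \<open>W\<close> meets that chart, and inside a chart restriction to a nonempty open set is
  injective.\<close>

lemma res_inj:
 assumes V: "op V" and W: "op W" "W ~= {}" "W <= V" and r: "r:$(SX V)" and z: "res X V W r = 0[SX W]"
 shows "r = 0[SX V]"
proof -
 interpret V: cring "SX V" by (rule sec_cring[OF V])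
 show ?thesis
 proof (rule set_sheaf_eq[OF sec_sheaf V r V.zero_closed])
  fix y assume y: "y:V"
  from chart_exists[OF op_pts[OF V y]] obtain U et where U: "y:U" "chart U et" by metis
  then have oU: "op U" by (simp add: chart_def)
  let ?Q = "V Int U" and ?T = "W Int U"
  have o: "op ?Q" "op ?T" "?T <= ?Q" "?Q <= U" "?Q <= V" "?T <= W" using V W oU by auto
  have T: "?T ~= {}" using irreducible[OF W(1,2) oU] U(1) by blast
  have "res X ?Q ?T (res X V ?Q r) = res X W ?T (res X V W r)"
   using preshD(3)[OF sec_presh V o(1,2,3,5) r] preshD(3)[OF sec_presh V W(1) o(2,6) W(3) r] by simp
  also have "\<dots> = 0[SX ?T]" unfolding z
   using ring_hom_zero[OF res_hom[OF W(1) o(2,6)]] sec_cring[OF W(1)] sec_cring[OF o(2)] by (simp add: cring_def)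
  finally have "res X V ?Q r = 0[SX ?Q]"
   using U(2) o T preshD(1)[OF sec_presh V o(1,5) r] unfolding chart_def by blast
  then show "EX Q. op Q & y:Q & Q <= V & res X V Q r = res X V Q 0[SX V]"
   using o y U(1) ring_hom_zero[OF res_hom[OF V o(1,5)]] sec_cring[OF V] sec_cring[OF o(1)] by (intro exI[of _ ?Q]) (simp add: cring_def)
 qed
qed

text \<open>Any nonempty open set meets a fixed chart by irreducibility, and the intersection
  contains the generic point of that chart.\<close>

lemma generic_point: "EX et:pts X. ALL V. op V --> V ~= {} --> et:V"
proof -
 obtain x where "x:pts X" using int unfolding integral_scheme_def by blast
 from chart_exists[OF this] obtain U et where U: "x:U" "chart U et" by metis
 then have oU: "op U" by (simp add: chart_def)
 have "et:V" if V: "op V" "V ~= {}" for V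
 proof -
  have "V Int U ~= {}" using irreducible[OF V oU] U(1) by blast
  then have "et:V Int U" using U(2) V oU unfolding chart_def by (metis inf_le2 openin_Int)
  then show ?thesis by simp
 qed
 moreover from this have "et:pts X" using U op_pts[OF oU] by (metis empty_iff oU)
 ultimately show ?thesis by blast
qed

end

section \<open>Ampleness and locally free sheaves\<close>

text \<open>Ampleness only speaks about sheaves with sections of type \<open>'r\<close>, so a locally free sheaf is
 transported along injections of its section modules into \<open>'r\<close>.\<close>

definition transport :: "('x set => 'm => 'n) => ('x, 'r, 'm) mod_presheaf => ('x, 'r, 'n) mod_presheaf" where
 "transport j E = (let k = (%U. inv_into ($(msec E U)) (j U)) in
  \<lparr>msec = (%U. \<lparr>carrier = j U ` $(msec E U), monoid.mult = undefined, monoid.one = undefined,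
    ring.zero = j U 0[msec E U], ring.add = (%a b. j U (k U a +[msec E U] k U b)), module.smult = (%r a. j U (r *.[msec E U] k U a))\<rparr>),
  mres = (%U V a. j V (mres E U V (k U a)))\<rparr>)"

context lrs
begin

context
 fixes E :: "('x, 'r, 'm) mod_presheaf" and j :: "'x set => 'm => 'n"
 assumes E: "module_sheaf X E" and j: "!!U. op U ==> inj_on (j U) ($(msec E U))"
begin

lemmas Ep = sheaf_presh[OF E]
abbreviation "E' \<equiv> transport j E"

lemma transport_simps:
 assumes U: "op U"
 shows "$(msec E' U) = j U ` $(msec E U)" "0[msec E' U] = j U 0[msec E U]"
  "s:$(msec E U) ==> t:$(msec E U) ==> j U s +[msec E' U] j U t = j U (s +[msec E U] t)"
  "s:$(msec E U) ==> r *.[msec E' U] j U s = j U (r *.[msec E U] s)"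
  "s:$(msec E U) ==> mres E' U V (j U s) = j V (mres E U V s)"
 using inv_into_f_f[OF j[OF U]] by (simp_all add: transport_def Let_def)

lemma transport_sheaf: "module_sheaf X E'"
 unfolding module_sheaf_def
proof (intro conjI allI impI ballI)
 fix U assume U: "op U"
 interpret module "SX U" "msec E U" by (rule P'(1)[OF Ep U])
 note s = transport_simps[OF U]
 show "module (SX U) (msec E' U)"
 proof (rule moduleI[OF sec_cring[OF U] abelian_groupI])
  show "EX y:$(msec E' U). y +[msec E' U] x = 0[msec E' U]" if "x:$(msec E' U)" for x
  proof -
   from that obtain a where a: "a:$(msec E U)" "x = j U a" unfolding s(1) by blast
   then show ?thesis using s(3)[of "-[msec E U] a" a] by (intro bexI[of _ "j U (-[msec E U] a)"]) (simp_all add: s M.l_neg)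
  qed
 qed (auto simp: s M.a_ac smult_l_distr smult_r_distr smult_assoc1)
next
 fix U V a b assume h: "op U & op V & V <= U" "a:$(msec E' U)" "b:$(msec E' U)"
 then have V: "op U" "op V" "V <= U" by auto
 interpret module "SX U" "msec E U" by (rule P'(1)[OF Ep V(1)])
 note e = slinD[OF P'(2)[OF Ep V]]
 from h show "mres E' U V (a +[msec E' U] b) = mres E' U V a +[msec E' V] mres E' U V b"
  unfolding transport_simps(1)[OF V(1)] using e by (auto simp: transport_simps[OF V(1)] transport_simps[OF V(2)])
next
 fix U V r a assume h: "op U & op V & V <= U" "r:$(SX U)" "a:$(msec E' U)"
 then have V: "op U" "op V" "V <= U" by auto
 interpret module "SX U" "msec E U" by (rule P'(1)[OF Ep V(1)])
 note e = slinD[OF P'(2)[OF Ep V]]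
 from h show "mres E' U V (r *.[msec E' U] a) = res X U V r *.[msec E' V] mres E' U V a"
  unfolding transport_simps(1)[OF V(1)] using e by (auto simp: transport_simps[OF V(1)] transport_simps[OF V(2)])
next
 have sE: "set_sheaf (topo X) (%U. $(msec E U)) (mres E)" using E by (simp add: module_sheaf_def)
 note p = preshD[OF set_sheaf_presh[OF sE]]
 show "set_sheaf (topo X) (%U. $(msec E' U)) (mres E')"
  unfolding set_sheaf_def
 proof (intro conjI allI impI ballI)
  show "mres E' U V:$(msec E' U) -> $(msec E' V)" if "op U & op V & V <= U" for U V
   using that p(1)[of U V] by (auto simp: transport_simps)
  show "mres E' U U a = a" if "op U" "a:$(msec E' U)" for U a
   using that p(2)[of U] by (auto simp: transport_simps)
  show "mres E' V W (mres E' U V a) = mres E' U W a" if "op U & op V & op W & W <= V & V <= U" "a:$(msec E' U)" for U V W a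
   using that p(1)[of U V] p(3)[of U V W] by (auto simp: transport_simps)
  fix VV t
  assume a: "(ALL V:VV. op V) & (ALL V:VV. t V:$(msec E' V)) & (ALL V:VV. ALL W:VV. mres E' V (V Int W) (t V) = mres E' W (V Int W) (t W))"
  then have o: "op V" if "V:VV" for V using that by blast
  have oU: "op (\<Union>VV)" using o by blast
  have "EX s. s:$(msec E V) & t V = j V s" if "V:VV" for V
   using a that transport_simps(1)[OF o[OF that]] by blast
  then obtain s where s: "!!V. V:VV ==> s V:$(msec E V)" "!!V. V:VV ==> t V = j V (s V)" by metis
  have c: "mres E V (V Int W) (s V) = mres E W (V Int W) (s W)" if "V:VV" "W:VV" for V W
  proof (rule inj_onD[OF j[OF openin_Int[OF o[OF that(1)] o[OF that(2)]]]])
   show "j (V Int W) (mres E V (V Int W) (s V)) = j (V Int W) (mres E W (V Int W) (s W))"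
    using a that s transport_simps(5)[OF o] by metis
  qed (use p(1) o that s(1) in "simp_all add: openin_Int")
  obtain u where u: "u:$(msec E (\<Union>VV))" "!!V. V:VV ==> mres E (\<Union>VV) V u = s V"
   using set_sheaf_glue[OF sE, of VV s] o s(1) c by blast
  show "EX! w. w:$(msec E' (\<Union>VV)) & (ALL V:VV. mres E' (\<Union>VV) V w = t V)"
  proof (rule ex1I[of _ "j (\<Union>VV) u"])
   show "j (\<Union>VV) u:$(msec E' (\<Union>VV)) & (ALL V:VV. mres E' (\<Union>VV) V (j (\<Union>VV) u) = t V)"
    using u s(2) by (simp add: transport_simps[OF oU])
   fix w assume w: "w:$(msec E' (\<Union>VV)) & (ALL V:VV. mres E' (\<Union>VV) V w = t V)"
   then obtain v where v: "v:$(msec E (\<Union>VV))" "w = j (\<Union>VV) v" unfolding transport_simps(1)[OF oU] by blast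
   have "mres E (\<Union>VV) V v = s V" if V: "V:VV" for V
    using w V s(2)[OF V] transport_simps(5)[OF oU v(1)] v(2)
    by (intro inj_onD[OF j[OF o[OF V]] _ p(1)[OF oU o[OF V] Union_upper[OF V] v(1)] s(1)[OF V]]) simp
   then have "v = u"
    using u o by (intro set_sheaf_eq[OF sE oU v(1) u(1)]) (metis UnionE Union_upper)
   then show "w = j (\<Union>VV) u" using v(2) by simp
  qed
 qed
qed

lemma transport_hom:
 "mod_hom X (pts X) E' E (%U. inv_into ($(msec E U)) (j U))"
 unfolding mod_hom_def opens_in_def
proof (intro ballI conjI funcsetI)
 fix W assume "W:{W. op W & W <= pts X}"
 then have W: "op W" by simp
 interpret module "SX W" "msec E W" by (rule P'(1)[OF Ep W])
 note s = transport_simps[OF W] and i = inv_into_f_f[OF j[OF W]]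
 fix a assume "a:$(msec E' W)"
 then obtain a' where a: "a':$(msec E W)" "a = j W a'" unfolding s(1) by blast
 show "inv_into ($(msec E W)) (j W) a:$(msec E W)" using a i by simp
 show "inv_into ($(msec E W)) (j W) (a +[msec E' W] b) = inv_into ($(msec E W)) (j W) a +[msec E W] inv_into ($(msec E W)) (j W) b"
  if "b:$(msec E' W)" for b
  using that a unfolding s(1) by (auto simp: s i)
 show "inv_into ($(msec E W)) (j W) (r *.[msec E' W] a) = r *.[msec E W] inv_into ($(msec E W)) (j W) a"
  if "r:$(SX W)" for r using that a by (simp add: s i)
 fix V assume "V:{Wa. op Wa & Wa <= W}"
 then have V: "op V" "V <= W" by auto
 show "inv_into ($(msec E V)) (j V) (mres E' W V a) = mres E W V (inv_into ($(msec E W)) (j W) a)"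
  using a i mres_closed[OF Ep W V a(1)] inv_into_f_f[OF j[OF V(1)]] by (simp add: s)
qed

lemma transport_locally_free:
 assumes "locally_free X n E"
 shows "locally_free X n E'"
 unfolding locally_free_def
proof (intro conjI ballI)
 show "module_sheaf X E'" by (rule transport_sheaf)
 fix x assume "x:pts X"
 then obtain U phi where U: "op U" "x:U" and phi: "mod_hom X U E (free_sheaf X n) phi"
  and b: "!!W. W:opens_in X U ==> bij_betw (phi W) ($(msec E W)) ($(msec (free_sheaf X n) W))"
  using assms unfolding locally_free_def mod_iso_on_def by blast
 let ?k = "%U. inv_into ($(msec E U)) (j U)"
 have UX: "U <= pts X" using openin_subset[OF U(1)] .
 have oX: "W:opens_in X (pts X)" if "W:opens_in X U" for W using that UX by (auto simp: opens_in_def)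
 note k = transport_hom[unfolded mod_hom_def, rule_format, OF oX] and f = phi[unfolded mod_hom_def, rule_format]
 have "mod_hom X U E' (free_sheaf X n) (%W a. phi W (?k W a))"
  unfolding mod_hom_def
 proof (intro ballI conjI funcsetI)
  fix W assume W: "W:opens_in X U"
  have kc: "?k W a:$(msec E W)" if "a:$(msec E' W)" for a using k[OF W] that by blast
  fix a assume a: "a:$(msec E' W)"
  show "phi W (?k W a):$(msec (free_sheaf X n) W)" using f[OF W] kc[OF a] by blast
  show "phi W (?k W (a +[msec E' W] c)) = phi W (?k W a) +[msec (free_sheaf X n) W] phi W (?k W c)" if "c:$(msec E' W)" for c
   using k[OF W] f[OF W] a that kc by metis
  show "phi W (?k W (r *.[msec E' W] a)) = r *.[msec (free_sheaf X n) W] phi W (?k W a)" if "r:$(SX W)" for r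
   using k[OF W] f[OF W] a that kc by metis
  show "phi V (?k V (mres E' W V a)) = mres (free_sheaf X n) W V (phi W (?k W a))" if "V:opens_in X W" for V
   using k[OF W] f[OF W] a that kc by metis
 qed
 moreover have "bij_betw (%a. phi W (?k W a)) ($(msec E' W)) ($(msec (free_sheaf X n) W))" if W: "W:opens_in X U" for W
 proof -
  have o: "op W" using W by (simp add: opens_in_def)
  have "bij_betw (?k W) ($(msec E' W)) ($(msec E W))"
   unfolding transport_simps(1)[OF o] using inj_on_imp_bij_betw[OF j[OF o]] by (rule bij_betw_inv_into)
  from bij_betw_trans[OF this b[OF W]] show ?thesis by (simp add: comp_def)
 qed
 ultimately show "EX U. op U & x:U & mod_iso_on X U E' (free_sheaf X n)" unfolding mod_iso_on_def using U by blast
qed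

end

text \<open>A local trivialization is a local presentation with \<open>n\<close> generators and no
  relations, so the free sheaf of rank 0 serves as the left term.\<close>

lemma locally_free_coherent:
 assumes E: "locally_free X n E"
 shows "coherent_sheaf X E"
 unfolding coherent_sheaf_def
proof (intro conjI ballI)
 show Es: "module_sheaf X E" using E by (simp add: locally_free_def)
 note Ep = sheaf_presh[OF Es]
 have sE: "set_sheaf (topo X) (%U. $(msec E U)) (mres E)" using Es by (simp add: module_sheaf_def)
 fix x assume "x:pts X"
 then obtain U phi where U: "op U" "x:U" and phi: "mod_hom X U E (free_sheaf X n) phi"
  and b: "!!W. W:opens_in X U ==> bij_betw (phi W) ($(msec E W)) ($(msec (free_sheaf X n) W))"
  using E unfolding locally_free_def mod_iso_on_def by blast
 have oU: "op W" "W <= U" if "W:opens_in X U" for W using that by (auto simp: opens_in_def)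
 have sub: "V:opens_in X U" if "V:opens_in X W" "W:opens_in X U" for V W using that by (auto simp: opens_in_def)
 let ?F = "free_sheaf X n"
 define psi where "psi W = inv_into ($(msec E W)) (phi W)" for W
 note f = phi[unfolded mod_hom_def, rule_format]
 have pphi: "psi W (phi W a) = a" if "W:opens_in X U" "a:$(msec E W)" for W a
  unfolding psi_def using inv_into_f_f[OF bij_betw_imp_inj_on[OF b[OF that(1)]] that(2)] .
 have ex: "EX a. a:$(msec E W) & t = phi W a" if "W:opens_in X U" "t:$(msec ?F W)" for W t
  using b[OF that(1)] that(2) unfolding bij_betw_def by blast
 have psi: "mod_hom X U ?F E psi"
  unfolding mod_hom_def
 proof (intro ballI conjI funcsetI)
  fix W t assume W: "W:opens_in X U" and t: "t:$(msec ?F W)"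
  interpret module "SX W" "msec E W" by (rule P'(1)[OF Ep oU(1)[OF W]])
  from ex[OF W t] obtain a where a: "a:$(msec E W)" "t = phi W a" by blast
  show "psi W t:$(msec E W)" using a pphi[OF W] by simp
  show "psi W (t +[msec ?F W] u) = psi W t +[msec E W] psi W u" if "u:$(msec ?F W)" for u
  proof -
   from ex[OF W that] obtain c where c: "c:$(msec E W)" "u = phi W c" by blast
   have "t +[msec ?F W] u = phi W (a +[msec E W] c)" unfolding a(2) c(2) using f[OF W] a c by metis
   then show ?thesis using pphi[OF W] a c by simp
  qed
  show "psi W (r *.[msec ?F W] t) = r *.[msec E W] psi W t" if r: "r:$(SX W)" for r
  proof -
   have "r *.[msec ?F W] t = phi W (r *.[msec E W] a)" unfolding a(2) using f[OF W] a r by metis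
   then show ?thesis using pphi[OF W] a r by simp
  qed
  show "psi V (mres ?F W V t) = mres E W V (psi W t)" if V: "V:opens_in X W" for V
  proof -
   have "mres ?F W V t = phi V (mres E W V a)" unfolding a(2) using f[OF W] a V by metis
   then show ?thesis using pphi[OF W a(1)] pphi[OF sub[OF V W]] mres_closed[OF Ep oU(1)[OF W] _ _ a(1), of V] V a(2) by (simp add: opens_in_def)
  qed
 qed
 note g = psi[unfolded mod_hom_def, rule_format]
 let ?z = "%W (u :: nat => 'r). 0[msec ?F W]"
 have z: "mod_hom X U (free_sheaf X 0) ?F ?z"
  unfolding mod_hom_def
 proof (intro ballI conjI funcsetI)
  fix W assume W: "W:opens_in X U"
  interpret cring "SX W" by (rule sec_cring[OF oU(1)[OF W]])
  show "0[msec ?F W]:$(msec ?F W)" by (simp add: free_sheaf_def PiE_def)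
  show "0[msec ?F W] = 0[msec ?F W] +[msec ?F W] 0[msec ?F W]" by (auto simp: free_sheaf_def restrict_def fun_eq_iff)
  show "0[msec ?F W] = r *.[msec ?F W] 0[msec ?F W]" if "r:$(SX W)" for r using that by (auto simp: free_sheaf_def restrict_def fun_eq_iff)
  show "0[msec ?F V] = mres ?F W V 0[msec ?F W]" if V: "V:opens_in X W" for V
   using ring_hom_zero[OF res_hom[OF oU(1)[OF W] oU(1)[OF sub[OF V W]]]] V ring_axioms sec_cring[OF oU(1)[OF sub[OF V W]]]
   by (auto simp: free_sheaf_def restrict_def fun_eq_iff opens_in_def cring_def)
 qed
 note zh = z[unfolded mod_hom_def, rule_format]
 have u0: "(%i. undefined):$(msec (free_sheaf X 0) W)" for W by (simp add: free_sheaf_def)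
 have psi0: "psi W 0[msec ?F W] = 0[msec E W]" if W: "W:opens_in X U" for W
 proof -
  interpret module "SX W" "msec E W" by (rule P'(1)[OF Ep oU(1)[OF W]])
  have c: "0[msec ?F W]:$(msec ?F W)" "0[msec ?F W] = 0[SX W] *.[msec ?F W] 0[msec ?F W]"
   using zh[OF W] u0 R.zero_closed by blast+
  have "psi W 0[msec ?F W] = 0[SX W] *.[msec E W] psi W 0[msec ?F W]" using g[OF W] c R.zero_closed by metis
  moreover have "psi W 0[msec ?F W]:$(msec E W)" using g[OF W] c(1) by blast
  ultimately show ?thesis by (simp add: smult_l_null)
 qed
 have psii: "t = u" if "W:opens_in X U" "t:$(msec ?F W)" "u:$(msec ?F W)" "psi W t = psi W u" for W t u
  using ex[OF that(1,2)] ex[OF that(1,3)] pphi[OF that(1)] that(4) by metis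
 show "EX U p q phi psi. op U & x:U & mod_hom X U (free_sheaf X p) (free_sheaf X q) phi & mod_hom X U (free_sheaf X q) E psi &
   (ALL W:opens_in X U. ALL s:$(msec E W). ALL y:W. EX W':opens_in X W. y:W' &
     (EX t:$(msec (free_sheaf X q) W'). psi W' t = mres E W W' s)) &
   (ALL W:opens_in X U. ALL t:$(msec (free_sheaf X q) W). psi W t = 0[msec E W] <->
     (ALL y:W. EX W':opens_in X W. y:W' & (EX u:$(msec (free_sheaf X p) W'). phi W' u = mres (free_sheaf X q) W W' t)))"
 proof (intro exI conjI ballI)
  show "op U" "x:U" by (rule U)+
  show "mod_hom X U (free_sheaf X 0) ?F ?z" by (rule z)
  show "mod_hom X U ?F E psi" by (rule psi)
  fix W assume W: "W:opens_in X U"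
  then have WW: "W:opens_in X W" by (simp add: opens_in_def)
  show "EX W':opens_in X W. y:W' & (EX t:$(msec ?F W'). psi W' t = mres E W W' s)" if s: "s:$(msec E W)" and y: "y:W" for s y
  proof -
   have "phi W s:$(msec ?F W)" using f[OF W] s by blast
   then show ?thesis using WW y pphi[OF W s] preshD(2)[OF P'(3)[OF Ep] oU(1)[OF W] s] by (intro bexI[of _ W] conjI bexI[of _ "phi W s"]) simp_all
  qed
  fix t assume t: "t:$(msec ?F W)"
  show "psi W t = 0[msec E W] <-> (ALL y:W. EX W':opens_in X W. y:W' & (EX u:$(msec (free_sheaf X 0) W'). ?z W' u = mres ?F W W' t))"
  proof
   assume "psi W t = 0[msec E W]"
   moreover have zc: "0[msec ?F W]:$(msec ?F W)" using zh[OF W] u0 by blast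
   ultimately have t0: "t = 0[msec ?F W]" using psii[OF W t zc] psi0[OF W] by simp
   have "?z W u = mres ?F W W t" for u unfolding t0 using zh[OF W] WW u0 by blast
   then show "ALL y:W. EX W':opens_in X W. y:W' & (EX u:$(msec (free_sheaf X 0) W'). ?z W' u = mres ?F W W' t)" using WW u0 by blast
  next
   assume h: "ALL y:W. EX W':opens_in X W. y:W' & (EX u:$(msec (free_sheaf X 0) W'). ?z W' u = mres ?F W W' t)"
   interpret module "SX W" "msec E W" by (rule P'(1)[OF Ep oU(1)[OF W]])
   have c: "psi W t:$(msec E W)" using g[OF W] t by blast
   show "psi W t = 0[msec E W]"
   proof (rule set_sheaf_eq[OF sE oU(1)[OF W] c M.zero_closed])
    fix y assume "y:W"
    with h obtain V where V: "V:opens_in X W" "y:V" "0[msec ?F V] = mres ?F W V t" by blast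
    have oV: "op V" "V <= W" using V(1) by (auto simp: opens_in_def)
    have "mres E W V (psi W t) = psi V (mres ?F W V t)" using g[OF W] V(1) t by metis
    also have "\<dots> = mres E W V 0[msec E W]"
     unfolding V(3)[symmetric] psi0[OF sub[OF V(1) W]]
     by (rule slin_zero[OF P'(2)[OF Ep oU(1)[OF W] oV] module_groups(1)[OF P'(1)[OF Ep oU(1)[OF W]]] module_groups(1)[OF P'(1)[OF Ep oV(1)]], symmetric])
    finally show "EX V. op V & y:V & V <= W & mres E W V (psi W t) = mres E W V 0[msec E W]" using oV V(2) by blast
   qed
  qed
 qed
qed

end

text \<open>Iterates the fact that an infinite type is in bijection with its square. Extensional
  functions appear because they are the sections of \<open>free_sheaf\<close>.\<close>

lemma infinite_power_inj:
 assumes "infinite (UNIV :: 'r set)"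
 shows "EX g :: (nat => 'r) => 'r. inj_on g (extensional {..<n})"
proof (induction n)
 case 0
 have "inj_on (%f. undefined) (extensional {..<0::nat} :: (nat => 'r) set)" by (auto simp: inj_on_def extensional_def)
 then show ?case by blast
next
 case (Suc n)
 then obtain g :: "(nat => 'r) => 'r" where g: "inj_on g (extensional {..<n})" by blast
 have "EX h :: 'r \<times> 'r => 'r. inj_on h (UNIV \<times> UNIV) & h ` (UNIV \<times> UNIV) <= UNIV"
  unfolding card_of_ordLeq by (rule ordIso_imp_ordLeq[OF card_of_Times_same_infinite[OF assms]])
 then obtain h :: "'r \<times> 'r => 'r" where h: "inj h" by auto
 have "inj_on (%f. h (g (restrict f {..<n}), f n)) (extensional {..<Suc n})"
 proof (rule inj_onI)
  fix f f' :: "nat => 'r" assume f: "f:extensional {..<Suc n}" "f':extensional {..<Suc n}"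
   and "h (g (restrict f {..<n}), f n) = h (g (restrict f' {..<n}), f' n)"
  then have e: "g (restrict f {..<n}) = g (restrict f' {..<n})" "f n = f' n" using injD[OF h] by auto
  have r: "restrict f {..<n} = restrict f' {..<n}" using e(1) by (rule inj_onD[OF g]) simp_all
  show "f = f'"
  proof (rule extensionalityI[OF f])
   fix i assume "i:{..<Suc n}"
   then show "f i = f' i" using e(2) fun_cong[OF r, of i] by (cases "i = n") auto
  qed
 qed
 then show ?case by blast
qed

section \<open>Embedding the sections of a locally free sheaf into the type of functions\<close>

context integral_lrs
begin

text \<open>In a local trivialization two sections are compared coordinate by coordinate, and
  \<open>res_inj\<close> applies to the differences because \<open>W\<close> meets every
  trivializing open set.\<close>

lemma locally_free_res_inj:
 assumes E: "locally_free X n E" and U: "op U" and W: "op W" "W ~= {}" "W <= U"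
  and s: "s:$(msec E U)" "t:$(msec E U)" and e: "mres E U W s = mres E U W t"
 shows "s = t"
proof -
 have Es: "module_sheaf X E" using E by (simp add: locally_free_def)
 note Ep = sheaf_presh[OF Es]
 have sE: "set_sheaf (topo X) (%U. $(msec E U)) (mres E)" using Es by (simp add: module_sheaf_def)
 note p = preshD[OF P'(3)[OF Ep]]
 show ?thesis
 proof (rule set_sheaf_eq[OF sE U s])
  fix y assume y: "y:U"
  obtain B phi where B: "op B" "y:B" and phi: "mod_hom X B E (free_sheaf X n) phi"
   and b: "!!W. W:opens_in X B ==> bij_betw (phi W) ($(msec E W)) ($(msec (free_sheaf X n) W))"
   using E op_pts[OF U y] unfolding locally_free_def mod_iso_on_def by blast
  let ?Q = "U Int B" and ?T = "W Int B"
  have o: "op ?Q" "op ?T" "?T <= ?Q" "?Q <= U" "?T <= W" using U W B by auto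
  have T: "?T ~= {}" using irreducible[OF W(1,2) B(1)] B(2) by blast
  have QO: "?Q:opens_in X B" "?T:opens_in X ?Q" using o by (auto simp: opens_in_def)
  note f = phi[unfolded mod_hom_def, rule_format, OF QO(1)]
  let ?s = "mres E U ?Q s" and ?t = "mres E U ?Q t"
  have c: "?s:$(msec E ?Q)" "?t:$(msec E ?Q)" using p(1)[OF U o(1,4)] s by auto
  have "mres E ?Q ?T ?s = mres E ?Q ?T ?t"
   using p(3)[OF U o(1,2,3,4)] p(3)[OF U W(1) o(2,5) W(3)] s e by metis
  then have "mres (free_sheaf X n) ?Q ?T (phi ?Q ?s) = mres (free_sheaf X n) ?Q ?T (phi ?Q ?t)"
   using f c QO(2) by metis
  then have r: "res X ?Q ?T (phi ?Q ?s i) = res X ?Q ?T (phi ?Q ?t i)" if "i < n" for i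
   using that by (simp add: free_sheaf_def restrict_def fun_eq_iff) metis
  have fc: "phi ?Q ?s:{..<n} \<rightarrow>\<^sub>E $(SX ?Q)" "phi ?Q ?t:{..<n} \<rightarrow>\<^sub>E $(SX ?Q)"
   using f c by (auto simp: free_sheaf_def)
  interpret Q: cring "SX ?Q" by (rule sec_cring[OF o(1)])
  interpret T: cring "SX ?T" by (rule sec_cring[OF o(2)])
  interpret h: ring_hom_cring "SX ?Q" "SX ?T" "res X ?Q ?T"
   by (rule ring_hom_cringI[OF ring_hom_ringI2[OF Q.ring_axioms T.ring_axioms res_hom[OF o(1,2,3)]] Q.is_cring T.is_cring])
  have "phi ?Q ?s i = phi ?Q ?t i" if i: "i < n" for i
  proof -
   have ci: "phi ?Q ?s i:$(SX ?Q)" "phi ?Q ?t i:$(SX ?Q)" using fc i by auto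
   have "res X ?Q ?T (phi ?Q ?s i -[SX ?Q] phi ?Q ?t i) = 0[SX ?T]"
    using r[OF i] ci h.hom_closed by (simp add: Q.minus_eq T.r_neg)
   from res_inj[OF o(1,2) T o(3) _ this] show ?thesis using ci minus_zero_iff[OF Q.abelian_group_axioms ci] by simp
  qed
  then have "phi ?Q ?s = phi ?Q ?t" using fc by (intro extensionalityI[of _ "{..<n}"]) (auto simp: PiE_def)
  then have "?s = ?t" using inj_onD[OF bij_betw_imp_inj_on[OF b[OF QO(1)]] _ c] by simp
  then show "EX W. op W & y:W & W <= U & mres E U W s = mres E U W t" using o y B(2) by (intro exI[of _ ?Q]) simp
 qed
qed

text \<open>One trivializing open set \<open>B\<close> serves all \<open>U\<close>: a section over a
  nonempty \<open>U\<close> is determined by its restriction to the intersection with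
  \<open>B\<close>, where it is a tuple of functions. Over the empty set there is at most one
  section.\<close>

lemma locally_free_inj:
 assumes E: "locally_free X n E" and inf: "infinite (UNIV :: 'r set)"
 shows "EX j :: 'x set => 'm => 'r. ALL U. op U --> inj_on (j U) ($(msec (E :: ('x, 'r, 'm) mod_presheaf) U))"
proof -
 have Es: "module_sheaf X E" using E by (simp add: locally_free_def)
 have sE: "set_sheaf (topo X) (%U. $(msec E U)) (mres E)" using Es by (simp add: module_sheaf_def)
 note Ep = sheaf_presh[OF Es]
 obtain g :: "(nat => 'r) => 'r" where g: "inj_on g (extensional {..<n})" using infinite_power_inj[OF inf] by blast
 obtain x where x: "x:pts X" using int unfolding integral_scheme_def by blast
 obtain B phi where B: "op B" "x:B"
  and phi: "mod_hom X B E (free_sheaf X n) phi" and b: "!!W. W:opens_in X B ==> bij_betw (phi W) ($(msec E W)) ($(msec (free_sheaf X n) W))"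
  using E x unfolding locally_free_def mod_iso_on_def by blast
 let ?j = "%U s. g (phi (U Int B) (mres E U (U Int B) s))"
 have "inj_on (?j U) ($(msec E U))" if U: "op U" for U
 proof (cases "U = {}")
  case True
  show ?thesis unfolding True
  proof (rule inj_onI)
   fix a c assume "a:$(msec E {})" "c:$(msec E {})"
   then show "a = c" by (rule set_sheaf_eq[OF sE openin_empty]) simp
  qed
 next
  case False
  let ?Q = "U Int B"
  have Q: "op ?Q" "?Q <= U" "?Q:opens_in X B" using U B by (auto simp: opens_in_def)
  have ne: "?Q ~= {}" using irreducible[OF U False B(1)] B(2) by blast
  show ?thesis
  proof (rule inj_onI)
   fix s t assume s: "s:$(msec E U)" "t:$(msec E U)" and e: "?j U s = ?j U t"
   note c = mres_closed[OF Ep U Q(1,2) s(1)] mres_closed[OF Ep U Q(1,2) s(2)]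
   have "phi ?Q (mres E U ?Q s):extensional {..<n}" "phi ?Q (mres E U ?Q t):extensional {..<n}"
    using bij_betwE[OF b[OF Q(3)]] c by (auto simp: free_sheaf_def PiE_def)
   from inj_onD[OF g e this] have "mres E U ?Q s = mres E U ?Q t" using inj_onD[OF bij_betw_imp_inj_on[OF b[OF Q(3)]] _ c] by simp
   then show "s = t" by (rule locally_free_res_inj[OF E U Q(1) ne Q(2) s])
  qed
 qed
 then show ?thesis by (intro exI[of _ ?j]) blast
qed

end

locale ample_lrs = line_bundle X A + integral_lrs X for X :: "('x, 'r) ringed_space" and A :: "('x, 'r, 'l) mod_presheaf" +
 assumes inf: "infinite (UNIV :: 'r set)" and amp: "ample X A"
begin

lemma globally_generated_full:
 assumes V: "mp V" and g: "globally_generated X (tsh V (wsh False n A))" and x: "x:pts X"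
 shows "full x V (int n)"
proof -
 let ?T = "tsh V (wsh False n A)"
 note T = tsh_presh[OF V wsh_presh[OF A_presh]]
 let ?S = "mg ?T x (pts X) ` $(msec ?T (pts X))"
 have G: "mprod x (St ?T x) Un ?S <= $(St ?T x)"
  using mprod_carrier[OF x stalk_module[OF T x]] mgerm_op(1)[OF T pts_op x] by blast
 have "module_span (Ox x) (St ?T x) ?S = $(St ?T x)" using g x by (simp add: globally_generated_def)
 then have "module_span (Ox x) (St ?T x) (mprod x (St ?T x) Un ?S) = $(St ?T x)"
  using span_mono[of ?S "mprod x (St ?T x) Un ?S" "Ox x" "St ?T x"] span_carrier[OF stalk_module[OF T x] G] by simp
 then show ?thesis using Bs_twist_A[OF V x, of n] Bs_iff[OF T x] by simp
qed

text \<open>Ampleness is applied to a copy of \<open>E\<close> with sections of the right type,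
  whose stalks map onto those of \<open>E\<close>. The bound it gives does not depend on the
  point.\<close>

lemma locally_free_full:
 fixes E :: "('x, 'r, 'm) mod_presheaf"
 assumes E: "locally_free X n E"
 shows "EX n0. ALL d x. n0 <= d --> x:pts X --> full x E d"
proof -
 have Es: "module_sheaf X E" using E by (simp add: locally_free_def)
 note Ep = sheaf_presh[OF Es]
 obtain j :: "'x set => 'm => 'r" where j: "!!U. op U ==> inj_on (j U) ($(msec E U))" using locally_free_inj[OF E inf] by blast
 let ?E = "transport j E"
 note Es' = transport_sheaf[OF Es j]
 note Ep' = sheaf_presh[OF Es']
 have "coherent_sheaf X ?E" by (rule locally_free_coherent[OF transport_locally_free[OF Es j E]])
 then obtain n0 where n0: "!!n. n0 <= n ==> globally_generated X (tsh ?E (wsh False n A))"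
  using amp unfolding ample_def tensor_power_wsh by blast
 let ?k = "%U. inv_into ($(msec E U)) (j U)"
 obtain f where f: "smor ?E E f" "!!y U s. op U ==> y:U ==> s:$(msec ?E U) ==> f y (mg ?E y U s) = mg E y U (?k U s)"
  using mod_hom_smor[OF Ep' Ep transport_hom[OF Es j]] by metis
 have "full x E d" if d: "int n0 <= d" and x: "x:pts X" for d x
 proof -
  obtain m where m: "d = int m" "n0 <= m" using d by (metis int_nat_eq nat_int_comparison(3) of_nat_0_le_iff order_trans nat_le_iff zero_le_imp_eq_int)
  have "$(St E x) <= f x ` $(St ?E x)"
  proof
   fix a assume "a:$(St E x)"
   from mstalk_rep[OF Ep this] obtain U s where U: "op U" "x:U" "s:$(msec E U)" "a = mg E x U s" by metis
   have js: "j U s:$(msec ?E U)" using U(3) transport_simps(1)[OF Es j U(1)] by simp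
   have "f x (mg ?E x U (j U s)) = a" unfolding f(2)[OF U(1,2) js] U(4) using inv_into_f_f[OF j[OF U(1)] U(3)] by simp
   then show "a:f x ` $(St ?E x)" using mgerm_op(1)[OF Ep' U(1,2) js] by (metis imageI)
  qed
  then have "f x ` $(St ?E x) = $(St E x)" using slinD(1)[OF smorD(1)[OF f(1) x]] by blast
  from full_surj[OF Ep' Ep f(1) x this globally_generated_full[OF Ep' n0[OF m(2)] x]] show ?thesis unfolding m(1) .
 qed
 then show ?thesis by blast
qed

lemma OX_locally_free: "locally_free X 1 OX"
proof -
 have "mod_iso_on X (pts X) OX (free_sheaf X 1)"
  unfolding mod_iso_on_def
 proof (intro exI conjI ballI)
  let ?phi = "%W s. \<lambda>i\<in>{..<1::nat}. s"
  show "mod_hom X (pts X) OX (free_sheaf X 1) ?phi"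
   unfolding mod_hom_def by (auto simp: free_sheaf_def structure_module_def restrict_def fun_eq_iff split: if_splits)
  show "bij_betw (?phi W) ($(msec OX W)) ($(msec (free_sheaf X 1) W))" for W
   by (rule bij_betwI[of _ _ _ "%f. f 0"]) (auto simp: free_sheaf_def OX_carrier PiE_def extensional_def restrict_def fun_eq_iff)
 qed
 then show ?thesis unfolding locally_free_def using OX_sheaf pts_op by blast
qed

end

section \<open>Base loci of direct sums\<close>

context lrs
begin

lemma smap_surj:
 assumes M: "mp M" and N: "mp N" and f: "smor M N f" and y: "y:pts X"
  and s: "f y ` $(St M y) = $(St N y)"
 shows "smap n M N f y ` $(St (Sy n M) y) = $(St (Sy n N) y)"
proof (rule subset_antisym)
 note l = smorD(1)[OF smap(1)[OF M N f] y, of n] and m = wsh_module[OF M y, of True n] wsh_module[OF N y, of True n]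
 show "smap n M N f y ` $(St (Sy n M) y) <= $(St (Sy n N) y)" using slinD(1)[OF l] by blast
 have I: "submodule (smap n M N f y ` $(St (Sy n M) y)) (Ox y) (St (Sy n N) y)"
  by (rule submodule_image[OF l m module.carrier_is_submodule[OF m(1)]])
 have "sw n N y k:smap n M N f y ` $(St (Sy n M) y)" if k: "k:words n (St N y)" for k
 proof -
  have "set k <= f y ` $(St M y)" using k unfolding s by (simp add: words_def)
  from set_subset_imageE[OF this] obtain k' where k': "k = map (f y) k'" "set k' <= $(St M y)" by metis
  have w: "k':words n (St M y)" using k k' by (simp add: words_def)
  show ?thesis unfolding k'(1) smap(2)[OF M N f y w, symmetric] by (rule imageI[OF wd_carrier[OF M y w]])
 qed
 then show "$(St (Sy n N) y) <= smap n M N f y ` $(St (Sy n M) y)"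
  unfolding wd_span[OF N y, of True n, symmetric] by (intro span_least[OF I] image_subsetI)
qed

end

locale char0_ample = ample_lrs X A + char0_line_bundle X A for X :: "('x, 'r) ringed_space" and A :: "('x, 'r, 'l) mod_presheaf"
begin

lemma aug_iff:
 assumes V: "mp V" and x: "x:pts X"
 shows "x \<notin> augmented_base_locus X A V <-> (\<exists>q\<ge>1. \<exists>m\<ge>1. full x (Sy m (Sy q V)) (- int m))"
 unfolding augmented_base_locus_def sym_power_wsh tensor_power_wsh
 using Bs_twist_dual[OF wsh_presh[OF wsh_presh[OF V]] x] by (simp add: Bex_def)

lemma dim_iff:
 assumes V: "mp V" and x: "x:pts X"
 shows "x \<notin> diminished_base_locus X A V <-> (\<forall>q\<ge>1. \<exists>m\<ge>1. full x (Sy m (Sy q V)) (int m))"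
 unfolding diminished_base_locus_def sym_power_wsh tensor_power_wsh
 using Bs_twist_A[OF wsh_presh[OF wsh_presh[OF V]] x] by (simp add: Ball_def Bex_def)

lemma loci_pts: "augmented_base_locus X A V <= pts X" "diminished_base_locus X A V <= pts X"
 unfolding augmented_base_locus_def diminished_base_locus_def Bs_def by (blast, force)

lemma full_generic:
 assumes E: "locally_free X n E" and x: "x:pts X" and et: "!!V. op V ==> V ~= {} ==> et:V"
  and f: "full x (Sy m (Sy q E)) d"
 shows "full et (Sy m (Sy q E)) d"
proof -
 have Ep: "mp E" by (rule sheaf_presh) (use E in "simp add: locally_free_def")
 from locally_free_gens[OF E x] obtain U Ga where U: "op U" "x:U" and g: "lgen E U Ga" by metis
 obtain Ga' where "lgen (Sy q E) U Ga'" using lgen_Sy[OF Ep U(1) g] by metis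
 then obtain Ga'' where "lgen (Sy m (Sy q E)) U Ga''" using lgen_Sy[OF wsh_presh[OF Ep] U(1)] by metis
 from full_generization[OF wsh_presh[OF wsh_presh[OF Ep]] U this f] show ?thesis using et by blast
qed

lemma flat_rate:
 assumes E: "locally_free X n E" and x: "x:pts X" and q: "q >= 1" and m: "m >= 1" and f: "full x (Sy m (Sy q E)) d"
 shows "rate x E (real_of_int d / real (m * q))"
proof -
 have Ep: "mp E" by (rule sheaf_presh) (use E in "simp add: locally_free_def")
 obtain n0 where n0: "!!d. n0 <= d ==> full x OX d" using locally_free_full[OF OX_locally_free] x by blast
 obtain n1 where n1: "full x E n1" using locally_free_full[OF E] x by blast
 show ?thesis
  by (rule rate_full[OF Ep x n0 n1 _ full_surj[OF wsh_presh[OF wsh_presh[OF Ep]] wsh_presh[OF Ep] sflat_smor[OF Ep] x sflat_surj[OF Ep x] f]])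
   (use q m in simp_all)
qed

lemma locally_free_presh: "locally_free X n E ==> mp E"
 by (simp add: locally_free_def sheaf_presh)

lemma stalk_gens:
 assumes V: "locally_free X n V" and x: "x:pts X"
 shows "EX G. finite G & G <= $(St V x) & module_span (Ox x) (St V x) G = $(St V x)"
proof -
 from locally_free_gens[OF V x] obtain U Ga where U: "op U" "x:U" and g: "lgen V U Ga" by metis
 then show ?thesis using lsec_carrier[OF locally_free_presh[OF V] _ U(2)] unfolding lgen_def by (intro exI[of _ "(%ga. ga x) ` Ga"]) auto
qed

lemma aug_rate:
 assumes V: "locally_free X n V" and x: "x:pts X" and a: "x \<notin> augmented_base_locus X A V"
 shows "EX tt<0. rate x V tt"
proof -
 from a aug_iff[OF locally_free_presh[OF V] x] obtain q m where q: "q >= 1" "m >= 1" "full x (Sy m (Sy q V)) (- int m)" by blast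
 from flat_rate[OF V x q] show ?thesis using q(1,2) by (intro exI[of _ "real_of_int (- int m) / real (m * q)"]) (simp add: divide_neg_pos)
qed

text \<open>The defining condition is applied with \<open>2 * q\<close> in place of
  \<open>q\<close>. After multiplication by \<open>q\<close> the slope is 1/2 instead of 1, and the
  difference will absorb the additive constant.\<close>

lemma dim_rate:
 assumes V: "locally_free X n V" and x: "x:pts X" and a: "x \<notin> diminished_base_locus X A V" and q: "q >= 1"
 shows "rate x V (1 / (2 * real q))"
proof -
 have q2: "2 * q >= 1" using q by simp
 then obtain m where m: "m >= 1" "full x (Sy m (Sy (2 * q) V)) (int m)" using a dim_iff[OF locally_free_presh[OF V] x] by blast
 have "real_of_int (int m) / real (m * (2 * q)) = 1 / (2 * real q)" using m(1) by simp
 then show ?thesis using flat_rate[OF V x q2 m] by simp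
qed

lemma generic_loci:
 assumes V: "locally_free X n V" and et: "et:pts X" "!!V. op V ==> V ~= {} ==> et:V"
 shows "V_big X A V ==> et \<notin> augmented_base_locus X A V" "V_psef X A V ==> et \<notin> diminished_base_locus X A V"
proof -
 note Vp = locally_free_presh[OF V]
 show "et \<notin> augmented_base_locus X A V" if b: "V_big X A V"
 proof -
  from b loci_pts(1) obtain x where x: "x:pts X" "x \<notin> augmented_base_locus X A V" unfolding V_big_def by blast
  then show ?thesis using aug_iff[OF Vp x(1)] aug_iff[OF Vp et(1)] full_generic[OF V x(1) et(2)] by blast
 qed
 show "et \<notin> diminished_base_locus X A V" if b: "V_psef X A V"
 proof -
  from b loci_pts(2) obtain x where x: "x:pts X" "x \<notin> diminished_base_locus X A V" unfolding V_psef_def by blast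
  then show ?thesis using dim_iff[OF Vp x(1)] dim_iff[OF Vp et(1)] full_generic[OF V x(1) et(2)] by blast
 qed
qed

context
 fixes E :: "('x, 'r, 'e) mod_presheaf" and F :: "('x, 'r, 'f) mod_presheaf" and e f
 assumes E: "locally_free X e E" and F: "locally_free X f F"
begin

abbreviation "W \<equiv> direct_sum_sheaf E F"

lemma sum_presh: "mp E" "mp F" "mp W"
proof -
 show E': "mp E" and F': "mp F" using E F by (simp_all add: locally_free_def sheaf_presh)
 show "mp W" by (rule direct_sum_presh[OF E' F'])
qed

lemma full_summand:
 assumes x: "x:pts X" and W: "full x (Sy m (Sy q W)) d"
 shows "full x (Sy m (Sy q E)) d" "full x (Sy m (Sy q F)) d"
proof -
 note p = sum_presh
 obtain i1 i2 p1 p2 where s: "smor E W i1" "smor F W i2" "smor W E p1" "smor W F p2"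
  and i: "!!y a. a:$(St E y) ==> p1 y (i1 y a) = a" "!!y b. b:$(St F y) ==> p2 y (i2 y b) = b"
  by (rule direct_sum_maps[OF p(1,2)]) (rule that; assumption)
 have s1: "p1 x ` $(St W x) = $(St E x)"
  using slinD(1)[OF smorD(1)[OF s(3) x]] slinD(1)[OF smorD(1)[OF s(1) x]] i(1) by (intro subset_antisym image_subsetI subsetI) (assumption | metis imageI)+
 have s2: "p2 x ` $(St W x) = $(St F x)"
  using slinD(1)[OF smorD(1)[OF s(4) x]] slinD(1)[OF smorD(1)[OF s(2) x]] i(2) by (intro subset_antisym image_subsetI subsetI) (assumption | metis imageI)+
 note t = wsh_presh[OF wsh_presh[OF p(3)]]
 show "full x (Sy m (Sy q E)) d"
  by (rule full_surj[OF t wsh_presh[OF wsh_presh[OF p(1)]] smap(1)[OF wsh_presh[OF p(3)] wsh_presh[OF p(1)] smap(1)[OF p(3,1) s(3)]] x _ W])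
   (rule smap_surj[OF wsh_presh[OF p(3)] wsh_presh[OF p(1)] smap(1)[OF p(3,1) s(3)] x smap_surj[OF p(3,1) s(3) x s1]])
 show "full x (Sy m (Sy q F)) d"
  by (rule full_surj[OF t wsh_presh[OF wsh_presh[OF p(2)]] smap(1)[OF wsh_presh[OF p(3)] wsh_presh[OF p(2)] smap(1)[OF p(3,2) s(4)]] x _ W])
   (rule smap_surj[OF wsh_presh[OF p(3)] wsh_presh[OF p(2)] smap(1)[OF p(3,2) s(4)] x smap_surj[OF p(3,2) s(4) x s2]])
qed

lemma sum_rate:
 assumes x: "x:pts X" and rE: "rate x E tt" and rF: "rate x F tt"
 shows "rate x (Sy q W) (real q * tt)"
proof -
 note p = sum_presh
 obtain n0 where n0: "!!d. n0 <= d ==> full x OX d" using locally_free_full[OF OX_locally_free] x by blast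
 obtain i1 i2 p1 p2 where s: "smor E W i1" "smor F W i2" "smor W E p1" "smor W F p2"
  and i: "!!y w. w:$(St W y) ==> w = i1 y (p1 y w) +[St W y] i2 y (p2 y w)"
  by (rule direct_sum_maps[OF p(1,2)]) (rule that; assumption)
 obtain G where G: "finite G" "G <= $(St E x)" "module_span (Ox x) (St E x) G = $(St E x)" using stalk_gens[OF E x] by metis
 obtain H where H: "finite H" "H <= $(St F x)" "module_span (Ox x) (St F x) H = $(St F x)" using stalk_gens[OF F x] by metis
 let ?T = "i1 x ` G Un i2 x ` H"
 note m = stalk_module[OF p(1) x] stalk_module[OF p(2) x] stalk_module[OF p(3) x]
 note l = smorD(1)[OF s(1) x] smorD(1)[OF s(2) x] smorD(1)[OF s(3) x] smorD(1)[OF s(4) x]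
 have T: "?T <= $(St W x)" using slinD(1)[OF l(1)] slinD(1)[OF l(2)] G(2) H(2) by blast
 note S = span_submodule[OF m(3) T]
 show ?thesis
 proof (rule Sy_rate[OF p(3) x n0])
  show "finite ?T" using G H by simp
  show "prate x W tt t" if "t:?T" for t
  proof -
   from that consider a where "a:G" "t = i1 x a" | b where "b:H" "t = i2 x b" by (elim UnE imageE)
   then show ?thesis
   proof cases
    case 1
    then show ?thesis using prate_smor[OF p(1,3) s(1) x rate_prate[OF p(1) x rE]] G(2) by blast
   next
    case 2
    then show ?thesis using prate_smor[OF p(2,3) s(2) x rate_prate[OF p(2) x rF]] H(2) by blast
   qed
  qed
  have a1: "i1 x a:module_span (Ox x) (St W x) ?T" if "a:$(St E x)" for a
   by (rule slin_span[OF l(1) m(1,3) rstalk_fun S G(2) _ that[folded G(3)]]) (rule span_incl, blast)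
  have a2: "i2 x a:module_span (Ox x) (St W x) ?T" if "a:$(St F x)" for a
   by (rule slin_span[OF l(2) m(2,3) rstalk_fun S H(2) _ that[folded H(3)]]) (rule span_incl, blast)
  show "module_span (Ox x) (St W x) ?T = $(St W x)"
  proof (rule subset_antisym[OF span_carrier[OF m(3) T] subsetI])
   fix w assume w: "w:$(St W x)"
   show "w:module_span (Ox x) (St W x) ?T"
    by (subst i[OF w]) (rule submoduleD(3)[OF m(3) S a1[OF slinD(1)[OF l(3) w]] a2[OF slinD(1)[OF l(4) w]]])
  qed
 qed
qed

lemma aug_sum: "augmented_base_locus X A W = augmented_base_locus X A E Un augmented_base_locus X A F"
proof -
 note p = sum_presh
 have "x:augmented_base_locus X A W <-> x:augmented_base_locus X A E Un augmented_base_locus X A F" if x: "x:pts X" for x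
 proof
  assume "x:augmented_base_locus X A E Un augmented_base_locus X A F"
  then show "x:augmented_base_locus X A W"
   using full_summand[OF x] aug_iff[OF p(1) x] aug_iff[OF p(2) x] aug_iff[OF p(3) x] by blast
 next
  assume a: "x:augmented_base_locus X A W"
  show "x:augmented_base_locus X A E Un augmented_base_locus X A F"
  proof (rule ccontr)
   assume "x \<notin> augmented_base_locus X A E Un augmented_base_locus X A F"
   then obtain tt1 tt2 where t: "tt1 < 0" "rate x E tt1" "tt2 < 0" "rate x F tt2" using aug_rate[OF E x] aug_rate[OF F x] by blast
   define tt where "tt = max tt1 tt2"
   have tt: "tt < 0" "rate x E tt" "rate x F tt" using t(1,3) rate_mono[OF t(2), of tt] rate_mono[OF t(4), of tt] by (simp_all add: tt_def)
   \<comment> \<open>A slope of at most -2 gives degree at most -2m + c on the m-th power; this is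
     at most -m as soon as \<open>m\<close> is at least \<open>c\<close>.\<close>
   obtain q where q: "2 / (- tt) < real q" using reals_Archimedean2 by blast
   then have qtt: "real q * tt <= - 2" using tt(1) mult_strict_right_mono[OF q, of "- tt"] by simp
   have q1: "q >= 1" using qtt by (cases q) auto
   from sum_rate[OF x tt(2,3), of q] obtain c where c: "!!j d. real q * tt * real j + c <= real_of_int d ==> full x (Sy j (Sy q W)) d" unfolding rate_def by blast
   obtain m where m: "max c 1 <= real m" using real_arch_simple by blast
   have "real q * tt * real m <= - 2 * real m" using qtt by (intro mult_right_mono) simp_all
   then have "full x (Sy m (Sy q W)) (- int m)" using m by (intro c) simp
   moreover have "m >= 1" using m by simp
   ultimately show False using a aug_iff[OF p(3) x] q1 by blast
  qed
 qed
 then show ?thesis using loci_pts(1)[of W] loci_pts(1)[of E] loci_pts(1)[of F] by blast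
qed

lemma dim_sum: "diminished_base_locus X A W = diminished_base_locus X A E Un diminished_base_locus X A F"
proof -
 note p = sum_presh
 have "x:diminished_base_locus X A W <-> x:diminished_base_locus X A E Un diminished_base_locus X A F" if x: "x:pts X" for x
 proof
  assume "x:diminished_base_locus X A E Un diminished_base_locus X A F"
  then show "x:diminished_base_locus X A W"
   using full_summand[OF x] dim_iff[OF p(1) x] dim_iff[OF p(2) x] dim_iff[OF p(3) x] by blast
 next
  assume a: "x:diminished_base_locus X A W"
  show "x:diminished_base_locus X A E Un diminished_base_locus X A F"
  proof (rule ccontr)
   assume n: "x \<notin> diminished_base_locus X A E Un diminished_base_locus X A F"
   have "\<exists>m\<ge>1. full x (Sy m (Sy q W)) (int m)" if q: "q >= 1" for q
   proof -
    have "rate x E (1 / (2 * real q))" "rate x F (1 / (2 * real q))" using dim_rate[OF E x _ q] dim_rate[OF F x _ q] n by blast+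
    from sum_rate[OF x this, of q] obtain c where c: "!!j d. real q * (1 / (2 * real q)) * real j + c <= real_of_int d ==> full x (Sy j (Sy q W)) d" unfolding rate_def by blast
    \<comment> \<open>The bound is m/2 + c, which is at most m once \<open>m\<close> is at least
      \<open>2 * c\<close>.\<close>
    obtain m where m: "max (2 * c) 1 <= real m" using real_arch_simple by blast
    have "full x (Sy m (Sy q W)) (int m)" using m q by (intro c) simp
    moreover have "m >= 1" using m by simp
    ultimately show ?thesis by blast
   qed
   then show False using a dim_iff[OF p(3) x] by blast
  qed
 qed
 then show ?thesis using loci_pts(2)[of W] loci_pts(2)[of E] loci_pts(2)[of F] by blast
qed

end

end

text \<open>A ring homomorphism from a field to the domain of global functions is injective. Hence
  the type of functions is infinite, and factorials are images of nonzero scalars, so they are units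
  in every stalk.\<close>

lemma projective_variety_char0_ample:
 fixes X :: "('x, 'r) ringed_space" and c :: "'k::{alg_closed_field, field_char_0} => 'r" and A :: "('x, 'r, 'l) mod_presheaf"
 assumes X: "projective_variety X c" and A: "ample X A"
 shows "char0_ample X A"
proof -
 have int: "integral_scheme X" and c: "c:ring_hom scalar_ring (sec X (pts X))" using X by (simp_all add: projective_variety_def)
 interpret lrs X by unfold_locales (use int in "simp add: integral_scheme_def scheme_def")
 have ne: "pts X ~= {}" using int unfolding integral_scheme_def by blast
 have o: "op (pts X)" by simp
 interpret D: domain "sec X (pts X)" using int o ne unfolding integral_scheme_def by blast
 have cm: "c (a * b) = c a *[sec X (pts X)] c b" "c (a + b) = c a +[sec X (pts X)] c b" "c a:$(sec X (pts X))" "c 1 = 1[sec X (pts X)]" for a b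
  using ring_hom_mult[OF c] ring_hom_add[OF c] ring_hom_closed[OF c] ring_hom_one[OF c] by (simp_all add: scalar_ring_def)
 have c0: "c 0 = 0[sec X (pts X)]" using cm(2)[of 0 0] cm(3)[of 0] D.add.l_cancel_one by fastforce
 have "inj c"
 proof (rule injI, rule ccontr)
  fix a b assume e: "c a = c b" and n: "a ~= b"
  have "c (a - b) +[sec X (pts X)] c b = c b" using cm(2)[of "a - b" b] e by simp
  then have "c (a - b) = 0[sec X (pts X)]" using cm(3) by simp
  then have "c ((a - b) * inverse (a - b)) = 0[sec X (pts X)]" using cm(1,3) by simp
  then show False using n cm(4) D.one_not_zero by simp
 qed
 then have inf: "infinite (UNIV :: 'r set)"
  using infinite_UNIV_char_0[where 'a = 'k] by (meson finite_imageD finite_subset subset_UNIV)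
 have A1: "locally_free X 1 A" using A by (simp add: ample_def)
 have "add_pow (Ox y) (fact j :: nat) 1[Ox y]:Units (Ox y)" if y: "y:pts X" for y j
 proof -
  interpret S: cring "Ox y" by (rule stalk_cring[OF y])
  let ?g = "%a. rgerm X y (pts X) (c a)"
  note g = rgerm_op[OF o y cm(3) cm(3)]
  have n: "?g (of_nat n) = add_pow (Ox y) n 1[Ox y]" for n
  proof (induction n)
   case 0
   then show ?case using rgerm_one[OF o y] g(3)[of 0 0] g(1)[of 0] cm(2)[of 0 0] S.add.l_cancel_one by simp
  next
   case (Suc n)
   then show ?case using g(3)[of 1 "of_nat n"] cm(2)[of 1 "of_nat n"] cm(4) rgerm_one[OF o y] g(1)
    by (metis S.add.nat_pow_Suc S.add.m_comm S.add.nat_pow_closed S.one_closed add.commute of_nat_Suc)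
  qed
  have "?g (of_nat (fact j)) *[Ox y] ?g (inverse (of_nat (fact j))) = 1[Ox y]"
   using g(2)[of "of_nat (fact j)" "inverse (of_nat (fact j))"] cm(1)[of "of_nat (fact j)" "inverse (of_nat (fact j))"] cm(4) rgerm_one[OF o y] by simp
  then show ?thesis unfolding n[symmetric] Units_def using g(1) S.m_comm by blast
 qed
 then show ?thesis
  by unfold_locales (use A1 inf A int in simp_all)
qed

theorem lemma2p20:
  fixes X :: "('x, 'r) ringed_space"
    and c :: "'k::{alg_closed_field, field_char_0} \<Rightarrow> 'r"
    and A :: "('x, 'r, 'l) mod_presheaf"
    and E :: "('x, 'r, 'e) mod_presheaf"
    and F :: "('x, 'r, 'f) mod_presheaf"
  assumes "projective_variety X c"
    and "ample X A"
    and "vector_bundle X E"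
    and "vector_bundle X F"
  shows "augmented_base_locus X A (direct_sum_sheaf E F) =
           augmented_base_locus X A E \<union> augmented_base_locus X A F \<and>
         diminished_base_locus X A (direct_sum_sheaf E F) =
           diminished_base_locus X A E \<union> diminished_base_locus X A F \<and>
         (V_big X A E \<and> V_big X A F \<longrightarrow> V_big X A (direct_sum_sheaf E F)) \<and>
         (V_psef X A E \<and> V_psef X A F \<longrightarrow> V_psef X A (direct_sum_sheaf E F))"
proof -
  interpret char0_ample X A by (rule projective_variety_char0_ample[OF assms(1,2)])
  obtain e f where E: "locally_free X e E" and F: "locally_free X f F" using assms(3,4) by (auto simp: vector_bundle_def)
  \<comment> \<open>A single point decides all four positivity hypotheses: it is missed by the base
    loci of both summands, hence by their union.\<close>
  obtain \<eta> where \<eta>: "\<eta> \<in> pts X" "\<And>V. op V \<Longrightarrow> V \<noteq> {} \<Longrightarrow> \<eta> \<in> V" using generic_point by blast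
  show ?thesis
    unfolding aug_sum[OF E F] dim_sum[OF E F] V_big_def V_psef_def
    using \<eta>(1) generic_loci[OF E \<eta>] generic_loci[OF F \<eta>] unfolding V_big_def V_psef_def by blast
qed

end
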